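(* There is a $\mathcal T^0_{\mathrm{cen}}$-measurable map $\mathbf P^0:\mathcal X_\Gamma\to\nabla_\infty$ with the following properties under every $\mu\in\mathscr C_{\mathrm{pf}}$. Write $\mathbf P_\mu=(\mathbf P_{\mu,i})_{i\ge1}$ for this map viewed under $\mu$, and put $\mathbf P_{\mu,0}=1-\sum_{i\ge1}\mathbf P_{\mu,i}$. Then $\mu$-almost surely $$\mathbf P_n(X_n)\longrightarrow\mathbf P_\mu\ \text{(coordinatewise)},\qquad D_n(X_n)\longrightarrow\mathbf P_{\mu,0},\qquad \nu_n(X_n)\Longrightarrow\nu_{\mathbf P_\mu}\ \text{(weakly)}.$$ The endpoints $X_n$ also converge $\mu$-almost surely to $\mathbf P_\mu$ in the Martin compactification of the path-forest graph. The completed central tail $\mathcal T_{\mathrm{cen}}$ (with respect to $\mu$) and the conditional path law satisfy $$\mathcal T_{\mathrm{cen}}=\overline{\sigma(\mathbf P_\mu)}^{\,\mu},\qquad \mathbb P_\mu(A\mid\mathbf P_\mu)=\mu^{\mathbf P_\mu}(A)\quad\mu\text{-a.s. for every Borel path event }A\subseteq\mathcal X_\Gamma .$$ With $\Theta_\mu$ the law of $\mathbf P_\mu$ under $\mu$, the representation $\mu=\int_{\nabla_\infty}\mu^p\,\Theta_\mu(dp)$ is the unique decomposition of $\mu$ into extreme points of $\mathscr C(\Gamma)$ (that is, the unique representing probability measure of $\mu$ concentrated on the extreme points of $\mathscr C(\Gamma)$). In particular, $\mu$ is extreme if and only if $\mathbf P_\mu$ is $\mu$-almost surely constant.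
   Context: Rooted trees are finite, unlabelled and non-plane. $\mathcal T_n$ is the set of those with $n$ vertices; $\bullet$ is the one-vertex tree. A tree is path-forest if every non-root vertex has at most one child; for an integer partition $\lambda$ (parts nonincreasing, zero padded), $P_\lambda$ is the path-forest tree whose root branches are chains with $\lambda_1,\lambda_2,\dots$ vertices, and $\lambda(P_\lambda):=\lambda$. For trees $s,t$, $n(s;t)$ is the number of vertices $v$ of $s$ such that attaching a new leaf at $v$ yields $t$. The Hoffman graph $\Gamma$ has all rooted trees as vertices and $n(s;t)$ edge copies from $s$ to $t$; $u(t)$ is the number of paths of edge copies from $\bullet$ to $t$. $\mathcal X_\Gamma$ is the space of infinite paths $(e_n)_{n\ge1}$ of edge copies starting at $\bullet$ ($e_n$ going from $\mathcal T_n$ to $\mathcal T_{n+1}$), a closed subspace of a product of finite discrete sets; $\mathsf E_n$ is the $n$-th edge coordinate, $X_n\in\mathcal T_n$ the $n$-th vertex; $C_\gamma$ is the cylinder of paths with finite prefix $\gamma$ starting at $\bullet$. A Borel probability measure $\mu$ on $\mathcal X_\Gamma$ is central if $\mu(C_\gamma)=\mu(X_n=t)/u(t)$ for every prefix $\gamma$ ending at $t\in\mathcal T_n$. $\mathscr C(\Gamma)$ is the compact convex set of central measures (weak topology), and $\mathscr C_{\mathrm{pf}}=\{\mu\in\mathscr C(\Gamma):\mu(X_n\text{ is path-forest})=1\ \forall n\}$. Tails: $\mathscr G_N^0=\sigma(X_N,\mathsf E_N,\mathsf E_{N+1},\dots)$ and $\mathcal T^0_{\mathrm{cen}}=\bigcap_{N\ge1}\mathscr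 G^0_N$ (raw central tail). For a Borel sub-sigma-field $\mathscr H$, $\overline{\mathscr H}^{\,\mu}$ is generated by $\mathscr H$ and all subsets of $\mu$-null Borel sets; $\mathcal T_{\mathrm{cen}}=\overline{\mathcal T^0_{\mathrm{cen}}}^{\,\mu}$. $\nabla_\infty=\{p_1\ge p_2\ge\cdots\ge0:\sum_ip_i\le1\}$ with the product topology, $p_0=1-\sum_ip_i$, and $\nu_p=p_0\delta_0+\sum_{i\ge1}p_i\delta_{p_i}$, a probability measure on $[0,1]$. $\Lambda=\mathbb R[\mathsf p_1,\mathsf p_2,\dots]$ is the algebra of symmetric functions, $\widetilde m_\lambda=\big(\prod_{j\ge1}r_j(\lambda)!\big)m_\lambda$ ($m_\lambda$ monomial symmetric function, $r_j(\lambda)$ multiplicity of the part $j$); $\chi_p:\Lambda\to\mathbb R$ is the unital algebra homomorphism with $\chi_p(\mathsf p_1)=1$, $\chi_p(\mathsf p_k)=\sum_ip_i^k$ ($k\ge2$). $\mu^p$ is the central law with $\mu^p(C_\gamma)=\chi_p(\widetilde m_\lambda)$ if $\gamma$ ends at $P_\lambda$, and $\mu^p(C_\gamma)=0$ if $\gamma$ ends at a non-path-forest tree. Empirical observables, for $n\ge2$ and $P_\lambda\in\mathcal T_n$ (so $|\lambda|=n-1$): $\mathbf P_n(P_\lambda)=(\lambda_1/(n-1),\lambda_2/(n-1),\dots)\in\nabla_\infty$, $D_n(P_\lambda)=r_1(\lambda)/(n-1)$, $\nu_n(P_\lambda)=\sum_{j\ge1}\frac{\lambda_j}{n-1}\delta_{\lambda_j/(n-1)}$.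 For $n=1$ and on non-path-forest trees, $\mathbf P_n=(0,0,\dots)$, $D_n=0$, $\nu_n=\delta_0$. Path-forest Martin compactification: for partitions $\mu,\lambda$ let $n_{\mathrm{pf}}(\mu;\lambda)$ be the number of paths of edge copies from $P_\mu$ to $P_\lambda$ (the length-zero path included) and $K^{\mathrm{pf}}_\mu(\lambda)=u(P_\mu)n_{\mathrm{pf}}(\mu;\lambda)/u(P_\lambda)$; the compactification is the closure of $\{(K^{\mathrm{pf}}_\mu(\lambda))_\mu:\lambda\}$ in $[0,1]^{\{\text{partitions}\}}$. Its boundary is identified with $\nabla_\infty$ by letting $p$ correspond to the point with coordinates $u(P_\mu)\chi_p(\widetilde m_\mu)$; $P_\lambda$ is identified with $\lambda$. *)

theory Defs
  imports "HOL-Probability.Probability" "HOL-Library.Multiset" "HOL-Library.Poly_Mapping"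
begin

section \<open>Rooted trees and the Hoffman graph\<close>

text \<open>A finite, unlabelled, non-plane rooted tree is the finite multiset of its root branches.\<close>

datatype rtree = Node (branches: "rtree multiset")

definition leaf :: rtree where
  "leaf = Node {#}"

lemma size_branch_less: "c \<in># M \<Longrightarrow> size c < size (Node M)"
proof -
  assume "c \<in># M"
  then obtain M' where "M = add_mset c M'"
    by (metis mset_add)
  then show ?thesis
    by simp
qed

function vertices :: "rtree \<Rightarrow> nat" where
  "vertices (Node M) = Suc (\<Sum>c\<in>#M. vertices c)"
  by pat_completeness auto
termination
  by (relation "Wellfounded.measure size") (auto intro: size_branch_less simp del: rtree.size)

definition trees :: "nat \<Rightarrow> rtree set" where
  "trees n = {t. vertices t = n}"

text \<open>
  The multiset \<open>grow s\<close> has one entry for every vertex \<open>v\<close> of \<open>s\<close>, namely the tree obtained by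
  attaching a new leaf at \<open>v\<close>: the first entry is the one for the root, the others come from the
  vertices of the root branches, repeated branches being counted with multiplicity.
\<close>

function grow :: "rtree \<Rightarrow> rtree multiset" where
  "grow (Node M) = add_mset (Node (add_mset leaf M))
     (\<Sum>c\<in>#M. image_mset (\<lambda>c'. Node (add_mset c' (M - {#c#}))) (grow c))"
  by pat_completeness auto
termination
  by (relation "Wellfounded.measure size") (auto intro: size_branch_less simp del: rtree.size)

lemma size_grow: "size (grow t) = vertices t"
proof (induction t)
  case (Node M)
  then show ?case
    by (simp add: size_mset_sum_mset_conv image_mset.compositionality comp_def cong: image_mset_cong)
qed

lemma vertices_grow: "t \<in># grow s \<Longrightarrow> vertices t = Suc (vertices s)"
proof (induction s arbitrary: t)
  case (Node M)
  from Node.prems consider "t = Node (add_mset leaf M)"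
    | c c' where "c \<in># M" "c' \<in># grow c" "t = Node (add_mset c' (M - {#c#}))"
    by (auto simp: in_Union_mset_iff)
  then show ?case
  proof cases
    case 1
    then show ?thesis by (simp add: leaf_def)
  next
    case 2
    then obtain M' where "M = add_mset c M'"
      by (metis mset_add)
    with 2 Node.IH[of c c'] show ?thesis by simp
  qed
qed

definition attach_count :: "rtree \<Rightarrow> rtree \<Rightarrow> nat" where
  "attach_count s t = count (grow s) t"

text \<open>The triple \<open>(s, t, k)\<close> is the \<open>k\<close>-th of the \<open>attach_count s t\<close> edge copies from \<open>s\<close> to \<open>t\<close>.\<close>

type_synonym edge = "rtree \<times> rtree \<times> nat"

definition src :: "edge \<Rightarrow> rtree" where
  "src e = fst e"

definition tgt :: "edge \<Rightarrow> rtree" where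
  "tgt e = fst (snd e)"

definition edges :: "edge set" where
  "edges = {(s, t, k). k < attach_count s t}"

fun is_walk :: "rtree \<Rightarrow> edge list \<Rightarrow> rtree \<Rightarrow> bool" where
  "is_walk s [] t \<longleftrightarrow> s = t"
| "is_walk s (e # es) t \<longleftrightarrow> e \<in> edges \<and> src e = s \<and> is_walk (tgt e) es t"

definition num_walks :: "rtree \<Rightarrow> rtree \<Rightarrow> nat" where
  "num_walks s t = card {es. is_walk s es t}"

definition u :: "rtree \<Rightarrow> nat" where
  "u t = num_walks leaf t"


section \<open>Partitions and path-forest trees\<close>

text \<open>An integer partition is the multiset of its parts; \<open>part \<rho> i\<close> is the zero-padded
  nonincreasing enumeration with indices starting at 0, so \<open>part \<rho> i\<close> is the \<open>(i+1)\<close>-st part.\<close>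

definition partitions :: "nat multiset set" where
  "partitions = {\<rho>. 0 \<notin># \<rho>}"

definition part :: "nat multiset \<Rightarrow> nat \<Rightarrow> nat" where
  "part \<rho> i = (if i < size \<rho> then rev (sorted_list_of_multiset \<rho>) ! i else 0)"

text \<open>\<open>chain k\<close> has \<open>k + 1\<close> vertices.\<close>

fun chain :: "nat \<Rightarrow> rtree" where
  "chain 0 = leaf"
| "chain (Suc k) = Node {#chain k#}"

definition path_forest_tree :: "nat multiset \<Rightarrow> rtree" where
  "path_forest_tree \<rho> = Node (image_mset (\<lambda>k. chain (k - 1)) \<rho>)"

text \<open>\<open>unary t\<close>: every vertex of \<open>t\<close>, including the root, has at most one child.\<close>

inductive unary :: "rtree \<Rightarrow> bool" where
  "size M \<le> 1 \<Longrightarrow> (\<And>c. c \<in># M \<Longrightarrow> unary c) \<Longrightarrow> unary (Node M)"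

definition path_forest :: "rtree \<Rightarrow> bool" where
  "path_forest t \<longleftrightarrow> (\<forall>c \<in># branches t. unary c)"

definition shape :: "rtree \<Rightarrow> nat multiset" where
  "shape t = (THE \<rho>. \<rho> \<in> partitions \<and> path_forest_tree \<rho> = t)"

lemma vertices_chain: "vertices (chain k) = Suc k"
  by (induction k) (auto simp: leaf_def)

lemma unary_iff_chain: "unary t \<longleftrightarrow> t = chain (vertices t - 1)"
proof
  assume "unary t"
  then show "t = chain (vertices t - 1)"
  proof induction
    case (1 M)
    show ?case
    proof (cases "M = {#}")
      case True
      then show ?thesis by (simp add: leaf_def)
    next
      case False
      with 1 obtain c where M: "M = {#c#}"
        by (metis One_nat_def le_Suc_eq le_zero_eq size_1_singleton_mset size_eq_0_iff_empty)
      then have c: "c = chain (vertices c - 1)"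
        using 1 by simp
      obtain k where "vertices c = Suc k"
        by (cases c) auto
      with M c show ?thesis by simp
    qed
  qed
next
  have "unary (chain k)" for k
    by (induction k) (auto simp: leaf_def intro: unary.intros)
  then show "t = chain (vertices t - 1) \<Longrightarrow> unary t"
    by metis
qed

lemma shape_path_forest_tree:
  assumes "\<rho> \<in> partitions"
  shows "shape (path_forest_tree \<rho>) = \<rho>"
proof -
  have *: "image_mset vertices (branches (path_forest_tree \<kappa>)) = \<kappa>" if "\<kappa> \<in> partitions" for \<kappa>
  proof -
    have "image_mset (\<lambda>k. vertices (chain (k - 1))) \<kappa> = image_mset (\<lambda>k. k) \<kappa>"
      using that by (intro image_mset_cong)
        (metis (mono_tags) Suc_pred' gr0I mem_Collect_eq partitions_def vertices_chain)
    then show ?thesis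
      by (simp add: path_forest_tree_def image_mset.compositionality comp_def)
  qed
  show ?thesis
    unfolding shape_def using assms * by (intro the_equality) metis+
qed

lemma path_forest_iff: "path_forest t \<longleftrightarrow> (\<exists>\<rho>\<in>partitions. path_forest_tree \<rho> = t)"
proof
  assume pf: "path_forest t"
  let ?L = "image_mset vertices (branches t)"
  have "vertices c \<noteq> 0" for c
    by (cases c) auto
  then have "?L \<in> partitions"
    by (fastforce simp: partitions_def simp del: neq0_conv)
  moreover have "image_mset (\<lambda>c. chain (vertices c - 1)) (branches t) = image_mset (\<lambda>c. c) (branches t)"
    using pf by (intro image_mset_cong) (auto simp: path_forest_def unary_iff_chain)
  then have "path_forest_tree ?L = t"
    by (cases t) (simp add: path_forest_tree_def image_mset.compositionality comp_def)
  ultimately show "\<exists>\<rho>\<in>partitions. path_forest_tree \<rho> = t"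
    by blast
next
  assume "\<exists>\<rho>\<in>partitions. path_forest_tree \<rho> = t"
  then show "path_forest t"
    by (auto simp: path_forest_def path_forest_tree_def unary_iff_chain vertices_chain)
qed


section \<open>The path space and central measures\<close>

text \<open>A path \<open>(e\<^sub>n)\<close>, \<open>n \<ge> 1\<close>, is stored with \<open>e\<^sub>n\<close> at index \<open>n - 1\<close>.  The coordinates \<open>edge_at n\<close> and
  \<open>vertex_at n\<close> keep the indexing from 1 and are only meaningful for \<open>n \<ge> 1\<close>.\<close>

type_synonym path = "nat \<Rightarrow> edge"

definition paths :: "path set" where
  "paths = {\<omega>. src (\<omega> 0) = leaf \<and> (\<forall>n. \<omega> n \<in> edges \<and> tgt (\<omega> n) = src (\<omega> (Suc n)))}"

definition edge_at :: "nat \<Rightarrow> path \<Rightarrow> edge" where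
  "edge_at n \<omega> = \<omega> (n - 1)"

definition vertex_at :: "nat \<Rightarrow> path \<Rightarrow> rtree" where
  "vertex_at n \<omega> = src (edge_at n \<omega>)"

definition path_topology :: "path topology" where
  "path_topology = subtopology
     (product_topology (\<lambda>i. discrete_topology {e \<in> edges. src e \<in> trees (Suc i)}) UNIV) paths"

lemma vertices_src_path: "\<omega> \<in> paths \<Longrightarrow> vertices (src (\<omega> n)) = Suc n"
proof (induction n)
  case 0
  then show ?case by (simp add: paths_def leaf_def)
next
  case (Suc n)
  then have "\<omega> n \<in> edges" "src (\<omega> (Suc n)) = tgt (\<omega> n)"
    by (auto simp: paths_def)
  moreover from this have "tgt (\<omega> n) \<in># grow (src (\<omega> n))"
    by (auto simp: edges_def src_def tgt_def attach_count_def simp flip: count_greater_zero_iff)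
  ultimately show ?case
    using Suc vertices_grow by simp
qed

lemma topspace_path_topology: "topspace path_topology = paths"
  using vertices_src_path by (auto simp: path_topology_def trees_def paths_def PiE_UNIV_domain)

definition path_borel :: "path measure" where
  "path_borel = sigma paths {U. openin path_topology U}"

definition cylinder :: "edge list \<Rightarrow> path set" where
  "cylinder \<gamma> = {\<omega> \<in> paths. \<forall>i < length \<gamma>. \<omega> i = \<gamma> ! i}"

definition central :: "path measure \<Rightarrow> bool" where
  "central m \<longleftrightarrow> (\<forall>n \<ge> 1. \<forall>\<gamma>. \<forall>t \<in> trees n. is_walk leaf \<gamma> t \<longrightarrow>
     measure m (cylinder \<gamma>) = measure m {\<omega> \<in> paths. vertex_at n \<omega> = t} / real (u t))"

definition central_measures :: "path measure set" where
  "central_measures = {m. prob_space m \<and> sets m = sets path_borel \<and> central m}"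

definition central_measures_pf :: "path measure set" where
  "central_measures_pf =
     {m \<in> central_measures. \<forall>n \<ge> 1. measure m {\<omega> \<in> paths. path_forest (vertex_at n \<omega>)} = 1}"

definition weak_topology :: "path measure topology" where
  "weak_topology = topology_generated_by
     {{m \<in> central_measures. (\<integral>\<omega>. f \<omega> \<partial>m) \<in> U} | f U.
        continuous_map path_topology euclideanreal f \<and> open U}"

definition central_borel :: "path measure measure" where
  "central_borel = sigma central_measures {U. openin weak_topology U}"

definition extreme_central :: "path measure set" where
  "extreme_central = {m \<in> central_measures.
     \<forall>m1 \<in> central_measures. \<forall>m2 \<in> central_measures. \<forall>c. 0 < c \<and> c < 1 \<and>
       (\<forall>A \<in> sets path_borel. measure m A = c * measure m1 A + (1 - c) * measure m2 A)
       \<longrightarrow> m1 = m \<and> m2 = m}"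

text \<open>\<open>M\<close> represents \<open>m\<close>, i.e. \<open>m\<close> is the barycentre of \<open>M\<close>.\<close>

definition represents :: "path measure measure \<Rightarrow> path measure \<Rightarrow> bool" where
  "represents M m \<longleftrightarrow> prob_space M \<and> sets M = sets central_borel \<and>
     (\<forall>f. continuous_map path_topology euclideanreal f \<longrightarrow>
        (\<integral>\<omega>. f \<omega> \<partial>m) = (\<integral>m'. (\<integral>\<omega>. f \<omega> \<partial>m') \<partial>M))"

definition extremal_decomposition :: "path measure measure \<Rightarrow> path measure \<Rightarrow> bool" where
  "extremal_decomposition M m \<longleftrightarrow> represents M m \<and> (AE m' in M. m' \<in> extreme_central)"


section \<open>Tail sigma-fields\<close>

definition raw_tail_from :: "nat \<Rightarrow> path set set" where
  "raw_tail_from N = sigma_sets paths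
     (range (\<lambda>B. vertex_at N -` B \<inter> paths) \<union> {edge_at k -` B \<inter> paths | k B. k \<ge> N})"

definition raw_central_tail :: "path set set" where
  "raw_central_tail = (\<Inter>N \<in> {1..}. raw_tail_from N)"

definition completed :: "path measure \<Rightarrow> path set set \<Rightarrow> path set set" where
  "completed m H = sigma_sets paths (H \<union> {A. \<exists>N \<in> null_sets m. A \<subseteq> N})"


section \<open>Symmetric functions\<close>

text \<open>The algebra \<open>\<real>[p\<^sub>1, p\<^sub>2, \<dots>]\<close> is the polynomial ring in countably many variables, variable number
  \<open>j\<close> (starting at 0) standing for the power sum \<open>p\<^sub>(j+1)\<close>.  Polynomials are finitely supported
  families of coefficients indexed by monomials \<open>nat \<Rightarrow>\<^sub>0 nat\<close>.\<close>

type_synonym poly_ring = "(nat \<Rightarrow>\<^sub>0 nat) \<Rightarrow>\<^sub>0 real"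

text \<open>The evaluation homomorphism: coefficients are mapped by \<open>c\<close>, variable \<open>j\<close> goes to \<open>v j\<close>.\<close>

definition eval_hom :: "(real \<Rightarrow> 'a::comm_ring_1) \<Rightarrow> (nat \<Rightarrow> 'a) \<Rightarrow> poly_ring \<Rightarrow> 'a" where
  "eval_hom c v f =
     (\<Sum>a \<in> Poly_Mapping.keys f. c (Poly_Mapping.lookup f a) *
        (\<Prod>j \<in> Poly_Mapping.keys a. v j ^ Poly_Mapping.lookup a j))"

lemma eval_hom_superset:
  assumes "finite S" "Poly_Mapping.keys f \<subseteq> S" "c 0 = 0"
  shows "eval_hom c v f = (\<Sum>a \<in> S. c (Poly_Mapping.lookup f a) *
        (\<Prod>j \<in> Poly_Mapping.keys a. v j ^ Poly_Mapping.lookup a j))"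
  unfolding eval_hom_def using assms
  by (intro sum.mono_neutral_left) (auto simp: in_keys_iff)

lemma eval_hom_single:
  assumes "c 0 = 0"
  shows "eval_hom c v (Poly_Mapping.single a r) =
    c r * (\<Prod>j \<in> Poly_Mapping.keys a. v j ^ Poly_Mapping.lookup a j)"
  using assms by (subst eval_hom_superset[of "{a}"]) auto

lemma eval_hom_add:
  assumes "c 0 = 0" "\<And>x y. c (x + y) = c x + c y"
  shows "eval_hom c v (f + g) = eval_hom c v f + eval_hom c v g"
proof -
  let ?S = "Poly_Mapping.keys f \<union> Poly_Mapping.keys g"
  have S: "finite ?S" "Poly_Mapping.keys f \<subseteq> ?S" "Poly_Mapping.keys g \<subseteq> ?S"
    "Poly_Mapping.keys (f + g) \<subseteq> ?S"
    by (auto simp: Poly_Mapping.keys_add subsetD[OF Poly_Mapping.keys_add])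
  show ?thesis
    using S assms
    by (simp add: eval_hom_superset[of ?S] lookup_add distrib_right sum.distrib)
qed

lemma eval_hom_sum:
  assumes "c 0 = 0" "\<And>x y. c (x + y) = c x + c y"
  shows "eval_hom c v (\<Sum>i\<in>I. f i) = (\<Sum>i\<in>I. eval_hom c v (f i))"
  by (induction I rule: infinite_finite_induct) (auto simp: eval_hom_add assms, auto simp: eval_hom_def)

lemma eval_hom_mult:
  assumes c: "c 0 = 0" "\<And>x y. c (x + y) = c x + c y" "\<And>x y. c (x * y) = c x * c y"
  shows "eval_hom c v (f * g) = eval_hom c v f * eval_hom c v g"
proof -
  let ?m = "\<lambda>a. \<Prod>j \<in> Poly_Mapping.keys a. v j ^ Poly_Mapping.lookup a j"
  let ?s = "\<lambda>h a. Poly_Mapping.single a (Poly_Mapping.lookup h a) :: poly_ring"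
  have m: "?m (a + b) = ?m a * ?m b" for a b
  proof -
    let ?S = "Poly_Mapping.keys a \<union> Poly_Mapping.keys b"
    have "?m d = (\<Prod>j\<in>?S. v j ^ Poly_Mapping.lookup d j)" if "Poly_Mapping.keys d \<subseteq> ?S" for d
      using that by (intro prod.mono_neutral_left) (auto simp: in_keys_iff)
    from this[of a] this[of b] this[OF Poly_Mapping.keys_add] show ?thesis
      by (simp add: lookup_add power_add prod.distrib)
  qed
  have sum_s: "h = (\<Sum>a\<in>Poly_Mapping.keys h. ?s h a)" for h
    by (rule poly_mapping_eqI)
      (auto simp: lookup_sum lookup_single when_def in_keys_iff if_distrib cong: if_cong)
  have "f * g = (\<Sum>a\<in>Poly_Mapping.keys f. ?s f a) * (\<Sum>b\<in>Poly_Mapping.keys g. ?s g b)"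
    by (simp flip: sum_s)
  then have "eval_hom c v (f * g) =
      (\<Sum>a\<in>Poly_Mapping.keys f. \<Sum>b\<in>Poly_Mapping.keys g. eval_hom c v (?s f a * ?s g b))"
    by (simp add: sum_product eval_hom_sum c)
  also have "\<dots> = (\<Sum>a\<in>Poly_Mapping.keys f. \<Sum>b\<in>Poly_Mapping.keys g.
      eval_hom c v (?s f a) * eval_hom c v (?s g b))"
    by (simp add: mult_single eval_hom_single c m algebra_simps)
  also have "\<dots> = eval_hom c v f * eval_hom c v g"
    by (simp add: eval_hom_single c sum_product[symmetric]) (simp add: eval_hom_def)
  finally show ?thesis .
qed

definition var :: "nat \<Rightarrow> poly_ring" where
  "var i = Poly_Mapping.single (Poly_Mapping.single i 1) 1"

text \<open>A symmetric function as a symmetric polynomial in \<open>x\<^sub>0, \<dots>, x\<^sub>(N-1)\<close>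
  (here the variables of \<open>poly_ring\<close> are the \<open>x\<^sub>i\<close>).\<close>

definition in_variables :: "nat \<Rightarrow> poly_ring \<Rightarrow> poly_ring" where
  "in_variables N = eval_hom (Poly_Mapping.single 0) (\<lambda>j. \<Sum>i<N. var i ^ (j + 1))"

text \<open>The sum of all distinct monomials in \<open>x\<^sub>0, \<dots>, x\<^sub>(N-1)\<close> whose multiset of nonzero exponents is \<open>\<rho>\<close>.\<close>

definition monomial_sym_poly :: "nat \<Rightarrow> nat multiset \<Rightarrow> poly_ring" where
  "monomial_sym_poly N \<rho> =
     (\<Sum>a \<in> {a. Poly_Mapping.keys a \<subseteq> {..<N} \<and>
                image_mset (Poly_Mapping.lookup a) (mset_set (Poly_Mapping.keys a)) = \<rho>}.
        Poly_Mapping.single a 1)"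

definition monomial_sym :: "nat multiset \<Rightarrow> poly_ring" where
  "monomial_sym \<rho> = (THE f. \<forall>N. in_variables N f = monomial_sym_poly N \<rho>)"

definition aug_monomial_sym :: "nat multiset \<Rightarrow> poly_ring" where
  "aug_monomial_sym \<rho> = of_nat (\<Prod>j \<in> set_mset \<rho>. fact (count \<rho> j)) * monomial_sym \<rho>"


section \<open>The simplex, the extreme laws and the empirical observables\<close>

text \<open>The coordinates \<open>p\<^sub>1 \<ge> p\<^sub>2 \<ge> \<dots>\<close> are stored at indices \<open>0, 1, \<dots>\<close>; \<open>dust p\<close> is \<open>p\<^sub>0 = 1 - \<Sum> p\<^sub>i\<close>.\<close>

definition nabla :: "(nat \<Rightarrow> real) set" where
  "nabla = {p. decseq p \<and> (\<forall>i. 0 \<le> p i) \<and> summable p \<and> suminf p \<le> 1}"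

definition nabla_borel :: "(nat \<Rightarrow> real) measure" where
  "nabla_borel = restrict_space borel nabla"

definition dust :: "(nat \<Rightarrow> real) \<Rightarrow> real" where
  "dust p = 1 - suminf p"

text \<open>\<open>atomic w x\<close> is the Borel measure \<open>\<Sum>\<^sub>i w\<^sub>i \<delta>\<^sub>(x\<^sub>i)\<close> on the line.  Its instances below are carried
  by \<open>[0,1]\<close>.\<close>

definition atomic :: "(nat \<Rightarrow> real) \<Rightarrow> (nat \<Rightarrow> real) \<Rightarrow> real measure" where
  "atomic w x = distr (density (count_space UNIV) (\<lambda>i. ennreal (w i))) borel x"

definition nu :: "(nat \<Rightarrow> real) \<Rightarrow> real measure" where
  "nu p = atomic (case_nat (dust p) p) (case_nat 0 p)"

definition chi :: "(nat \<Rightarrow> real) \<Rightarrow> poly_ring \<Rightarrow> real" where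
  "chi p = eval_hom (\<lambda>r. r) (\<lambda>j. if j = 0 then 1 else suminf (\<lambda>i. p i ^ (j + 1)))"

text \<open>\<open>chi p\<close> is the unital algebra homomorphism determined by its values on the power sums.\<close>

lemma chi_add: "chi p (f + g) = chi p f + chi p g"
  and chi_mult: "chi p (f * g) = chi p f * chi p g"
  and chi_const: "chi p (Poly_Mapping.single 0 r) = r"
  and chi_power_sum: "chi p (var j) = (if j = 0 then 1 else suminf (\<lambda>i. p i ^ (j + 1)))"
  by (simp_all add: chi_def eval_hom_add eval_hom_mult eval_hom_single var_def)

definition extreme_law :: "(nat \<Rightarrow> real) \<Rightarrow> path measure" where
  "extreme_law p = (THE m. m \<in> central_measures \<and>
     (\<forall>\<gamma> t. is_walk leaf \<gamma> t \<longrightarrow> measure m (cylinder \<gamma>) =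
        (if path_forest t then chi p (aug_monomial_sym (shape t)) else 0)))"

definition emp_freq :: "nat \<Rightarrow> rtree \<Rightarrow> nat \<Rightarrow> real" where
  "emp_freq n t = (if n \<ge> 2 \<and> path_forest t
     then (\<lambda>i. real (part (shape t) i) / (real n - 1)) else (\<lambda>_. 0))"

definition emp_dust :: "nat \<Rightarrow> rtree \<Rightarrow> real" where
  "emp_dust n t = (if n \<ge> 2 \<and> path_forest t then real (count (shape t) 1) / (real n - 1) else 0)"

definition emp_nu :: "nat \<Rightarrow> rtree \<Rightarrow> real measure" where
  "emp_nu n t = (if n \<ge> 2 \<and> path_forest t
     then atomic (\<lambda>j. real (part (shape t) j) / (real n - 1)) (\<lambda>j. real (part (shape t) j) / (real n - 1))
     else return borel 0)"


section \<open>The Martin compactification of the path-forest graph\<close>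

definition martin_kernel :: "nat multiset \<Rightarrow> nat multiset \<Rightarrow> real" where
  "martin_kernel \<kappa> \<rho> = real (u (path_forest_tree \<kappa>)) *
     real (num_walks (path_forest_tree \<kappa>) (path_forest_tree \<rho>)) / real (u (path_forest_tree \<rho>))"

definition martin_vertex :: "nat multiset \<Rightarrow> nat multiset \<Rightarrow> real" where
  "martin_vertex \<rho> = (\<lambda>\<kappa>\<in>partitions. martin_kernel \<kappa> \<rho>)"

definition martin_cube :: "(nat multiset \<Rightarrow> real) topology" where
  "martin_cube = product_topology (\<lambda>_. top_of_set {0..1}) partitions"

definition martin_compactification :: "(nat multiset \<Rightarrow> real) topology" where
  "martin_compactification = subtopology martin_cube (martin_cube closure_of (martin_vertex ` partitions))"

text \<open>The identification of the simplex with the boundary.\<close>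

definition martin_boundary_point :: "(nat \<Rightarrow> real) \<Rightarrow> nat multiset \<Rightarrow> real" where
  "martin_boundary_point p =
     (\<lambda>\<kappa>\<in>partitions. real (u (path_forest_tree \<kappa>)) * chi p (aug_monomial_sym \<kappa>))"

end

theory Submission
  imports Defs
begin

text \<open>
  A path through path-forests grows a set partition one element at a time, and a central law makes it
  exchangeable: given everything from level \<open>N\<close> on, the types of its restrictions are obtained by
  sampling elements without replacement from the blocks at level \<open>N\<close>, so the sampling probabilities
  form reverse martingales.  They differ by \<open>O(1/N)\<close> from polynomials in the power sums of the block
  frequencies.  Hence the power sums at levels \<open>M \<le> N\<close> differ by \<open>O(M\<^sup>-\<^sup>1\<^sup>/\<^sup>2)\<close> in \<open>L\<^sup>2\<close>, so
  they converge almost surely along \<open>M = j\<^sup>4\<close>, and everywhere because one step changes them by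
  \<open>O(1/M)\<close> only.  The power sums of order at least 2 determine the frequencies, and the limit of the
  sampling probabilities is the paintbox formula for the conditional law given the tail.  The proportion
  of singletons is at most the dust in the limit for trivial reasons; that it is not smaller follows from
  a conditional variance bound of order \<open>1/M\<close>.

  Conditioning a central law on a tail event gives a central law again, so extreme laws have constant
  limit frequencies; conversely a law with constant limit frequencies is a paintbox law, and every law in
  a convex combination representing it inherits the constant.  The mixing measure of a decomposition is
  recovered through the map sending an extreme law to its mean frequencies.
\<close>

text \<open>One identity, \<open>isum_mult\<close>, carries the algebra. For falling factorials it
  makes the sampling probabilities harmonic for the growth of path-forests; for powers of
  frequencies and for formal variables it expands products with power sums by one common rule.
  Limits are therefore compared by induction on the number of parts, not through explicit formulas.
  Since \<open>monomial_sym\<close> is a definite description, existence and uniqueness come first;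
  uniqueness is the algebraic independence of the power sums.

  Order 1 is special: total frequency can be lost in a limit, while chi_p(p_1) = 1 always. The lost
  mass is the dust, so only orders >= 2 are used to identify limits, and singletons need an argument
  of their own.

  The exponent 4: an L2 distance O(M^(-1/2)) gives increments O(j^(-2)) in L1 along M = j^4, which
  are summable, and gaps O(j^3) between fourth powers allow a drift O(1/j) only. Any exponent above
  2 would do.

  The limit map is defined path by path, without reference to a law, so that one map serves every
  \<mu>.\<close>

declare of_nat_sum_mset [simp del]

section \<open>Injective sums\<close>

definition isum_step :: "('a \<Rightarrow> 'b::comm_ring_1) \<Rightarrow> ('a multiset \<Rightarrow> 'b) \<Rightarrow> 'a multiset \<Rightarrow> 'b" where
  "isum_step w X L = (\<Sum>l\<in>#L. w l * X (L - {#l#}))"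

text \<open>\<open>isum {#w\<^sub>1, \<dots>, w\<^sub>r#} L\<close> is the sum of \<open>w\<^sub>1 l\<^sub>1 \<cdots> w\<^sub>r l\<^sub>r\<close> over the ways to draw
  \<open>l\<^sub>1, \<dots>, l\<^sub>r\<close> from \<open>L\<close> without replacement.\<close>

definition isum :: "('a \<Rightarrow> 'b::comm_ring_1) multiset \<Rightarrow> 'a multiset \<Rightarrow> 'b" where
  "isum W = fold_mset isum_step (\<lambda>_. 1) W"

lemma sum_mset_remove:
  fixes f :: "'a \<Rightarrow> 'b::ab_group_add"
  assumes "l \<in># L" shows "(\<Sum>m\<in>#L - {#l#}. f m) = (\<Sum>m\<in>#L. f m) - f l"
proof -
  from assms obtain L' where "L = add_mset l L'" by (rule mset_add)
  then show ?thesis by simp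
qed

lemma sum_mset_subtractf:
  fixes f g :: "'a \<Rightarrow> 'b::ab_group_add"
  shows "(\<Sum>x\<in>#A. f x - g x) = (\<Sum>x\<in>#A. f x) - (\<Sum>x\<in>#A. g x)"
  by (induction A) auto

text \<open>Sums over ordered pairs of distinct occurrences: the full double sum minus the diagonal
  is symmetric in the two indices.\<close>

lemma sum_mset_pairs_swap:
  fixes f :: "'a \<Rightarrow> 'a \<Rightarrow> 'b::ab_group_add"
  shows "(\<Sum>l\<in>#L. \<Sum>m\<in>#L - {#l#}. f l m) = (\<Sum>m\<in>#L. \<Sum>l\<in>#L - {#m#}. f l m)"
proof -
  have "(\<Sum>l\<in>#L. \<Sum>m\<in>#L - {#l#}. f l m) = (\<Sum>l\<in>#L. (\<Sum>m\<in>#L. f l m) - f l l)"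
    by (intro arg_cong[where f=sum_mset] image_mset_cong) (simp add: sum_mset_remove)
  also have "\<dots> = (\<Sum>m\<in>#L. (\<Sum>l\<in>#L. f l m) - f m m)"
    unfolding sum_mset_subtractf by (rule arg_cong2[where f="(-)"], rule sum_mset.swap, rule refl)
  also have "\<dots> = (\<Sum>m\<in>#L. \<Sum>l\<in>#L - {#m#}. f l m)"
    by (intro arg_cong[where f=sum_mset] image_mset_cong) (simp add: sum_mset_remove)
  finally show ?thesis .
qed

text \<open>Two successive draws range over ordered pairs of distinct occurrences, so the weights
  may be processed in any order. This is what allows the fold over an unordered multiset of
  weights.\<close>

lemma isum_step_commute: "isum_step v (isum_step w X) L = isum_step w (isum_step v X) L"
  unfolding isum_step_def
  by (simp add: sum_mset_distrib_left)
     (subst sum_mset_pairs_swap, simp add: mult.left_commute add_mset_commute)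

interpretation isum: comp_fun_commute isum_step
  by standard (auto simp: fun_eq_iff isum_step_commute)

lemma isum_empty [simp]: "isum {#} L = 1"
  by (simp add: isum_def)

lemma isum_add: "isum (add_mset w W) L = (\<Sum>l\<in>#L. w l * isum W (L - {#l#}))"
  by (simp add: isum_def isum_step_def)

lemma sum_mset_cong: "(\<And>x. x \<in># A \<Longrightarrow> f x = g x) \<Longrightarrow> (\<Sum>x\<in>#A. f x) = (\<Sum>x\<in>#A. g x)"
  by (intro arg_cong[where f=sum_mset] image_mset_cong)

text \<open>The free index l either avoids all drawn ones or coincides with exactly one of them, say
  the one of v, whose weight then becomes w l * v l. The recursions for falling factorials,
  frequencies and variables are all instances.\<close>

lemma isum_mult:
  "(\<Sum>l\<in>#L. w l) * isum W L =
     isum (add_mset w W) L + (\<Sum>v\<in>#W. isum (add_mset (\<lambda>l. w l * v l) (W - {#v#})) L)"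
proof (induction W arbitrary: L)
  case empty
  then show ?case by (simp add: isum_add)
next
  case (add v W)
  \<comment> \<open>Fix the draw m made for v: the sum of w over L is w m plus the sum over what is
    left, to which the induction hypothesis applies.\<close>
  have "(\<Sum>l\<in>#L. w l) * isum (add_mset v W) L =
     (\<Sum>m\<in>#L. v m * w m * isum W (L - {#m#}) + v m * ((\<Sum>l\<in>#L - {#m#}. w l) * isum W (L - {#m#})))"
    unfolding isum_add sum_mset_distrib_left
    by (intro sum_mset_cong) (simp add: sum_mset_remove algebra_simps)
  also have "\<dots> = (\<Sum>m\<in>#L. w m * v m * isum W (L - {#m#})) + (\<Sum>m\<in>#L. v m * isum (add_mset w W) (L - {#m#}))
      + (\<Sum>m\<in>#L. v m * (\<Sum>v'\<in>#W. isum (add_mset (\<lambda>l. w l * v' l) (W - {#v'#})) (L - {#m#})))"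
    unfolding add by (simp add: sum_mset.distrib algebra_simps)
  also have "(\<Sum>m\<in>#L. v m * isum (add_mset w W) (L - {#m#})) = isum (add_mset w (add_mset v W)) L"
    by (subst add_mset_commute) (simp only: isum_add[of v])
  also have "(\<Sum>m\<in>#L. v m * (\<Sum>v'\<in>#W. isum (add_mset (\<lambda>l. w l * v' l) (W - {#v'#})) (L - {#m#}))) =
     (\<Sum>v'\<in>#W. isum (add_mset v (add_mset (\<lambda>l. w l * v' l) (W - {#v'#}))) L)"
    by (simp add: sum_mset_distrib_left isum_add[of v]) (subst sum_mset.swap, rule refl)
  also have "\<dots> = (\<Sum>v'\<in>#W. isum (add_mset (\<lambda>l. w l * v' l) (add_mset v W - {#v'#})) L)"
    by (intro sum_mset_cong) (simp add: add_mset_commute)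
  finally show ?case
    by (simp add: isum_add algebra_simps)
qed

lemma isum_add_linear:
  "isum (add_mset (\<lambda>l. f l + c * g l) W) L = isum (add_mset f W) L + c * isum (add_mset g W) L"
  by (simp add: isum_add sum_mset.distrib sum_mset_distrib_left algebra_simps)

section \<open>Falling factorials\<close>

definition fall :: "nat \<Rightarrow> nat \<Rightarrow> real" where
  "fall k l = (\<Prod>i<k. real l - real i)"

lemma fall_0 [simp]: "fall 0 l = 1" and fall_Suc: "fall (Suc k) l = fall k l * (real l - real k)"
  by (simp_all add: fall_def)

lemma fall_1 [simp]: "fall 1 l = real l" "fall (Suc 0) l = real l"
  by (simp_all add: fall_def)

lemma fall_fun_1: "fall (Suc 0) = real"
  by (rule ext) simp

lemma fall_eq_0: "l < k \<Longrightarrow> fall k l = 0"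
  unfolding fall_def by (rule prod_zero) auto

lemma fall_pos: "k \<le> l \<Longrightarrow> fall k l > 0"
  unfolding fall_def by (intro prod_pos) auto

lemma fall_nonneg [simp]: "fall k l \<ge> 0"
  by (cases "k \<le> l") (auto simp: fall_eq_0 less_imp_le[OF fall_pos])

lemma fall_le_power: "fall k l \<le> real l ^ k"
proof (cases "k \<le> l")
  case True
  then have "fall k l \<le> (\<Prod>i<k. real l)"
    unfolding fall_def by (intro prod_mono) auto
  then show ?thesis by simp
qed (simp add: fall_eq_0)

lemma fall_Suc_shift: "fall (Suc k) (Suc l) = real (Suc l) * fall k l"
  unfolding fall_def prod.lessThan_Suc_shift by simp

text \<open>The factor l/N is kept in the error because the errors are later summed over the parts l
  of a partition, where the l/N add up to at most 1. The constant is closed under the induction by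
  k^2 + k <= (k+1)^2.\<close>

lemma fall_approx:
  assumes "k \<ge> 1" "l \<le> N" "N > 0"
  shows "0 \<le> (real l / real N) ^ k - fall k l / real N ^ k"
    "(real l / real N) ^ k - fall k l / real N ^ k \<le> (real k)\<^sup>2 / real N * (real l / real N)"
proof -
  let ?x = "real l / real N"
  show "0 \<le> ?x ^ k - fall k l / real N ^ k"
    using fall_le_power[of k l] assms by (simp add: power_divide divide_right_mono)
  have x: "0 \<le> ?x" "?x \<le> 1" using assms by auto
  show "?x ^ k - fall k l / real N ^ k \<le> (real k)\<^sup>2 / real N * ?x"
    using \<open>k \<ge> 1\<close>
  proof (induction k rule: dec_induct)
    case base
    then show ?case using assms by simp
  next
    case (step k)
    let ?f = "fall k l / real N ^ k"
    have f: "0 \<le> ?f" "?f \<le> ?x ^ k" "?f \<le> ?x"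
    proof -
      show "?f \<le> ?x ^ k"
        using fall_le_power[of k l] by (simp add: power_divide divide_right_mono)
      have "?f \<le> ?x ^ k"
        using fall_le_power[of k l] by (simp add: power_divide divide_right_mono)
      also have "\<dots> \<le> ?x ^ 1" using x step by (intro power_decreasing) auto
      finally show "?f \<le> ?x" by simp
    qed simp
    have "fall (Suc k) l / real N ^ Suc k = ?f * ((real l - real k) / real N)"
      by (simp add: fall_Suc)
    also have "(real l - real k) / real N = ?x - real k / real N"
      by (rule diff_divide_distrib)
    finally have "?x ^ Suc k - fall (Suc k) l / real N ^ Suc k = ?x * (?x ^ k - ?f) + real k / real N * ?f"
      unfolding power_Suc by (simp only: algebra_simps)
    also have "\<dots> \<le> 1 * ((real k)\<^sup>2 / real N * ?x) + real k / real N * ?x"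
      using step.IH x f assms by (intro add_mono mult_mono) auto
    also have "\<dots> = ((real k)\<^sup>2 + real k) / real N * ?x"
      by (simp only: add_divide_distrib distrib_right mult_1)
    also have "\<dots> \<le> (real (Suc k))\<^sup>2 / real N * ?x"
      using x by (intro mult_right_mono divide_right_mono) (auto simp: power2_eq_square algebra_simps)
    finally show ?case .
  qed
qed

section \<open>Sampling without replacement and its approximation by power sums\<close>

definition sfall :: "nat multiset \<Rightarrow> nat multiset \<Rightarrow> real" where
  "sfall \<kappa> \<rho> = isum (image_mset fall \<kappa>) \<rho>"

definition weight_pow :: "nat \<Rightarrow> nat \<Rightarrow> nat \<Rightarrow> real" where
  "weight_pow N k l = (real l / real N) ^ k"

definition spow :: "nat multiset \<Rightarrow> nat multiset \<Rightarrow> real" where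
  "spow \<kappa> \<rho> = isum (image_mset (weight_pow (sum_mset \<rho>)) \<kappa>) \<rho>"

definition psum :: "nat \<Rightarrow> nat multiset \<Rightarrow> real" where
  "psum k \<rho> = (\<Sum>l\<in>#\<rho>. (real l / real (sum_mset \<rho>)) ^ k)"

text \<open>The probability that in a uniformly random set partition of type \<open>\<rho>\<close> a given set partition
  of type \<open>\<kappa>\<close> is the restriction to the first \<open>sum_mset \<kappa>\<close> elements.\<close>

definition sampling :: "nat multiset \<Rightarrow> nat multiset \<Rightarrow> real" where
  "sampling \<kappa> \<rho> = sfall \<kappa> \<rho> / fall (sum_mset \<kappa>) (sum_mset \<rho>)"

lemma sfall_empty [simp]: "sfall {#} \<rho> = 1"
  by (simp add: sfall_def)

lemma sfall_add: "sfall (add_mset k \<kappa>) \<rho> = (\<Sum>l\<in>#\<rho>. fall k l * sfall \<kappa> (\<rho> - {#l#}))"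
  by (simp add: sfall_def isum_add)

lemma sum_mset_nonneg': "(\<And>x. x \<in># A \<Longrightarrow> f x \<ge> (0::real)) \<Longrightarrow> (\<Sum>x\<in>#A. f x) \<ge> 0"
  by (induction A) auto

lemma sfall_nonneg [simp]: "sfall \<kappa> \<rho> \<ge> 0"
  by (induction \<kappa> arbitrary: \<rho>) (auto simp: sfall_add intro!: sum_mset_nonneg')

lemma sum_mset_eq_0D: "(\<Sum>x\<in>#A. f x :: real) \<noteq> 0 \<Longrightarrow> \<exists>x\<in>#A. f x \<noteq> 0"
  by (induction A) auto

text \<open>A nonzero term assigns to the parts k of \<kappa> distinct occurrences of parts l >= k
  of \<rho>. Equal totals then force l = k throughout and leave over only zero parts.\<close>

lemma sfall_neq_0D:
  assumes "sfall \<kappa> \<rho> \<noteq> 0"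
  shows "sum_mset \<kappa> \<le> sum_mset \<rho>"
    "sum_mset \<kappa> = sum_mset \<rho> \<Longrightarrow> 0 \<notin># \<rho> \<Longrightarrow> \<kappa> = \<rho>"
proof -
  have "sum_mset \<kappa> \<le> sum_mset \<rho> \<and> (sum_mset \<kappa> = sum_mset \<rho> \<longrightarrow> 0 \<notin># \<rho> \<longrightarrow> \<kappa> = \<rho>)"
    using assms
  proof (induction \<kappa> arbitrary: \<rho>)
    case empty
    then show ?case by (cases \<rho>) auto
  next
    case (add k \<kappa>)
    from sum_mset_eq_0D[OF add.prems[unfolded sfall_add]] obtain l where
      l: "l \<in># \<rho>" "fall k l \<noteq> 0" "sfall \<kappa> (\<rho> - {#l#}) \<noteq> 0" by auto
    then obtain \<rho>' where \<rho>: "\<rho> = add_mset l \<rho>'" by (metis mset_add)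
    have "k \<le> l" using l(2) fall_eq_0 not_le by blast
    with add.IH[of \<rho>'] l(3) \<rho> show ?case by auto
  qed
  then show "sum_mset \<kappa> \<le> sum_mset \<rho>" "sum_mset \<kappa> = sum_mset \<rho> \<Longrightarrow> 0 \<notin># \<rho> \<Longrightarrow> \<kappa> = \<rho>"
    by auto
qed


lemma sum_real_mset: "(\<Sum>l\<in>#\<rho>. real l) = real (sum_mset \<rho>)"
  by (induction \<rho>) auto

text \<open>The instance w = \<open>real\<close> of \<open>isum_mult\<close>, with l * fall j l =
  fall (j+1) l + j * fall j l. The terms with factor j add up to the total of \<kappa> and move to
  the left-hand side.\<close>

lemma sfall_harmonic:
  "(real (sum_mset \<rho>) - real (sum_mset \<kappa>)) * sfall \<kappa> \<rho> =
     sfall (add_mset 1 \<kappa>) \<rho> + (\<Sum>j\<in>#\<kappa>. sfall (add_mset (j + 1) (\<kappa> - {#j#})) \<rho>)"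
proof -
  have "real (sum_mset \<rho>) * sfall \<kappa> \<rho> = isum (add_mset (\<lambda>l. real l) (image_mset fall \<kappa>)) \<rho>
     + (\<Sum>j\<in>#\<kappa>. isum (add_mset (\<lambda>l. real l * fall j l) (image_mset fall \<kappa> - {#fall j#})) \<rho>)"
    using isum_mult[of "\<lambda>l. real l" \<rho> "image_mset fall \<kappa>"]
    by (simp add: sfall_def sum_real_mset image_mset.compositionality comp_def)
  also have "isum (add_mset (\<lambda>l. real l) (image_mset fall \<kappa>)) \<rho> = sfall (add_mset 1 \<kappa>) \<rho>"
    by (simp add: sfall_def fall_fun_1)
  also have "(\<Sum>j\<in>#\<kappa>. isum (add_mset (\<lambda>l. real l * fall j l) (image_mset fall \<kappa> - {#fall j#})) \<rho>) =
     (\<Sum>j\<in>#\<kappa>. sfall (add_mset (j + 1) (\<kappa> - {#j#})) \<rho> + real j * sfall \<kappa> \<rho>)"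
  proof (intro sum_mset_cong)
    fix j assume j: "j \<in># \<kappa>"
    then obtain \<kappa>' where \<kappa>: "\<kappa> = add_mset j \<kappa>'" by (metis mset_add)
    have "(\<lambda>l. real l * fall j l) = (\<lambda>l. fall (j + 1) l + real j * fall j l)"
      by (auto simp: fall_Suc algebra_simps)
    then show "isum (add_mset (\<lambda>l. real l * fall j l) (image_mset fall \<kappa> - {#fall j#})) \<rho> =
      sfall (add_mset (j + 1) (\<kappa> - {#j#})) \<rho> + real j * sfall \<kappa> \<rho>"
      by (simp only: isum_add_linear) (simp add: \<kappa> sfall_def)
  qed
  also have "\<dots> = (\<Sum>j\<in>#\<kappa>. sfall (add_mset (j + 1) (\<kappa> - {#j#})) \<rho>) + real (sum_mset \<kappa>) * sfall \<kappa> \<rho>"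
    by (simp add: sum_mset.distrib sum_mset_distrib_right[symmetric] sum_real_mset)
  finally show ?thesis by (simp add: algebra_simps)
qed

lemma sampling_empty [simp]: "sampling {#} \<rho> = 1"
  by (simp add: sampling_def)

lemma sampling_nonneg [simp]: "sampling \<kappa> \<rho> \<ge> 0"
  by (simp add: sampling_def)

lemma sum_mset_move: "j \<in># \<kappa> \<Longrightarrow> sum_mset (add_mset (j + k) (\<kappa> - {#j#})) = sum_mset \<kappa> + (k::nat)"
  by (drule multi_member_split) auto

text \<open>Division by fall (m+1) N = fall m N * (N - m); the strict inequality keeps it nonzero.
  In words of set partitions: element m+1 opens a new block or joins one of the existing
  blocks.\<close>

lemma sampling_harmonic:
  assumes "sum_mset \<kappa> < sum_mset \<rho>"
  shows "sampling \<kappa> \<rho> = sampling (add_mset 1 \<kappa>) \<rho> + (\<Sum>j\<in>#\<kappa>. sampling (add_mset (j + 1) (\<kappa> - {#j#})) \<rho>)"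
proof -
  let ?m = "sum_mset \<kappa>" and ?N = "sum_mset \<rho>"
  have "real ?m < real ?N" using assms by (simp only: of_nat_less_iff)
  then have pos: "fall ?m ?N > 0" "real ?N - real ?m > 0" using assms fall_pos[of ?m ?N] by linarith+
  have "sampling (add_mset 1 \<kappa>) \<rho> + (\<Sum>j\<in>#\<kappa>. sampling (add_mset (j + 1) (\<kappa> - {#j#})) \<rho>) =
     sfall (add_mset 1 \<kappa>) \<rho> / fall (Suc ?m) ?N +
     (\<Sum>j\<in>#\<kappa>. sfall (add_mset (j + 1) (\<kappa> - {#j#})) \<rho> / fall (Suc ?m) ?N)"
    unfolding sampling_def
    by (intro arg_cong2[where f="(+)"] sum_mset_cong) (simp, subst sum_mset_move, auto)
  also have "\<dots> = (sfall (add_mset 1 \<kappa>) \<rho> + (\<Sum>j\<in>#\<kappa>. sfall (add_mset (j + 1) (\<kappa> - {#j#})) \<rho>)) / fall (Suc ?m) ?N"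
    by (simp add: divide_inverse sum_mset_distrib_right[symmetric] distrib_right)
  also have "\<dots> = sampling \<kappa> \<rho>"
    unfolding sfall_harmonic[symmetric] using pos by (simp add: sampling_def fall_Suc)
  finally show ?thesis ..
qed

text \<open>The boundary values: at the level of \<rho> the harmonic function \<kappa> ->
  \<open>sampling \<kappa> \<rho>\<close> is concentrated on \<rho>. Together with harmonicity this
  counts walks ending at \<rho>.\<close>

lemma sampling_eq_0:
  assumes "sum_mset \<kappa> = sum_mset \<rho>" "0 \<notin># \<rho>" "\<kappa> \<noteq> \<rho>"
  shows "sampling \<kappa> \<rho> = 0"
  using sfall_neq_0D(2)[of \<kappa> \<rho>] assms by (auto simp: sampling_def)

lemma spow_recursion:
  assumes "0 < sum_mset \<rho>"
  shows "psum k \<rho> * spow \<kappa> \<rho> = spow (add_mset k \<kappa>) \<rho> + (\<Sum>j\<in>#\<kappa>. spow (add_mset (j + k) (\<kappa> - {#j#})) \<rho>)"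
proof -
  let ?w = "weight_pow (sum_mset \<rho>)"
  have "psum k \<rho> * spow \<kappa> \<rho> = isum (add_mset (?w k) (image_mset ?w \<kappa>)) \<rho>
     + (\<Sum>j\<in>#\<kappa>. isum (add_mset (\<lambda>l. ?w k l * ?w j l) (image_mset ?w \<kappa> - {#?w j#})) \<rho>)"
    using isum_mult[of "?w k" \<rho> "image_mset ?w \<kappa>"]
    by (simp add: spow_def psum_def weight_pow_def image_mset.compositionality comp_def)
  also have "(\<Sum>j\<in>#\<kappa>. isum (add_mset (\<lambda>l. ?w k l * ?w j l) (image_mset ?w \<kappa> - {#?w j#})) \<rho>) =
     (\<Sum>j\<in>#\<kappa>. spow (add_mset (j + k) (\<kappa> - {#j#})) \<rho>)"
  proof (intro sum_mset_cong)
    fix j assume j: "j \<in># \<kappa>"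
    then obtain \<kappa>' where \<kappa>: "\<kappa> = add_mset j \<kappa>'" by (metis mset_add)
    have "(\<lambda>l. ?w k l * ?w j l) = ?w (j + k)"
      by (auto simp: weight_pow_def power_add)
    then show "isum (add_mset (\<lambda>l. ?w k l * ?w j l) (image_mset ?w \<kappa> - {#?w j#})) \<rho> =
      spow (add_mset (j + k) (\<kappa> - {#j#})) \<rho>"
      by (simp add: \<kappa> spow_def)
  qed
  finally show ?thesis by (simp add: spow_def)
qed

lemma psum_1:
  assumes "0 < sum_mset \<rho>" shows "psum 1 \<rho> = 1"
proof -
  have "real (sum_mset \<rho>) \<noteq> 0" using assms by (simp only: of_nat_eq_0_iff)
  then show ?thesis
  by (simp add: psum_def sum_mset_distrib_right[symmetric] sum_real_mset divide_inverse)
qed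

lemma abs_sum_mset_le: "\<bar>\<Sum>x\<in>#A. f x :: real\<bar> \<le> (\<Sum>x\<in>#A. \<bar>f x\<bar>)"
  by (induction A) auto

definition approx_const :: "nat multiset \<Rightarrow> real" where
  "approx_const \<kappa> = (\<Sum>k\<in>#\<kappa>. (real k)\<^sup>2)"

lemma approx_const_nonneg [simp]: "approx_const \<kappa> \<ge> 0"
  unfolding approx_const_def by (intro sum_mset_nonneg') auto

lemma sum_weight_le_1:
  assumes "sum_mset \<rho> \<le> N"
  shows "(\<Sum>l\<in>#\<rho>. real l / real N) \<le> 1"
proof -
  have "(\<Sum>l\<in>#\<rho>. real l / real N) = real (sum_mset \<rho>) / real N"
    by (induction \<rho>) (auto simp: add_divide_distrib)
  also have "\<dots> \<le> 1" using assms by (simp add: divide_le_eq)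
  finally show ?thesis .
qed

lemma mem_le_sum_mset: "l \<in># \<rho> \<Longrightarrow> l \<le> sum_mset (\<rho> :: nat multiset)"
  by (drule multi_member_split) auto

lemma sum_mset_diff_le: "sum_mset (\<rho> - {#l#}) \<le> sum_mset (\<rho> :: nat multiset)"
  by (cases "l \<in># \<rho>") (auto dest: multi_member_split simp: diff_single_trivial)

text \<open>N only dominates the total of \<rho>, because the induction removes parts from \<rho>
  while the normalisation has to stay fixed. In b - a the error of the first factor is k^2/N * x and
  that of the remaining factors is multiplied by x^k <= x, with x = l/N; both are summed against
  weights of total at most 1.\<close>

lemma isum_fall_bounds:
  assumes "0 \<notin># \<kappa>" "sum_mset \<rho> \<le> N" "N > 0"
  defines "a \<equiv> \<lambda>\<kappa> \<rho>. isum (image_mset (\<lambda>k l. fall k l / real N ^ k) \<kappa>) \<rho>"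
  defines "b \<equiv> \<lambda>\<kappa> \<rho>. isum (image_mset (weight_pow N) \<kappa>) \<rho>"
  shows "0 \<le> a \<kappa> \<rho> \<and> a \<kappa> \<rho> \<le> 1 \<and> \<bar>b \<kappa> \<rho> - a \<kappa> \<rho>\<bar> \<le> approx_const \<kappa> / real N"
  using assms(1,2)
proof (induction \<kappa> arbitrary: \<rho>)
  case empty
  then show ?case by (simp add: a_def b_def approx_const_def)
next
  case (add k \<kappa>)
  let ?x = "\<lambda>l. real l / real N"
  let ?f = "\<lambda>l. fall k l / real N ^ k"
  have k: "k \<ge> 1" using add.prems by (cases k) auto
  have IH: "0 \<le> a \<kappa> (\<rho> - {#l#}) \<and> a \<kappa> (\<rho> - {#l#}) \<le> 1 \<and>
      \<bar>b \<kappa> (\<rho> - {#l#}) - a \<kappa> (\<rho> - {#l#})\<bar> \<le> approx_const \<kappa> / real N" for l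
    using add.prems sum_mset_diff_le[of \<rho> l] by (intro add.IH) auto
  have x: "0 \<le> ?x l" "?x l \<le> 1" "0 \<le> ?f l" "?f l \<le> ?x l ^ k" "?x l ^ k \<le> ?x l"
     "?x l ^ k - ?f l \<le> (real k)\<^sup>2 / real N * ?x l" if "l \<in># \<rho>" for l
  proof -
    have l: "l \<le> N" using mem_le_sum_mset[OF that] add.prems by simp
    show *: "0 \<le> ?x l" "?x l \<le> 1" "0 \<le> ?f l" using l assms by auto
    show "?f l \<le> ?x l ^ k" "?x l ^ k - ?f l \<le> (real k)\<^sup>2 / real N * ?x l"
      using fall_approx[OF k l \<open>N > 0\<close>] by linarith+
    show "?x l ^ k \<le> ?x l"
      using power_decreasing[of 1 k "?x l"] k * by simp
  qed
  have a: "a (add_mset k \<kappa>) \<rho> = (\<Sum>l\<in>#\<rho>. ?f l * a \<kappa> (\<rho> - {#l#}))"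
    by (simp add: a_def isum_add)
  have b: "b (add_mset k \<kappa>) \<rho> = (\<Sum>l\<in>#\<rho>. ?x l ^ k * b \<kappa> (\<rho> - {#l#}))"
    by (simp add: b_def isum_add weight_pow_def)
  have 1: "0 \<le> a (add_mset k \<kappa>) \<rho>"
    unfolding a using x IH by (intro sum_mset_nonneg') auto
  have "a (add_mset k \<kappa>) \<rho> \<le> (\<Sum>l\<in>#\<rho>. ?x l)"
    unfolding a
  proof (intro sum_mset_mono)
    fix l assume "l \<in># \<rho>"
    then have "?f l * a \<kappa> (\<rho> - {#l#}) \<le> ?x l * 1"
      using x[of l] IH[of l] by (intro mult_mono) linarith+
    then show "?f l * a \<kappa> (\<rho> - {#l#}) \<le> ?x l" by simp
  qed
  also have "\<dots> \<le> 1" using add.prems by (intro sum_weight_le_1) auto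
  finally have 2: "a (add_mset k \<kappa>) \<rho> \<le> 1" .
  have "\<bar>b (add_mset k \<kappa>) \<rho> - a (add_mset k \<kappa>) \<rho>\<bar> =
      \<bar>\<Sum>l\<in>#\<rho>. ?x l ^ k * b \<kappa> (\<rho> - {#l#}) - ?f l * a \<kappa> (\<rho> - {#l#})\<bar>"
    unfolding a b by (simp add: sum_mset_subtractf)
  also have "\<dots> \<le> (\<Sum>l\<in>#\<rho>. \<bar>?x l ^ k * b \<kappa> (\<rho> - {#l#}) - ?f l * a \<kappa> (\<rho> - {#l#})\<bar>)"
    by (rule abs_sum_mset_le)
  also have "\<dots> \<le> (\<Sum>l\<in>#\<rho>. approx_const (add_mset k \<kappa>) / real N * ?x l)"
  proof (intro sum_mset_mono)
    fix l assume l: "l \<in># \<rho>"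
    let ?a = "a \<kappa> (\<rho> - {#l#})" and ?b = "b \<kappa> (\<rho> - {#l#})"
    have "?x l ^ k * ?b - ?f l * ?a = ?x l ^ k * (?b - ?a) + (?x l ^ k - ?f l) * ?a"
      by (simp add: algebra_simps)
    also have "\<bar>\<dots>\<bar> \<le> ?x l ^ k * \<bar>?b - ?a\<bar> + (?x l ^ k - ?f l) * ?a"
      using x[OF l] IH[of l] by (intro order_trans[OF abs_triangle_ineq]) (auto simp: abs_mult)
    also have "\<dots> \<le> ?x l * (approx_const \<kappa> / real N) + ((real k)\<^sup>2 / real N * ?x l) * 1"
      using x[OF l] IH[of l] by (intro add_mono mult_mono) auto
    also have "\<dots> = approx_const (add_mset k \<kappa>) / real N * ?x l"
      using assms by (simp add: approx_const_def field_simps)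
    finally show "\<bar>?x l ^ k * ?b - ?f l * ?a\<bar> \<le> approx_const (add_mset k \<kappa>) / real N * ?x l" .
  qed
  also have "\<dots> = approx_const (add_mset k \<kappa>) / real N * (\<Sum>l\<in>#\<rho>. ?x l)"
    by (simp only: sum_mset_distrib_left)
  also have "\<dots> \<le> approx_const (add_mset k \<kappa>) / real N * 1"
    using add.prems by (intro mult_left_mono sum_weight_le_1) simp_all
  finally show ?case using 1 2 by simp
qed

lemma isum_fall_scaled:
  assumes "N > 0"
  shows "isum (image_mset (\<lambda>k l. fall k l / real N ^ k) \<kappa>) \<rho> = sfall \<kappa> \<rho> / real N ^ sum_mset \<kappa>"
proof (induction \<kappa> arbitrary: \<rho>)
  case (add k \<kappa>)
  have "isum (image_mset (\<lambda>k l. fall k l / real N ^ k) (add_mset k \<kappa>)) \<rho> =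
     (\<Sum>l\<in>#\<rho>. fall k l * sfall \<kappa> (\<rho> - {#l#}) * inverse (real N ^ sum_mset (add_mset k \<kappa>)))"
    by (simp add: isum_add add power_add field_simps)
  then show ?case by (simp add: sfall_add sum_mset_distrib_right[symmetric] divide_inverse)
qed simp

text \<open>Two replacements, each of cost O(1/N): falling factorials of the parts by powers, and
  the normalisation \<open>fall m N\<close> by N^m.\<close>

lemma sampling_approx:
  assumes "0 \<notin># \<kappa>" "sum_mset \<kappa> \<le> sum_mset \<rho>" "0 < sum_mset \<rho>" "sampling \<kappa> \<rho> \<le> 1"
  shows "\<bar>sampling \<kappa> \<rho> - spow \<kappa> \<rho>\<bar> \<le> (approx_const \<kappa> + (real (sum_mset \<kappa>))\<^sup>2) / real (sum_mset \<rho>)"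
proof -
  let ?m = "sum_mset \<kappa>" and ?N = "sum_mset \<rho>"
  let ?a = "sfall \<kappa> \<rho> / real ?N ^ ?m" and ?f = "fall ?m ?N / real ?N ^ ?m"
  have 1: "\<bar>spow \<kappa> \<rho> - ?a\<bar> \<le> approx_const \<kappa> / real ?N"
    using isum_fall_bounds[of \<kappa> \<rho> ?N] isum_fall_scaled[of ?N \<kappa> \<rho>] assms by (simp add: spow_def)
  have f: "0 \<le> 1 - ?f \<and> 1 - ?f \<le> (real ?m)\<^sup>2 / real ?N"
  proof (cases "?m = 0")
    case True
    show ?thesis unfolding True by simp
  next
    case False
    have one: "real ?N / real ?N = 1" using assms(3) by (intro divide_self) (simp only: of_nat_eq_0_iff)
    from False have m: "?m \<ge> 1" by linarith
    from fall_approx[OF m order_refl[of ?N] assms(3), unfolded one] show ?thesis by simp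
  qed
  have "sampling \<kappa> \<rho> - ?a = sampling \<kappa> \<rho> * (1 - ?f)"
  proof -
    have "real ?N \<noteq> 0" using assms(3) by (simp only: of_nat_eq_0_iff)
    then have "?a = sampling \<kappa> \<rho> * ?f"
      using fall_pos[OF assms(2)] by (simp add: sampling_def)
    then show ?thesis by (simp add: right_diff_distrib)
  qed
  then have "\<bar>sampling \<kappa> \<rho> - ?a\<bar> = sampling \<kappa> \<rho> * (1 - ?f)"
    using f by (simp add: abs_mult)
  also have "\<dots> \<le> 1 * ((real ?m)\<^sup>2 / real ?N)"
    using f assms by (intro mult_mono) auto
  finally have 2: "\<bar>sampling \<kappa> \<rho> - ?a\<bar> \<le> (real ?m)\<^sup>2 / real ?N" by simp
  show ?thesis using 1 2 by (simp add: add_divide_distrib)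
qed

section \<open>Augmented monomial symmetric functions\<close>

definition expo_type :: "(nat \<Rightarrow>\<^sub>0 nat) \<Rightarrow> nat multiset" where
  "expo_type a = image_mset (Poly_Mapping.lookup a) (mset_set (Poly_Mapping.keys a))"

definition monomials :: "nat set \<Rightarrow> nat multiset \<Rightarrow> (nat \<Rightarrow>\<^sub>0 nat) set" where
  "monomials V \<rho> = {a. Poly_Mapping.keys a \<subseteq> V \<and> expo_type a = \<rho>}"

definition mult_fact :: "nat multiset \<Rightarrow> nat" where
  "mult_fact \<rho> = (\<Prod>j\<in>set_mset \<rho>. fact (count \<rho> j))"

definition aug_poly :: "nat set \<Rightarrow> nat multiset \<Rightarrow> poly_ring" where
  "aug_poly V \<rho> = isum (image_mset (\<lambda>k i. var i ^ k) \<rho>) (mset_set V)"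

lemma finite_monomials:
  assumes "finite V" shows "finite (monomials V \<rho>)"
proof -
  let ?F = "{f. \<forall>x. (x \<in> V \<longrightarrow> f x \<in> insert 0 (set_mset \<rho>)) \<and> (x \<notin> V \<longrightarrow> f x = (0::nat))}"
  have "finite ?F" by (intro finite_set_of_finite_funs assms) auto
  moreover have "Poly_Mapping.lookup ` monomials V \<rho> \<subseteq> ?F"
  proof clarify
    fix a x assume "a \<in> monomials V \<rho>"
    then have "Poly_Mapping.keys a \<subseteq> V" "set_mset \<rho> = Poly_Mapping.lookup a ` Poly_Mapping.keys a"
      by (auto simp: monomials_def expo_type_def)
    then show "(x \<in> V \<longrightarrow> Poly_Mapping.lookup a x \<in> insert 0 (set_mset \<rho>)) \<and>
        (x \<notin> V \<longrightarrow> Poly_Mapping.lookup a x = 0)"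
      by (auto simp: in_keys_iff)
  qed
  ultimately have "finite (Poly_Mapping.lookup ` monomials V \<rho>)" by (rule finite_subset[rotated])
  then show ?thesis by (rule finite_imageD) (auto intro!: inj_onI poly_mapping_eqI)
qed

lemma mult_fact_add: "mult_fact (add_mset k \<rho>) = mult_fact \<rho> * Suc (count \<rho> k)"
proof (cases "k \<in># \<rho>")
  case True
  then have [simp]: "insert k (set_mset \<rho>) = set_mset \<rho>" by auto
  have "mult_fact (add_mset k \<rho>) = fact (Suc (count \<rho> k)) * (\<Prod>j\<in>set_mset \<rho> - {k}. fact (count (add_mset k \<rho>) j))"
    unfolding mult_fact_def using True by (simp add: prod.remove[of _ k])
  also have "(\<Prod>j\<in>set_mset \<rho> - {k}. fact (count (add_mset k \<rho>) j)) = (\<Prod>j\<in>set_mset \<rho> - {k}. fact (count \<rho> j) :: nat)"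
    by (rule prod.cong) auto
  finally show ?thesis using True by (simp add: mult_fact_def prod.remove[of _ k] algebra_simps)
next
  case False
  have "(\<Prod>j\<in>set_mset \<rho>. fact (count (add_mset k \<rho>) j)) = (\<Prod>j\<in>set_mset \<rho>. fact (count \<rho> j) :: nat)"
    using False by (intro prod.cong) auto
  with False show ?thesis by (simp add: mult_fact_def not_in_iff)
qed

lemma mult_fact_pos: "mult_fact \<rho> > 0"
  by (auto simp: mult_fact_def intro!: prod_pos)

lemma var_power: "var i ^ k = Poly_Mapping.single (Poly_Mapping.single i k) 1"
proof (induction k)
  case (Suc k)
  then show ?case
    by (simp add: var_def mult_single) (simp flip: single_add)
qed simp

lemma expo_type_single_add:
  assumes "i \<notin> Poly_Mapping.keys a" "k > 0"
  shows "expo_type (Poly_Mapping.single i k + a) = add_mset k (expo_type a)"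
    "Poly_Mapping.keys (Poly_Mapping.single i k + a) = insert i (Poly_Mapping.keys a)"
    "Poly_Mapping.lookup (Poly_Mapping.single i k + a) i = k"
proof -
  show k: "Poly_Mapping.keys (Poly_Mapping.single i k + a) = insert i (Poly_Mapping.keys a)"
    using assms by (auto simp: in_keys_iff lookup_add lookup_single when_def split: if_splits)
  show l: "Poly_Mapping.lookup (Poly_Mapping.single i k + a) i = k"
    using assms by (auto simp: in_keys_iff lookup_add)
  have "image_mset (Poly_Mapping.lookup (Poly_Mapping.single i k + a)) (mset_set (Poly_Mapping.keys a))
      = image_mset (Poly_Mapping.lookup a) (mset_set (Poly_Mapping.keys a))"
    using assms by (intro image_mset_cong) (auto simp: lookup_add lookup_single when_def)
  then show "expo_type (Poly_Mapping.single i k + a) = add_mset k (expo_type a)"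
    unfolding expo_type_def k using assms l by simp
qed

lemma count_image_mset_set:
  "finite A \<Longrightarrow> count (image_mset f (mset_set A)) y = card {x \<in> A. f x = y}"
  by (simp add: count_image_mset Int_def vimage_def Collect_conj_eq[symmetric] conj_commute
        sum.If_cases count_mset_set(1))

lemma count_expo_type: "count (expo_type b) k = card {i \<in> Poly_Mapping.keys b. Poly_Mapping.lookup b i = k}"
  unfolding expo_type_def by (rule count_image_mset_set) simp

lemma split_monomial:
  assumes "b \<in> monomials V (add_mset k \<rho>)" "i \<in> Poly_Mapping.keys b" "Poly_Mapping.lookup b i = k"
  shows "\<exists>a. a \<in> monomials (V - {i}) \<rho> \<and> b = Poly_Mapping.single i k + a"
proof -
  let ?a = "Poly_Mapping.update i 0 b"
  have la: "Poly_Mapping.lookup ?a j = (if j = i then 0 else Poly_Mapping.lookup b j)" for j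
    by (simp add: lookup_update)
  have b: "b = Poly_Mapping.single i k + ?a"
    by (rule poly_mapping_eqI) (auto simp: lookup_add la lookup_single when_def assms)
  have i: "i \<notin> Poly_Mapping.keys ?a" by (simp add: in_keys_iff la)
  have k: "k > 0" using assms(2,3) by (simp add: in_keys_iff)
  from expo_type_single_add[OF i k] b assms(1) i have "?a \<in> monomials (V - {i}) \<rho>"
    by (auto simp: monomials_def)
  with b show ?thesis by blast
qed

text \<open>Equal exponents can be assigned to their variables in any order, so each monomial of
  type \<rho> arises \<open>mult_fact \<rho>\<close> times from the injective sum.\<close>

lemma aug_poly_eq:
  assumes "finite V" "0 \<notin># \<rho>"
  shows "aug_poly V \<rho> = of_nat (mult_fact \<rho>) * (\<Sum>a\<in>monomials V \<rho>. Poly_Mapping.single a 1)"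
  using assms
proof (induction \<rho> arbitrary: V)
  case empty
  have "monomials V {#} = {0}"
    by (auto simp: monomials_def expo_type_def mset_set_empty_iff)
  then show ?case by (simp add: aug_poly_def mult_fact_def)
next
  case (add k \<rho>)
  have k: "k > 0" using add.prems by auto
  let ?S = "Sigma V (\<lambda>i. monomials (V - {i}) \<rho>)"
  let ?T = "Sigma (monomials V (add_mset k \<rho>)) (\<lambda>b. {i \<in> Poly_Mapping.keys b. Poly_Mapping.lookup b i = k})"
  have "aug_poly V (add_mset k \<rho>) = (\<Sum>i\<in>V. var i ^ k * aug_poly (V - {i}) \<rho>)"
    using add.prems
    by (simp add: aug_poly_def isum_add sum_unfold_sum_mset mset_set_Diff
        cong: image_mset_cong)
  also have "\<dots> = (\<Sum>i\<in>V. of_nat (mult_fact \<rho>) *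
      (\<Sum>a\<in>monomials (V - {i}) \<rho>. Poly_Mapping.single (Poly_Mapping.single i k + a) 1))"
    using add by (intro sum.cong refl)
      (simp add: var_power mult.left_commute sum_distrib_left mult_single)
  also have "\<dots> = of_nat (mult_fact \<rho>) * (\<Sum>(i, a)\<in>?S. Poly_Mapping.single (Poly_Mapping.single i k + a) 1)"
    using add.prems by (simp add: sum_distrib_left[symmetric] sum.Sigma finite_monomials)
  \<comment> \<open>Double counting: a pair (i, a) corresponds to the monomial b = x_i^k a with a
    marked variable of exponent k, and b admits count \<rho> k + 1 such marks.\<close>
  also have "(\<Sum>(i, a)\<in>?S. Poly_Mapping.single (Poly_Mapping.single i k + a) 1 :: poly_ring) =
     (\<Sum>(b, i)\<in>?T. Poly_Mapping.single b 1)"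
  proof (rule sum.reindex_bij_witness[of _ "\<lambda>(b, i). (i, b - Poly_Mapping.single i k)"
        "\<lambda>(i, a). (Poly_Mapping.single i k + a, i)"], goal_cases)
    case (1 x)
    then show ?case by auto
  next
    case (2 x)
    then obtain i a where x: "x = (i, a)" "i \<in> V" "a \<in> monomials (V - {i}) \<rho>" by auto
    then have "i \<notin> Poly_Mapping.keys a" by (auto simp: monomials_def)
    from expo_type_single_add[OF this k] x show ?case by (auto simp: monomials_def)
  next
    case (3 x)
    then obtain b i where x: "x = (b, i)" "b \<in> monomials V (add_mset k \<rho>)" "i \<in> Poly_Mapping.keys b"
      "Poly_Mapping.lookup b i = k" by auto
    from split_monomial[OF x(2-4)] obtain a where "b = Poly_Mapping.single i k + a" by auto
    then show ?case using x by simp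
  next
    case (4 x)
    then obtain b i where x: "x = (b, i)" "b \<in> monomials V (add_mset k \<rho>)" "i \<in> Poly_Mapping.keys b"
      "Poly_Mapping.lookup b i = k" by auto
    from split_monomial[OF x(2-4)] obtain a where "b = Poly_Mapping.single i k + a" "a \<in> monomials (V - {i}) \<rho>"
      by auto
    then show ?case using x by (auto simp: monomials_def)
  next
    case (5 x)
    then show ?case by auto
  qed
  also have "\<dots> = (\<Sum>b\<in>monomials V (add_mset k \<rho>). \<Sum>i\<in>{i \<in> Poly_Mapping.keys b. Poly_Mapping.lookup b i = k}.
      Poly_Mapping.single b 1)"
    using add.prems by (subst sum.Sigma[symmetric]) (auto simp: finite_monomials)
  also have "\<dots> = (\<Sum>b\<in>monomials V (add_mset k \<rho>). of_nat (Suc (count \<rho> k)) * Poly_Mapping.single b 1)"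
  proof (intro sum.cong refl)
    fix b assume "b \<in> monomials V (add_mset k \<rho>)"
    then have "card {i \<in> Poly_Mapping.keys b. Poly_Mapping.lookup b i = k} = Suc (count \<rho> k)"
      by (simp add: count_expo_type[symmetric] monomials_def)
    then show "(\<Sum>i\<in>{i \<in> Poly_Mapping.keys b. Poly_Mapping.lookup b i = k}. Poly_Mapping.single b (1::real)) =
       of_nat (Suc (count \<rho> k)) * Poly_Mapping.single b 1"
      by (simp only: sum_constant)
  qed
  also have "of_nat (mult_fact \<rho>) * \<dots> = of_nat (mult_fact (add_mset k \<rho>)) *
      (\<Sum>b\<in>monomials V (add_mset k \<rho>). Poly_Mapping.single b (1::real))"
    by (simp only: mult_fact_add of_nat_mult sum_distrib_left mult.assoc)
  finally show ?case .
qed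

lemma monomial_sym_poly_eq: "monomial_sym_poly N \<rho> = (\<Sum>a\<in>monomials {..<N} \<rho>. Poly_Mapping.single a 1)"
  by (simp add: monomial_sym_poly_def monomials_def expo_type_def)

section \<open>Products with power sums and algebraic independence\<close>

definition power_poly :: "nat set \<Rightarrow> nat \<Rightarrow> poly_ring" where
  "power_poly V k = (\<Sum>i\<in>V. var i ^ k)"

lemma aug_poly_recursion:
  "power_poly V k * aug_poly V \<rho> = aug_poly V (add_mset k \<rho>) + (\<Sum>j\<in>#\<rho>. aug_poly V (add_mset (j + k) (\<rho> - {#j#})))"
proof -
  have "power_poly V k * aug_poly V \<rho> = isum (add_mset (\<lambda>i. var i ^ k) (image_mset (\<lambda>k i. var i ^ k) \<rho>)) (mset_set V)
     + (\<Sum>j\<in>#\<rho>. isum (add_mset (\<lambda>i. var i ^ k * var i ^ j) (image_mset (\<lambda>k i. var i ^ k) \<rho> - {#\<lambda>i. var i ^ j#})) (mset_set V))"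
    using isum_mult[of "\<lambda>i. var i ^ k" "mset_set V" "image_mset (\<lambda>k i. var i ^ k) \<rho>"]
    by (simp add: aug_poly_def power_poly_def sum_unfold_sum_mset image_mset.compositionality comp_def)
  also have "(\<Sum>j\<in>#\<rho>. isum (add_mset (\<lambda>i. var i ^ k * var i ^ j) (image_mset (\<lambda>k i. var i ^ k) \<rho> - {#\<lambda>i. var i ^ j#})) (mset_set V))
    = (\<Sum>j\<in>#\<rho>. aug_poly V (add_mset (j + k) (\<rho> - {#j#})))"
  proof (intro sum_mset_cong)
    fix j assume "j \<in># \<rho>"
    then obtain \<rho>' where "\<rho> = add_mset j \<rho>'" by (metis mset_add)
    then show "isum (add_mset (\<lambda>i. var i ^ k * var i ^ j) (image_mset (\<lambda>k i. var i ^ k) \<rho> - {#\<lambda>i. var i ^ j#})) (mset_set V) =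
      aug_poly V (add_mset (j + k) (\<rho> - {#j#}))"
      by (simp add: aug_poly_def power_add mult.commute)
  qed
  finally show ?thesis by (simp add: aug_poly_def)
qed

lemma lookup_of_nat_mult: "Poly_Mapping.lookup (of_nat n * f) b = real n * Poly_Mapping.lookup (f :: poly_ring) b"
  by (induction n) (auto simp: lookup_add algebra_simps)

lemma lookup_aug_poly:
  assumes "finite V" "0 \<notin># \<rho>" "Poly_Mapping.keys b \<subseteq> V"
  shows "Poly_Mapping.lookup (aug_poly V \<rho>) b = (if expo_type b = \<rho> then real (mult_fact \<rho>) else 0)"
proof -
  have "Poly_Mapping.lookup (\<Sum>a\<in>monomials V \<rho>. Poly_Mapping.single a (1::real)) b =
    (if b \<in> monomials V \<rho> then 1 else 0)"
    by (simp add: lookup_sum lookup_single when_def finite_monomials assms)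
  then show ?thesis
    using assms by (simp add: aug_poly_eq lookup_of_nat_mult monomials_def)
qed

text \<open>A product of power sums is unitriangular in the augmented monomial functions, ordered by the
  number of parts; this makes the power sums algebraically independent.\<close>

lemma lookup_power_product:
  assumes "finite V" "Poly_Mapping.keys b \<subseteq> V" "0 \<notin># \<sigma>" "0 \<notin># \<tau>" "size \<sigma> + size \<tau> \<le> size (expo_type b)"
  shows "Poly_Mapping.lookup ((\<Prod>k\<in>#\<tau>. power_poly V k) * aug_poly V \<sigma>) b =
    (if \<sigma> + \<tau> = expo_type b then real (mult_fact (expo_type b)) else 0)"
  using assms(3-5)
proof (induction \<tau> arbitrary: \<sigma>)
  case empty
  then show ?case using assms by (auto simp: lookup_aug_poly)
next
  case (add k \<tau>)
  let ?P = "\<Prod>k\<in>#\<tau>. power_poly V k"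
  have "(\<Prod>k\<in>#add_mset k \<tau>. power_poly V k) * aug_poly V \<sigma> = ?P * aug_poly V (add_mset k \<sigma>)
     + (\<Sum>j\<in>#\<sigma>. ?P * aug_poly V (add_mset (j + k) (\<sigma> - {#j#})))"
    using aug_poly_recursion[of V k \<sigma>]
    by (simp add: mult.assoc mult.left_commute[of "power_poly V k"] distrib_left sum_mset_distrib_left)
  moreover have "Poly_Mapping.lookup (\<Sum>j\<in>#\<sigma>. ?P * aug_poly V (add_mset (j + k) (\<sigma> - {#j#}))) b = 0"
  proof -
    have "Poly_Mapping.lookup (?P * aug_poly V (add_mset (j + k) (\<sigma> - {#j#}))) b = 0" if j: "j \<in># \<sigma>" for j
    proof -
      from j obtain \<sigma>' where \<sigma>: "\<sigma> = add_mset j \<sigma>'" by (metis mset_add)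
      \<comment> \<open>Merging j and k loses a part, so this multiset has fewer parts than b and
        the induction hypothesis gives the coefficient 0.\<close>
      have "add_mset (j + k) \<sigma>' + \<tau> \<noteq> expo_type b"
      proof
        assume "add_mset (j + k) \<sigma>' + \<tau> = expo_type b"
        then have "size (add_mset (j + k) \<sigma>' + \<tau>) = size (expo_type b)" by simp
        then show False using add.prems \<sigma> by simp
      qed
      then show ?thesis using add.IH[of "add_mset (j + k) \<sigma>'"] add.prems \<sigma> by simp
    qed
    then have "\<forall>j\<in>#A. j \<in># \<sigma> \<Longrightarrow> Poly_Mapping.lookup (\<Sum>j\<in>#A. ?P * aug_poly V (add_mset (j + k) (\<sigma> - {#j#}))) b = 0" for A
      by (induction A) (auto simp: lookup_add)
    then show ?thesis by simp
  qed
  ultimately show ?case using add.IH[of "add_mset k \<sigma>"] add.prems by (simp add: lookup_add)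
qed

lemma in_variables_add: "in_variables N (f + g) = in_variables N f + in_variables N g"
  and in_variables_mult: "in_variables N (f * g) = in_variables N f * in_variables N g"
  unfolding in_variables_def
  by (rule eval_hom_add eval_hom_mult; simp add: single_add mult_single)+

lemma in_variables_0 [simp]: "in_variables N 0 = 0"
  by (simp add: in_variables_def eval_hom_def)

lemma in_variables_const: "in_variables N (Poly_Mapping.single 0 c) = Poly_Mapping.single 0 c"
  by (simp add: in_variables_def eval_hom_single)

lemma in_variables_1 [simp]: "in_variables N 1 = 1"
  using in_variables_const[of N 1] by simp

lemma in_variables_uminus: "in_variables N (- f) = - in_variables N f"
  using in_variables_add[of N f "- f"] by (simp add: eq_neg_iff_add_eq_0 add.commute)

lemma in_variables_diff: "in_variables N (f - g) = in_variables N f - in_variables N g"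
  using in_variables_add[of N f "- g"] by (simp add: in_variables_uminus)

lemma in_variables_sum_mset: "in_variables N (\<Sum>x\<in>#A. f x) = (\<Sum>x\<in>#A. in_variables N (f x))"
  by (induction A) (auto simp: in_variables_add)

lemma in_variables_var: "k \<ge> 1 \<Longrightarrow> in_variables N (var (k - 1)) = power_poly {..<N} k"
  by (cases k) (simp_all add: in_variables_def var_def eval_hom_single power_poly_def)

text \<open>The partition indexing a product of power sums; the shift j + 1 is there because
  variable number j stands for the power sum of order j + 1.\<close>

definition power_type :: "(nat \<Rightarrow>\<^sub>0 nat) \<Rightarrow> nat multiset" where
  "power_type a = (\<Sum>j\<in>Poly_Mapping.keys a. replicate_mset (Poly_Mapping.lookup a j) (j + 1))"

lemma count_power_type: "count (power_type a) (Suc j) = Poly_Mapping.lookup a j"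
  by (cases "j \<in> Poly_Mapping.keys a")
    (auto simp: power_type_def count_sum in_keys_iff if_distrib cong: if_cong)

lemma power_type_inj: "power_type a = power_type b \<Longrightarrow> a = b"
  by (metis count_power_type poly_mapping_eqI)

lemma power_type_0: "0 \<notin># power_type a"
  by (auto simp: power_type_def set_mset_sum in_replicate_mset split: if_splits)

lemma prod_power_type:
  "(\<Prod>k\<in>#power_type a. power_poly V k) = (\<Prod>j\<in>Poly_Mapping.keys a. power_poly V (j + 1) ^ Poly_Mapping.lookup a j)"
proof -
  have "(\<Prod>k\<in>#(\<Sum>j\<in>A. replicate_mset (Poly_Mapping.lookup a j) (j + 1)). power_poly V k) =
      (\<Prod>j\<in>A. power_poly V (j + 1) ^ Poly_Mapping.lookup a j)" if "finite A" for A
    using that by (induction A) auto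
  from this[of "Poly_Mapping.keys a"] show ?thesis by (simp add: power_type_def)
qed

lemma ex_monomial: "0 \<notin># \<kappa> \<Longrightarrow> \<exists>b. Poly_Mapping.keys b \<subseteq> {..<size \<kappa>} \<and> expo_type b = \<kappa>"
proof (induction \<kappa>)
  case empty
  then show ?case by (intro exI[of _ 0]) (simp add: expo_type_def)
next
  case (add k \<kappa>)
  then obtain b where b: "Poly_Mapping.keys b \<subseteq> {..<size \<kappa>}" "expo_type b = \<kappa>" by auto
  with add.prems have "size \<kappa> \<notin> Poly_Mapping.keys b" "k > 0" by auto
  from expo_type_single_add[OF this] b show ?case
    by (intro exI[of _ "Poly_Mapping.single (size \<kappa>) k + b"]) auto
qed

text \<open>Take a monomial a of f whose product of power sums has the most factors, and as many
  variables as factors. There is then a monomial b of exponent type \<open>power_type a\<close>, and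
  by unitriangularity no other term of f contributes to the coefficient of b.\<close>

lemma in_variables_eq_0:
  assumes "\<And>N. in_variables N f = 0" shows "f = 0"
proof (rule ccontr)
  assume "f \<noteq> 0"
  then have ne: "Poly_Mapping.keys f \<noteq> {}" by simp
  let ?s = "\<lambda>a. size (power_type a)"
  have "Max (?s ` Poly_Mapping.keys f) \<in> ?s ` Poly_Mapping.keys f"
    using ne by (intro Max_in) auto
  then obtain a where a': "a \<in> Poly_Mapping.keys f" "?s a = Max (?s ` Poly_Mapping.keys f)" by auto
  then have a: "a \<in> Poly_Mapping.keys f" "\<And>a'. a' \<in> Poly_Mapping.keys f \<Longrightarrow> ?s a' \<le> ?s a"
    by simp_all
  let ?\<kappa> = "power_type a" let ?V = "{..<size ?\<kappa>}"
  obtain b where b: "Poly_Mapping.keys b \<subseteq> ?V" "expo_type b = ?\<kappa>"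
    using ex_monomial[OF power_type_0] by blast
  have tm: "Poly_Mapping.lookup (Poly_Mapping.single 0 (Poly_Mapping.lookup f a') *
       (\<Prod>j\<in>Poly_Mapping.keys a'. power_poly ?V (j + 1) ^ Poly_Mapping.lookup a' j)) b =
     (if a' = a then Poly_Mapping.lookup f a * real (mult_fact ?\<kappa>) else 0)"
    if "a' \<in> Poly_Mapping.keys f" for a'
  proof -
    have "Poly_Mapping.lookup (\<Prod>k\<in>#power_type a'. power_poly ?V k) b =
      (if power_type a' = ?\<kappa> then real (mult_fact ?\<kappa>) else 0)"
      using lookup_power_product[of ?V b "{#}" "power_type a'"] b a(2)[OF that] power_type_0[of a']
      by (simp add: aug_poly_def)
    moreover have "Poly_Mapping.lookup (Poly_Mapping.single 0 c * g) b = c * Poly_Mapping.lookup g b"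
      for c and g :: poly_ring
      by (simp add: lookup_mult lookup_single when_mult)
    ultimately show ?thesis using power_type_inj[of a' a] by (auto simp: prod_power_type)
  qed
  have "0 = Poly_Mapping.lookup (in_variables (size ?\<kappa>) f) b" using assms by simp
  also have "\<dots> = (\<Sum>a'\<in>Poly_Mapping.keys f. if a' = a then Poly_Mapping.lookup f a * real (mult_fact ?\<kappa>) else 0)"
    unfolding in_variables_def eval_hom_def lookup_sum
    using tm by (intro sum.cong refl) (simp add: power_poly_def)
  also have "\<dots> = Poly_Mapping.lookup f a * real (mult_fact ?\<kappa>)"
    using a(1) by simp
  also have "\<dots> \<noteq> 0" using a(1) mult_fact_pos[of ?\<kappa>] by (simp add: in_keys_iff)
  finally show False by simp
qed

lemma in_variables_inj: "(\<And>N. in_variables N f = in_variables N g) \<Longrightarrow> f = g"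
  using in_variables_eq_0[of "f - g"] by (simp add: in_variables_diff)

text \<open>The product rule is solved for its term with the most parts; the factor
  \<open>\<rho>'\<close> and the merged terms all have one part fewer.\<close>

lemma ex_aug: "0 \<notin># \<rho> \<Longrightarrow> \<exists>f. \<forall>N. in_variables N f = aug_poly {..<N} \<rho>"
proof (induction "size \<rho>" arbitrary: \<rho>)
  case 0
  then show ?case by (intro exI[of _ 1]) (simp add: aug_poly_def)
next
  case (Suc n)
  then obtain k \<rho>' where \<rho>: "\<rho> = add_mset k \<rho>'" by (metis size_eq_Suc_imp_eq_union)
  with Suc.prems have k: "k \<ge> 1" "0 \<notin># \<rho>'" by auto
  have ex: "\<exists>f. \<forall>N. in_variables N f = aug_poly {..<N} (add_mset (j + k) (\<rho>' - {#j#}))" if j: "j \<in># \<rho>'" for j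
  proof (rule Suc.hyps(1))
    from j obtain \<rho>'' where "\<rho>' = add_mset j \<rho>''" by (metis mset_add)
    with Suc k \<rho> show "n = size (add_mset (j + k) (\<rho>' - {#j#}))" "0 \<notin># add_mset (j + k) (\<rho>' - {#j#})" by auto
  qed
  then obtain F where F: "\<And>j N. j \<in># \<rho>' \<Longrightarrow> in_variables N (F j) = aug_poly {..<N} (add_mset (j + k) (\<rho>' - {#j#}))"
    by metis
  from Suc.hyps(1)[of \<rho>'] Suc.hyps(2) \<rho> k obtain f where f: "\<And>N. in_variables N f = aug_poly {..<N} \<rho>'" by auto
  have "in_variables N (var (k - 1) * f - (\<Sum>j\<in>#\<rho>'. F j)) = aug_poly {..<N} \<rho>" for N
    using aug_poly_recursion[of "{..<N}" k \<rho>'] k(1)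
    by (simp add: in_variables_diff in_variables_mult in_variables_sum_mset in_variables_var[unfolded One_nat_def] f F \<rho> cong: image_mset_cong)
  then show ?case by blast
qed

text \<open>This unlocks the definite description \<open>monomial_sym\<close>: existence is
  \<open>ex_aug\<close> divided by the multiplicity factor, uniqueness is
  \<open>in_variables_inj\<close>.\<close>

lemma in_variables_aug_monomial_sym:
  assumes "0 \<notin># \<rho>"
  shows "in_variables N (aug_monomial_sym \<rho>) = aug_poly {..<N} \<rho>"
proof -
  obtain f where f: "\<And>N. in_variables N f = aug_poly {..<N} \<rho>" using ex_aug[OF assms] by blast
  let ?c = "real (mult_fact \<rho>)"
  have c: "?c \<noteq> 0" using mult_fact_pos[of \<rho>] by simp
  have of_nat_single: "of_nat n = (Poly_Mapping.single 0 (real n) :: poly_ring)" for n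
    by (rule poly_mapping_eqI) (simp add: lookup_of_nat lookup_single when_def)
  let ?g = "Poly_Mapping.single 0 (1 / ?c) * f"
  have inv: "Poly_Mapping.single 0 (1 / ?c) * (of_nat (mult_fact \<rho>) * h) = h"
    "of_nat (mult_fact \<rho>) * (Poly_Mapping.single 0 (1 / ?c) * h) = h" for h :: poly_ring
    unfolding of_nat_single mult.assoc[symmetric] mult_single using c by simp_all
  have g: "in_variables N ?g = monomial_sym_poly N \<rho>" for N
    unfolding in_variables_mult in_variables_const f aug_poly_eq[OF finite_lessThan assms] monomial_sym_poly_eq
    by (rule inv)
  have "monomial_sym \<rho> = ?g"
    unfolding monomial_sym_def
  proof (rule the_equality)
    show "\<And>h. \<forall>N. in_variables N h = monomial_sym_poly N \<rho> \<Longrightarrow> h = ?g"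
      by (rule in_variables_inj) (simp only: g)
  qed (simp only: g simp_thms)
  then have "aug_monomial_sym \<rho> = f"
    unfolding aug_monomial_sym_def mult_fact_def[symmetric] by (simp only: inv)
  then show ?thesis using f by simp
qed

lemma aug_monomial_sym_empty [simp]: "aug_monomial_sym {#} = 1"
  by (rule in_variables_inj) (simp add: in_variables_aug_monomial_sym aug_poly_def)

lemma aug_monomial_sym_recursion:
  assumes "0 \<notin># \<rho>" "k \<ge> 1"
  shows "var (k - 1) * aug_monomial_sym \<rho> = aug_monomial_sym (add_mset k \<rho>) +
    (\<Sum>j\<in>#\<rho>. aug_monomial_sym (add_mset (j + k) (\<rho> - {#j#})))"
proof (rule in_variables_inj)
  fix N
  have "0 \<notin># add_mset (j + k) (\<rho> - {#j#})" for j
    using assms by (auto dest: in_diffD)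
  then show "in_variables N (var (k - 1) * aug_monomial_sym \<rho>) = in_variables N (aug_monomial_sym (add_mset k \<rho>) +
    (\<Sum>j\<in>#\<rho>. aug_monomial_sym (add_mset (j + k) (\<rho> - {#j#}))))"
    using assms aug_poly_recursion[of "{..<N}" k \<rho>]
    by (simp add: in_variables_add in_variables_mult in_variables_sum_mset in_variables_var[unfolded One_nat_def]
        in_variables_aug_monomial_sym cong: image_mset_cong)
qed

text \<open>The value of chi_p on the power sum of order k. At k = 1 it is the constant 1, which
  exceeds the sum of the p i by the dust.\<close>

definition power_sum :: "nat \<Rightarrow> (nat \<Rightarrow> real) \<Rightarrow> real" where
  "power_sum k p = (if k = 1 then 1 else suminf (\<lambda>i. p i ^ k))"

text \<open>Kingman's paintbox probability of one given set partition with block sizes \<rho>. The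
  probabilistic meaning enters only later, when it appears as a limit of sampling
  probabilities.\<close>

definition paintbox :: "(nat \<Rightarrow> real) \<Rightarrow> nat multiset \<Rightarrow> real" where
  "paintbox p \<rho> = chi p (aug_monomial_sym \<rho>)"

lemma chi_sum_mset: "chi p (\<Sum>x\<in>#A. f x) = (\<Sum>x\<in>#A. chi p (f x))"
  by (induction A) (auto simp: chi_add, simp add: chi_def eval_hom_def)

lemma chi_1 [simp]: "chi p 1 = 1"
  using chi_const[of p 1] by simp

lemma paintbox_empty [simp]: "paintbox p {#} = 1"
  by (simp add: paintbox_def)

lemma paintbox_recursion:
  assumes "0 \<notin># \<rho>" "k \<ge> 1"
  shows "power_sum k p * paintbox p \<rho> = paintbox p (add_mset k \<rho>) + (\<Sum>j\<in>#\<rho>. paintbox p (add_mset (j + k) (\<rho> - {#j#})))"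
proof -
  have "power_sum k p = chi p (var (k - 1))"
    using assms(2) by (simp add: chi_power_sum power_sum_def)
  then have "power_sum k p * paintbox p \<rho> = chi p (var (k - 1) * aug_monomial_sym \<rho>)"
    by (simp add: chi_mult paintbox_def)
  then show ?thesis
    unfolding aug_monomial_sym_recursion[OF assms] by (simp add: chi_add chi_sum_mset paintbox_def)
qed

section \<open>Growth of path-forests\<close>

text \<open>Extension by zero to all trees, so that harmonicity can be stated on the whole Hoffman
  graph.\<close>

definition pf_fun :: "(nat multiset \<Rightarrow> real) \<Rightarrow> rtree \<Rightarrow> real" where
  "pf_fun \<phi> t = (if path_forest t then \<phi> (shape t) else 0)"

lemma path_forest_path_forest_tree [simp]: "path_forest (path_forest_tree \<kappa>)"
  by (auto simp: path_forest_def path_forest_tree_def unary_iff_chain vertices_chain)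

lemma pf_fun_tree [simp]: "0 \<notin># \<kappa> \<Longrightarrow> pf_fun \<phi> (path_forest_tree \<kappa>) = \<phi> \<kappa>"
  by (simp add: pf_fun_def shape_path_forest_tree partitions_def)

lemma vertices_path_forest_tree: "0 \<notin># \<kappa> \<Longrightarrow> vertices (path_forest_tree \<kappa>) = Suc (sum_mset \<kappa>)"
proof -
  assume *: "0 \<notin># \<kappa>"
  have "(\<Sum>k\<in>#\<kappa>. vertices (chain (k - 1))) = (\<Sum>k\<in>#\<kappa>. k)"
    using * by (intro sum_mset_cong) (metis Suc_pred' gr0I vertices_chain)
  then show ?thesis by (simp add: path_forest_tree_def image_mset.compositionality comp_def)
qed

lemma path_forestE:
  assumes "path_forest t"
  obtains \<kappa> where "0 \<notin># \<kappa>" "t = path_forest_tree \<kappa>" "shape t = \<kappa>"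
  using assms shape_path_forest_tree by (auto simp: path_forest_iff partitions_def)

lemma path_forest_tree_inj:
  "0 \<notin># \<kappa> \<Longrightarrow> 0 \<notin># \<rho> \<Longrightarrow> path_forest_tree \<kappa> = path_forest_tree \<rho> \<longleftrightarrow> \<kappa> = \<rho>"
  using shape_path_forest_tree by (auto simp: partitions_def) metis

lemma shape_partition: "path_forest t \<Longrightarrow> 0 \<notin># shape t" "path_forest t \<Longrightarrow> path_forest_tree (shape t) = t"
  "path_forest t \<Longrightarrow> sum_mset (shape t) = vertices t - 1"
  by (auto elim!: path_forestE simp: vertices_path_forest_tree)

lemma leaf_path_forest: "leaf = path_forest_tree {#}"
  by (simp add: leaf_def path_forest_tree_def)

lemma pf_fun_leaf [simp]: "pf_fun \<phi> leaf = \<phi> {#}"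
  by (simp add: leaf_path_forest)

lemma vertices_leaf [simp]: "vertices leaf = 1"
  by (simp add: leaf_def)

lemma unary_Node: "unary (Node M) \<longleftrightarrow> size M \<le> 1 \<and> (\<forall>c\<in>#M. unary c)"
  by (auto elim: unary.cases intro: unary.intros)

lemma unary_chain [simp]: "unary (chain k)"
  by (simp add: unary_iff_chain vertices_chain)

text \<open>A leaf attached anywhere but at the last vertex creates a vertex with two children. The
  weight g is arbitrary so that the induction can absorb the enclosing \<open>Node\<close> into
  it.\<close>

lemma sum_grow_chain:
  "(\<Sum>c\<in>#grow (chain i). if unary c then g c else 0) = (g (chain (Suc i)) :: real)"
proof (induction i arbitrary: g)
  case 0
  then show ?case by (simp add: leaf_def unary_Node)
next
  case (Suc i)
  have "(\<Sum>c\<in>#grow (chain (Suc i)). if unary c then g c else 0) =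
     (\<Sum>c\<in>#grow (chain i). if unary c then g (Node {#c#}) else 0)"
    by (simp add: unary_Node image_mset.compositionality comp_def)
  then show ?case using Suc.IH[of "\<lambda>c. g (Node {#c#})"] by simp
qed

lemma unary_grow: "c' \<in># grow c \<Longrightarrow> unary c' \<Longrightarrow> unary c"
proof (induction c arbitrary: c')
  case (Node M)
  from Node.prems(1) consider "c' = Node (add_mset leaf M)"
    | d d' where "d \<in># M" "d' \<in># grow d" "c' = Node (add_mset d' (M - {#d#}))"
    by (auto simp: in_Union_mset_iff)
  then show ?case
  proof cases
    case 1
    with Node.prems show ?thesis by (simp add: unary_Node)
  next
    case 2
    with Node.prems have d': "unary d'" "size (M - {#d#}) = 0" by (auto simp: unary_Node)
    then have "M = {#d#}" using 2(1) by (metis insert_DiffM size_eq_0_iff_empty)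
    with Node.IH[OF _ 2(2) d'(1)] show ?thesis by (simp add: unary_Node)
  qed
qed

lemma path_forest_grow: "t \<in># grow s \<Longrightarrow> path_forest t \<Longrightarrow> path_forest s"
proof (cases s)
  case (Node M)
  assume t: "t \<in># grow s" "path_forest t"
  from t(1) Node consider "t = Node (add_mset leaf M)"
    | d d' where "d \<in># M" "d' \<in># grow d" "t = Node (add_mset d' (M - {#d#}))"
    by (auto simp: in_Union_mset_iff)
  then show ?thesis
  proof cases
    case 1
    with t Node show ?thesis by (simp add: path_forest_def)
  next
    case 2
    then obtain M' where M: "M = add_mset d M'" by (metis mset_add)
    with 2 t have "unary d'" "\<forall>c\<in>#M'. unary c" by (auto simp: path_forest_def)
    with unary_grow[OF 2(2)] Node M show ?thesis by (auto simp: path_forest_def)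
  qed
qed

text \<open>A leaf at the root opens a branch of size 1; inside a branch only the prolongation of
  the chain stays within the path-forests, and all other growths have \<open>pf_fun\<close>
  zero.\<close>

lemma sum_grow_path_forest:
  assumes "0 \<notin># \<kappa>"
  shows "(\<Sum>t\<in>#grow (path_forest_tree \<kappa>). pf_fun \<phi> t) =
    \<phi> (add_mset 1 \<kappa>) + (\<Sum>j\<in>#\<kappa>. \<phi> (add_mset (j + 1) (\<kappa> - {#j#})))"
proof -
  let ?c = "\<lambda>k. chain (k - 1)"
  let ?M = "image_mset ?c \<kappa>"
  have 1: "Node (add_mset leaf ?M) = path_forest_tree (add_mset 1 \<kappa>)"
    by (simp add: path_forest_tree_def)
  have 2: "(\<Sum>c'\<in>#grow (?c j). pf_fun \<phi> (Node (add_mset c' (?M - {#?c j#})))) = \<phi> (add_mset (j + 1) (\<kappa> - {#j#}))"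
    if j: "j \<in># \<kappa>" for j
  proof -
    from j obtain \<kappa>' where \<kappa>: "\<kappa> = add_mset j \<kappa>'" by (metis mset_add)
    have j0: "j > 0" using assms j by (metis gr0I)
    let ?g = "\<lambda>c'. pf_fun \<phi> (Node (add_mset c' (image_mset ?c \<kappa>')))"
    have "(\<Sum>c'\<in>#grow (?c j). ?g c') = (\<Sum>c'\<in>#grow (?c j). if unary c' then ?g c' else 0)"
      by (intro sum_mset_cong) (auto simp: pf_fun_def path_forest_def)
    also have "\<dots> = ?g (chain (Suc (j - 1)))" by (rule sum_grow_chain)
    also have "Node (add_mset (chain (Suc (j - 1))) (image_mset ?c \<kappa>')) = path_forest_tree (add_mset (j + 1) \<kappa>')"
      using j0 by (simp add: path_forest_tree_def)
    finally show ?thesis using assms \<kappa> by simp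
  qed
  have "(\<Sum>t\<in>#grow (path_forest_tree \<kappa>). pf_fun \<phi> t) = pf_fun \<phi> (Node (add_mset leaf ?M)) +
     (\<Sum>j\<in>#\<kappa>. \<Sum>c'\<in>#grow (?c j). pf_fun \<phi> (Node (add_mset c' (?M - {#?c j#}))))"
  proof -
    have *: "(\<Sum>t\<in>#(\<Sum>c\<in>#A. F c). h t) = (\<Sum>c\<in>#A. \<Sum>t\<in>#F c. h t)" for A :: "nat multiset" and F and h :: "rtree \<Rightarrow> real"
      by (induction A) auto
    show ?thesis
      by (simp add: path_forest_tree_def * image_mset.compositionality comp_def)
  qed
  also have "\<dots> = \<phi> (add_mset 1 \<kappa>) + (\<Sum>j\<in>#\<kappa>. \<phi> (add_mset (j + 1) (\<kappa> - {#j#})))"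
    unfolding 1 using assms by (intro arg_cong2[where f="(+)"] sum_mset_cong 2) simp_all
  finally show ?thesis .
qed

text \<open>The recursion is asked for only at the level of s, since \<open>sampling\<close> obeys
  it only strictly below the level of \<rho>. Off the path-forests both sides vanish: no growth
  leads back into them.\<close>

lemma pf_fun_harmonic:
  assumes "\<And>\<kappa>. 0 \<notin># \<kappa> \<Longrightarrow> Suc (sum_mset \<kappa>) = vertices s \<Longrightarrow>
    \<phi> \<kappa> = \<phi> (add_mset 1 \<kappa>) + (\<Sum>j\<in>#\<kappa>. \<phi> (add_mset (j + 1) (\<kappa> - {#j#})))"
  shows "pf_fun \<phi> s = (\<Sum>t\<in>#grow s. pf_fun \<phi> t)"
proof (cases "path_forest s")
  case True
  then obtain \<kappa> where "0 \<notin># \<kappa>" "s = path_forest_tree \<kappa>" by (auto elim: path_forestE)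
  with assms[of \<kappa>] sum_grow_path_forest[of \<kappa> \<phi>] show ?thesis by (simp add: vertices_path_forest_tree)
next
  case False
  then have "pf_fun \<phi> t = 0" if "t \<in># grow s" for t
    using path_forest_grow[OF that] by (auto simp: pf_fun_def)
  then have "(\<Sum>t\<in>#grow s. pf_fun \<phi> t) = (\<Sum>t\<in>#grow s. 0)" by (intro sum_mset_cong) auto
  with False show ?thesis by (simp add: pf_fun_def)
qed

section \<open>Walks in the Hoffman graph\<close>

text \<open>Reads off the last target without checking that the list is a walk; the check sits in
  \<open>walks\<close>, whose fixed length makes these sets finite.\<close>

primrec walk_end :: "rtree \<Rightarrow> edge list \<Rightarrow> rtree" where
  "walk_end s [] = s"
| "walk_end s (e # es) = walk_end (tgt e) es"

definition walks :: "rtree \<Rightarrow> nat \<Rightarrow> edge list set" where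
  "walks s n = {es. length es = n \<and> is_walk s es (walk_end s es)}"

definition out_edges :: "rtree \<Rightarrow> edge set" where
  "out_edges s = {e \<in> edges. src e = s}"

lemma is_walk_iff: "is_walk s es t \<longleftrightarrow> es \<in> walks s (length es) \<and> walk_end s es = t"
  by (induction es arbitrary: s) (auto simp: walks_def)

lemma out_edges_eq: "out_edges s = (\<lambda>(t, k). (s, t, k)) ` Sigma (set_mset (grow s)) (\<lambda>t. {..<count (grow s) t})"
  by (force simp: out_edges_def edges_def src_def attach_count_def count_greater_zero_iff[symmetric]
      simp del: count_greater_zero_iff)

lemma finite_out_edges [simp]: "finite (out_edges s)"
  by (simp add: out_edges_eq)

lemma sum_mset_eq_sum_count: "(\<Sum>t\<in>#A. g t) = (\<Sum>t\<in>set_mset A. real (count A t) * g t)"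
proof (induction A)
  case (add x A)
  have "(\<Sum>t\<in>set_mset (add_mset x A). real (count (add_mset x A) t) * g t) =
     (\<Sum>t\<in>insert x (set_mset A). real (count A t) * g t + (if t = x then g t else 0))"
    by (intro sum.cong) (auto simp: algebra_simps)
  also have "\<dots> = (\<Sum>t\<in>insert x (set_mset A). real (count A t) * g t) + g x"
    by (simp add: sum.distrib)
  also have "(\<Sum>t\<in>insert x (set_mset A). real (count A t) * g t) = (\<Sum>t\<in>set_mset A. real (count A t) * g t)"
    by (intro sum.mono_neutral_right) (auto simp: not_in_iff)
  finally show ?case using add by simp
qed simp

lemma sum_out_edges: "(\<Sum>e\<in>out_edges s. g (tgt e)) = (\<Sum>t\<in>#grow s. g t :: real)"
proof -
  have "(\<Sum>e\<in>out_edges s. g (tgt e)) = (\<Sum>(t, k)\<in>Sigma (set_mset (grow s)) (\<lambda>t. {..<count (grow s) t}). g t)"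
    unfolding out_edges_eq by (subst sum.reindex) (auto simp: inj_on_def tgt_def intro!: sum.cong)
  also have "\<dots> = (\<Sum>t\<in>set_mset (grow s). real (count (grow s) t) * g t)"
    by (subst sum.Sigma[symmetric]) auto
  finally show ?thesis by (simp add: sum_mset_eq_sum_count)
qed

lemma walks_0 [simp]: "walks s 0 = {[]}"
  by (auto simp: walks_def)

lemma walks_Suc: "walks s (Suc n) = (\<lambda>(e, es). e # es) ` Sigma (out_edges s) (\<lambda>e. walks (tgt e) n)"
proof (intro set_eqI iffI)
  fix x assume "x \<in> walks s (Suc n)"
  then obtain e es where "x = e # es" by (cases x) (auto simp: walks_def)
  with \<open>x \<in> walks s (Suc n)\<close> show "x \<in> (\<lambda>(e, es). e # es) ` Sigma (out_edges s) (\<lambda>e. walks (tgt e) n)"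
    by (auto simp: walks_def out_edges_def image_iff)
qed (auto simp: walks_def out_edges_def)

lemma finite_walks [simp]: "finite (walks s n)"
  by (induction n arbitrary: s) (auto simp: walks_Suc)

lemma sum_walks_Suc:
  "(\<Sum>es\<in>walks s (Suc n). h es) = (\<Sum>e\<in>out_edges s. \<Sum>es\<in>walks (tgt e) n. h (e # es))"
proof -
  have "inj_on (\<lambda>(e, es). e # es) (Sigma (out_edges s) (\<lambda>e. walks (tgt e) n))"
    by (auto simp: inj_on_def)
  then show ?thesis
    unfolding walks_Suc by (subst sum.reindex) (auto simp: sum.Sigma case_prod_unfold)
qed

lemma tgt_out_edges: "e \<in> out_edges s \<Longrightarrow> tgt e \<in># grow s"
  by (auto simp: out_edges_eq tgt_def)

lemma vertices_walk_end: "es \<in> walks s n \<Longrightarrow> vertices (walk_end s es) = vertices s + n"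
proof (induction n arbitrary: s es)
  case (Suc n)
  then obtain e es' where e: "es = e # es'" "e \<in> out_edges s" "es' \<in> walks (tgt e) n"
    by (auto simp: walks_Suc)
  with Suc.IH[OF e(3)] vertices_grow[OF tgt_out_edges[OF e(2)]] show ?case by simp
qed simp

text \<open>Harmonicity is used only strictly below the final level, as it must be for functions
  such as \<open>sampling\<close>.\<close>

lemma sum_walks_harmonic:
  assumes "\<And>t. vertices t < vertices s + n \<Longrightarrow> \<psi> t = (\<Sum>t'\<in>#grow t. \<psi> t')"
  shows "(\<Sum>es\<in>walks s n. \<psi> (walk_end s es)) = (\<psi> s :: real)"
  using assms
proof (induction n arbitrary: s)
  case (Suc n)
  have "(\<Sum>es\<in>walks s (Suc n). \<psi> (walk_end s es)) = (\<Sum>e\<in>out_edges s. \<psi> (tgt e))"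
    unfolding sum_walks_Suc
  proof (intro sum.cong refl)
    fix e assume "e \<in> out_edges s"
    from vertices_grow[OF tgt_out_edges[OF this]] have "vertices (tgt e) + n = vertices s + Suc n" by simp
    then show "(\<Sum>es\<in>walks (tgt e) n. \<psi> (walk_end s (e # es))) = \<psi> (tgt e)"
      using Suc.IH[of "tgt e"] Suc.prems by simp
  qed
  also have "\<dots> = \<psi> s" using Suc.prems[of s] by (simp add: sum_out_edges)
  finally show ?case .
qed simp

lemma num_walks_eq: "vertices t = vertices s + n \<Longrightarrow> num_walks s t = card {es \<in> walks s n. walk_end s es = t}"
proof -
  assume *: "vertices t = vertices s + n"
  have "is_walk s es t \<longleftrightarrow> es \<in> walks s n \<and> walk_end s es = t" for es
  proof
    assume "is_walk s es t"
    then have es: "es \<in> walks s (length es)" "walk_end s es = t" by (simp_all add: is_walk_iff)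
    with vertices_walk_end[OF es(1)] * have "length es = n" by simp
    with es show "es \<in> walks s n \<and> walk_end s es = t" by simp
  next
    assume es: "es \<in> walks s n \<and> walk_end s es = t"
    then have "length es = n" by (simp add: walks_def)
    with es show "is_walk s es t" by (simp add: is_walk_iff)
  qed
  then show ?thesis by (simp add: num_walks_def)
qed

lemma num_walks_eq_0: "vertices t < vertices s \<Longrightarrow> num_walks s t = 0"
proof -
  assume *: "vertices t < vertices s"
  have "\<not> is_walk s es t" for es
    using * vertices_walk_end[of es s "length es"] by (auto simp: is_walk_iff)
  then show ?thesis by (simp add: num_walks_def)
qed

text \<open>Propagate the harmonic function \<kappa> -> \<open>sampling \<kappa> \<rho>\<close> from
  s up to the level of \<rho>: there each walk ending at \<rho> contributes
  \<open>sampling \<rho> \<rho>\<close> and every other walk contributes 0.\<close>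

lemma num_walks_sampling:
  assumes "0 \<notin># \<rho>" "vertices s \<le> Suc (sum_mset \<rho>)"
  shows "real (num_walks s (path_forest_tree \<rho>)) * sampling \<rho> \<rho> = pf_fun (\<lambda>\<kappa>. sampling \<kappa> \<rho>) s"
proof -
  let ?\<psi> = "pf_fun (\<lambda>\<kappa>. sampling \<kappa> \<rho>)" let ?t = "path_forest_tree \<rho>"
  obtain n where n: "Suc (sum_mset \<rho>) = vertices s + n" using assms(2) le_Suc_ex by blast
  have "?\<psi> s = (\<Sum>es\<in>walks s n. ?\<psi> (walk_end s es))"
  proof (rule sum_walks_harmonic[symmetric], rule pf_fun_harmonic)
    fix t and \<kappa> :: "nat multiset" assume "vertices t < vertices s + n" "Suc (sum_mset \<kappa>) = vertices t"
    with n show "sampling \<kappa> \<rho> = sampling (add_mset 1 \<kappa>) \<rho> + (\<Sum>j\<in>#\<kappa>. sampling (add_mset (j + 1) (\<kappa> - {#j#})) \<rho>)"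
      by (intro sampling_harmonic) auto
  qed
  also have "\<dots> = (\<Sum>es\<in>walks s n. if walk_end s es = ?t then sampling \<rho> \<rho> else 0)"
  proof (intro sum.cong refl)
    fix es assume "es \<in> walks s n"
    then have v: "vertices (walk_end s es) = Suc (sum_mset \<rho>)" using vertices_walk_end n by metis
    show "?\<psi> (walk_end s es) = (if walk_end s es = ?t then sampling \<rho> \<rho> else 0)"
    proof (cases "path_forest (walk_end s es)")
      case True
      then obtain \<kappa> where \<kappa>: "0 \<notin># \<kappa>" "walk_end s es = path_forest_tree \<kappa>" by (auto elim: path_forestE)
      then have "sum_mset \<kappa> = sum_mset \<rho>" using v by (simp add: vertices_path_forest_tree)
      then show ?thesis using \<kappa> assms(1) by (auto simp: sampling_eq_0 path_forest_tree_inj)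
    qed (use assms(1) in \<open>auto simp: pf_fun_def\<close>)
  qed
  also have "\<dots> = real (card {es \<in> walks s n. walk_end s es = ?t}) * sampling \<rho> \<rho>"
    by (simp add: sum.If_cases Int_def)
  also have "card {es \<in> walks s n. walk_end s es = ?t} = num_walks s ?t"
    using n assms(1) by (subst num_walks_eq) (auto simp: vertices_path_forest_tree)
  finally show ?thesis by simp
qed

lemma u_sampling: "0 \<notin># \<rho> \<Longrightarrow> real (u (path_forest_tree \<rho>)) * sampling \<rho> \<rho> = 1"
  using num_walks_sampling[of \<rho> leaf] by (simp add: u_def)

lemma u_path_forest_pos: "0 \<notin># \<rho> \<Longrightarrow> u (path_forest_tree \<rho>) > 0"
  using u_sampling[of \<rho>] by (cases "u (path_forest_tree \<rho>)") auto

text \<open>From the root the value of the harmonic function is 1, so \<open>u\<close> is the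
  reciprocal of \<open>sampling \<rho> \<rho>\<close>. The quotient of walk counts n(s;t)/u(t),
  which governs both the Martin kernel and conditional path probabilities, is thus a sampling
  probability.\<close>

lemma num_walks_u:
  assumes "0 \<notin># \<rho>" "vertices s \<le> Suc (sum_mset \<rho>)"
  shows "real (num_walks s (path_forest_tree \<rho>)) = real (u (path_forest_tree \<rho>)) * pf_fun (\<lambda>\<kappa>. sampling \<kappa> \<rho>) s"
proof -
  have "real (num_walks s (path_forest_tree \<rho>)) =
    real (num_walks s (path_forest_tree \<rho>)) * (real (u (path_forest_tree \<rho>)) * sampling \<rho> \<rho>)"
    unfolding u_sampling[OF assms(1)] by simp
  also have "\<dots> = real (u (path_forest_tree \<rho>)) * (real (num_walks s (path_forest_tree \<rho>)) * sampling \<rho> \<rho>)"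
    by (simp only: mult_ac)
  finally show ?thesis unfolding num_walks_sampling[OF assms] .
qed

section \<open>Grouping walks from the root by their end partition\<close>

definition parts :: "nat \<Rightarrow> nat multiset set" where
  "parts n = {\<kappa>. 0 \<notin># \<kappa> \<and> sum_mset \<kappa> = n}"

lemma size_le_sum_mset: "0 \<notin># \<kappa> \<Longrightarrow> size \<kappa> \<le> sum_mset \<kappa>"
  by (induction \<kappa>) auto

lemma finite_parts [simp]: "finite (parts n)"
proof -
  have "parts n \<subseteq> mset ` {xs. set xs \<subseteq> {..n} \<and> length xs \<le> n}"
  proof
    fix \<kappa> assume \<kappa>: "\<kappa> \<in> parts n"
    obtain xs where xs: "mset xs = \<kappa>" using ex_mset by blast
    have "set xs \<subseteq> {..n}" using \<kappa> xs mem_le_sum_mset[of _ \<kappa>] by (auto simp: parts_def)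
    moreover have "length xs \<le> n" using \<kappa> xs size_le_sum_mset[of \<kappa>] by (auto simp: parts_def)
    ultimately show "\<kappa> \<in> mset ` {xs. set xs \<subseteq> {..n} \<and> length xs \<le> n}" using xs by blast
  qed
  then show ?thesis by (rule finite_subset) (simp add: finite_lists_length_le)
qed

lemma sum_walks_group:
  assumes "\<And>t. \<not> path_forest t \<Longrightarrow> h t = 0"
  shows "(\<Sum>es\<in>walks leaf n. h (walk_end leaf es)) =
    (\<Sum>\<kappa>\<in>parts n. real (u (path_forest_tree \<kappa>)) * h (path_forest_tree \<kappa>))"
proof -
  let ?W = "{es \<in> walks leaf n. path_forest (walk_end leaf es)}"
  have "(\<Sum>es\<in>walks leaf n. h (walk_end leaf es)) = (\<Sum>es\<in>?W. h (walk_end leaf es))"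
    using assms by (intro sum.mono_neutral_right) auto
  also have "\<dots> = (\<Sum>\<kappa>\<in>parts n. \<Sum>es\<in>{es\<in>?W. shape (walk_end leaf es) = \<kappa>}. h (walk_end leaf es))"
    by (rule sum.group[symmetric], simp, simp) (auto simp: parts_def shape_partition vertices_walk_end)
  also have "\<dots> = (\<Sum>\<kappa>\<in>parts n. real (u (path_forest_tree \<kappa>)) * h (path_forest_tree \<kappa>))"
  proof (intro sum.cong refl)
    fix \<kappa> assume \<kappa>: "\<kappa> \<in> parts n"
    have "{es\<in>?W. shape (walk_end leaf es) = \<kappa>} = {es \<in> walks leaf n. walk_end leaf es = path_forest_tree \<kappa>}"
      using \<kappa> by (auto simp: parts_def shape_path_forest_tree partitions_def shape_partition)
    moreover have "card \<dots> = u (path_forest_tree \<kappa>)"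
      unfolding u_def using \<kappa> by (subst num_walks_eq) (auto simp: vertices_path_forest_tree parts_def)
    ultimately show "(\<Sum>es\<in>{es\<in>?W. shape (walk_end leaf es) = \<kappa>}. h (walk_end leaf es)) =
      real (u (path_forest_tree \<kappa>)) * h (path_forest_tree \<kappa>)" by simp
  qed
  finally show ?thesis .
qed

lemma sum_u_sampling:
  assumes "m \<le> sum_mset \<rho>"
  shows "(\<Sum>\<kappa>\<in>parts m. real (u (path_forest_tree \<kappa>)) * sampling \<kappa> \<rho>) = 1"
proof -
  let ?\<psi> = "pf_fun (\<lambda>\<kappa>. sampling \<kappa> \<rho>)"
  have "1 = (\<Sum>es\<in>walks leaf m. ?\<psi> (walk_end leaf es))"
    by (subst sum_walks_harmonic)
      (use assms in \<open>auto intro!: pf_fun_harmonic sampling_harmonic\<close>)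
  also have "\<dots> = (\<Sum>\<kappa>\<in>parts m. real (u (path_forest_tree \<kappa>)) * ?\<psi> (path_forest_tree \<kappa>))"
    by (rule sum_walks_group) (simp add: pf_fun_def)
  finally show ?thesis by (simp add: parts_def)
qed

lemma u_sampling_le_1:
  assumes "0 \<notin># \<kappa>" "sum_mset \<kappa> \<le> sum_mset \<rho>"
  shows "real (u (path_forest_tree \<kappa>)) * sampling \<kappa> \<rho> \<le> 1" "sampling \<kappa> \<rho> \<le> 1"
proof -
  have "real (u (path_forest_tree \<kappa>)) * sampling \<kappa> \<rho> \<le>
     (\<Sum>\<kappa>'\<in>parts (sum_mset \<kappa>). real (u (path_forest_tree \<kappa>')) * sampling \<kappa>' \<rho>)"
    using assms(1) by (intro member_le_sum finite_parts) (auto simp: parts_def)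
  with sum_u_sampling[OF assms(2)] show 1: "real (u (path_forest_tree \<kappa>)) * sampling \<kappa> \<rho> \<le> 1" by simp
  have "1 * sampling \<kappa> \<rho> \<le> real (u (path_forest_tree \<kappa>)) * sampling \<kappa> \<rho>"
    using u_path_forest_pos[OF assms(1)] by (intro mult_right_mono) auto
  with 1 show "sampling \<kappa> \<rho> \<le> 1" by simp
qed

text \<open>The unnormalised form of \<open>sum_u_sampling\<close>, valid also for m above the total
  of \<rho>, where both sides vanish. That range occurs when a large part has been removed from
  \<rho>.\<close>

lemma sum_u_sfall:
  "(\<Sum>\<kappa>\<in>parts m. real (u (path_forest_tree \<kappa>)) * sfall \<kappa> \<rho>) = fall m (sum_mset \<rho>)"
proof (cases "m \<le> sum_mset \<rho>")
  case True
  have "(\<Sum>\<kappa>\<in>parts m. real (u (path_forest_tree \<kappa>)) * sfall \<kappa> \<rho>) =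
    fall m (sum_mset \<rho>) * (\<Sum>\<kappa>\<in>parts m. real (u (path_forest_tree \<kappa>)) * sampling \<kappa> \<rho>)"
    unfolding sum_distrib_left using fall_pos[OF True]
    by (intro sum.cong refl) (auto simp: sampling_def parts_def)
  then show ?thesis using sum_u_sampling[OF True] by simp
next
  case False
  then have "sfall \<kappa> \<rho> = 0" if "\<kappa> \<in> parts m" for \<kappa>
    using sfall_neq_0D(1)[of \<kappa> \<rho>] that by (auto simp: parts_def)
  then show ?thesis using False by (simp add: fall_eq_0)
qed

text \<open>Both sides count set partitions with a marked singleton block.\<close>

lemma u_add_1:
  assumes "0 \<notin># \<kappa>"
  shows "real (u (path_forest_tree (add_mset 1 \<kappa>))) * real (count (add_mset 1 \<kappa>) 1) =
    real (Suc (sum_mset \<kappa>)) * real (u (path_forest_tree \<kappa>))"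
proof -
  let ?\<rho> = "add_mset 1 \<kappa>" let ?m = "sum_mset \<kappa>"
  have "sfall ?\<rho> ?\<rho> = (\<Sum>l\<in>#?\<rho>. if l = 1 then sfall \<kappa> \<kappa> else 0)"
    unfolding sfall_add[of 1 \<kappa>]
  proof (intro sum_mset_cong)
    fix l assume l: "l \<in># ?\<rho>"
    show "fall 1 l * sfall \<kappa> (?\<rho> - {#l#}) = (if l = 1 then sfall \<kappa> \<kappa> else 0)"
    proof (cases "l = 1")
      case False
      then obtain \<kappa>' where \<kappa>: "\<kappa> = add_mset l \<kappa>'" using l by (metis insert_noteq_member mset_add)
      then have "l > 1" using assms False by (metis less_one linorder_neqE_nat union_single_eq_member)
      \<comment> \<open>Removing a part l > 1 leaves a smaller total than that of \<kappa>, so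
        \<kappa> cannot be drawn from the rest.\<close>
      then have "sfall \<kappa> (?\<rho> - {#l#}) = 0"
        using sfall_neq_0D(1)[of \<kappa> "?\<rho> - {#l#}"] \<kappa> by auto
      then show ?thesis using False by simp
    qed simp
  qed
  also have "\<dots> = real (count ?\<rho> 1) * sfall \<kappa> \<kappa>"
    by (subst sum_mset_delta) simp
  finally have s: "sfall ?\<rho> ?\<rho> = real (count ?\<rho> 1) * sfall \<kappa> \<kappa>" .
  have f: "fall (sum_mset ?\<rho>) (sum_mset ?\<rho>) = real (Suc ?m) * fall ?m ?m" "fall ?m ?m > 0"
    by (simp_all add: fall_Suc_shift fall_pos)
  have 1: "real (u (path_forest_tree ?\<rho>)) * sfall ?\<rho> ?\<rho> = real (Suc ?m) * fall ?m ?m"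
    using u_sampling[of ?\<rho>] assms f by (simp add: sampling_def fall_pos field_simps)
  have 2: "real (u (path_forest_tree \<kappa>)) * sfall \<kappa> \<kappa> = fall ?m ?m"
    using u_sampling[of \<kappa>] assms f by (simp add: sampling_def field_simps)
  have nz: "sfall \<kappa> \<kappa> \<noteq> 0" using 2 f(2) by auto
  have "real (u (path_forest_tree ?\<rho>)) * real (count ?\<rho> 1) * sfall \<kappa> \<kappa> =
    real (Suc ?m) * real (u (path_forest_tree \<kappa>)) * sfall \<kappa> \<kappa>"
    using 1 2 s by (simp add: mult_ac)
  then show ?thesis using nz by (metis mult_right_cancel)
qed

text \<open>Mark a singleton block and delete its element; partitions without a part 1 carry no
  mark. This turns first and second factorial moments of the number of singletons into sums one or
  two levels lower.\<close>

lemma sum_parts_count_1: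
  "(\<Sum>\<kappa>\<in>parts (Suc m). real (u (path_forest_tree \<kappa>)) * real (count \<kappa> 1) * G \<kappa>) =
   real (Suc m) * (\<Sum>\<kappa>\<in>parts m. real (u (path_forest_tree \<kappa>)) * G (add_mset 1 \<kappa>))"
proof -
  have "(\<Sum>\<kappa>\<in>parts (Suc m). real (u (path_forest_tree \<kappa>)) * real (count \<kappa> 1) * G \<kappa>) =
    (\<Sum>\<kappa>\<in>add_mset 1 ` parts m. real (u (path_forest_tree \<kappa>)) * real (count \<kappa> 1) * G \<kappa>)"
  proof (intro sum.mono_neutral_right ballI)
    show "add_mset 1 ` parts m \<subseteq> parts (Suc m)" by (auto simp: parts_def)
    fix \<kappa> assume \<kappa>: "\<kappa> \<in> parts (Suc m) - add_mset 1 ` parts m"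
    have "1 \<notin># \<kappa>"
    proof
      assume "1 \<in># \<kappa>"
      then obtain \<kappa>' where "\<kappa> = add_mset 1 \<kappa>'" by (metis mset_add)
      with \<kappa> show False by (auto simp: parts_def)
    qed
    then show "real (u (path_forest_tree \<kappa>)) * real (count \<kappa> 1) * G \<kappa> = 0" by (simp add: not_in_iff)
  qed simp
  also have "\<dots> = (\<Sum>\<kappa>\<in>parts m. real (u (path_forest_tree (add_mset 1 \<kappa>))) * real (count (add_mset 1 \<kappa>) 1) * G (add_mset 1 \<kappa>))"
    by (subst sum.reindex) (auto simp: inj_on_def)
  also have "\<dots> = (\<Sum>\<kappa>\<in>parts m. real (Suc m) * (real (u (path_forest_tree \<kappa>)) * G (add_mset 1 \<kappa>)))"
    by (intro sum.cong refl, subst u_add_1) (auto simp: parts_def)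
  finally show ?thesis by (simp add: sum_distrib_left)
qed

lemma martin_kernel_eq:
  assumes "0 \<notin># \<kappa>" "0 \<notin># \<rho>"
  shows "martin_kernel \<kappa> \<rho> = (if sum_mset \<kappa> \<le> sum_mset \<rho> then real (u (path_forest_tree \<kappa>)) * sampling \<kappa> \<rho> else 0)"
  using assms num_walks_u[of \<rho> "path_forest_tree \<kappa>"] u_path_forest_pos[of \<rho>]
  by (auto simp: martin_kernel_def vertices_path_forest_tree num_walks_eq_0)

section \<open>The simplex\<close>

text \<open>The bound p i <= 1/(i+1) follows from monotonicity and total mass at most 1. Being
  uniform in p, it supplies the majorants for later passages to the limit under infinite
  sums.\<close>

lemma nablaD:
  assumes "p \<in> nabla"
  shows "decseq p" "0 \<le> p i" "summable p" "suminf p \<le> 1" "sum p {..<n} \<le> 1" "p i \<le> 1 / real (Suc i)" "p i \<le> 1"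
proof -
  show 1: "decseq p" "0 \<le> p i" "summable p" "suminf p \<le> 1" for i using assms by (auto simp: nabla_def)
  show s: "sum p {..<n} \<le> 1" for n
    using sum_le_suminf[OF 1(3), of "{..<n}"] 1 by auto
  have "real (Suc i) * p i = (\<Sum>j<Suc i. p i)" by simp
  also have "\<dots> \<le> sum p {..<Suc i}"
    using 1(1) by (intro sum_mono) (auto simp: decseq_def)
  finally show "p i \<le> 1 / real (Suc i)" using s[of "Suc i"] by (simp add: field_simps)
  also have "\<dots> \<le> 1" by simp
  finally show "p i \<le> 1" .
qed

lemma nablaI:
  assumes "decseq p" "\<And>i. 0 \<le> p i" "\<And>n. sum p {..<n} \<le> 1"
  shows "p \<in> nabla"
proof -
  have "summable p" using assms by (intro summableI_nonneg_bounded[of p 1]) auto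
  moreover have "suminf p \<le> 1" using assms(3) by (intro suminf_le_const \<open>summable p\<close>)
  ultimately show ?thesis using assms by (auto simp: nabla_def)
qed

lemma nabla_closed_limit:
  assumes "\<And>n. x n \<in> nabla" "\<And>i. (\<lambda>n. x n i) \<longlonglongrightarrow> p i"
  shows "p \<in> nabla"
proof (rule nablaI)
  show "decseq p" unfolding decseq_Suc_iff
    using assms(2) nablaD(1)[OF assms(1)] by (auto intro!: LIMSEQ_le[OF assms(2) assms(2)] simp: decseq_Suc_iff)
  show "0 \<le> p i" for i using nablaD(2)[OF assms(1)] by (intro LIMSEQ_le_const[OF assms(2)]) auto
  show "sum p {..<n} \<le> 1" for n
    using nablaD(5)[OF assms(1)] by (intro LIMSEQ_le_const2[OF tendsto_sum[OF assms(2)]]) auto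
qed

lemma zero_in_nabla [simp]: "(\<lambda>_. 0) \<in> nabla"
  by (rule nablaI) auto

lemma nabla_power_le: "p \<in> nabla \<Longrightarrow> k \<ge> 1 \<Longrightarrow> p i ^ k \<le> p i"
  using power_decreasing[of 1 k "p i"] nablaD(2,7) by simp

lemma nabla_summable_power: "p \<in> nabla \<Longrightarrow> k \<ge> 1 \<Longrightarrow> summable (\<lambda>i. p i ^ k)"
  by (rule summable_comparison_test'[OF nablaD(3), of p 0]) (auto simp: nablaD(2) nabla_power_le)

lemma tannery_sequence:
  fixes a :: "nat \<Rightarrow> nat \<Rightarrow> real"
  assumes "\<And>i. (\<lambda>n. a n i) \<longlonglongrightarrow> b i" "\<And>n i. \<bar>a n i\<bar> \<le> M i" "summable M"
  shows "(\<lambda>n. suminf (a n)) \<longlonglongrightarrow> suminf b"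
proof -
  have "\<forall>\<^sub>F (i, n) in sequentially \<times>\<^sub>F sequentially. norm (a n i) \<le> M i"
    by (rule always_eventually) (use assms(2) in auto)
  from tannerys_theorem[OF assms(1) this assms(3)] show ?thesis by simp
qed

text \<open>For k >= 2 the terms are dominated by 1/(i+1)^2 uniformly along the sequence. For k = 1
  mass could escape to arbitrarily large indices.\<close>

lemma power_sum_tendsto:
  assumes x: "\<And>n. x n \<in> nabla" and "\<And>i. (\<lambda>n. x n i) \<longlonglongrightarrow> p i" "k \<ge> 2"
  shows "(\<lambda>n. power_sum k (x n)) \<longlonglongrightarrow> power_sum k p"
proof -
  have M: "summable (\<lambda>i. (1 / real (Suc i)) ^ 2)"
  proof -
    have "summable (\<lambda>n. inverse ((real n)\<^sup>2))" by (rule inverse_power_summable) simp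
    then have "summable (\<lambda>n. inverse ((real (Suc n))\<^sup>2))"
      by (simp only: summable_Suc_iff[of "\<lambda>n. inverse ((real n)\<^sup>2)"])
    then show ?thesis by (simp add: inverse_eq_divide power_divide)
  qed
  have "norm (x n i ^ k) \<le> (1 / real (Suc i)) ^ 2" for n i
  proof -
    have "x n i ^ k \<le> x n i ^ 2"
      using assms(3) nablaD(2,7)[OF x] by (intro power_decreasing) auto
    also have "\<dots> \<le> (1 / real (Suc i)) ^ 2"
      using nablaD(2,6)[OF x] by (intro power_mono) auto
    finally show ?thesis using nablaD(2)[OF x] by simp
  qed
  then have "(\<lambda>n. suminf (\<lambda>i. x n i ^ k)) \<longlonglongrightarrow> suminf (\<lambda>i. p i ^ k)"
    by (intro tannery_sequence[OF _ _ M] tendsto_power assms(2)) simp_all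
  then show ?thesis using assms(3) by (simp add: power_sum_def)
qed

lemma power_sum_le_1: "p \<in> nabla \<Longrightarrow> k \<ge> 1 \<Longrightarrow> power_sum k p \<le> 1"
proof (cases "k = 1")
  case False
  assume p: "p \<in> nabla" "k \<ge> 1"
  have "suminf (\<lambda>i. p i ^ k) \<le> suminf p"
    using p by (intro suminf_le nabla_summable_power nabla_power_le nablaD(3))
  with False nablaD(4)[OF p(1)] show ?thesis by (simp add: power_sum_def)
qed (simp add: power_sum_def)

text \<open>The common head cancels from the power sums. If q i < p i, comparing the tails gives p
  i^(m+2) <= q i^m, that is p i^2 <= (q i / p i)^m for every m, which forces p i = 0.\<close>

lemma nabla_eqI_aux:
  assumes p: "p \<in> nabla" "q \<in> nabla" and eq: "\<And>k. k \<ge> 2 \<Longrightarrow> power_sum k p = power_sum k q"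
    and head: "\<And>j. j < i \<Longrightarrow> p j = q j"
  shows "p i \<le> q i"
proof (rule ccontr)
  assume "\<not> p i \<le> q i"
  then have less: "q i < p i" by simp
  let ?r = "q i / p i"
  have pos: "0 < p i" "0 \<le> q i" using less nablaD(2)[OF p(2), of i] by linarith+
  have r: "0 \<le> ?r" "?r < 1" using pos less by auto
  have "p i ^ 2 \<le> ?r ^ m" for m
  proof -
    let ?k = "m + 2"
    have k: "?k \<ge> 1" "?k \<ge> 2" "?k \<noteq> 1" by auto
    have "suminf (\<lambda>j. p (j + i) ^ ?k) = suminf (\<lambda>j. q (j + i) ^ ?k)"
      using suminf_minus_initial_segment[OF nabla_summable_power[OF p(1) k(1)], of i]
        suminf_minus_initial_segment[OF nabla_summable_power[OF p(2) k(1)], of i] eq[OF k(2)] head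
      by (simp add: power_sum_def)
    moreover have "p i ^ ?k \<le> suminf (\<lambda>j. p (j + i) ^ ?k)"
      using sum_le_suminf[OF summable_ignore_initial_segment[OF nabla_summable_power[OF p(1) k(1)], of i], of "{0}"]
        nablaD(2)[OF p(1)] by simp
    moreover have "suminf (\<lambda>j. q (j + i) ^ ?k) \<le> q i ^ m"
    proof -
      have le: "q (j + i) ^ ?k \<le> q i ^ m * q (j + i) ^ 2" for j
        unfolding power_add using nablaD(1,2)[OF p(2)]
        by (intro mult_right_mono power_mono) (auto simp: decseq_def)
      have s2: "summable (\<lambda>j. q (j + i) ^ 2)"
        by (intro summable_ignore_initial_segment nabla_summable_power p) simp
      have "suminf (\<lambda>j. q (j + i) ^ ?k) \<le> suminf (\<lambda>j. q i ^ m * q (j + i) ^ 2)"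
        by (intro suminf_le le summable_mult s2 summable_ignore_initial_segment[OF nabla_summable_power[OF p(2) k(1)]])
      also have "\<dots> = q i ^ m * suminf (\<lambda>j. q (j + i) ^ 2)" by (rule suminf_mult[OF s2])
      finally have 1: "suminf (\<lambda>j. q (j + i) ^ ?k) \<le> q i ^ m * suminf (\<lambda>j. q (j + i) ^ 2)" .
      have "suminf (\<lambda>j. q (j + i) ^ 2) \<le> suminf (\<lambda>j. q j ^ 2)"
        using suminf_minus_initial_segment[OF nabla_summable_power[OF p(2), of 2], of i] nablaD(2)[OF p(2)]
        by (simp add: sum_nonneg)
      also have "\<dots> \<le> 1" using power_sum_le_1[OF p(2), of 2] by (simp add: power_sum_def)
      finally have "q i ^ m * suminf (\<lambda>j. q (j + i) ^ 2) \<le> q i ^ m * 1"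
        using pos by (intro mult_left_mono) auto
      with 1 show ?thesis by linarith
    qed
    ultimately have "p i ^ ?k \<le> q i ^ m" by linarith
    then have "p i ^ m * p i ^ 2 \<le> q i ^ m" unfolding power_add .
    then show ?thesis using pos by (simp add: power_divide field_simps)
  qed
  moreover have "(\<lambda>m. ?r ^ m) \<longlonglongrightarrow> 0" using r by (intro LIMSEQ_power_zero) auto
  ultimately have "p i ^ 2 \<le> 0" by (intro LIMSEQ_le_const) auto
  then show False using pos by simp
qed

lemma nabla_eqI:
  assumes p: "p \<in> nabla" "q \<in> nabla" and eq: "\<And>k. k \<ge> 2 \<Longrightarrow> power_sum k p = power_sum k q"
  shows "p = q"
proof
  fix i show "p i = q i"
  proof (induction i rule: less_induct)
    case (less i)
    then show ?case using nabla_eqI_aux[OF p eq, of i] nabla_eqI_aux[OF p(2,1) eq[symmetric], of i]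
      by (metis antisym)
  qed
qed

lemma nabla_seq_compact:
  fixes x :: "nat \<Rightarrow> nat \<Rightarrow> real"
  assumes "\<And>n. x n \<in> nabla"
  shows "\<exists>r p. strict_mono r \<and> p \<in> nabla \<and> (\<forall>i. (\<lambda>n. x (r n) i) \<longlonglongrightarrow> p i)"
proof -
  have "compact (Pi\<^sub>E UNIV (\<lambda>_::nat. {0..1::real}))"
    using compactin_PiE[of "\<lambda>_::nat. euclidean :: real topology" UNIV "\<lambda>_. {0..1}"]
    by (simp add: euclidean_product_topology)
  then have "seq_compact (Pi\<^sub>E UNIV (\<lambda>_::nat. {0..1::real}))"
    by (simp add: compact_eq_seq_compact_metric)
  moreover have "\<forall>n. x n \<in> Pi\<^sub>E UNIV (\<lambda>_::nat. {0..1::real})"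
    using nablaD(2,7)[OF assms] by auto
  ultimately obtain p r where r: "strict_mono r" "(x \<circ> r) \<longlonglongrightarrow> p"
    by (rule seq_compactE[of _ x]) auto
  have "(\<lambda>n. x (r n) i) \<longlonglongrightarrow> p i" for i
    using continuous_on_tendsto_compose[OF continuous_on_product_coordinates[of i] r(2)] by (simp add: comp_def)
  moreover from this have "p \<in> nabla" using nabla_closed_limit[of "\<lambda>n. x (r n)" p] assms by blast
  ultimately show ?thesis using r by blast
qed

text \<open>Compactness: every subsequential limit has the limiting power sums as its own, and these
  determine a point of the simplex, so all subsequential limits agree.\<close>

lemma nabla_convergence:
  assumes x: "\<And>n. x n \<in> nabla" and conv: "\<And>k. k \<ge> 2 \<Longrightarrow> convergent (\<lambda>n. power_sum k (x n))"
  shows "\<exists>p\<in>nabla. \<forall>i. (\<lambda>n. x n i) \<longlonglongrightarrow> p i"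
proof -
  obtain r p where r: "strict_mono r" "p \<in> nabla" "\<And>i. (\<lambda>n. x (r n) i) \<longlonglongrightarrow> p i"
    using nabla_seq_compact[of x] x by blast
  have lim: "(\<lambda>n. power_sum k (x n)) \<longlonglongrightarrow> power_sum k q"
    if s: "strict_mono s" "\<And>i. (\<lambda>n. x (s n) i) \<longlonglongrightarrow> q i" "k \<ge> 2" for s q k
  proof -
    obtain L where L: "(\<lambda>n. power_sum k (x n)) \<longlonglongrightarrow> L" using conv[OF s(3)] by (auto simp: convergent_def)
    have "(\<lambda>n. power_sum k (x (s n))) \<longlonglongrightarrow> power_sum k q"
      by (rule power_sum_tendsto[OF x s(2,3)])
    with LIMSEQ_subseq_LIMSEQ[OF L s(1)] have "L = power_sum k q" by (auto simp: comp_def intro: LIMSEQ_unique)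
    with L show ?thesis by simp
  qed
  have "(\<lambda>n. x n i) \<longlonglongrightarrow> p i" for i
  proof (rule ccontr)
    assume "\<not> (\<lambda>n. x n i) \<longlonglongrightarrow> p i"
    then obtain e where e: "e > 0" "\<exists>\<^sub>F n in sequentially. \<not> dist (x n i) (p i) < e"
      by (auto simp: tendsto_iff not_eventually)
    from e(2) have "infinite {n. \<not> dist (x n i) (p i) < e}"
      unfolding infinite_nat_iff_unbounded_le frequently_sequentially mem_Collect_eq .
    then obtain s :: "nat \<Rightarrow> nat" where s: "strict_mono s" "\<And>n. \<not> dist (x (s n) i) (p i) < e"
      using infinite_enumerate[of "{n. \<not> dist (x n i) (p i) < e}"] by auto
    obtain t q where t: "strict_mono t" "q \<in> nabla" "\<And>i. (\<lambda>n. x (s (t n)) i) \<longlonglongrightarrow> q i"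
      using nabla_seq_compact[of "\<lambda>n. x (s n)"] x by blast
    have "strict_mono (\<lambda>n. s (t n))" using s t by (simp add: strict_mono_def)
    from LIMSEQ_unique[OF lim[OF r(1,3)] lim[OF this t(3)]] have "p = q"
      by (intro nabla_eqI r t) auto
    with t(3)[of i] e(1) have "\<forall>\<^sub>F n in sequentially. dist (x (s (t n)) i) (p i) < e" by (auto simp: tendsto_iff)
    with s(2) show False by auto
  qed
  then show ?thesis using r by blast
qed

section \<open>Frequencies of a partition\<close>

text \<open>The empty partition gets the zero sequence, because x / 0 = 0, and so stays inside the
  simplex.\<close>

definition freq :: "nat multiset \<Rightarrow> nat \<Rightarrow> real" where
  "freq \<rho> i = real (part \<rho> i) / real (sum_mset \<rho>)"

text \<open>The condition on g 0 disposes of the zero padding of \<open>part\<close>.\<close>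

lemma sums_part:
  assumes "g 0 = (0::real)"
  shows "(\<lambda>i. g (part \<rho> i)) sums (\<Sum>l\<in>#\<rho>. g l)"
proof -
  let ?xs = "rev (sorted_list_of_multiset \<rho>)"
  have "(\<lambda>i. g (part \<rho> i)) sums (\<Sum>i<size \<rho>. g (part \<rho> i))"
    using assms by (intro sums_finite) (auto simp: part_def)
  also have "(\<Sum>i<size \<rho>. g (part \<rho> i)) = (\<Sum>i<length ?xs. g (?xs ! i))"
    by (intro sum.cong) (auto simp: part_def size_mset[symmetric] simp del: size_mset)
  also have "\<dots> = sum_list (map g ?xs)"
    by (simp add: sum_list_sum_nth atLeast0LessThan)
  also have "\<dots> = (\<Sum>l\<in>#mset ?xs. g l)"
    by (simp only: mset_map[symmetric] sum_mset_sum_list)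
  finally show ?thesis by simp
qed

lemma decseq_part: "decseq (part \<rho>)"
  unfolding decseq_def
proof (intro allI impI)
  fix m n :: nat assume mn: "m \<le> n"
  let ?xs = "sorted_list_of_multiset \<rho>"
  have len: "length ?xs = size \<rho>" by (metis mset_sorted_list_of_multiset size_mset)
  show "part \<rho> n \<le> part \<rho> m"
  proof (cases "n < size \<rho>")
    case True
    then have "?xs ! (size \<rho> - Suc n) \<le> ?xs ! (size \<rho> - Suc m)"
      using mn len by (intro sorted_nth_mono) auto
    with True mn len show ?thesis by (simp add: part_def rev_nth)
  qed (simp add: part_def)
qed

lemma freq_in_nabla: "freq \<rho> \<in> nabla"
proof (rule nablaI)
  show "decseq (freq \<rho>)" using decseq_part[of \<rho>] by (auto simp: decseq_def freq_def divide_right_mono)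
  show "0 \<le> freq \<rho> i" for i by (simp add: freq_def)
  have "freq \<rho> sums (\<Sum>l\<in>#\<rho>. real l / real (sum_mset \<rho>))"
    unfolding freq_def by (rule sums_part) simp
  then show "sum (freq \<rho>) {..<n} \<le> 1" for n
    using sum_weight_le_1[of \<rho> "sum_mset \<rho>"] sum_le_suminf[of "freq \<rho>" "{..<n}"]
    by (auto simp: sums_iff freq_def)
qed

lemma suminf_freq: "0 < sum_mset \<rho> \<Longrightarrow> freq \<rho> sums 1"
  using sums_part[of "\<lambda>l. real l / real (sum_mset \<rho>)" \<rho>] psum_1[of \<rho>]
  by (simp add: freq_def[abs_def] psum_def)

lemma power_sum_freq:
  assumes "0 < sum_mset \<rho>" "k \<ge> 1" shows "power_sum k (freq \<rho>) = psum k \<rho>"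
proof (cases "k = 1")
  case True
  then show ?thesis using psum_1[OF assms(1)] by (simp add: power_sum_def)
next
  case False
  then show ?thesis
    using assms sums_part[of "\<lambda>l. (real l / real (sum_mset \<rho>)) ^ k" \<rho>]
    by (simp add: power_sum_def psum_def freq_def sums_iff)
qed

lemma psum_bounds: "0 \<le> psum k \<rho>" "0 < sum_mset \<rho> \<Longrightarrow> k \<ge> 1 \<Longrightarrow> psum k \<rho> \<le> 1"
  using power_sum_freq[of \<rho> k] power_sum_le_1[OF freq_in_nabla, of k \<rho>]
  by (auto simp: psum_def intro!: sum_mset_nonneg')

lemma not_0_move: "0 \<notin># (\<kappa> :: nat multiset) \<Longrightarrow> k \<ge> 1 \<Longrightarrow> 0 \<notin># add_mset (j + k) (\<kappa> - {#j#})"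
  using in_diffD[of 0 \<kappa> "{#j#}"] by auto

lemma size_move: "j \<in># \<kappa> \<Longrightarrow> size (add_mset (j + k) (\<kappa> - {#j#})) = size \<kappa>"
  by (auto dest!: multi_member_split)

lemma tendsto_sum_mset: "(\<And>x. x \<in># A \<Longrightarrow> (f x \<longlongrightarrow> g x) F) \<Longrightarrow> ((\<lambda>n. \<Sum>x\<in>#A. f x n) \<longlongrightarrow> (\<Sum>x\<in>#A. (g x :: real))) F"
  by (induction A) (auto intro!: tendsto_add)

text \<open>Quantities obeying the recursion of the augmented monomial functions are determined by the power sums.\<close>

lemma spow_tendsto:
  assumes "\<And>n. 0 < sum_mset (\<rho> n)" "\<And>k. k \<ge> 2 \<Longrightarrow> (\<lambda>n. psum k (\<rho> n)) \<longlonglongrightarrow> power_sum k p"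
    and "0 \<notin># \<kappa>"
  shows "(\<lambda>n. spow \<kappa> (\<rho> n)) \<longlonglongrightarrow> paintbox p \<kappa>"
  using assms(3)
proof (induction "size \<kappa>" arbitrary: \<kappa>)
  case 0
  then show ?case by (simp add: spow_def)
next
  case (Suc m)
  then obtain k \<kappa>' where \<kappa>: "\<kappa> = add_mset k \<kappa>'" by (metis size_eq_Suc_imp_eq_union)
  have k: "k \<ge> 1" "0 \<notin># \<kappa>'" "size \<kappa>' = m" using Suc \<kappa> by auto
  have ps: "(\<lambda>n. psum k (\<rho> n)) \<longlonglongrightarrow> power_sum k p"
  proof (cases "k = 1")
    case True
    show ?thesis unfolding True psum_1[OF assms(1)] by (simp add: power_sum_def)
  qed (use assms(2)[of k] k in auto)
  have "(\<lambda>n. psum k (\<rho> n) * spow \<kappa>' (\<rho> n) - (\<Sum>j\<in>#\<kappa>'. spow (add_mset (j + k) (\<kappa>' - {#j#})) (\<rho> n))) \<longlonglongrightarrow>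
     power_sum k p * paintbox p \<kappa>' - (\<Sum>j\<in>#\<kappa>'. paintbox p (add_mset (j + k) (\<kappa>' - {#j#})))"
  proof (intro tendsto_diff tendsto_mult ps tendsto_sum_mset Suc.hyps(1))
    fix j assume "j \<in># \<kappa>'"
    then show "m = size (add_mset (j + k) (\<kappa>' - {#j#}))" using k size_move by metis
    show "0 \<notin># add_mset (j + k) (\<kappa>' - {#j#})" using k by (intro not_0_move)
  qed (use k in auto)
  then show ?case
    using spow_recursion[OF assms(1)] paintbox_recursion[OF k(2,1), of p] \<kappa> by simp
qed

lemma sampling_tendsto:
  assumes "\<And>n. 0 < sum_mset (\<rho> n)" "\<And>k. k \<ge> 2 \<Longrightarrow> (\<lambda>n. psum k (\<rho> n)) \<longlonglongrightarrow> power_sum k p"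
    and "0 \<notin># \<kappa>" "filterlim (\<lambda>n. sum_mset (\<rho> n)) at_top sequentially"
  shows "(\<lambda>n. sampling \<kappa> (\<rho> n)) \<longlonglongrightarrow> paintbox p \<kappa>"
proof -
  let ?C = "approx_const \<kappa> + (real (sum_mset \<kappa>))\<^sup>2"
  have "(\<lambda>n. ?C / real (sum_mset (\<rho> n))) \<longlonglongrightarrow> 0"
    by (rule real_tendsto_divide_at_top[OF tendsto_const filterlim_compose[OF filterlim_real_sequentially assms(4)]])
  then have "(\<lambda>n. sampling \<kappa> (\<rho> n) - spow \<kappa> (\<rho> n)) \<longlonglongrightarrow> 0"
  proof (rule Lim_null_comparison[rotated])
    have "\<forall>\<^sub>F n in sequentially. sum_mset \<kappa> \<le> sum_mset (\<rho> n)"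
      using assms(4) by (simp add: filterlim_at_top)
    then show "\<forall>\<^sub>F n in sequentially. norm (sampling \<kappa> (\<rho> n) - spow \<kappa> (\<rho> n)) \<le> ?C / real (sum_mset (\<rho> n))"
      by eventually_elim (use assms in \<open>auto intro!: sampling_approx u_sampling_le_1\<close>)
  qed
  from tendsto_add[OF this spow_tendsto[OF assms(1-3)]] show ?thesis by simp
qed

text \<open>Round N * p i down and fill up to N with parts 1. The filling imitates the dust and is
  invisible to power sums of order k >= 2: at most N parts of frequency 1/N contribute at most
  N^(1-k).\<close>

lemma partition_approx:
  assumes p: "p \<in> nabla"
  shows "\<exists>\<rho>. (\<forall>N. 0 \<notin># \<rho> N \<and> sum_mset (\<rho> N) = N) \<and> (\<forall>k\<ge>2. (\<lambda>N. psum k (\<rho> N)) \<longlonglongrightarrow> power_sum k p)"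
proof -
  define a where "a N i = nat \<lfloor>real N * p i\<rfloor>" for N i
  define I where "I N = {i\<in>{..<N}. a N i \<noteq> 0}" for N
  define A where "A N = (\<Sum>i\<in>I N. a N i)" for N
  define \<rho> where "\<rho> N = image_mset (a N) (mset_set (I N)) + replicate_mset (N - A N) 1" for N
  have fin: "finite (I N)" for N by (simp add: I_def)
  have a_le: "real (a N i) \<le> real N * p i" for N i
    using nablaD(2)[OF p, of i] by (simp add: a_def)
  have a_ge: "real N * p i - 1 \<le> real (a N i)" for N i
    using nablaD(2)[OF p, of i] by (simp add: a_def)
  \<comment> \<open>Since p i <= 1/(i+1), the product N * p i is below 1 for i >= N; hence only
    finitely many parts arise.\<close>
  have a0: "a N i = 0" if "i \<ge> N" for N i
  proof -
    have "real N * p i \<le> real N * (1 / real (Suc i))" using nablaD(6)[OF p] by (intro mult_left_mono) auto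
    also have "\<dots> < 1" using that by simp
    finally show ?thesis using a_le[of N i] by simp
  qed
  have A_le: "A N \<le> N" for N
  proof -
    have "real (A N) \<le> (\<Sum>i<N. real N * p i)"
      unfolding A_def of_nat_sum using fin nablaD(2)[OF p]
      by (intro order_trans[OF sum_mono[OF a_le] sum_mono2]) (auto simp: I_def)
    also have "\<dots> \<le> real N * 1" unfolding sum_distrib_left[symmetric]
      by (intro mult_left_mono nablaD(5)[OF p]) auto
    finally show ?thesis by simp
  qed
  have sum_eq: "sum_mset (\<rho> N) = N" for N
    using A_le[of N] by (simp add: \<rho>_def A_def sum_unfold_sum_mset)
  have not0: "0 \<notin># \<rho> N" for N
    using fin by (auto simp: \<rho>_def I_def in_replicate_mset split: if_splits)
  have lim: "(\<lambda>N. psum k (\<rho> N)) \<longlonglongrightarrow> power_sum k p" if k: "k \<ge> 2" for k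
  proof -
    have eq: "psum k (\<rho> N) = suminf (\<lambda>i. (real (a N i) / real N) ^ k) + real (N - A N) / real N ^ k" for N
    proof -
      have "psum k (\<rho> N) = (\<Sum>i\<in>I N. (real (a N i) / real N) ^ k) + real (N - A N) / real N ^ k"
        unfolding psum_def sum_eq
        by (simp add: \<rho>_def image_mset.compositionality comp_def sum_unfold_sum_mset power_one_over divide_inverse power_inverse)
      also have "(\<Sum>i\<in>I N. (real (a N i) / real N) ^ k) = suminf (\<lambda>i. (real (a N i) / real N) ^ k)"
        using k a0[of N] fin[of N] by (intro suminf_finite[symmetric]) (auto simp: I_def not_less intro: ccontr)
      finally show ?thesis .
    qed
    have "(\<lambda>N. suminf (\<lambda>i. (real (a N i) / real N) ^ k)) \<longlonglongrightarrow> suminf (\<lambda>i. p i ^ k)"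
    proof -
      have "(\<lambda>N. real (a N i) / real N) \<longlonglongrightarrow> p i" for i
      proof (rule tendsto_sandwich[of "\<lambda>N. p i - 1 / real N"])
        show "\<forall>\<^sub>F N in sequentially. p i - 1 / real N \<le> real (a N i) / real N"
          using eventually_gt_at_top[of 0]
        proof eventually_elim
          case (elim N)
          then have "p i - 1 / real N = (real N * p i - 1) / real N" by (simp add: diff_divide_distrib)
          also have "\<dots> \<le> real (a N i) / real N" by (intro divide_right_mono a_ge) simp
          finally show ?case .
        qed
        show "\<forall>\<^sub>F N in sequentially. real (a N i) / real N \<le> p i"
          using eventually_gt_at_top[of 0] by eventually_elim (use a_le in \<open>auto simp: field_simps\<close>)
        show "(\<lambda>N. p i - 1 / real N) \<longlonglongrightarrow> p i"
          using tendsto_diff[OF tendsto_const lim_1_over_n, of "p i"] by simp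
      qed simp
      moreover have "norm ((real (a N i) / real N) ^ k) \<le> p i" for N i
      proof -
        have "real (a N i) / real N \<le> p i"
          using a_le[of N i] nablaD(2)[OF p, of i] by (cases "N = 0") (auto simp: field_simps)
        then have "(real (a N i) / real N) ^ k \<le> p i ^ k" by (intro power_mono) auto
        also have "\<dots> \<le> p i" using p k by (intro nabla_power_le) auto
        finally show ?thesis by simp
      qed
      ultimately show ?thesis
        by (intro tannery_sequence[OF _ _ nablaD(3)[OF p]] tendsto_power) simp_all
    qed
    moreover have "(\<lambda>N. real (N - A N) / real N ^ k) \<longlonglongrightarrow> 0"
    proof (rule Lim_null_comparison[OF _ lim_1_over_n])
      show "\<forall>\<^sub>F N in sequentially. norm (real (N - A N) / real N ^ k) \<le> 1 / real N"
        using eventually_gt_at_top[of 0]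
      proof eventually_elim
        case (elim N)
        have "real (N - A N) / real N ^ k \<le> real N / real N ^ k" by (intro divide_right_mono) auto
        also have "\<dots> \<le> real N / real N ^ 2" using k elim by (intro divide_left_mono power_increasing) auto
        also have "\<dots> = 1 / real N" using elim by (simp add: power2_eq_square)
        finally show ?case by simp
      qed
    qed
    ultimately have "(\<lambda>N. psum k (\<rho> N)) \<longlonglongrightarrow> suminf (\<lambda>i. p i ^ k) + 0"
      unfolding eq by (rule tendsto_add)
    then show ?thesis using k by (simp add: power_sum_def)
  qed
  show ?thesis using sum_eq not0 lim by blast
qed

text \<open>Signs are not visible in the polynomial expression; nonnegativity is inherited from
  sampling probabilities of approximating partitions.\<close>

lemma paintbox_nonneg:
  assumes "p \<in> nabla" "0 \<notin># \<kappa>" shows "0 \<le> paintbox p \<kappa>"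
proof -
  obtain \<rho> where \<rho>: "\<And>N. sum_mset (\<rho> N) = N" "\<And>k. k \<ge> 2 \<Longrightarrow> (\<lambda>N. psum k (\<rho> N)) \<longlonglongrightarrow> power_sum k p"
    using partition_approx[OF assms(1)] by blast
  have "(\<lambda>N. sampling \<kappa> (\<rho> (Suc N))) \<longlonglongrightarrow> paintbox p \<kappa>"
    by (rule sampling_tendsto)
      (auto simp: \<rho>(1) assms(2) filterlim_Suc intro!: LIMSEQ_Suc \<rho>(2))
  then show ?thesis by (rule LIMSEQ_le_const) auto
qed

text \<open>The product rule with the power sum of order 1, whose value is 1.\<close>

lemma paintbox_harmonic:
  "0 \<notin># \<kappa> \<Longrightarrow> paintbox p \<kappa> = paintbox p (add_mset 1 \<kappa>) + (\<Sum>j\<in>#\<kappa>. paintbox p (add_mset (j + 1) (\<kappa> - {#j#})))"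
  using paintbox_recursion[of \<kappa> 1 p] by (simp add: power_sum_def)

lemma continuous_on_power_sum: "k \<ge> 1 \<Longrightarrow> continuous_on nabla (power_sum k)"
proof (cases "k = 1")
  case True
  have "power_sum k = (\<lambda>_. 1)" by (simp add: power_sum_def True fun_eq_iff)
  then show ?thesis by simp
next
  case False
  assume "k \<ge> 1"
  with False have k: "k \<ge> 2" by simp
  show ?thesis
    unfolding continuous_on_sequentially
  proof (intro allI ballI impI, elim conjE)
    fix x p assume *: "p \<in> nabla" "\<forall>n. x n \<in> nabla" "x \<longlonglongrightarrow> p"
    have "(\<lambda>n. x n i) \<longlonglongrightarrow> p i" for i
      using continuous_on_tendsto_compose[OF continuous_on_product_coordinates[of i] *(3)] by simp
    then show "(power_sum k \<circ> x) \<longlonglongrightarrow> power_sum k p"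
      unfolding comp_def using * k by (intro power_sum_tendsto) auto
  qed
qed

lemma continuous_on_sum_mset: "(\<And>x. x \<in># A \<Longrightarrow> continuous_on S (f x)) \<Longrightarrow> continuous_on S (\<lambda>y. \<Sum>x\<in>#A. (f x y :: real))"
  by (induction A) (auto intro!: continuous_intros)

text \<open>This yields the measurability of p -> \<mu>^p as a kernel and, with uniform
  approximation by prefix functions, its weak continuity.\<close>

lemma continuous_on_paintbox: "0 \<notin># \<kappa> \<Longrightarrow> continuous_on nabla (\<lambda>p. paintbox p \<kappa>)"
proof (induction "size \<kappa>" arbitrary: \<kappa>)
  case 0
  then show ?case by simp
next
  case (Suc m)
  then obtain k \<kappa>' where \<kappa>: "\<kappa> = add_mset k \<kappa>'" by (metis size_eq_Suc_imp_eq_union)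
  have k: "k \<ge> 1" "0 \<notin># \<kappa>'" "size \<kappa>' = m" using Suc \<kappa> by auto
  have eq: "(\<lambda>p. paintbox p \<kappa>) =
      (\<lambda>p. power_sum k p * paintbox p \<kappa>' - (\<Sum>j\<in>#\<kappa>'. paintbox p (add_mset (j + k) (\<kappa>' - {#j#}))))"
    using paintbox_recursion[OF k(2,1)] \<kappa> by (simp add: fun_eq_iff)
  show ?case
    unfolding eq
  proof (intro continuous_on_diff continuous_on_mult continuous_on_power_sum continuous_on_sum_mset Suc.hyps(1))
    fix j assume "j \<in># \<kappa>'"
    then show "m = size (add_mset (j + k) (\<kappa>' - {#j#}))" using k size_move by metis
    show "0 \<notin># add_mset (j + k) (\<kappa>' - {#j#})" using k by (intro not_0_move)
  qed (use k in auto)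
qed

section \<open>The path space\<close>

definition prefix_at :: "nat \<Rightarrow> path \<Rightarrow> edge list" where
  "prefix_at n \<omega> = map \<omega> [0..<n]"

lemma length_prefix_at [simp]: "length (prefix_at n \<omega>) = n"
  by (simp add: prefix_at_def)

lemma prefix_at_Suc: "prefix_at (Suc n) \<omega> = prefix_at n \<omega> @ [\<omega> n]"
  by (simp add: prefix_at_def)

lemma prefix_at_0 [simp]: "prefix_at 0 \<omega> = []"
  by (simp add: prefix_at_def)

lemma nth_prefix_at: "i < n \<Longrightarrow> prefix_at n \<omega> ! i = \<omega> i"
  by (simp add: prefix_at_def)

lemma prefix_at_eq_iff: "prefix_at n \<omega> = \<gamma> \<longleftrightarrow> length \<gamma> = n \<and> (\<forall>i<n. \<omega> i = \<gamma> ! i)"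
  by (auto simp: list_eq_iff_nth_eq nth_prefix_at)

lemma take_prefix_at: "m \<le> n \<Longrightarrow> take m (prefix_at n \<omega>) = prefix_at m \<omega>"
  by (simp add: prefix_at_def take_map)

lemma is_walk_append: "is_walk s (es @ es') t \<longleftrightarrow> (\<exists>r. is_walk s es r \<and> is_walk r es' t)"
  by (induction es arbitrary: s) auto

lemma walk_end_append [simp]: "walk_end s (es @ es') = walk_end (walk_end s es) es'"
  by (induction es arbitrary: s) auto

lemma is_walk_end: "is_walk s es t \<Longrightarrow> walk_end s es = t"
  by (simp add: is_walk_iff)

lemma walks_append:
  "es @ es' \<in> walks s n \<longleftrightarrow> es \<in> walks s (length es) \<and> es' \<in> walks (walk_end s es) (length es') \<and> n = length es + length es'"
  by (auto simp: walks_def is_walk_append dest: is_walk_end)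

lemma walks_snoc: "es @ [e] \<in> walks s (Suc n) \<longleftrightarrow> es \<in> walks s n \<and> e \<in> out_edges (walk_end s es)"
  unfolding walks_append by (auto simp: walks_def out_edges_def)

lemma walks_length: "es \<in> walks s n \<Longrightarrow> length es = n"
  by (simp add: walks_def)

lemma prefix_at_path:
  assumes "\<omega> \<in> paths"
  shows "prefix_at n \<omega> \<in> walks leaf n" "walk_end leaf (prefix_at n \<omega>) = src (\<omega> n)"
proof -
  have "prefix_at n \<omega> \<in> walks leaf n \<and> walk_end leaf (prefix_at n \<omega>) = src (\<omega> n)"
    using assms by (induction n) (auto simp: prefix_at_Suc walks_snoc paths_def out_edges_def)
  then show "prefix_at n \<omega> \<in> walks leaf n" "walk_end leaf (prefix_at n \<omega>) = src (\<omega> n)" by auto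
qed

lemma paths_iff: "\<omega> \<in> paths \<longleftrightarrow> (\<forall>n. prefix_at n \<omega> \<in> walks leaf n)"
proof
  assume *: "\<forall>n. prefix_at n \<omega> \<in> walks leaf n"
  have o: "\<omega> n \<in> out_edges (walk_end leaf (prefix_at n \<omega>))" for n
    using *[rule_format, of "Suc n"] by (simp add: prefix_at_Suc walks_snoc)
  have "tgt (\<omega> n) = src (\<omega> (Suc n))" for n
    using o[of "Suc n"] by (simp add: prefix_at_Suc out_edges_def)
  with o[of 0] o show "\<omega> \<in> paths" by (auto simp: paths_def out_edges_def)
qed (simp add: prefix_at_path)

lemma cylinder_eq: "cylinder \<gamma> = {\<omega> \<in> paths. prefix_at (length \<gamma>) \<omega> = \<gamma>}"
  by (auto simp: cylinder_def prefix_at_eq_iff)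

lemma cylinder_Nil [simp]: "cylinder [] = paths"
  by (simp add: cylinder_def)

lemma cylinder_not_walk: "\<gamma> \<notin> walks leaf (length \<gamma>) \<Longrightarrow> cylinder \<gamma> = {}"
  using prefix_at_path(1) by (simp add: cylinder_eq) metis

lemma prefix_set_eq: "{\<omega> \<in> paths. Q (prefix_at n \<omega>)} = (\<Union>\<gamma>\<in>{\<gamma>\<in>walks leaf n. Q \<gamma>}. cylinder \<gamma>)"
proof safe
  fix \<omega> assume *: "\<omega> \<in> paths" "Q (prefix_at n \<omega>)"
  then have "\<omega> \<in> cylinder (prefix_at n \<omega>)" by (simp add: cylinder_eq)
  with * prefix_at_path(1)[OF *(1), of n] show "\<omega> \<in> (\<Union>\<gamma>\<in>{\<gamma>\<in>walks leaf n. Q \<gamma>}. cylinder \<gamma>)" by blast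
qed (auto simp: cylinder_eq dest: walks_length)

abbreviation "edge_space i \<equiv> {e \<in> edges. src e \<in> trees (Suc i)}"

lemma path_in_edge_space: "\<omega> \<in> paths \<Longrightarrow> \<omega> i \<in> edge_space i"
  using vertices_src_path[of \<omega> i] by (auto simp: paths_def trees_def)

lemma cylinder_PiE: "cylinder \<gamma> = paths \<inter> Pi\<^sub>E UNIV (\<lambda>i. if i < length \<gamma> then {\<gamma> ! i} \<inter> edge_space i else edge_space i)"
proof (intro set_eqI iffI)
  fix \<omega> assume *: "\<omega> \<in> cylinder \<gamma>"
  then have "\<omega> \<in> paths" "\<And>i. i < length \<gamma> \<Longrightarrow> \<gamma> ! i = \<omega> i" by (auto simp: cylinder_def)
  with path_in_edge_space[of \<omega>] show "\<omega> \<in> paths \<inter> Pi\<^sub>E UNIV (\<lambda>i. if i < length \<gamma> then {\<gamma> ! i} \<inter> edge_space i else edge_space i)"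
    by (auto simp: PiE_UNIV_domain)
next
  fix \<omega> assume *: "\<omega> \<in> paths \<inter> Pi\<^sub>E UNIV (\<lambda>i. if i < length \<gamma> then {\<gamma> ! i} \<inter> edge_space i else edge_space i)"
  then have i: "\<omega> i \<in> (if i < length \<gamma> then {\<gamma> ! i} \<inter> edge_space i else edge_space i)" for i
    using PiE_mem[of \<omega> UNIV _ i] by blast
  have "\<omega> i = \<gamma> ! i" if "i < length \<gamma>" for i
    using i[of i] that by simp
  with * show "\<omega> \<in> cylinder \<gamma>" by (simp add: cylinder_def)
qed

lemma openin_cylinder: "openin path_topology (cylinder \<gamma>)"
proof -
  let ?S = "\<lambda>i. if i < length \<gamma> then {\<gamma> ! i} \<inter> edge_space i else edge_space i"
  have "{i \<in> UNIV. ?S i \<noteq> edge_space i} \<subseteq> {..<length \<gamma>}" by auto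
  then have "finite {i \<in> UNIV. ?S i \<noteq> edge_space i}" by (rule finite_subset) simp
  then have "openin (product_topology (\<lambda>i. discrete_topology (edge_space i)) UNIV) (Pi\<^sub>E UNIV ?S)"
    by (intro product_topology_basis) auto
  then show ?thesis unfolding path_topology_def cylinder_PiE openin_subtopology by blast
qed

lemma openin_path_cylinder:
  assumes "openin path_topology U" "\<omega> \<in> U"
  shows "\<exists>n. cylinder (prefix_at n \<omega>) \<subseteq> U"
proof -
  from assms(1) obtain T where T: "openin (product_topology (\<lambda>i. discrete_topology (edge_space i)) UNIV) T" "U = T \<inter> paths"
    by (auto simp: path_topology_def openin_subtopology)
  with assms(2) obtain V where V: "finite {i \<in> UNIV. V i \<noteq> topspace (discrete_topology (edge_space i))}"
      "\<omega> \<in> Pi\<^sub>E UNIV V" "Pi\<^sub>E UNIV V \<subseteq> T"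
    unfolding openin_product_topology_alt by blast
  obtain n where "{i \<in> UNIV. V i \<noteq> topspace (discrete_topology (edge_space i))} \<subseteq> {..<n}"
    using finite_nat_bounded[OF V(1)] by blast
  then have n: "\<And>i. V i \<noteq> edge_space i \<Longrightarrow> i < n" by auto
  have "cylinder (prefix_at n \<omega>) \<subseteq> U"
  proof
    fix \<omega>' assume "\<omega>' \<in> cylinder (prefix_at n \<omega>)"
    then have \<omega>': "\<omega>' \<in> paths" "\<And>i. i < n \<Longrightarrow> \<omega>' i = \<omega> i" by (auto simp: cylinder_def nth_prefix_at)
    have "\<omega>' i \<in> V i" for i
    proof (cases "i < n")
      case True
      with \<omega>'(2) V(2) show ?thesis by (auto simp: PiE_UNIV_domain Pi_iff)
    next
      case False
      with n have "V i = edge_space i" by blast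
      with path_in_edge_space[OF \<omega>'(1)] show ?thesis by simp
    qed
    then have "\<omega>' \<in> Pi\<^sub>E UNIV V" by (auto simp: PiE_UNIV_domain)
    with V(3) T(2) \<omega>'(1) show "\<omega>' \<in> U" by auto
  qed
  then show ?thesis by blast
qed

lemma cylinder_subset_paths: "cylinder \<gamma> \<subseteq> paths"
  by (auto simp: cylinder_def)

lemma countable_walks: "countable (\<Union>n. walks s n)"
  by (intro countable_UN) (auto intro: countable_finite)

text \<open>There are only countably many finite walks, so every open set is a countable union of
  cylinders.\<close>

lemma sets_path_borel: "sets path_borel = sigma_sets paths (range cylinder)"
proof -
  have sub: "{U. openin path_topology U} \<subseteq> Pow paths"
    using openin_subset topspace_path_topology by fastforce
  have "U \<in> sigma_sets paths (range cylinder)" if U: "openin path_topology U" for U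
  proof -
    have "U = (\<Union>\<gamma>\<in>{\<gamma>\<in>(\<Union>n. walks leaf n). cylinder \<gamma> \<subseteq> U}. cylinder \<gamma>)" (is "_ = ?R")
    proof
      show "U \<subseteq> ?R"
      proof
        fix \<omega> assume \<omega>: "\<omega> \<in> U"
        then have p: "\<omega> \<in> paths" using U openin_subset topspace_path_topology by fastforce
        obtain n where "cylinder (prefix_at n \<omega>) \<subseteq> U" using openin_path_cylinder[OF U \<omega>] by blast
        moreover have "\<omega> \<in> cylinder (prefix_at n \<omega>)" using p by (simp add: cylinder_eq)
        ultimately show "\<omega> \<in> ?R" using prefix_at_path(1)[OF p] by auto
      qed
    qed auto
    moreover have "?R \<in> sigma_sets paths (range cylinder)"
      by (rule sigma_sets_UNION) (auto intro!: countable_image countable_subset[OF _ countable_walks])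
    ultimately show ?thesis by simp
  qed
  then have "sigma_sets paths {U. openin path_topology U} = sigma_sets paths (range cylinder)"
    by (intro sigma_sets_eqI) (auto intro: openin_cylinder)
  with sub show ?thesis by (simp add: path_borel_def)
qed

lemma space_path_borel [simp]: "space path_borel = paths"
  by (simp add: path_borel_def space_measure_of_conv)

lemma cylinder_sets [simp, measurable]: "cylinder \<gamma> \<in> sets path_borel"
  by (auto simp: sets_path_borel)

lemma prefix_sets: "{\<omega> \<in> paths. Q (prefix_at n \<omega>)} \<in> sets path_borel"
  unfolding prefix_set_eq by (intro sets.finite_UN) auto

lemma coordinate_sets: "{\<omega> \<in> paths. Q (\<omega> i)} \<in> sets path_borel"
  using prefix_sets[of "\<lambda>\<gamma>. Q (\<gamma> ! i)" "Suc i"] by (simp add: nth_prefix_at)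

text \<open>Disjoint cylinders must intersect in a cylinder for the family to be
  intersection-stable. Growing the one-vertex tree never returns it, so a loop at
  \<open>leaf\<close> is not an edge.\<close>

lemma ex_empty_cylinder: "\<exists>\<gamma>. cylinder \<gamma> = {}"
proof
  have "(leaf, leaf, 0) \<notin> edges" by (simp add: edges_def attach_count_def leaf_def)
  then show "cylinder [(leaf, leaf, 0)] = {}" by (auto simp: cylinder_def paths_def) metis
qed

lemma Int_stable_cylinder: "Int_stable (range cylinder)"
proof -
  have le: "cylinder \<gamma> \<inter> cylinder \<delta> \<in> range cylinder" if "length \<gamma> \<le> length \<delta>" for \<gamma> \<delta>
  proof (cases "take (length \<gamma>) \<delta> = \<gamma>")
    case True
    have "cylinder \<delta> \<subseteq> cylinder \<gamma>"
    proof
      fix \<omega> assume \<omega>: "\<omega> \<in> cylinder \<delta>"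
      with True take_prefix_at[OF that, of \<omega>] show "\<omega> \<in> cylinder \<gamma>" by (simp add: cylinder_eq)
    qed
    then have "cylinder \<gamma> \<inter> cylinder \<delta> = cylinder \<delta>" by blast
    then show ?thesis by auto
  next
    case False
    then have "cylinder \<gamma> \<inter> cylinder \<delta> = {}"
      using take_prefix_at[OF that] by (auto simp: cylinder_eq) metis
    then show ?thesis using ex_empty_cylinder by (metis rangeI)
  qed
  show ?thesis
    unfolding Int_stable_def
  proof clarify
    fix \<gamma> \<delta> :: "edge list"
    show "cylinder \<gamma> \<inter> cylinder \<delta> \<in> range cylinder"
      using le[of \<gamma> \<delta>] le[of \<delta> \<gamma>] by (cases "length \<gamma> \<le> length \<delta>") (auto simp: Int_commute)
  qed
qed

lemma path_measure_eqI:
  assumes "prob_space m" "prob_space m'" "sets m = sets path_borel" "sets m' = sets path_borel"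
    and eq: "\<And>n \<gamma>. \<gamma> \<in> walks leaf n \<Longrightarrow> measure m (cylinder \<gamma>) = measure m' (cylinder \<gamma>)"
  shows "m = m'"
proof (rule measure_eqI_generator_eq[OF Int_stable_cylinder, of paths _ _ "\<lambda>_. paths"])
  interpret m: prob_space m by fact
  interpret m': prob_space m' by fact
  fix X assume "X \<in> range cylinder"
  then obtain \<gamma> where X: "X = cylinder \<gamma>" by auto
  show "emeasure m X = emeasure m' X"
    using eq[of \<gamma> "length \<gamma>"] cylinder_not_walk[of \<gamma>]
    by (cases "\<gamma> \<in> walks leaf (length \<gamma>)") (auto simp: X m.emeasure_eq_measure m'.emeasure_eq_measure)
next
  show "range (\<lambda>_::nat. paths) \<subseteq> range cylinder" using cylinder_Nil by blast
  interpret m: prob_space m by fact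
  show "emeasure m paths \<noteq> \<infinity>" by simp
qed (use assms in \<open>auto simp: sets_path_borel cylinder_def\<close>)

text \<open>Each coordinate is first confined to the edges that occur at that step of some walk from
  the root, a finite set by \<open>finite_walks\<close>. Being a path is a closed condition: at each
  level it is a finite union of closed boxes.\<close>

lemma compact_path_topology: "compact_space path_topology"
proof -
  let ?X = "product_topology (\<lambda>i. discrete_topology (edge_space i)) UNIV"
  define K where "K = Pi\<^sub>E UNIV (\<lambda>i. edge_space i \<inter> (\<lambda>\<gamma>. \<gamma> ! i) ` walks leaf (Suc i))"
  have K: "compactin ?X K"
    unfolding K_def compactin_PiE by (auto simp: compactin_discrete_topology)
  have sub: "paths \<subseteq> K"
  proof
    fix \<omega> assume \<omega>: "\<omega> \<in> paths"
    have "\<omega> i \<in> (\<lambda>\<gamma>. \<gamma> ! i) ` walks leaf (Suc i)" for i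
      by (rule image_eqI[OF _ prefix_at_path(1)[OF \<omega>, of "Suc i"]]) (simp add: nth_prefix_at)
    with path_in_edge_space[OF \<omega>] show "\<omega> \<in> K" by (auto simp: K_def PiE_UNIV_domain)
  qed
  have cl: "closedin ?X paths"
  proof -
    let ?Z = "\<lambda>n \<gamma>. Pi\<^sub>E UNIV (\<lambda>i. if i < n then {\<gamma> ! i} \<inter> edge_space i else edge_space i)"
    have "paths = (\<Inter>n. \<Union>\<gamma>\<in>walks leaf n. ?Z n \<gamma>)" (is "_ = ?R")
    proof
      show "paths \<subseteq> ?R"
      proof clarify
        fix \<omega> n assume \<omega>: "\<omega> \<in> paths"
        have "\<omega> \<in> ?Z n (prefix_at n \<omega>)"
          using path_in_edge_space[OF \<omega>] by (auto simp: PiE_UNIV_domain nth_prefix_at)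
        with prefix_at_path(1)[OF \<omega>] show "\<omega> \<in> (\<Union>\<gamma>\<in>walks leaf n. ?Z n \<gamma>)" by blast
      qed
      show "?R \<subseteq> paths"
      proof
        fix \<omega> assume \<omega>: "\<omega> \<in> ?R"
        have "prefix_at n \<omega> \<in> walks leaf n" for n
        proof -
          from \<omega> obtain \<gamma> where \<gamma>: "\<gamma> \<in> walks leaf n" "\<omega> \<in> ?Z n \<gamma>" by blast
          have "\<omega> i = \<gamma> ! i" if "i < n" for i
            using PiE_mem[OF \<gamma>(2), of i] that by simp
          then have "prefix_at n \<omega> = \<gamma>" using walks_length[OF \<gamma>(1)] by (simp add: prefix_at_eq_iff)
          with \<gamma> show ?thesis by simp
        qed
        then show "\<omega> \<in> paths" by (simp add: paths_iff)
      qed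
    qed
    moreover have "closedin ?X (?Z n \<gamma>)" for n \<gamma>
      unfolding closedin_product_topology by (rule disjI2) (simp add: closedin_discrete_topology)
    then have "closedin ?X (\<Union>\<gamma>\<in>walks leaf n. ?Z n \<gamma>)" for n
      by (intro closedin_Union) (simp_all only: finite_imageI finite_walks, blast)
    then have "closedin ?X (\<Inter>n. \<Union>\<gamma>\<in>walks leaf n. ?Z n \<gamma>)"
      by (intro closedin_Inter) blast+
    ultimately show ?thesis by simp
  qed
  have "compactin ?X paths" by (rule closed_compactin[OF K sub cl])
  then show ?thesis by (simp add: path_topology_def compact_space_subtopology)
qed

text \<open>Finitely many cylinders on which f oscillates by less than e cover the space; a prefix
  longer than all of them decides the cylinder. Hence f is uniformly close to a function of a finite
  prefix.\<close>

lemma continuous_uniform_approx: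
  assumes f: "continuous_map path_topology euclideanreal f" and "0 < e"
  shows "\<exists>n. \<forall>\<omega>\<in>paths. \<forall>\<omega>'\<in>paths. prefix_at n \<omega> = prefix_at n \<omega>' \<longrightarrow> \<bar>f \<omega> - f \<omega>'\<bar> < e"
proof -
  define \<C> where "\<C> = {cylinder \<gamma> | \<gamma>. \<forall>\<omega>\<in>cylinder \<gamma>. \<forall>\<omega>'\<in>cylinder \<gamma>. \<bar>f \<omega> - f \<omega>'\<bar> < e}"
  have "\<omega> \<in> \<Union>\<C>" if \<omega>: "\<omega> \<in> paths" for \<omega>
  proof -
    let ?U = "{\<omega>' \<in> paths. f \<omega>' \<in> ball (f \<omega>) (e / 2)}"
    have "openin path_topology ?U"
      using openin_continuous_map_preimage[OF f, of "ball (f \<omega>) (e / 2)"] by (simp add: topspace_path_topology)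
    moreover have "\<omega> \<in> ?U" using \<omega> \<open>0 < e\<close> by simp
    ultimately obtain n where n: "cylinder (prefix_at n \<omega>) \<subseteq> ?U" using openin_path_cylinder by blast
    have "\<bar>f \<omega>1 - f \<omega>2\<bar> < e" if "\<omega>1 \<in> cylinder (prefix_at n \<omega>)" "\<omega>2 \<in> cylinder (prefix_at n \<omega>)" for \<omega>1 \<omega>2
    proof -
      from n that have "\<omega>1 \<in> ?U" "\<omega>2 \<in> ?U" by blast+
      then have "\<bar>f \<omega> - f \<omega>1\<bar> < e / 2" "\<bar>f \<omega> - f \<omega>2\<bar> < e / 2" by (simp_all add: dist_real_def)
      then show ?thesis by linarith
    qed
    then have "cylinder (prefix_at n \<omega>) \<in> \<C>" unfolding \<C>_def by blast
    moreover have "\<omega> \<in> cylinder (prefix_at n \<omega>)" using \<omega> by (simp add: cylinder_eq)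
    ultimately show ?thesis by blast
  qed
  then have cover: "paths \<subseteq> \<Union>\<C>" by blast
  have "\<forall>C\<in>\<C>. openin path_topology C" by (auto simp: \<C>_def openin_cylinder)
  from compact_path_topology[unfolded compact_space_alt topspace_path_topology, THEN spec, THEN mp, OF conjI[OF this cover]]
  obtain \<F> where \<F>: "finite \<F>" "\<F> \<subseteq> \<C>" "paths \<subseteq> \<Union>\<F>"
    by blast
  then have "\<forall>C\<in>\<F>. \<exists>\<gamma>. C = cylinder \<gamma>" by (auto simp: \<C>_def)
  from bchoice[OF this] obtain g where g1: "\<And>C. C \<in> \<F> \<Longrightarrow> C = cylinder (g C)" by blast
  have g2: "\<bar>f \<omega> - f \<omega>'\<bar> < e" if "C \<in> \<F>" "\<omega> \<in> C" "\<omega>' \<in> C" for C \<omega> \<omega>'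
  proof -
    from that(1) \<F>(2) have "C \<in> \<C>" by blast
    then show ?thesis using that(2,3) unfolding \<C>_def by blast
  qed
  \<comment> \<open>Any common upper bound of the lengths would serve; the sum is one.\<close>
  define n where "n = (\<Sum>C\<in>\<F>. length (g C))"
  have "\<bar>f \<omega> - f \<omega>'\<bar> < e" if *: "\<omega> \<in> paths" "\<omega>' \<in> paths" "prefix_at n \<omega> = prefix_at n \<omega>'" for \<omega> \<omega>'
  proof -
    obtain C where C: "C \<in> \<F>" "\<omega> \<in> C" using \<F>(3) *(1) by blast
    have len: "length (g C) \<le> n" unfolding n_def using C \<F>(1) by (intro member_le_sum) auto
    have "prefix_at (length (g C)) \<omega>' = prefix_at (length (g C)) \<omega>"
      using take_prefix_at[OF len] *(3) by metis
    moreover have "\<omega> \<in> cylinder (g C)" using C g1 by blast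
    ultimately have "\<omega>' \<in> cylinder (g C)" using *(2) by (simp add: cylinder_eq)
    then have "\<omega>' \<in> C" using g1[OF C(1)] by blast
    with g2 C show ?thesis by blast
  qed
  then show ?thesis by blast
qed

lemma continuous_measurable:
  "continuous_map path_topology euclideanreal f \<Longrightarrow> f \<in> borel_measurable path_borel"
proof (rule borel_measurableI)
  fix S :: "real set" assume "continuous_map path_topology euclideanreal f" "open S"
  then have "openin path_topology {\<omega> \<in> paths. f \<omega> \<in> S}"
    using openin_continuous_map_preimage[of path_topology euclideanreal f S] by (simp add: topspace_path_topology)
  then have "{\<omega> \<in> paths. f \<omega> \<in> S} \<in> sets path_borel"
    unfolding path_borel_def using openin_subset topspace_path_topology
    by (subst sets_measure_of) (fastforce simp: topspace_path_topology)+
  then show "f -` S \<inter> space path_borel \<in> sets path_borel"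
    by (simp add: vimage_def Int_def conj_commute)
qed

lemma continuous_bounded:
  assumes f: "continuous_map path_topology euclideanreal f"
  shows "\<exists>B. \<forall>\<omega>\<in>paths. \<bar>f \<omega>\<bar> \<le> B"
proof -
  have "compactin euclideanreal (f ` paths)"
    using image_compactin[OF _ f, of paths] compact_path_topology
    by (simp add: compact_space_def topspace_path_topology)
  then have "bounded (f ` paths)" by (simp add: compact_imp_bounded)
  then show ?thesis by (auto simp: bounded_iff)
qed

lemma openin_prefix: "openin path_topology {\<omega> \<in> paths. Q (prefix_at n \<omega>)}"
  unfolding prefix_set_eq using openin_cylinder by (intro openin_Union) blast

lemma continuous_prefix: "continuous_map path_topology euclideanreal (\<lambda>\<omega>. g (prefix_at n \<omega>))"
  unfolding continuous_map topspace_path_topology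
  using openin_prefix[where Q="\<lambda>\<gamma>. g \<gamma> \<in> U" for U] by simp

text \<open>Cylinders are open and closed, so their probabilities are weakly continuous functions of
  the law. This links the weak topology with cylinder probabilities.\<close>

lemma continuous_indicator_cylinder:
  "continuous_map path_topology euclideanreal (indicator (cylinder \<gamma>))"
proof -
  have "continuous_map path_topology euclideanreal
      (\<lambda>\<omega>. (if prefix_at (length \<gamma>) \<omega> = \<gamma> then 1 else 0))"
    by (rule continuous_prefix)
  then show ?thesis
    by (rule continuous_map_eq) (simp add: topspace_path_topology cylinder_eq)
qed

section \<open>Measures with prescribed cylinder probabilities\<close>

lemma out_edges_nonempty: "out_edges t \<noteq> {}"
proof -
  obtain M where t: "t = Node M" by (cases t)
  then have "Node (add_mset leaf M) \<in># grow t" by simp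
  then have "(t, Node (add_mset leaf M), 0) \<in> out_edges t"
    by (simp add: out_edges_def edges_def attach_count_def src_def)
  then show ?thesis by blast
qed

text \<open>Doob's transform: step along e with probability \<psi> (tgt e) / \<psi> t. Where \<psi>
  t = 0 all successors have value 0 too, and any law on the outgoing edges works. The product form
  of the conclusion covers both cases.\<close>

lemma ex_step_pmf:
  assumes nonneg: "\<And>t. 0 \<le> \<psi> t" and h: "\<psi> t = (\<Sum>t'\<in>#grow t. \<psi> t')"
  shows "\<exists>q :: edge pmf. set_pmf q \<subseteq> out_edges t \<and> (\<forall>e\<in>out_edges t. \<psi> t * pmf q e = \<psi> (tgt e))"
proof (cases "\<psi> t = 0")
  case True
  obtain e0 where "e0 \<in> out_edges t" using out_edges_nonempty by blast
  moreover have "\<forall>e\<in>out_edges t. \<psi> (tgt e) = 0"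
    using h True nonneg by (subst sum_nonneg_eq_0_iff[symmetric]) (auto simp: sum_out_edges)
  ultimately show ?thesis using True by (intro exI[of _ "return_pmf e0"]) auto
next
  case False
  with nonneg[of t] have pos: "\<psi> t > 0" by simp
  let ?f = "\<lambda>e. if e \<in> out_edges t then \<psi> (tgt e) / \<psi> t else 0"
  have nn: "0 \<le> ?f e" for e using nonneg pos by auto
  have "(\<integral>\<^sup>+e. ennreal (?f e) \<partial>count_space UNIV) = (\<Sum>e\<in>out_edges t. ennreal (?f e))"
    by (rule nn_integral_count_space') auto
  also have "\<dots> = ennreal (\<Sum>e\<in>out_edges t. \<psi> (tgt e) / \<psi> t)"
    using nonneg pos by (simp add: sum_ennreal)
  also have "(\<Sum>e\<in>out_edges t. \<psi> (tgt e) / \<psi> t) = 1"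
    using pos h by (simp add: sum_divide_distrib[symmetric] sum_out_edges)
  finally have 1: "(\<integral>\<^sup>+e. ennreal (?f e) \<partial>count_space UNIV) = 1" by simp
  have p: "pmf (embed_pmf ?f) e = ?f e" for e using nn 1 by (rule pmf_embed_pmf)
  show ?thesis
    using pos by (intro exI[of _ "embed_pmf ?f"]) (auto simp: set_pmf_iff p split: if_splits)
qed

text \<open>The chain lives on arbitrary edge sequences with discrete coordinate fields; that it
  follows genuine paths is established afterwards, from the masses of the prefixes.\<close>

locale edge_chain =
  fixes K :: "rtree \<Rightarrow> edge pmf"
begin

definition state :: "nat \<Rightarrow> path \<Rightarrow> rtree" where
  "state i x = (if i = 0 then leaf else tgt (x (i - 1)))"

sublocale IT: Ionescu_Tulcea "\<lambda>i x. measure_pmf (K (state i x))" "\<lambda>_. count_space UNIV"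
proof
  fix i
  have st: "(\<lambda>x. state i x) \<in> measurable (PiM {0..<i} (\<lambda>_. count_space UNIV)) (count_space UNIV)"
  proof (cases "i = 0")
    case False
    then have "(\<lambda>x. x (i - 1)) \<in> measurable (PiM {0..<i} (\<lambda>_. count_space UNIV)) (count_space UNIV)"
      by (intro measurable_component_singleton) auto
    from measurable_compose[OF this, of tgt "count_space UNIV"] show ?thesis
      using False by (simp add: state_def)
  qed (simp add: state_def)
  have "(\<lambda>t. measure_pmf (K t)) \<in> measurable (count_space UNIV) (subprob_algebra (count_space UNIV))"
    by (simp add: measure_pmf_in_subprob_space)
  from measurable_compose[OF st this]
  show "(\<lambda>x. measure_pmf (K (state i x))) \<in> PiM {0..<i} (\<lambda>_. count_space UNIV) \<rightarrow>\<^sub>M subprob_algebra (count_space UNIV)" .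
qed

abbreviation prefix_box :: "nat \<Rightarrow> edge list \<Rightarrow> path set" where
  "prefix_box n \<gamma> \<equiv> Pi\<^sub>E {0..<n} (\<lambda>i. {\<gamma> ! i})"

lemma box_sets: "prefix_box n \<gamma> \<in> sets (PiM {0..<n} (\<lambda>_. count_space UNIV))"
  by (intro sets_PiM_I_finite) auto

text \<open>The step probabilities telescope: each edge multiplies the mass \<psi> of the current
  vertex into \<psi> of its target, starting from \<psi> leaf = 1.\<close>

lemma emeasure_C_box:
  assumes \<psi>: "\<psi> leaf = 1" "\<And>t. 0 \<le> \<psi> t" "\<And>t e. e \<in> out_edges t \<Longrightarrow> \<psi> t * pmf (K t) e = \<psi> (tgt e)"
    and "\<gamma> \<in> walks leaf n"
  shows "emeasure (IT.C 0 n (\<lambda>_. undefined)) (prefix_box n \<gamma>) = ennreal (\<psi> (walk_end leaf \<gamma>))"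
  using assms(4)
proof (induction n arbitrary: \<gamma>)
  case 0
  then show ?case by (simp add: \<psi> PiM_empty)
next
  case (Suc n)
  then obtain \<gamma>' e where \<gamma>: "\<gamma> = \<gamma>' @ [e]" by (metis append_butlast_last_id length_0_conv nat.distinct(1) walks_length)
  with Suc.prems have g: "\<gamma>' \<in> walks leaf n" "e \<in> out_edges (walk_end leaf \<gamma>')" by (auto simp: walks_snoc)
  have len: "length \<gamma>' = n" using g by (simp add: walks_length)
  let ?M = "\<lambda>n. PiM {0..<n} (\<lambda>_::nat. count_space (UNIV :: edge set))"
  let ?C = "IT.C 0 n (\<lambda>_. undefined)"
  have sp: "space ?C = space (?M n)" "sets ?C = sets (?M n)"
    using IT.space_C[of "\<lambda>_. undefined" 0 n] IT.sets_C[of "\<lambda>_. undefined" 0 n] by (auto simp: PiM_empty)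
  have me: "IT.eP n \<in> measurable ?C (subprob_algebra (?M (Suc n)))"
    using IT.measurable_eP[of n] by (simp add: measurable_cong_sets[OF sp(2) refl])
  have "emeasure (IT.C 0 (Suc n) (\<lambda>_. undefined)) (prefix_box (Suc n) \<gamma>) = emeasure (?C \<bind> IT.eP n) (prefix_box (Suc n) \<gamma>)"
    by simp
  also have "\<dots> = (\<integral>\<^sup>+x. emeasure (IT.eP n x) (prefix_box (Suc n) \<gamma>) \<partial>?C)"
    by (rule emeasure_bind[OF _ me box_sets]) (simp add: sp)
  also have "\<dots> = (\<integral>\<^sup>+x. ennreal (pmf (K (walk_end leaf \<gamma>')) e) * indicator (prefix_box n \<gamma>') x \<partial>?C)"
  proof (intro nn_integral_cong)
    fix x assume "x \<in> space ?C"
    then have x: "x \<in> space (?M n)" by (simp add: sp)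
    have "emeasure (IT.eP n x) (prefix_box (Suc n) \<gamma>) = emeasure (measure_pmf (K (state n x))) ((\<lambda>y. x(n := y)) -` prefix_box (Suc n) \<gamma> \<inter> UNIV)"
      using IT.emeasure_eP[OF x box_sets[of "Suc n" \<gamma>]] by simp
    also have "(\<lambda>y. x(n := y)) -` prefix_box (Suc n) \<gamma> \<inter> UNIV = (if x \<in> prefix_box n \<gamma>' then {e} else {})"
    proof -
      have "x(n := y) \<in> prefix_box (Suc n) \<gamma> \<longleftrightarrow> x \<in> prefix_box n \<gamma>' \<and> y = e" for y
        using x len unfolding \<gamma> by (auto simp: PiE_iff space_PiM nth_append extensional_def less_Suc_eq)
      then show ?thesis by auto
    qed
    also have "emeasure (measure_pmf (K (state n x))) (if x \<in> prefix_box n \<gamma>' then {e} else {}) =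
      ennreal (pmf (K (walk_end leaf \<gamma>')) e) * indicator (prefix_box n \<gamma>') x"
    proof (cases "x \<in> prefix_box n \<gamma>'")
      case True
      have "state n x = walk_end leaf \<gamma>'"
      proof (cases n)
        case 0
        with len show ?thesis by (simp add: state_def)
      next
        case (Suc k)
        with len obtain \<delta> d where d: "\<gamma>' = \<delta> @ [d]" by (metis append_butlast_last_id length_0_conv nat.distinct(1))
        with len Suc have "length \<delta> = k" by simp
        then have "\<gamma>' ! k = d" using d by auto
        moreover have "x k = \<gamma>' ! k" using True Suc by (auto simp: PiE_iff)
        ultimately show ?thesis using d Suc by (simp add: state_def)
      qed
      with True show ?thesis by (simp add: emeasure_pmf_single)
    qed simp
    finally show "emeasure (IT.eP n x) (prefix_box (Suc n) \<gamma>) = ennreal (pmf (K (walk_end leaf \<gamma>')) e) * indicator (prefix_box n \<gamma>') x" .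
  qed
  also have "\<dots> = ennreal (pmf (K (walk_end leaf \<gamma>')) e) * emeasure ?C (prefix_box n \<gamma>')"
    using box_sets[of n \<gamma>'] by (intro nn_integral_cmult_indicator) (simp add: sp)
  also have "\<dots> = ennreal (pmf (K (walk_end leaf \<gamma>')) e) * ennreal (\<psi> (walk_end leaf \<gamma>'))"
    by (simp add: Suc.IH[OF g(1)])
  also have "\<dots> = ennreal (\<psi> (walk_end leaf \<gamma>') * pmf (K (walk_end leaf \<gamma>')) e)"
    using \<psi>(2) by (simp add: ennreal_mult mult.commute)
  also have "\<dots> = ennreal (\<psi> (walk_end leaf \<gamma>))"
    using \<psi>(3)[OF g(2)] by (simp add: \<gamma>)
  finally show ?case .
qed

lemma emeasure_lim_prefix:
  assumes \<psi>: "\<psi> leaf = 1" "\<And>t. 0 \<le> \<psi> t" "\<And>t e. e \<in> out_edges t \<Longrightarrow> \<psi> t * pmf (K t) e = \<psi> (tgt e)"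
    and "\<gamma> \<in> walks leaf n"
  shows "emeasure IT.PF.lim {x. prefix_at n x = \<gamma>} = ennreal (\<psi> (walk_end leaf \<gamma>))"
    "{x. prefix_at n x = \<gamma>} \<in> sets IT.PF.lim"
proof -
  have eq: "prod_emb UNIV (\<lambda>_. count_space UNIV) {0..<n} (prefix_box n \<gamma>) = {x. prefix_at n x = \<gamma>}"
    using walks_length[OF assms(4)]
    by (auto simp: prod_emb_def space_PiM PiE_iff prefix_at_eq_iff restrict_def extensional_def)
  have "emeasure IT.PF.lim (prod_emb UNIV (\<lambda>_. count_space UNIV) {0..<n} (prefix_box n \<gamma>)) = emeasure (IT.CI {0..<n}) (prefix_box n \<gamma>)"
    by (rule IT.lim) (auto intro: box_sets)
  also have "\<dots> = emeasure (IT.C 0 n (\<lambda>_. undefined)) (prod_emb {0..<n} (\<lambda>_. count_space UNIV) {0..<n} (prefix_box n \<gamma>))"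
    by (rule IT.emeasure_CI) (auto intro: box_sets)
  also have "prod_emb {0..<n} (\<lambda>_. count_space UNIV) {0..<n} (prefix_box n \<gamma>) = prefix_box n \<gamma>"
    by (rule prod_emb_id) (auto simp: PiE_iff)
  finally show "emeasure IT.PF.lim {x. prefix_at n x = \<gamma>} = ennreal (\<psi> (walk_end leaf \<gamma>))"
    unfolding eq by (simp add: emeasure_C_box[OF assms])
  have "prod_emb UNIV (\<lambda>_. count_space UNIV) {0..<n} (prefix_box n \<gamma>) \<in> sets (PiM UNIV (\<lambda>_. count_space UNIV))"
    by (intro sets_PiM_I) (auto intro: box_sets)
  then show "{x. prefix_at n x = \<gamma>} \<in> sets IT.PF.lim" unfolding eq by simp
qed

end

text \<open>The sum of \<psi> over the ends of all walks of length n is \<psi> leaf = 1, so at each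
  level the prefix is almost surely a walk from the root, and the path space has full mass.\<close>

lemma ex_measure_of_harmonic:
  assumes \<psi>: "\<psi> leaf = 1" "\<And>t. 0 \<le> \<psi> t" "\<And>t. \<psi> t = (\<Sum>t'\<in>#grow t. \<psi> t')"
  shows "\<exists>m. prob_space m \<and> sets m = sets path_borel \<and>
    (\<forall>n. \<forall>\<gamma>\<in>walks leaf n. measure m (cylinder \<gamma>) = \<psi> (walk_end leaf \<gamma>))"
proof -
  have "\<forall>t. \<exists>q. \<forall>e\<in>out_edges t. \<psi> t * pmf q e = \<psi> (tgt e)"
    using ex_step_pmf[of \<psi>] \<psi> by blast
  from choice[OF this] obtain K where K: "\<And>t e. e \<in> out_edges t \<Longrightarrow> \<psi> t * pmf (K t) e = \<psi> (tgt e)"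
    by blast
  interpret edge_chain K .
  let ?L = "IT.PF.lim"
  have em: "emeasure ?L {x. prefix_at n x = \<gamma>} = ennreal (\<psi> (walk_end leaf \<gamma>))"
    "{x. prefix_at n x = \<gamma>} \<in> sets ?L" if "\<gamma> \<in> walks leaf n" for n \<gamma>
    by (rule emeasure_lim_prefix[where \<psi>=\<psi>, OF \<psi>(1) \<psi>(2) K that], assumption)+
  have spP: "space (PiM UNIV (\<lambda>_::nat. count_space (UNIV :: edge set))) = UNIV"
    by (simp add: space_PiM PiE_UNIV_domain)
  then have spL: "space ?L = UNIV" by (simp only: IT.PF.space_lim)
  interpret L: prob_space ?L
    by (rule prob_spaceI) (use em(1)[of "[]" 0] \<psi>(1) in \<open>simp only: spL prefix_at_0 simp_thms Collect_const walks_0 insertI1 walk_end.simps if_True ennreal_1\<close>)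
  define A where "A n = {x. prefix_at n x \<in> walks leaf n}" for n
  have A_eq: "A n = (\<Union>\<gamma>\<in>walks leaf n. {x. prefix_at n x = \<gamma>})" for n
    by (auto simp: A_def)
  have A_sets: "A n \<in> sets ?L" for n
    unfolding A_eq using em(2) by (intro sets.finite_UN) auto
  have "emeasure ?L (A n) = 1" for n
  proof -
    have "emeasure ?L (A n) = (\<Sum>\<gamma>\<in>walks leaf n. emeasure ?L {x. prefix_at n x = \<gamma>})"
      unfolding A_eq using em(2) by (intro sum_emeasure[symmetric]) (auto simp: disjoint_family_on_def)
    also have "\<dots> = ennreal (\<Sum>\<gamma>\<in>walks leaf n. \<psi> (walk_end leaf \<gamma>))"
      using \<psi>(2) by (simp add: em(1) sum_ennreal)
    also have "(\<Sum>\<gamma>\<in>walks leaf n. \<psi> (walk_end leaf \<gamma>)) = \<psi> leaf"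
      by (rule sum_walks_harmonic[OF \<psi>(3)])
    finally show ?thesis by (simp add: \<psi>(1))
  qed
  then have AE1: "AE x in ?L. x \<in> A n" for n
    using A_sets by (simp add: L.AE_in_set_eq_1 L.emeasure_eq_measure)
  have paths_eq: "paths = (\<Inter>n. A n)" by (auto simp: paths_iff A_def)
  have paths_sets: "paths \<in> sets ?L" unfolding paths_eq using A_sets by blast
  have AEp: "AE x in ?L. x \<in> paths" unfolding paths_eq using AE1 by (simp add: AE_all_countable)
  with paths_sets have "measure ?L paths = 1" by (simp add: L.AE_in_set_eq_1)
  then have "paths \<noteq> {}" by auto
  then obtain \<omega>0 where \<omega>0: "\<omega>0 \<in> paths" by blast
  \<comment> \<open>The null set of non-paths is sent to one fixed path, which makes the image
    measure live on \<open>paths\<close>.\<close>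
  let ?r = "\<lambda>x. if x \<in> paths then x else \<omega>0"
  have pre: "{x \<in> paths. prefix_at (length \<gamma>) x = \<gamma>} \<in> sets ?L" for \<gamma>
  proof (cases "\<gamma> \<in> walks leaf (length \<gamma>)")
    case True
    have "{x \<in> paths. prefix_at (length \<gamma>) x = \<gamma>} = paths \<inter> {x. prefix_at (length \<gamma>) x = \<gamma>}" by auto
    with em(2)[OF True] paths_sets show ?thesis by auto
  next
    case False
    then show ?thesis unfolding cylinder_eq[symmetric] cylinder_not_walk[OF False] by simp
  qed
  have meas: "?r \<in> measurable ?L path_borel"
  proof (rule measurable_sigma_sets[OF sets_path_borel])
    show "range cylinder \<subseteq> Pow paths" using cylinder_subset_paths by blast
    show "?r \<in> space ?L \<rightarrow> paths" using \<omega>0 by auto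
    fix C assume "C \<in> range cylinder"
    then obtain \<gamma> where C: "C = cylinder \<gamma>" by auto
    have "?r -` C \<inter> space ?L = {x \<in> paths. prefix_at (length \<gamma>) x = \<gamma>} \<union> (if \<omega>0 \<in> C then space ?L - paths else {})"
      by (auto simp: C cylinder_eq spP)
    then show "?r -` C \<inter> space ?L \<in> sets ?L" using pre paths_sets by auto
  qed
  let ?m = "distr ?L path_borel ?r"
  have "measure ?m (cylinder \<gamma>) = \<psi> (walk_end leaf \<gamma>)" if \<gamma>: "\<gamma> \<in> walks leaf n" for n \<gamma>
  proof -
    have len: "length \<gamma> = n" using \<gamma> by (rule walks_length)
    have "emeasure ?m (cylinder \<gamma>) = emeasure ?L (?r -` cylinder \<gamma> \<inter> space ?L)"
      by (rule emeasure_distr[OF meas]) simp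
    also have "\<dots> = emeasure ?L {x. prefix_at n x = \<gamma>}"
      using AEp em(2)[OF \<gamma>] measurable_sets[OF meas cylinder_sets[of \<gamma>]]
      by (intro emeasure_eq_AE) (auto simp: cylinder_eq spP len)
    finally show ?thesis using em(1)[OF \<gamma>] \<psi>(2) by (simp add: measure_def)
  qed
  moreover have "prob_space ?m" by (rule L.prob_space_distr[OF meas])
  ultimately show ?thesis by (intro exI[of _ ?m]) auto
qed

text \<open>If all cylinders ending at t have the same mass, that mass is the probability of t
  divided by the number of such cylinders. The given walk shows that this number is
  positive.\<close>

lemma central_measuresI:
  assumes "prob_space m" "sets m = sets path_borel"
    and cyl: "\<And>n \<gamma>. \<gamma> \<in> walks leaf n \<Longrightarrow> measure m (cylinder \<gamma>) = \<psi> (walk_end leaf \<gamma>)"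
  shows "m \<in> central_measures"
proof -
  interpret m: prob_space m by fact
  have "central m"
    unfolding central_def
  proof (intro allI ballI impI)
    fix n :: nat and \<gamma> t assume n: "1 \<le> n" and t: "t \<in> trees n" and w: "is_walk leaf \<gamma> t"
    from w have g: "\<gamma> \<in> walks leaf (length \<gamma>)" "walk_end leaf \<gamma> = t" by (simp_all add: is_walk_iff)
    have len: "length \<gamma> = n - 1" using vertices_walk_end[OF g(1)] g(2) t by (simp add: trees_def)
    let ?W = "{\<delta>\<in>walks leaf (n - 1). walk_end leaf \<delta> = t}"
    have "{\<omega> \<in> paths. vertex_at n \<omega> = t} = {\<omega> \<in> paths. walk_end leaf (prefix_at (n - 1) \<omega>) = t}"
      by (auto simp: vertex_at_def edge_at_def prefix_at_path)
    also have "\<dots> = (\<Union>\<delta>\<in>?W. cylinder \<delta>)" by (rule prefix_set_eq)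
    finally have "measure m {\<omega> \<in> paths. vertex_at n \<omega> = t} = measure m (\<Union>\<delta>\<in>?W. cylinder \<delta>)" by simp
    also have "\<dots> = (\<Sum>\<delta>\<in>?W. measure m (cylinder \<delta>))"
    proof (rule m.finite_measure_finite_Union)
      show "cylinder ` ?W \<subseteq> sets m" unfolding assms(2) using cylinder_sets by blast
      show "disjoint_family_on cylinder ?W"
        unfolding disjoint_family_on_def
      proof (intro ballI impI)
        fix \<delta> \<epsilon> assume "\<delta> \<in> ?W" "\<epsilon> \<in> ?W" "\<delta> \<noteq> \<epsilon>"
        moreover from this have "length \<delta> = n - 1" "length \<epsilon> = n - 1" by (auto dest: walks_length)
        ultimately show "cylinder \<delta> \<inter> cylinder \<epsilon> = {}" by (auto simp: cylinder_eq)
      qed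
    qed simp
    also have "\<dots> = (\<Sum>\<delta>\<in>?W. \<psi> t)" by (intro sum.cong refl) (auto dest: cyl)
    also have "\<dots> = real (u t) * \<psi> t"
      using n t unfolding u_def by (subst num_walks_eq[of t leaf "n - 1"]) (auto simp: trees_def)
    finally have *: "measure m {\<omega> \<in> paths. vertex_at n \<omega> = t} = real (u t) * \<psi> t" .
    have "?W \<noteq> {}" using g len by auto
    then have "u t > 0"
      using n t unfolding u_def by (subst num_walks_eq[of t leaf "n - 1"]) (auto simp: trees_def card_gt_0_iff)
    moreover have "measure m (cylinder \<gamma>) = \<psi> t" using cyl[OF g(1)] g(2) by simp
    ultimately show "measure m (cylinder \<gamma>) = measure m {\<omega> \<in> paths. vertex_at n \<omega> = t} / real (u t)"
      using * by simp
  qed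
  with assms show ?thesis by (simp add: central_measures_def)
qed

text \<open>Existence for the definite description comes from the nonnegative harmonic function
  given by the paintbox, uniqueness from agreement on cylinders.\<close>

lemma extreme_law:
  assumes p: "p \<in> nabla"
  shows "extreme_law p \<in> central_measures"
    "\<gamma> \<in> walks leaf n \<Longrightarrow> measure (extreme_law p) (cylinder \<gamma>) = pf_fun (paintbox p) (walk_end leaf \<gamma>)"
proof -
  let ?P = "\<lambda>m. m \<in> central_measures \<and> (\<forall>\<gamma> t. is_walk leaf \<gamma> t \<longrightarrow> measure m (cylinder \<gamma>) =
        (if path_forest t then chi p (aug_monomial_sym (shape t)) else 0))"
  have P_iff: "?P m \<longleftrightarrow> m \<in> central_measures \<and>
      (\<forall>n. \<forall>\<gamma>\<in>walks leaf n. measure m (cylinder \<gamma>) = pf_fun (paintbox p) (walk_end leaf \<gamma>))" for m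
    by (auto simp: is_walk_iff pf_fun_def paintbox_def dest: walks_length)
  let ?\<psi> = "pf_fun (paintbox p)"
  have nn: "0 \<le> ?\<psi> t" for t using paintbox_nonneg[OF p] by (auto simp: pf_fun_def shape_partition)
  have h: "?\<psi> t = (\<Sum>t'\<in>#grow t. ?\<psi> t')" for t by (intro pf_fun_harmonic paintbox_harmonic)
  obtain m where m: "prob_space m" "sets m = sets path_borel"
      "\<And>n \<gamma>. \<gamma> \<in> walks leaf n \<Longrightarrow> measure m (cylinder \<gamma>) = ?\<psi> (walk_end leaf \<gamma>)"
    using ex_measure_of_harmonic[of ?\<psi>, OF _ nn h] by auto
  have "?P m" unfolding P_iff using central_measuresI[OF m(1,2), of ?\<psi>] m(3) by blast
  moreover have "m' = m" if "?P m'" for m'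
    using that m unfolding P_iff
    by (intro path_measure_eqI) (auto simp: central_measures_def)
  ultimately have "?P (extreme_law p)"
    unfolding extreme_law_def by (rule theI)
  then show "extreme_law p \<in> central_measures"
    "\<gamma> \<in> walks leaf n \<Longrightarrow> measure (extreme_law p) (cylinder \<gamma>) = ?\<psi> (walk_end leaf \<gamma>)"
    unfolding P_iff by blast+
qed

section \<open>Central measures and the tail\<close>

lemma central_measuresD:
  assumes "m \<in> central_measures"
  shows "prob_space m" "sets m = sets path_borel" "space m = paths"
  using assms sets_eq_imp_space_eq[of m path_borel] by (auto simp: central_measures_def)

text \<open>For a central law, the common probability of all cylinders ending at t.\<close>

definition state_weight :: "path measure \<Rightarrow> rtree \<Rightarrow> real" where
  "state_weight m t = measure m {\<omega> \<in> paths. vertex_at (vertices t) \<omega> = t} / real (u t)"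

lemma central_cylinder:
  assumes "m \<in> central_measures" "\<gamma> \<in> walks leaf n"
  shows "measure m (cylinder \<gamma>) = state_weight m (walk_end leaf \<gamma>)"
proof -
  have "is_walk leaf \<gamma> (walk_end leaf \<gamma>)" using assms(2) by (simp add: walks_def)
  moreover have "1 \<le> vertices (walk_end leaf \<gamma>)" by (simp add: vertices_walk_end[OF assms(2)])
  moreover have "walk_end leaf \<gamma> \<in> trees (vertices (walk_end leaf \<gamma>))" by (simp add: trees_def)
  ultimately show ?thesis
    using assms(1) unfolding central_measures_def central_def state_weight_def by blast
qed

lemma measure_prefix_set:
  assumes "prob_space m" "sets m = sets path_borel"
  shows "measure m {\<omega> \<in> paths. Q (prefix_at n \<omega>)} = (\<Sum>\<gamma>\<in>{\<gamma>\<in>walks leaf n. Q \<gamma>}. measure m (cylinder \<gamma>))"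
proof -
  interpret prob_space m by fact
  show ?thesis
    unfolding prefix_set_eq
  proof (rule finite_measure_finite_Union)
    show "cylinder ` {\<gamma> \<in> walks leaf n. Q \<gamma>} \<subseteq> sets m" unfolding assms(2) using cylinder_sets by blast
    show "disjoint_family_on cylinder {\<gamma> \<in> walks leaf n. Q \<gamma>}"
      unfolding disjoint_family_on_def
    proof (intro ballI impI)
      fix \<delta> \<epsilon> assume "\<delta> \<in> {\<gamma> \<in> walks leaf n. Q \<gamma>}" "\<epsilon> \<in> {\<gamma> \<in> walks leaf n. Q \<gamma>}" "\<delta> \<noteq> \<epsilon>"
      moreover from this have "length \<delta> = n" "length \<epsilon> = n" by (auto dest: walks_length)
      ultimately show "cylinder \<delta> \<inter> cylinder \<epsilon> = {}" by (auto simp: cylinder_eq)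
    qed
  qed simp
qed

lemma integrable_prefix:
  fixes k :: "edge list \<Rightarrow> real"
  assumes "prob_space m" "sets m = sets path_borel"
  shows "integrable m (\<lambda>\<omega>. k (prefix_at n \<omega>))" "(\<lambda>\<omega>. k (prefix_at n \<omega>)) \<in> borel_measurable m"
proof -
  interpret prob_space m by fact
  have sp: "space m = paths" using sets_eq_imp_space_eq[OF assms(2)] by simp
  show meas: "(\<lambda>\<omega>. k (prefix_at n \<omega>)) \<in> borel_measurable m"
  proof (rule borel_measurableI)
    fix S :: "real set" assume "open S"
    have "(\<lambda>\<omega>. k (prefix_at n \<omega>)) -` S \<inter> space m = {\<omega> \<in> paths. k (prefix_at n \<omega>) \<in> S}"
      using sp by auto
    then show "(\<lambda>\<omega>. k (prefix_at n \<omega>)) -` S \<inter> space m \<in> sets m"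
      using prefix_sets[of "\<lambda>\<gamma>. k \<gamma> \<in> S" n] assms(2) by simp
  qed
  show "integrable m (\<lambda>\<omega>. k (prefix_at n \<omega>))"
  proof (rule integrable_const_bound[OF AE_I2 meas])
    fix \<omega> assume "\<omega> \<in> space m"
    then have "prefix_at n \<omega> \<in> walks leaf n" using sp prefix_at_path(1) by auto
    then show "norm (k (prefix_at n \<omega>)) \<le> (\<Sum>\<gamma>\<in>walks leaf n. \<bar>k \<gamma>\<bar>)"
      using member_le_sum[of "prefix_at n \<omega>" "walks leaf n" "\<lambda>\<gamma>. \<bar>k \<gamma>\<bar>"] by simp
  qed
qed

text \<open>With edges stored from index 0, the tail field \<open>raw_tail_from (Suc N)\<close> is
  that of the coordinates from index N on.\<close>

definition tail_cyl :: "nat \<Rightarrow> edge list \<Rightarrow> path set" where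
  "tail_cyl N \<delta> = {\<omega> \<in> paths. drop N (prefix_at (N + length \<delta>) \<omega>) = \<delta>}"

lemma tail_cyl_iff: "\<omega> \<in> tail_cyl N \<delta> \<longleftrightarrow> \<omega> \<in> paths \<and> (\<forall>i<length \<delta>. \<omega> (N + i) = \<delta> ! i)"
proof -
  have "drop N (prefix_at (N + length \<delta>) \<omega>) = map (\<lambda>i. \<omega> (N + i)) [0..<length \<delta>]"
    by (rule nth_equalityI) (simp_all add: nth_prefix_at)
  then have "\<omega> \<in> tail_cyl N \<delta> \<longleftrightarrow> \<omega> \<in> paths \<and> map (\<lambda>i. \<omega> (N + i)) [0..<length \<delta>] = \<delta>"
    by (simp only: tail_cyl_def mem_Collect_eq)
  also have "map (\<lambda>i. \<omega> (N + i)) [0..<length \<delta>] = \<delta> \<longleftrightarrow> (\<forall>i<length \<delta>. \<omega> (N + i) = \<delta> ! i)"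
    unfolding list_eq_iff_nth_eq by simp
  finally show ?thesis .
qed

text \<open>The vertex at the start of the tail is the source of its first edge, so edges alone
  generate. Only nonempty \<delta> are used, since they determine that vertex.\<close>

lemma raw_tail_from_sub:
  "raw_tail_from (Suc N) \<subseteq> sigma_sets paths (tail_cyl N ` {\<delta>. \<delta> \<noteq> []})"
proof -
  have *: "{\<omega> \<in> paths. Q (\<omega> k)} \<in> sigma_sets paths (tail_cyl N ` {\<delta>. \<delta> \<noteq> []})" if k: "N \<le> k" for Q k
  proof -
    let ?D = "{\<delta> \<in> drop N ` walks leaf (Suc k). Q (\<delta> ! (k - N))}"
    have ne: "\<delta> \<noteq> []" "length \<delta> = Suc k - N" if "\<delta> \<in> ?D" for \<delta>
      using that k by (auto dest!: walks_length)
    have "{\<omega> \<in> paths. Q (\<omega> k)} = (\<Union>\<delta>\<in>?D. tail_cyl N \<delta>)"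
    proof (intro set_eqI iffI)
      fix \<omega> assume \<omega>: "\<omega> \<in> {\<omega> \<in> paths. Q (\<omega> k)}"
      let ?\<delta> = "drop N (prefix_at (Suc k) \<omega>)"
      have "?\<delta> \<in> ?D" using \<omega> k prefix_at_path(1)[of \<omega> "Suc k"] by (auto simp: nth_prefix_at)
      moreover have "\<omega> \<in> tail_cyl N ?\<delta>" using \<omega> k by (auto simp: tail_cyl_iff nth_prefix_at)
      ultimately show "\<omega> \<in> (\<Union>\<delta>\<in>?D. tail_cyl N \<delta>)" by blast
    next
      fix \<omega> assume "\<omega> \<in> (\<Union>\<delta>\<in>?D. tail_cyl N \<delta>)"
      then obtain \<delta> where \<delta>: "\<delta> \<in> ?D" "\<omega> \<in> tail_cyl N \<delta>" by blast
      have "k - N < length \<delta>" using ne(2)[OF \<delta>(1)] k by simp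
      then have "\<omega> (N + (k - N)) = \<delta> ! (k - N)" using \<delta>(2) unfolding tail_cyl_iff by blast
      then show "\<omega> \<in> {\<omega> \<in> paths. Q (\<omega> k)}" using \<delta> k by (auto simp: tail_cyl_iff)
    qed
    also have "\<dots> \<in> sigma_sets paths (tail_cyl N ` {\<delta>. \<delta> \<noteq> []})"
    proof (rule sigma_sets_UNION)
      show "countable (tail_cyl N ` ?D)" by (intro countable_image countable_finite) simp
      fix B assume "B \<in> tail_cyl N ` ?D"
      then obtain \<delta> where "\<delta> \<in> ?D" "B = tail_cyl N \<delta>" by blast
      with ne(1) show "B \<in> sigma_sets paths (tail_cyl N ` {\<delta>. \<delta> \<noteq> []})"
        by (intro sigma_sets.Basic) blast
    qed
    finally show ?thesis .
  qed
  show ?thesis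
    unfolding raw_tail_from_def
  proof (rule sigma_sets_mono, safe)
    fix B :: "rtree set"
    have "vertex_at (Suc N) -` B \<inter> paths = {\<omega> \<in> paths. src (\<omega> N) \<in> B}"
      by (auto simp: vertex_at_def edge_at_def)
    then show "vertex_at (Suc N) -` B \<inter> paths \<in> sigma_sets paths (tail_cyl N ` {\<delta>. \<delta> \<noteq> []})"
      using *[of N "\<lambda>e. src e \<in> B"] by simp
  next
    fix k and B :: "edge set" assume "Suc N \<le> k"
    moreover have "edge_at k -` B \<inter> paths = {\<omega> \<in> paths. \<omega> (k - 1) \<in> B}"
      by (auto simp: edge_at_def)
    ultimately show "edge_at k -` B \<inter> paths \<in> sigma_sets paths (tail_cyl N ` {\<delta>. \<delta> \<noteq> []})"
      using *[of "k - 1" "\<lambda>e. e \<in> B"] by simp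
  qed
qed

lemma tail_cyl_Pow: "tail_cyl N ` D \<subseteq> Pow paths"
  by (auto simp: tail_cyl_def)

lemma tail_cyl_sets: "tail_cyl N \<delta> \<in> sets path_borel"
  unfolding tail_cyl_def by (rule prefix_sets)

lemma raw_tail_sets: "T \<in> raw_tail_from (Suc N) \<Longrightarrow> T \<in> sets path_borel"
proof -
  assume "T \<in> raw_tail_from (Suc N)"
  moreover have "sigma_sets paths (tail_cyl N ` {\<delta>. \<delta> \<noteq> []}) \<subseteq> sets path_borel"
    using sets.sigma_sets_subset[of "tail_cyl N ` {\<delta>. \<delta> \<noteq> []}" path_borel] tail_cyl_sets by auto
  ultimately show ?thesis using raw_tail_from_sub by blast
qed

lemma raw_tail_sigma_algebra: "sigma_algebra paths (raw_tail_from N)"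
  unfolding raw_tail_from_def by (rule sigma_algebra_sigma_sets) auto

lemma raw_tail_coordinate: "Suc N \<le> k \<Longrightarrow> {\<omega> \<in> paths. Q (\<omega> (k - 1))} \<in> raw_tail_from (Suc N)"
  unfolding raw_tail_from_def
  by (rule sigma_sets.Basic) (auto simp: edge_at_def intro!: exI[of _ "{e. Q e}"] exI[of _ k])

lemma raw_tail_state: "N \<le> k \<Longrightarrow> {\<omega> \<in> paths. Q (src (\<omega> k))} \<in> raw_tail_from (Suc N)"
  using raw_tail_coordinate[of N "Suc k" "\<lambda>e. Q (src e)"] by simp

lemma raw_tail_antimono:
  assumes "M \<le> N" shows "raw_tail_from (Suc N) \<subseteq> raw_tail_from (Suc M)"
  unfolding raw_tail_from_def[of "Suc N"]
proof (rule sigma_algebra.sigma_sets_subset[OF raw_tail_sigma_algebra], safe)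
  fix B :: "rtree set"
  have "vertex_at (Suc N) -` B \<inter> paths = {\<omega> \<in> paths. src (\<omega> N) \<in> B}"
    by (auto simp: vertex_at_def edge_at_def)
  then show "vertex_at (Suc N) -` B \<inter> paths \<in> raw_tail_from (Suc M)"
    using raw_tail_state[OF assms, of "\<lambda>t. t \<in> B"] by simp
next
  fix k and B :: "edge set" assume k: "Suc N \<le> k"
  have "edge_at k -` B \<inter> paths = {\<omega> \<in> paths. \<omega> (k - 1) \<in> B}"
    by (auto simp: edge_at_def)
  then show "edge_at k -` B \<inter> paths \<in> raw_tail_from (Suc M)"
    using raw_tail_coordinate[of M k "\<lambda>e. e \<in> B"] assms k by simp
qed

lemma Int_stable_tail_cyl: "Int_stable (tail_cyl N ` {\<delta>. \<delta> \<noteq> []})"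
proof -
  have empty: "{} \<in> tail_cyl N ` {\<delta>. \<delta> \<noteq> []}"
  proof
    have bad: "(leaf, leaf, 0) \<notin> edges" by (simp add: edges_def attach_count_def leaf_def)
    have "\<omega> (N + 0) \<in> edges" if "\<omega> \<in> paths" for \<omega>
      using that by (auto simp: paths_def)
    with bad have "\<omega> \<notin> tail_cyl N [(leaf, leaf, 0)]" for \<omega>
      using tail_cyl_iff[of \<omega> N "[(leaf, leaf, 0)]"] by auto (metis)
    then show "{} = tail_cyl N [(leaf, leaf, 0)]" by blast
  qed simp
  have le: "tail_cyl N \<gamma> \<inter> tail_cyl N \<delta> \<in> tail_cyl N ` {\<delta>. \<delta> \<noteq> []}" if "length \<gamma> \<le> length \<delta>" "\<delta> \<noteq> []" for \<gamma> \<delta>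
  proof (cases "\<forall>i<length \<gamma>. \<gamma> ! i = \<delta> ! i")
    case True
    then have "tail_cyl N \<gamma> \<inter> tail_cyl N \<delta> = tail_cyl N \<delta>"
      using that by (auto simp: tail_cyl_iff)
    with that show ?thesis by auto
  next
    case False
    then have "tail_cyl N \<gamma> \<inter> tail_cyl N \<delta> = {}"
      using that by (auto simp: tail_cyl_iff)
    with empty show ?thesis by simp
  qed
  show ?thesis
    unfolding Int_stable_def
  proof clarify
    fix \<gamma> \<delta> :: "edge list" assume "\<gamma> \<noteq> []" "\<delta> \<noteq> []"
    then show "tail_cyl N \<gamma> \<inter> tail_cyl N \<delta> \<in> tail_cyl N ` {\<delta>. \<delta> \<noteq> []}"
      using le[of \<gamma> \<delta>] le[of \<delta> \<gamma>] by (cases "length \<gamma> \<le> length \<delta>") (auto simp: Int_commute)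
  qed
qed

text \<open>The event splits into cylinders of the walks \<gamma> @ \<beta> @ \<delta>, with \<beta>
  running over the walks from the end of \<gamma> to the start of \<delta>. By centrality they all
  have the same mass, determined by the end of \<delta>.\<close>

lemma measure_cylinder_tail_cyl:
  assumes m: "m \<in> central_measures" and \<gamma>: "\<gamma> \<in> walks leaf k" and "k \<le> N" and \<delta>: "\<delta> \<noteq> []"
    and t: "vertices (src (hd \<delta>)) = Suc N"
  shows "measure m (cylinder \<gamma> \<inter> tail_cyl N \<delta>) = real (num_walks (walk_end leaf \<gamma>) (src (hd \<delta>))) *
    (if \<delta> \<in> walks (src (hd \<delta>)) (length \<delta>) then state_weight m (walk_end (src (hd \<delta>)) \<delta>) else 0)"
proof -
  note mD = central_measuresD[OF m]
  let ?t = "src (hd \<delta>)" and ?s = "walk_end leaf \<gamma>" and ?n = "N + length \<delta>"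
  let ?Q = "\<lambda>\<zeta>. take k \<zeta> = \<gamma> \<and> drop N \<zeta> = \<delta>"
  let ?B = "{\<beta>\<in>walks ?s (N - k). walk_end ?s \<beta> = ?t}"
  have len: "length \<gamma> = k" using \<gamma> by (rule walks_length)
  have "cylinder \<gamma> \<inter> tail_cyl N \<delta> = {\<omega> \<in> paths. ?Q (prefix_at ?n \<omega>)}"
    using \<open>k \<le> N\<close> by (auto simp: cylinder_eq tail_cyl_def take_prefix_at len)
  then have *: "measure m (cylinder \<gamma> \<inter> tail_cyl N \<delta>) = (\<Sum>\<zeta>\<in>{\<zeta>\<in>walks leaf ?n. ?Q \<zeta>}. measure m (cylinder \<zeta>))"
    using measure_prefix_set[OF mD(1,2), of ?Q ?n] by simp
  have walk_hd: "walk_end leaf \<alpha> = ?t" if "\<delta> \<in> walks (walk_end leaf \<alpha>) (length \<delta>)" for \<alpha>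
    using that \<delta> by (cases \<delta>) (auto simp: walks_def)
  have set_eq: "{\<zeta>\<in>walks leaf ?n. ?Q \<zeta>} = (if \<delta> \<in> walks ?t (length \<delta>) then (\<lambda>\<beta>. \<gamma> @ \<beta> @ \<delta>) ` ?B else {})"
  proof -
    have 1: "\<zeta> \<in> (\<lambda>\<beta>. \<gamma> @ \<beta> @ \<delta>) ` ?B \<and> \<delta> \<in> walks ?t (length \<delta>)" if \<zeta>: "\<zeta> \<in> walks leaf ?n" "?Q \<zeta>" for \<zeta>
    proof -
      let ?\<beta> = "drop k (take N \<zeta>)"
      have \<zeta>_eq: "\<zeta> = \<gamma> @ ?\<beta> @ \<delta>"
        using \<zeta>(2) \<open>k \<le> N\<close> by (metis append.assoc append_take_drop_id min.absorb1 take_take)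
      have "length \<zeta> = ?n" using \<zeta>(1) by (rule walks_length)
      then have "length ?\<beta> = N - k" by simp
      moreover have w: "?\<beta> \<in> walks ?s (length ?\<beta>)" "\<delta> \<in> walks (walk_end ?s ?\<beta>) (length \<delta>)"
        using \<zeta>(1) by (subst (asm) \<zeta>_eq, simp only: walks_append append_assoc[symmetric] walk_end_append)+
      moreover have "walk_end ?s ?\<beta> = ?t"
        using walk_hd[of "\<gamma> @ ?\<beta>"] w(2) by simp
      ultimately show ?thesis using \<zeta>_eq by (metis (mono_tags, lifting) image_eqI mem_Collect_eq)
    qed
    have 2: "\<gamma> @ \<beta> @ \<delta> \<in> {\<zeta>\<in>walks leaf ?n. ?Q \<zeta>}" if "\<beta> \<in> ?B" "\<delta> \<in> walks ?t (length \<delta>)" for \<beta>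
    proof -
      have "length \<beta> = N - k" "\<beta> \<in> walks ?s (N - k)" using that walks_length by auto
      with that \<gamma> len \<open>k \<le> N\<close> show ?thesis by (auto simp: walks_append)
    qed
    show ?thesis using 1 2 by auto
  qed
  have "measure m (cylinder \<zeta>) = state_weight m (walk_end ?t \<delta>)" if "\<zeta> \<in> {\<zeta>\<in>walks leaf ?n. ?Q \<zeta>}" for \<zeta>
  proof -
    from that set_eq obtain \<beta> where "\<beta> \<in> ?B" "\<zeta> = \<gamma> @ \<beta> @ \<delta>" by (auto split: if_splits)
    then have "walk_end leaf \<zeta> = walk_end ?t \<delta>" by simp
    with central_cylinder[OF m, of \<zeta> ?n] that show ?thesis by simp
  qed
  then have "measure m (cylinder \<gamma> \<inter> tail_cyl N \<delta>) = real (card {\<zeta>\<in>walks leaf ?n. ?Q \<zeta>}) * state_weight m (walk_end ?t \<delta>)"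
    unfolding * by simp
  moreover have "card ((\<lambda>\<beta>. \<gamma> @ \<beta> @ \<delta>) ` ?B) = num_walks ?s ?t"
    using t \<open>k \<le> N\<close> by (subst card_image, simp add: inj_on_def, subst num_walks_eq[of _ _ "N - k"])
      (auto simp: vertices_walk_end[OF \<gamma>])
  ultimately show ?thesis unfolding set_eq by simp
qed

text \<open>h is the conditional probability of the prefix \<gamma> given the tail: comparing the
  count for \<gamma> with that for the empty walk, the mass attached to \<delta> cancels. Tail
  cylinders form an intersection-stable generator, so the identity extends to all tail
  events.\<close>

lemma measure_cylinder_tail:
  assumes m: "m \<in> central_measures" and \<gamma>: "\<gamma> \<in> walks leaf k" and k: "k \<le> N" and T: "T \<in> raw_tail_from (Suc N)"
  defines "h \<equiv> \<lambda>\<omega>. real (num_walks (walk_end leaf \<gamma>) (src (\<omega> N))) / real (u (src (\<omega> N)))"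
  shows "measure m (cylinder \<gamma> \<inter> T) = (\<integral>\<omega>. indicator T \<omega> * h \<omega> \<partial>m)"
proof -
  note mD = central_measuresD[OF m]
  interpret prob_space m by (rule mD(1))
  have h_prefix: "h = (\<lambda>\<omega>. (\<lambda>\<zeta>. real (num_walks (walk_end leaf \<gamma>) (src (\<zeta> ! N))) / real (u (src (\<zeta> ! N)))) (prefix_at (Suc N) \<omega>))"
    by (simp add: h_def nth_prefix_at)
  have int_h: "integrable m h" unfolding h_prefix by (rule integrable_prefix[OF mD(1,2)])
  have setsT: "A \<in> sets m" if "A \<in> sigma_sets paths (tail_cyl N ` {\<delta>. \<delta> \<noteq> []})" for A
    using that sets.sigma_sets_subset[of "tail_cyl N ` {\<delta>. \<delta> \<noteq> []}" path_borel] tail_cyl_sets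
    by (auto simp: mD(2))
  have int: "integrable m (\<lambda>\<omega>. indicator A \<omega> * h \<omega>)" if "A \<in> sets m" for A
    using integrable_mult_indicator[OF that int_h] by simp
  have cyl_sets: "cylinder \<gamma> \<in> sets m" by (simp add: mD(2))
  have basic_eq: "measure m (cylinder \<gamma> \<inter> tail_cyl N \<delta>) = (\<integral>\<omega>. indicator (tail_cyl N \<delta>) \<omega> * h \<omega> \<partial>m)" if \<delta>: "\<delta> \<noteq> []" for \<delta>
  proof (cases "tail_cyl N \<delta> = {}")
    case False
    then obtain \<omega>0 where "\<omega>0 \<in> tail_cyl N \<delta>" by blast
    then have "\<omega>0 \<in> paths" "\<omega>0 N = hd \<delta>" using \<delta> by (auto simp: tail_cyl_iff hd_conv_nth dest!: spec[of _ 0])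
    then have t: "vertices (src (hd \<delta>)) = Suc N" using vertices_src_path[of \<omega>0 N] by simp
    let ?t = "src (hd \<delta>)" and ?s = "walk_end leaf \<gamma>"
    let ?c = "if \<delta> \<in> walks ?t (length \<delta>) then state_weight m (walk_end ?t \<delta>) else 0"
    have "(\<integral>\<omega>. indicator (tail_cyl N \<delta>) \<omega> * h \<omega> \<partial>m) =
      (\<integral>\<omega>. indicator (tail_cyl N \<delta>) \<omega> * (real (num_walks ?s ?t) / real (u ?t)) \<partial>m)"
      using \<delta> by (intro Bochner_Integration.integral_cong)
        (auto simp: h_def indicator_def tail_cyl_iff hd_conv_nth dest!: spec[of _ 0])
    also have "\<dots> = measure m (tail_cyl N \<delta>) * (real (num_walks ?s ?t) / real (u ?t))"
      using tail_cyl_sets[of N \<delta>] by (simp add: mD(2))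
    also have "measure m (tail_cyl N \<delta>) = real (u ?t) * ?c"
    proof -
      have "cylinder [] \<inter> tail_cyl N \<delta> = tail_cyl N \<delta>" by (auto simp: tail_cyl_iff)
      with measure_cylinder_tail_cyl[OF m _ _ \<delta> t, of "[]" 0] show ?thesis by (simp add: u_def)
    qed
    \<comment> \<open>The path \<open>\<omega>0\<close> runs through \<open>?t\<close>, so
      \<open>u ?t\<close> does not vanish and may be cancelled.\<close>
    also have "real (u ?t) * ?c * (real (num_walks ?s ?t) / real (u ?t)) = real (num_walks ?s ?t) * ?c"
    proof (cases "u ?t = 0")
      case True
      have "u ?t = card {es \<in> walks leaf N. walk_end leaf es = ?t}"
        unfolding u_def using t by (intro num_walks_eq) simp
      moreover have "prefix_at N \<omega>0 \<in> {es \<in> walks leaf N. walk_end leaf es = ?t}"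
        using prefix_at_path[OF \<open>\<omega>0 \<in> paths\<close>, of N] \<open>\<omega>0 N = hd \<delta>\<close> by simp
      ultimately have "u ?t \<noteq> 0" by (auto simp: card_eq_0_iff)
      with True show ?thesis by simp
    qed simp
    also have "\<dots> = measure m (cylinder \<gamma> \<inter> tail_cyl N \<delta>)"
      by (rule measure_cylinder_tail_cyl[OF m \<gamma> k \<delta> t, symmetric])
    finally show ?thesis ..
  qed simp
  have compl_eq: "measure m (cylinder \<gamma> \<inter> (paths - A)) = (\<integral>\<omega>. indicator (paths - A) \<omega> * h \<omega> \<partial>m)"
    if A: "A \<in> sets m" "measure m (cylinder \<gamma> \<inter> A) = (\<integral>\<omega>. indicator A \<omega> * h \<omega> \<partial>m)"
      and all: "measure m (cylinder \<gamma> \<inter> paths) = (\<integral>\<omega>. indicator paths \<omega> * h \<omega> \<partial>m)" for A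
  proof -
    have sub: "A \<subseteq> paths" using sets.sets_into_space[OF A(1)] mD(3) by simp
    have "cylinder \<gamma> \<inter> (paths - A) = cylinder \<gamma> \<inter> paths - cylinder \<gamma> \<inter> A" by auto
    then have "measure m (cylinder \<gamma> \<inter> (paths - A)) = measure m (cylinder \<gamma> \<inter> paths) - measure m (cylinder \<gamma> \<inter> A)"
    proof (simp only:, intro finite_measure_Diff)
      show "cylinder \<gamma> \<inter> paths \<in> sets m" "cylinder \<gamma> \<inter> A \<in> sets m"
        using A(1) cyl_sets sets.top[of m] mD(3) by auto
    qed (use sub in auto)
    also have "\<dots> = (\<integral>\<omega>. indicator paths \<omega> * h \<omega> - indicator A \<omega> * h \<omega> \<partial>m)"
      unfolding A(2) all using int A(1) sets.top[of m] mD(3) by (intro Bochner_Integration.integral_diff[symmetric]) auto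
    also have "\<dots> = (\<integral>\<omega>. indicator (paths - A) \<omega> * h \<omega> \<partial>m)"
      using sub by (intro Bochner_Integration.integral_cong) (auto simp: indicator_def)
    finally show ?thesis .
  qed
  \<comment> \<open>The whole space is not itself of the form \<open>tail_cyl N \<delta>\<close>
    with nonempty \<delta>; it is a finite disjoint union of such sets, one for each possible edge
    at index N.\<close>
  have all: "measure m (cylinder \<gamma> \<inter> paths) = (\<integral>\<omega>. indicator paths \<omega> * h \<omega> \<partial>m)"
  proof -
    let ?E = "last ` walks leaf (Suc N)"
    let ?T = "\<lambda>e. tail_cyl N [e]"
    have e: "\<omega> N \<in> ?E" if "\<omega> \<in> paths" for \<omega>
      by (rule image_eqI[OF _ prefix_at_path(1)[OF that, of "Suc N"]]) (simp add: prefix_at_Suc)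
    have T: "\<omega> \<in> ?T e \<longleftrightarrow> \<omega> \<in> paths \<and> \<omega> N = e" for \<omega> e by (auto simp: tail_cyl_iff)
    have Ts: "?T e \<in> sets m" for e by (simp add: mD(2) tail_cyl_sets)
    have "cylinder \<gamma> \<inter> paths = (\<Union>e\<in>?E. cylinder \<gamma> \<inter> ?T e)"
    proof (intro set_eqI iffI)
      fix \<omega> assume *: "\<omega> \<in> cylinder \<gamma> \<inter> paths"
      with e[of \<omega>] have "\<omega> N \<in> ?E" "\<omega> \<in> ?T (\<omega> N)" by (auto simp: T)
      with * show "\<omega> \<in> (\<Union>e\<in>?E. cylinder \<gamma> \<inter> ?T e)" by blast
    qed (auto simp: T)
    then have "measure m (cylinder \<gamma> \<inter> paths) = (\<Sum>e\<in>?E. measure m (cylinder \<gamma> \<inter> ?T e))"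
    proof (simp only:, intro finite_measure_finite_Union)
      show "(\<lambda>e. cylinder \<gamma> \<inter> ?T e) ` ?E \<subseteq> sets m" using Ts cyl_sets by blast
      show "disjoint_family_on (\<lambda>e. cylinder \<gamma> \<inter> ?T e) ?E"
        unfolding disjoint_family_on_def
      proof (intro ballI impI)
        fix e e' :: edge assume "e \<noteq> e'"
        then show "cylinder \<gamma> \<inter> ?T e \<inter> (cylinder \<gamma> \<inter> ?T e') = {}" by (simp add: set_eq_iff T)
      qed
    qed simp
    also have "\<dots> = (\<integral>\<omega>. (\<Sum>e\<in>?E. indicator (?T e) \<omega> * h \<omega>) \<partial>m)"
      using basic_eq int[OF Ts] by (subst Bochner_Integration.integral_sum) auto
    also have "\<dots> = (\<integral>\<omega>. indicator paths \<omega> * h \<omega> \<partial>m)"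
    proof (intro Bochner_Integration.integral_cong refl)
      fix \<omega> assume "\<omega> \<in> space m"
      then have w: "\<omega> \<in> paths" using mD(3) by simp
      have "(\<Sum>e\<in>?E. indicator (?T e) \<omega> * h \<omega>) = (\<Sum>e\<in>?E. if e = \<omega> N then h \<omega> else 0)"
        by (intro sum.cong) (auto simp: indicator_def T w)
      then show "(\<Sum>e\<in>?E. indicator (?T e) \<omega> * h \<omega>) = indicator paths \<omega> * h \<omega>"
        using e[OF w] w by simp
    qed
    finally show ?thesis .
  qed
  have union_eq: "measure m (cylinder \<gamma> \<inter> (\<Union>i. A i)) = (\<integral>\<omega>. indicator (\<Union>i. A i) \<omega> * h \<omega> \<partial>m)"
    if dis: "disjoint_family A" and A: "\<And>i::nat. A i \<in> sets m"
      and eq: "\<And>i. measure m (cylinder \<gamma> \<inter> A i) = (\<integral>\<omega>. indicator (A i) \<omega> * h \<omega> \<partial>m)" for A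
  proof -
    have h0: "0 \<le> h \<omega>" for \<omega> by (simp add: h_def)
    have "(\<lambda>i. measure m (cylinder \<gamma> \<inter> A i)) sums measure m (\<Union>i. cylinder \<gamma> \<inter> A i)"
      using A cyl_sets dis by (intro finite_measure_UNION) (auto simp: disjoint_family_on_def)
    then have "measure m (\<Union>i. cylinder \<gamma> \<inter> A i) = suminf (\<lambda>i. \<integral>\<omega>. indicator (A i) \<omega> * h \<omega> \<partial>m)"
      unfolding eq by (rule sums_unique)
    also have "\<dots> = (\<integral>\<omega>. indicator (\<Union>i. A i) \<omega> * h \<omega> \<partial>m)"
      using lebesgue_integral_countable_add[of A m h] A dis int[of "\<Union>i. A i"]
      by (auto simp: disjoint_family_on_def set_integrable_def set_lebesgue_integral_def)
    finally show ?thesis by (simp only: Int_UN_distrib)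
  qed
  have "T \<in> sigma_sets paths (tail_cyl N ` {\<delta>. \<delta> \<noteq> []})" using T raw_tail_from_sub by blast
  with Int_stable_tail_cyl tail_cyl_Pow show ?thesis
  proof (induction rule: sigma_sets_induct_disjoint)
    case (basic A)
    then show ?case using basic_eq by auto
  next
    case empty
    then show ?case by simp
  next
    case (compl A)
    then show ?case using compl_eq[OF setsT[OF compl(1)] _ all] by simp
  next
    case (union A)
    then show ?case using setsT by (intro union_eq) auto
  qed
qed

section \<open>Path-forest central laws: reverse martingales and conditional expectations\<close>

locale central_pf =
  fixes \<mu> :: "path measure"
  assumes central_pf: "\<mu> \<in> central_measures_pf"
begin

lemma central: "\<mu> \<in> central_measures"
  using central_pf by (simp add: central_measures_pf_def)

sublocale prob_space \<mu>
  by (rule central_measuresD[OF central])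

lemma sets_eq [measurable_cong]: "sets \<mu> = sets path_borel"
  and space_eq [simp]: "space \<mu> = paths"
  by (rule central_measuresD[OF central])+

text \<open>Index N of the stored path starts at a tree with N + 1 vertices, so \<open>Y N\<close>
  is a partition of N. Off the path-forests \<open>shape\<close> is unspecified, which is why
  statements on \<open>Y\<close> are made along \<open>pf_path\<close> or almost surely.\<close>

abbreviation Y :: "nat \<Rightarrow> path \<Rightarrow> nat multiset" where
  "Y N \<omega> \<equiv> shape (src (\<omega> N))"

definition pf_path :: "path \<Rightarrow> bool" where
  "pf_path \<omega> \<longleftrightarrow> \<omega> \<in> paths \<and> (\<forall>N. path_forest (src (\<omega> N)))"

lemma AE_pf: "AE \<omega> in \<mu>. pf_path \<omega>"
proof -
  have "AE \<omega> in \<mu>. path_forest (src (\<omega> N))" for N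
  proof -
    have "measure \<mu> {\<omega> \<in> paths. path_forest (vertex_at (Suc N) \<omega>)} = 1"
      using central_pf by (simp add: central_measures_pf_def)
    then have "measure \<mu> {\<omega> \<in> paths. path_forest (src (\<omega> N))} = 1"
      by (simp add: vertex_at_def edge_at_def)
    moreover have "{\<omega> \<in> paths. path_forest (src (\<omega> N))} \<in> sets \<mu>"
      using coordinate_sets[of "\<lambda>e. path_forest (src e)" N] by (simp add: sets_eq)
    ultimately have "AE \<omega> in \<mu>. \<omega> \<in> {\<omega> \<in> paths. path_forest (src (\<omega> N))}"
      by (simp only: AE_in_set_eq_1)
    then show ?thesis by eventually_elim auto
  qed
  then have "AE \<omega> in \<mu>. \<forall>N. path_forest (src (\<omega> N))" by (simp add: AE_all_countable)
  then show ?thesis using AE_space by eventually_elim (auto simp: pf_path_def)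
qed

lemma pf_pathD:
  assumes "pf_path \<omega>"
  shows "\<omega> \<in> paths" "path_forest (src (\<omega> N))" "0 \<notin># Y N \<omega>" "sum_mset (Y N \<omega>) = N" "Y N \<omega> \<in> parts N"
    "src (\<omega> N) = path_forest_tree (Y N \<omega>)"
proof -
  show *: "\<omega> \<in> paths" "path_forest (src (\<omega> N))" using assms by (auto simp: pf_path_def)
  then show "0 \<notin># Y N \<omega>" "sum_mset (Y N \<omega>) = N" "Y N \<omega> \<in> parts N" "src (\<omega> N) = path_forest_tree (Y N \<omega>)"
    using vertices_src_path[of \<omega> N] by (auto simp: shape_partition parts_def)
qed

lemma integrable_Y: "integrable \<mu> (\<lambda>\<omega>. f (Y N \<omega>))" for f :: "nat multiset \<Rightarrow> real"
  using integrable_prefix(1)[OF prob_space_axioms sets_eq, of "\<lambda>\<gamma>. f (shape (src (\<gamma> ! N)))" "Suc N"]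
  by (simp add: nth_prefix_at)

lemma integrable_Y2: "integrable \<mu> (\<lambda>\<omega>. f (Y M \<omega>) (Y N \<omega>))" for f :: "nat multiset \<Rightarrow> nat multiset \<Rightarrow> real"
  using integrable_prefix(1)[OF prob_space_axioms sets_eq,
      of "\<lambda>\<gamma>. f (shape (src (\<gamma> ! M))) (shape (src (\<gamma> ! N)))" "Suc (max M N)"]
  by (simp add: nth_prefix_at)

lemma measurable_Y: "(\<lambda>\<omega>. f (Y N \<omega>)) \<in> borel_measurable \<mu>" for f :: "nat multiset \<Rightarrow> real"
  using integrable_Y by (rule borel_measurable_integrable)

text \<open>The conditional probability of a prefix given the tail is a quotient of walk counts,
  hence almost surely a sampling probability by \<open>num_walks_u\<close>.\<close>

lemma sampling_integral:
  assumes \<kappa>: "0 \<notin># \<kappa>" and \<gamma>: "\<gamma> \<in> walks leaf (sum_mset \<kappa>)" "walk_end leaf \<gamma> = path_forest_tree \<kappa>"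
    and N: "sum_mset \<kappa> \<le> N" and T: "T \<in> raw_tail_from (Suc N)"
  shows "measure \<mu> (cylinder \<gamma> \<inter> T) = (\<integral>\<omega>. indicator T \<omega> * sampling \<kappa> (Y N \<omega>) \<partial>\<mu>)"
proof -
  have "measure \<mu> (cylinder \<gamma> \<inter> T) =
    (\<integral>\<omega>. indicator T \<omega> * (real (num_walks (path_forest_tree \<kappa>) (src (\<omega> N))) / real (u (src (\<omega> N)))) \<partial>\<mu>)"
    using measure_cylinder_tail[OF central \<gamma>(1) N T] \<gamma>(2) by simp
  also have "\<dots> = (\<integral>\<omega>. indicator T \<omega> * sampling \<kappa> (Y N \<omega>) \<partial>\<mu>)"
  proof (rule integral_cong_AE)
    have T': "T \<in> sets \<mu>" using raw_tail_sets[OF T] by (simp add: sets_eq)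
    have "(\<lambda>\<omega>. real (num_walks (path_forest_tree \<kappa>) (src (\<omega> N))) / real (u (src (\<omega> N)))) \<in> borel_measurable \<mu>"
      using integrable_prefix(2)[OF prob_space_axioms sets_eq,
          of "\<lambda>\<gamma>. real (num_walks (path_forest_tree \<kappa>) (src (\<gamma> ! N))) / real (u (src (\<gamma> ! N)))" "Suc N"]
      by (simp add: nth_prefix_at)
    then show "(\<lambda>\<omega>. indicator T \<omega> * (real (num_walks (path_forest_tree \<kappa>) (src (\<omega> N))) / real (u (src (\<omega> N))))) \<in> borel_measurable \<mu>"
      by (intro borel_measurable_times borel_measurable_indicator T')
    show "(\<lambda>\<omega>. indicator T \<omega> * sampling \<kappa> (Y N \<omega>)) \<in> borel_measurable \<mu>"
      using T' measurable_Y by simp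
    show "AE \<omega> in \<mu>. indicator T \<omega> * (real (num_walks (path_forest_tree \<kappa>) (src (\<omega> N))) / real (u (src (\<omega> N)))) =
        indicator T \<omega> * sampling \<kappa> (Y N \<omega>)"
      using AE_pf
    proof eventually_elim
      case (elim \<omega>)
      note D = pf_pathD(1)[OF elim] pf_pathD(2-6)[OF elim, of N]
      have "real (num_walks (path_forest_tree \<kappa>) (src (\<omega> N))) = real (u (src (\<omega> N))) * sampling \<kappa> (Y N \<omega>)"
      proof -
        have "vertices (path_forest_tree \<kappa>) \<le> Suc (sum_mset (Y N \<omega>))"
          unfolding D(4) using \<kappa> N by (simp add: vertices_path_forest_tree)
        from num_walks_u[OF D(3) this] \<kappa> show ?thesis unfolding D(6)[symmetric] by simp
      qed
      moreover have "u (src (\<omega> N)) > 0" using u_path_forest_pos[OF D(3)] D(6) by simp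
      ultimately show ?case by simp
    qed
  qed
  finally show ?thesis .
qed

lemma ex_walk: "0 \<notin># \<kappa> \<Longrightarrow> \<exists>\<gamma>\<in>walks leaf (sum_mset \<kappa>). walk_end leaf \<gamma> = path_forest_tree \<kappa>"
proof -
  assume \<kappa>: "0 \<notin># \<kappa>"
  have "u (path_forest_tree \<kappa>) = card {es\<in>walks leaf (sum_mset \<kappa>). walk_end leaf es = path_forest_tree \<kappa>}"
    unfolding u_def using \<kappa> by (intro num_walks_eq) (simp add: vertices_path_forest_tree)
  with u_path_forest_pos[OF \<kappa>] have "{es\<in>walks leaf (sum_mset \<kappa>). walk_end leaf es = path_forest_tree \<kappa>} \<noteq> {}"
    by (metis card.empty less_irrefl)
  then show ?thesis by blast
qed

definition weight :: "nat multiset \<Rightarrow> real" where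
  "weight \<kappa> = state_weight \<mu> (path_forest_tree \<kappa>)"

lemma tail_paths: "paths \<in> raw_tail_from (Suc N)"
  by (simp add: raw_tail_from_def sigma_sets_top)

text \<open>The value is the same at every level N, which pins down second moments of the power sums
  up to O(1/N).\<close>

lemma expectation_sampling:
  assumes \<kappa>: "0 \<notin># \<kappa>" and N: "sum_mset \<kappa> \<le> N"
  shows "(\<integral>\<omega>. sampling \<kappa> (Y N \<omega>) \<partial>\<mu>) = weight \<kappa>"
proof -
  obtain \<gamma> where \<gamma>: "\<gamma> \<in> walks leaf (sum_mset \<kappa>)" "walk_end leaf \<gamma> = path_forest_tree \<kappa>" using ex_walk[OF \<kappa>] by blast
  have "(\<integral>\<omega>. sampling \<kappa> (Y N \<omega>) \<partial>\<mu>) = (\<integral>\<omega>. indicator paths \<omega> * sampling \<kappa> (Y N \<omega>) \<partial>\<mu>)"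
    by (intro Bochner_Integration.integral_cong) auto
  also have "\<dots> = measure \<mu> (cylinder \<gamma> \<inter> paths)"
    by (rule sampling_integral[OF \<kappa> \<gamma> N tail_paths, symmetric])
  also have "cylinder \<gamma> \<inter> paths = cylinder \<gamma>" by (auto simp: cylinder_eq)
  finally show ?thesis using central_cylinder[OF central \<gamma>(1)] \<gamma>(2) by (simp add: weight_def)
qed

definition level_set :: "nat \<Rightarrow> nat multiset \<Rightarrow> path set" where
  "level_set N \<rho> = {\<omega>\<in>paths. path_forest (src (\<omega> N)) \<and> Y N \<omega> = \<rho>}"

lemma level_set_sets: "level_set N \<rho> \<in> sets \<mu>"
  unfolding level_set_def sets_eq
  using coordinate_sets[of "\<lambda>e. path_forest (src e) \<and> shape (src e) = \<rho>" N] .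

text \<open>At level N there are finitely many partitions, so identities tested against functions of
  \<open>Y N\<close> need only be checked on the tail events
  \<open>level_set N \<rho>\<close>.\<close>

lemma integral_split_Y:
  fixes F :: "path \<Rightarrow> real"
  assumes F: "integrable \<mu> F"
  shows "(\<integral>\<omega>. F \<omega> * g (Y N \<omega>) \<partial>\<mu>) =
    (\<Sum>\<rho>\<in>parts N. g \<rho> * (\<integral>\<omega>. indicator (level_set N \<rho>) \<omega> * F \<omega> \<partial>\<mu>))"
proof -
  let ?T = "level_set N"
  note T = level_set_sets
  have int: "integrable \<mu> (\<lambda>\<omega>. indicator (?T \<rho>) \<omega> * F \<omega>)" for \<rho>
    using integrable_mult_indicator[OF T F] by simp
  have "(\<integral>\<omega>. F \<omega> * g (Y N \<omega>) \<partial>\<mu>) = (\<integral>\<omega>. (\<Sum>\<rho>\<in>parts N. g \<rho> * (indicator (?T \<rho>) \<omega> * F \<omega>)) \<partial>\<mu>)"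
  proof (rule integral_cong_AE)
    show "(\<lambda>\<omega>. F \<omega> * g (Y N \<omega>)) \<in> borel_measurable \<mu>"
      using F measurable_Y by (intro borel_measurable_times) auto
    show "(\<lambda>\<omega>. \<Sum>\<rho>\<in>parts N. g \<rho> * (indicator (?T \<rho>) \<omega> * F \<omega>)) \<in> borel_measurable \<mu>"
      using borel_measurable_integrable[OF int]
      by (intro borel_measurable_sum borel_measurable_times[OF borel_measurable_const]) simp
    show "AE \<omega> in \<mu>. F \<omega> * g (Y N \<omega>) = (\<Sum>\<rho>\<in>parts N. g \<rho> * (indicator (?T \<rho>) \<omega> * F \<omega>))"
      using AE_pf
    proof eventually_elim
      case (elim \<omega>)
      note D = pf_pathD(1)[OF elim] pf_pathD(2-6)[OF elim, of N]
      have "(\<Sum>\<rho>\<in>parts N. g \<rho> * (indicator (?T \<rho>) \<omega> * F \<omega>)) = (\<Sum>\<rho>\<in>parts N. if \<rho> = Y N \<omega> then g (Y N \<omega>) * F \<omega> else 0)"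
        using D(1,2) by (intro sum.cong) (auto simp: indicator_def level_set_def)
      then show ?case using D(5) by simp
    qed
  qed
  also have "\<dots> = (\<Sum>\<rho>\<in>parts N. g \<rho> * (\<integral>\<omega>. indicator (?T \<rho>) \<omega> * F \<omega> \<partial>\<mu>))"
    using int by (subst Bochner_Integration.integral_sum) auto
  finally show ?thesis .
qed

lemma tail_Y: "level_set N \<rho> \<in> raw_tail_from (Suc N)"
  unfolding level_set_def using raw_tail_state[of N N "\<lambda>t. path_forest t \<and> shape t = \<rho>"] by simp

text \<open>The tail field at N lies in the one at M <= N, so on its events both integrals compute
  the probability of the same prefix event.\<close>

lemma reverse_martingale:
  assumes \<kappa>: "0 \<notin># \<kappa>" and N: "sum_mset \<kappa> \<le> M" "M \<le> N"
  shows "(\<integral>\<omega>. sampling \<kappa> (Y M \<omega>) * g (Y N \<omega>) \<partial>\<mu>) = (\<integral>\<omega>. sampling \<kappa> (Y N \<omega>) * g (Y N \<omega>) \<partial>\<mu>)"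
proof -
  obtain \<gamma> where \<gamma>: "\<gamma> \<in> walks leaf (sum_mset \<kappa>)" "walk_end leaf \<gamma> = path_forest_tree \<kappa>" using ex_walk[OF \<kappa>] by blast
  have "(\<integral>\<omega>. indicator T \<omega> * sampling \<kappa> (Y M \<omega>) \<partial>\<mu>) = (\<integral>\<omega>. indicator T \<omega> * sampling \<kappa> (Y N \<omega>) \<partial>\<mu>)"
    if "T \<in> raw_tail_from (Suc N)" for T
    using sampling_integral[OF \<kappa> \<gamma>, of M T] sampling_integral[OF \<kappa> \<gamma>, of N T] raw_tail_antimono[OF N(2)] N that by auto
  then show ?thesis
    unfolding integral_split_Y[OF integrable_Y[of "sampling \<kappa>"]] using tail_Y by simp
qed

text \<open>Given level N, each of the \<open>u\<close> walks to \<kappa> has conditional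
  probability \<open>sampling \<kappa> (Y N \<omega>)\<close>, whence the conditional law of
  \<open>Y M\<close>.\<close>

lemma conditional_expectation_Y:
  assumes "M \<le> N"
  shows "(\<integral>\<omega>. f (Y M \<omega>) * g (Y N \<omega>) \<partial>\<mu>) =
    (\<integral>\<omega>. (\<Sum>\<kappa>\<in>parts M. real (u (path_forest_tree \<kappa>)) * sampling \<kappa> (Y N \<omega>) * f \<kappa>) * g (Y N \<omega>) \<partial>\<mu>)"
proof -
  have "(\<integral>\<omega>. indicator T \<omega> * f (Y M \<omega>) \<partial>\<mu>) =
    (\<integral>\<omega>. indicator T \<omega> * (\<Sum>\<kappa>\<in>parts M. real (u (path_forest_tree \<kappa>)) * sampling \<kappa> (Y N \<omega>) * f \<kappa>) \<partial>\<mu>)"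
    if T: "T \<in> raw_tail_from (Suc N)" for T
  proof -
    have T': "T \<in> sets \<mu>" using raw_tail_sets[OF T] by (simp add: sets_eq)
    have Tsub: "T \<subseteq> paths" using sets.sets_into_space[OF T'] by simp
    have "(\<integral>\<omega>. indicator T \<omega> * f (Y M \<omega>) \<partial>\<mu>) =
      (\<Sum>\<kappa>\<in>parts M. f \<kappa> * (\<integral>\<omega>. indicator (level_set M \<kappa>) \<omega> * indicator T \<omega> \<partial>\<mu>))"
      using T' by (intro integral_split_Y) (simp add: emeasure_eq_measure)
    also have "\<dots> = (\<Sum>\<kappa>\<in>parts M. f \<kappa> * (real (u (path_forest_tree \<kappa>)) * (\<integral>\<omega>. indicator T \<omega> * sampling \<kappa> (Y N \<omega>) \<partial>\<mu>)))"
    proof (intro sum.cong refl arg_cong2[where f="(*)"])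
      fix \<kappa> assume "\<kappa> \<in> parts M"
      then have \<kappa>: "0 \<notin># \<kappa>" "sum_mset \<kappa> = M" by (auto simp: parts_def)
      let ?A = "level_set M \<kappa>"
      let ?W = "{\<gamma>\<in>walks leaf M. walk_end leaf \<gamma> = path_forest_tree \<kappa>}"
      have A_eq: "?A = (\<Union>\<gamma>\<in>?W. cylinder \<gamma>)"
      proof -
        have "?A = {\<omega>\<in>paths. walk_end leaf (prefix_at M \<omega>) = path_forest_tree \<kappa>}"
          using \<kappa>(1) by (auto simp: level_set_def prefix_at_path shape_partition shape_path_forest_tree partitions_def)
        then show ?thesis
          using prefix_set_eq[of "\<lambda>\<gamma>. walk_end leaf \<gamma> = path_forest_tree \<kappa>" M] by (simp only:)
      qed
      have "(\<integral>\<omega>. indicator ?A \<omega> * indicator T \<omega> \<partial>\<mu>) = measure \<mu> (?A \<inter> T)"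
        using T' Tsub by (simp add: indicator_inter_arith[symmetric]) (metis Int_absorb2 Int_lower2 order_trans)
      also have "?A \<inter> T = (\<Union>\<gamma>\<in>?W. cylinder \<gamma> \<inter> T)" unfolding A_eq by blast
      also have "measure \<mu> \<dots> = (\<Sum>\<gamma>\<in>?W. measure \<mu> (cylinder \<gamma> \<inter> T))"
      proof (rule finite_measure_finite_Union)
        show "(\<lambda>\<gamma>. cylinder \<gamma> \<inter> T) ` ?W \<subseteq> sets \<mu>" using T' by (auto simp: sets_eq)
        show "disjoint_family_on (\<lambda>\<gamma>. cylinder \<gamma> \<inter> T) ?W"
          unfolding disjoint_family_on_def
        proof (intro ballI impI)
          fix \<delta> \<epsilon> assume "\<delta> \<in> ?W" "\<epsilon> \<in> ?W" "\<delta> \<noteq> \<epsilon>"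
          moreover from this have "length \<delta> = M" "length \<epsilon> = M" by (auto dest: walks_length)
          ultimately show "cylinder \<delta> \<inter> T \<inter> (cylinder \<epsilon> \<inter> T) = {}" by (auto simp: cylinder_eq)
        qed
      qed simp
      also have "\<dots> = (\<Sum>\<gamma>\<in>?W. (\<integral>\<omega>. indicator T \<omega> * sampling \<kappa> (Y N \<omega>) \<partial>\<mu>))"
        using sampling_integral[OF \<kappa>(1) _ _ _ T] assms \<kappa>(2) by (intro sum.cong) auto
      also have "\<dots> = real (u (path_forest_tree \<kappa>)) * (\<integral>\<omega>. indicator T \<omega> * sampling \<kappa> (Y N \<omega>) \<partial>\<mu>)"
        unfolding u_def using \<kappa> by (subst num_walks_eq[of _ _ M]) (auto simp: vertices_path_forest_tree)
      finally show "(\<integral>\<omega>. indicator ?A \<omega> * indicator T \<omega> \<partial>\<mu>) = real (u (path_forest_tree \<kappa>)) * (\<integral>\<omega>. indicator T \<omega> * sampling \<kappa> (Y N \<omega>) \<partial>\<mu>)" .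
    qed
    also have "\<dots> = (\<integral>\<omega>. (\<Sum>\<kappa>\<in>parts M. f \<kappa> * (real (u (path_forest_tree \<kappa>)) * (indicator T \<omega> * sampling \<kappa> (Y N \<omega>)))) \<partial>\<mu>)"
      using integrable_mult_indicator[OF T' integrable_Y[of "sampling _" N]]
      by (subst Bochner_Integration.integral_sum) auto
    also have "\<dots> = (\<integral>\<omega>. indicator T \<omega> * (\<Sum>\<kappa>\<in>parts M. real (u (path_forest_tree \<kappa>)) * sampling \<kappa> (Y N \<omega>) * f \<kappa>) \<partial>\<mu>)"
      by (intro Bochner_Integration.integral_cong refl) (simp add: sum_distrib_left mult_ac)
    finally show ?thesis .
  qed
  then show ?thesis
    unfolding integral_split_Y[OF integrable_Y[of f]]
      integral_split_Y[OF integrable_Y[of "\<lambda>\<rho>. \<Sum>\<kappa>\<in>parts M. real (u (path_forest_tree \<kappa>)) * sampling \<kappa> \<rho> * f \<kappa>"]]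
    using tail_Y by simp
qed

end

section \<open>Almost sure convergence along slowly varying sequences\<close>

text \<open>15 = 4 + 6 + 4 + 1, the binomial coefficients without the leading one.\<close>

lemma fourth_power_gap: "1 \<le> t \<Longrightarrow> (t + 1) ^ 4 - t ^ 4 \<le> 15 * t ^ 3" for t :: real
proof -
  assume t: "1 \<le> t"
  have "(t + 1) ^ 4 - t ^ 4 = 4 * t ^ 3 + 6 * t ^ 2 + 4 * t + 1"
    by (simp add: power4_eq_xxxx power3_eq_cube power2_eq_square algebra_simps)
  moreover have "t ^ 2 \<le> t ^ 3" "t ^ 1 \<le> t ^ 3" "t ^ 0 \<le> t ^ 3"
    using t by (intro power_increasing; simp)+
  ultimately show ?thesis by simp
qed

lemma fourth_power_floor: "\<exists>j. j ^ 4 \<le> N \<and> N < (j + 1) ^ (4::nat)" for N :: nat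
proof (induction N)
  case (Suc N)
  then obtain j where j: "j ^ 4 \<le> N" "N < (j + 1) ^ 4" by blast
  show ?case
  proof (cases "Suc N < (j + 1) ^ 4")
    case True
    with j show ?thesis by (intro exI[of _ j]) auto
  next
    case False
    with j have "Suc N = (j + 1) ^ 4" by simp
    moreover have "(j + 1) ^ 4 < (j + 1 + 1) ^ (4::nat)" by (rule power_strict_mono) auto
    ultimately show ?thesis by (intro exI[of _ "j + 1"]) auto
  qed
qed (auto intro: exI[of _ 0])

lemma slowly_varying_drift:
  fixes x :: "nat \<Rightarrow> real"
  assumes "\<And>N. \<bar>x (Suc N) - x N\<bar> \<le> c / real (Suc N)" "a \<le> N" "0 < a"
  shows "\<bar>x N - x a\<bar> \<le> c * (real N - real a) / real a"
  using assms(2)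
proof (induction N rule: dec_induct)
  case (step N)
  have c: "0 \<le> c" using order_trans[OF abs_ge_zero assms(1)[of 0]] by simp
  have "\<bar>x (Suc N) - x a\<bar> \<le> \<bar>x (Suc N) - x N\<bar> + \<bar>x N - x a\<bar>" by linarith
  also have "\<dots> \<le> c / real (Suc N) + c * (real N - real a) / real a"
    using step.IH assms(1)[of N] by linarith
  also have "c / real (Suc N) \<le> c / real a"
    using step.hyps assms(3) c by (intro divide_left_mono) auto
  also have "c / real a + c * (real N - real a) / real a = c * (real (Suc N) - real a) / real a"
    by (simp add: add_divide_distrib[symmetric] algebra_simps)
  finally show ?case by simp
qed simp

text \<open>Between j^4 and (j+1)^4 there are at most 15 j^3 steps of size at most c / j^4, a total
  drift of 15 c / j.\<close>

lemma slowly_varying_limit: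
  fixes x :: "nat \<Rightarrow> real"
  assumes step: "\<And>N. \<bar>x (Suc N) - x N\<bar> \<le> c / real (Suc N)"
    and lim: "(\<lambda>j. x (j ^ 4)) \<longlonglongrightarrow> L"
  shows "x \<longlonglongrightarrow> L"
proof (rule LIMSEQ_I)
  fix e :: real assume e: "0 < e"
  have c: "0 \<le> c" using order_trans[OF abs_ge_zero step[of 0]] by simp
  obtain J1 where J1: "\<And>j. j \<ge> J1 \<Longrightarrow> \<bar>x (j ^ 4) - L\<bar> < e / 2"
    using LIMSEQ_D[OF lim, of "e / 2"] e by auto
  \<comment> \<open>Chosen so that the drift 15 c / j stays below e / 2.\<close>
  obtain J2 :: nat where J2: "30 * c / e < real J2" using reals_Archimedean2 by blast
  let ?J = "max 1 (max J1 J2)"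
  show "\<exists>no. \<forall>N\<ge>no. norm (x N - L) < e"
  proof (intro exI[of _ "?J ^ 4"] allI impI)
    fix N assume N: "N \<ge> ?J ^ 4"
    obtain j where j: "j ^ 4 \<le> N" "N < (j + 1) ^ 4" using fourth_power_floor by blast
    have "?J ^ 4 < (j + 1) ^ 4" using N j(2) by simp
    then have "?J < j + 1" by (rule power_less_imp_less_base) simp
    then have jJ: "j \<ge> 1" "j \<ge> J1" "j \<ge> J2" by auto
    have "\<bar>x N - x (j ^ 4)\<bar> \<le> c * (real N - real (j ^ 4)) / real (j ^ 4)"
      using jJ by (intro slowly_varying_drift step j) auto
    also have "\<dots> \<le> c * (15 * real j ^ 3) / real (j ^ 4)"
    proof (intro divide_right_mono mult_left_mono c)
      have "real N - real (j ^ 4) \<le> real ((j + 1) ^ 4) - real (j ^ 4)" using j(2) by (simp del: of_nat_power)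
      also have "\<dots> = (real j + 1) ^ 4 - real j ^ 4" by (simp add: add.commute)
      also have "\<dots> \<le> 15 * real j ^ 3" using jJ(1) by (intro fourth_power_gap) simp
      finally show "real N - real (j ^ 4) \<le> 15 * real j ^ 3" .
    qed simp
    also have "\<dots> = 15 * c / real j" using jJ(1) by (simp add: power4_eq_xxxx power3_eq_cube)
    also have "\<dots> < e / 2"
    proof -
      have "30 * c / e < real j" using J2 jJ(3) by linarith
      then show ?thesis using e jJ(1) by (simp add: field_simps)
    qed
    finally show "norm (x N - L) < e" using J1[OF jJ(2)] unfolding real_norm_def by linarith
  qed
qed

text \<open>The expected sum is finite by monotone convergence, hence the sum is almost surely
  finite.\<close>

lemma (in prob_space) AE_summable:
  fixes F :: "nat \<Rightarrow> 'a \<Rightarrow> real"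
  assumes F: "\<And>j. integrable M (F j)" "\<And>j x. 0 \<le> F j x" and b: "\<And>j. (\<integral>x. F j x \<partial>M) \<le> b j" "summable b"
  shows "AE x in M. summable (\<lambda>j. F j x)"
proof -
  have [measurable]: "F j \<in> borel_measurable M" for j using F(1) by (rule borel_measurable_integrable)
  have b0: "0 \<le> b j" for j using b(1)[of j] F(2) by (intro order_trans[OF integral_nonneg_AE b(1)]) auto
  have "(\<integral>\<^sup>+x. suminf (\<lambda>j. ennreal (F j x)) \<partial>M) = suminf (\<lambda>j. \<integral>\<^sup>+x. ennreal (F j x) \<partial>M)"
    by (rule nn_integral_suminf) simp
  also have "\<dots> \<le> suminf (\<lambda>j. ennreal (b j))"
    using F b by (intro suminf_le) (auto simp: nn_integral_eq_integral intro!: ennreal_leI)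
  also have "\<dots> < \<infinity>" using suminf_ennreal_eq[OF b0 summable_sums[OF b(2)]] by simp
  finally have "(\<integral>\<^sup>+x. suminf (\<lambda>j. ennreal (F j x)) \<partial>M) \<noteq> \<infinity>" by simp
  then have "AE x in M. suminf (\<lambda>j. ennreal (F j x)) \<noteq> \<infinity>"
    by (intro nn_integral_noteq_infinite) auto
  then show ?thesis
    by eventually_elim (use F(2) in \<open>auto intro!: summable_suminf_not_top\<close>)
qed

lemma (in prob_space) slowly_varying_AE_convergent:
  fixes X :: "nat \<Rightarrow> 'a \<Rightarrow> real"
  assumes X: "\<And>M' N. integrable M (\<lambda>x. (X M' x - X N x)\<^sup>2)" "\<And>N. integrable M (X N)"
    and L2: "\<And>m N. m0 \<le> m \<Longrightarrow> m \<le> N \<Longrightarrow> (\<integral>x. (X m x - X N x)\<^sup>2 \<partial>M) \<le> C / real m"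
    and step: "AE x in M. \<forall>N. \<bar>X (Suc N) x - X N x\<bar> \<le> c / real (Suc N)"
  shows "AE x in M. convergent (\<lambda>N. X N x)"
proof -
  \<comment> \<open>The shift puts every level above the threshold m0 and keeps \<open>d j\<close>
    positive.\<close>
  define n where "n j = (j + Suc m0) ^ 4" for j
  define d where "d j = real (j + Suc m0)" for j
  let ?F = "\<lambda>j x. \<bar>X (n j) x - X (n (Suc j)) x\<bar>"
  have n_ge: "m0 \<le> n j" for j
  proof -
    have "m0 \<le> j + Suc m0" by simp
    also have "\<dots> \<le> n j" unfolding n_def by (rule self_le_power) auto
    finally show ?thesis .
  qed
  have n_mono: "n j \<le> n (Suc j)" for j
    unfolding n_def by (rule power_mono) auto
  have nd: "real (n j) = d j ^ 4" "d j > 0" for j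
    by (simp only: n_def d_def of_nat_power) (simp add: d_def)
  have int: "integrable M (?F j)" for j
    using X(2) by (intro integrable_abs Bochner_Integration.integrable_diff)
  have le: "(\<integral>x. ?F j x \<partial>M) \<le> (C + 1) * inverse ((d j)\<^sup>2)" for j
  proof -
    have int2: "integrable M (\<lambda>x. (d j)\<^sup>2 * (X (n j) x - X (n (Suc j)) x)\<^sup>2)"
      using X(1) by (rule integrable_mult_right)
    \<comment> \<open>From L2 to L1 by a * b <= a^2 + b^2 with a = d |x| and b = 1/d; the choice d =
      M^(1/4) makes both terms O(d^(-2)).\<close>
    have "(\<integral>x. ?F j x \<partial>M) \<le> (\<integral>x. (d j)\<^sup>2 * (X (n j) x - X (n (Suc j)) x)\<^sup>2 + inverse ((d j)\<^sup>2) \<partial>M)"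
    proof (intro integral_mono int)
      show "integrable M (\<lambda>x. (d j)\<^sup>2 * (X (n j) x - X (n (Suc j)) x)\<^sup>2 + inverse ((d j)\<^sup>2))"
        using int2 by (rule Bochner_Integration.integrable_add) simp
      fix x
      define a where "a = d j * \<bar>X (n j) x - X (n (Suc j)) x\<bar>"
      define b where "b = inverse (d j)"
      have "(a - b)\<^sup>2 = a\<^sup>2 - 2 * (a * b) + b\<^sup>2" by (simp add: power2_eq_square algebra_simps)
      then have "a * b \<le> a\<^sup>2 + b\<^sup>2"
        using zero_le_power2[of "a - b"] zero_le_power2[of a] zero_le_power2[of b] by linarith
      moreover have "a * b = ?F j x" using nd(2)[of j] by (simp add: a_def b_def)
      moreover have "a\<^sup>2 = (d j)\<^sup>2 * (X (n j) x - X (n (Suc j)) x)\<^sup>2" by (simp add: a_def power_mult_distrib)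
      moreover have "b\<^sup>2 = inverse ((d j)\<^sup>2)" by (simp add: b_def power_inverse)
      ultimately show "?F j x \<le> (d j)\<^sup>2 * (X (n j) x - X (n (Suc j)) x)\<^sup>2 + inverse ((d j)\<^sup>2)" by simp
    qed
    also have "\<dots> = (d j)\<^sup>2 * (\<integral>x. (X (n j) x - X (n (Suc j)) x)\<^sup>2 \<partial>M) + inverse ((d j)\<^sup>2)"
      using int2 by (subst Bochner_Integration.integral_add) (simp_all add: prob_space)
    also have "\<dots> \<le> (d j)\<^sup>2 * (C / real (n j)) + inverse ((d j)\<^sup>2)"
      using L2[OF n_ge n_mono] by (intro add_right_mono mult_left_mono) auto
    also have "\<dots> = (C + 1) * inverse ((d j)\<^sup>2)"
      unfolding nd(1) using nd(2)[of j] by (simp add: power4_eq_xxxx power2_eq_square field_simps)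
    finally show ?thesis .
  qed
  have "summable (\<lambda>n. inverse ((real n)\<^sup>2))" by (rule inverse_power_summable) simp
  then have "summable (\<lambda>j. inverse ((d j)\<^sup>2))"
    unfolding d_def by (rule summable_ignore_initial_segment)
  then have sb: "summable (\<lambda>j. (C + 1) * inverse ((d j)\<^sup>2))" by (rule summable_mult)
  have "AE x in M. summable (\<lambda>j. ?F j x)"
    using int le sb by (intro AE_summable[where b="\<lambda>j. (C + 1) * inverse ((d j)\<^sup>2)"]) simp_all
  with step show ?thesis
  proof eventually_elim
    case (elim x)
    define f where "f j = X (n j) x" for j
    have "summable (\<lambda>j. \<bar>f (Suc j) - f j\<bar>)"
      using elim(2) by (simp add: f_def abs_minus_commute)
    then have "summable (\<lambda>j. f (Suc j) - f j)" by (rule summable_rabs_cancel)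
    then obtain s where "(\<lambda>n. \<Sum>j<n. f (Suc j) - f j) \<longlonglongrightarrow> s"
      by (auto simp: summable_def sums_def)
    then have "(\<lambda>n. f n - f 0) \<longlonglongrightarrow> s"
      by (simp only: sum_lessThan_telescope)
    from tendsto_add[OF this tendsto_const[of "f 0"]]
    have "(\<lambda>j. X ((j + Suc m0) ^ 4) x) \<longlonglongrightarrow> s + f 0" by (simp add: f_def n_def)
    then have "(\<lambda>j. X (j ^ 4) x) \<longlonglongrightarrow> s + f 0" by (rule LIMSEQ_offset)
    from slowly_varying_limit[OF elim(1)[rule_format] this] show ?case by (auto simp: convergent_def)
  qed
qed

section \<open>Convergence of the frequencies\<close>

text \<open>Test the growth formula on the indicator of the shape of t: were t of another form, a
  sum of nonnegative terms containing a 1 would vanish.\<close>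

lemma grow_shape:
  assumes \<kappa>: "0 \<notin># \<kappa>" and t: "t \<in># grow (path_forest_tree \<kappa>)" "path_forest t"
  shows "shape t = add_mset 1 \<kappa> \<or> (\<exists>j\<in>#\<kappa>. shape t = add_mset (j + 1) (\<kappa> - {#j#}))"
proof (rule ccontr)
  assume not: "\<not> ?thesis"
  let ?\<phi> = "\<lambda>\<nu>. if \<nu> = shape t then 1 else (0::real)"
  obtain G where G: "grow (path_forest_tree \<kappa>) = add_mset t G" using t(1) by (metis mset_add)
  have "(\<Sum>j\<in>#\<kappa>. ?\<phi> (add_mset (j + 1) (\<kappa> - {#j#}))) = (\<Sum>j\<in>#\<kappa>. 0)"
    using not by (intro sum_mset_cong) auto
  moreover have "?\<phi> (add_mset 1 \<kappa>) = 0" using not by auto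
  ultimately have "(\<Sum>s\<in>#grow (path_forest_tree \<kappa>). pf_fun ?\<phi> s) = 0"
    unfolding sum_grow_path_forest[OF \<kappa>] by simp
  moreover have "(\<Sum>s\<in>#G. pf_fun ?\<phi> s) \<ge> 0" by (intro sum_mset_nonneg') (auto simp: pf_fun_def)
  moreover have "pf_fun ?\<phi> t = 1" using t(2) by (simp add: pf_fun_def)
  ultimately show False by (simp add: G)
qed

lemma power_diff_le: "0 \<le> x \<Longrightarrow> (x + 1) ^ k - x ^ k \<le> real k * (x + 1) ^ (k - 1)" for x :: real
proof (induction k)
  case (Suc k)
  show ?case
  proof (cases k)
    case (Suc k')
    have "(x + 1) ^ Suc k - x ^ Suc k = (x + 1) * ((x + 1) ^ k - x ^ k) + x ^ k" by (simp add: algebra_simps)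
    also have "\<dots> \<le> (x + 1) * (real k * (x + 1) ^ (k - 1)) + (x + 1) ^ k"
      using Suc.IH Suc.prems by (intro add_mono mult_left_mono power_mono) auto
    also have "\<dots> = real (Suc k) * (x + 1) ^ (Suc k - 1)" using Suc by (simp add: algebra_simps)
    finally show ?thesis .
  qed simp
qed simp

text \<open>One block grows and the normalisation grows. The two effects have opposite signs and
  each is at most k/(N+1), so the bound needs no factor 2.\<close>

lemma psum_step:
  assumes \<nu>: "\<nu> = add_mset 1 \<kappa> \<or> (\<exists>j\<in>#\<kappa>. \<nu> = add_mset (j + 1) (\<kappa> - {#j#}))" and k: "k \<ge> 1"
  shows "\<bar>psum k \<nu> - psum k \<kappa>\<bar> \<le> real k / real (Suc (sum_mset \<kappa>))"
proof -
  let ?N = "sum_mset \<kappa>"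
  define S where "S = (\<Sum>l\<in>#\<kappa>. real l ^ k)"
  have N': "sum_mset \<nu> = Suc ?N" using \<nu> sum_mset_move[of _ \<kappa> 1] by auto
  have psum_eq: "psum k \<rho> = (\<Sum>l\<in>#\<rho>. real l ^ k) / real (sum_mset \<rho>) ^ k" for \<rho>
    unfolding psum_def power_divide by (simp add: divide_inverse sum_mset_distrib_right)
  obtain d where d: "(\<Sum>l\<in>#\<nu>. real l ^ k) = S + d" "0 \<le> d" "d \<le> real k * real (Suc ?N) ^ (k - 1)"
  proof (cases "\<nu> = add_mset 1 \<kappa>")
    case True
    have "1 * 1 \<le> real k * real (Suc ?N) ^ (k - 1)" using k by (intro mult_mono one_le_power) auto
    with True show ?thesis by (intro that[of 1]) (auto simp: S_def)
  next
    case False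
    with \<nu> obtain j where j: "j \<in># \<kappa>" "\<nu> = add_mset (j + 1) (\<kappa> - {#j#})" by blast
    then obtain \<kappa>' where \<kappa>': "\<kappa> = add_mset j \<kappa>'" by (metis mset_add)
    have "real (j + 1) ^ k - real j ^ k \<le> real k * real (j + 1) ^ (k - 1)"
      using power_diff_le[of "real j" k] by (simp add: add.commute)
    also have "\<dots> \<le> real k * real (Suc ?N) ^ (k - 1)"
      using mem_le_sum_mset[OF j(1)] by (intro mult_left_mono power_mono) auto
    finally show ?thesis
      using j \<kappa>' by (intro that[of "real (j + 1) ^ k - real j ^ k"]) (auto simp: S_def intro!: power_mono)
  qed
  have pos: "0 < real (Suc ?N)" by simp
  have D: "d / real (Suc ?N) ^ k \<le> real k / real (Suc ?N)"
  proof -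
    have "d / real (Suc ?N) ^ k \<le> (real k * real (Suc ?N) ^ (k - 1)) / real (Suc ?N) ^ k"
      using d(3) by (intro divide_right_mono) auto
    also have "\<dots> = real k / real (Suc ?N)" using k by (cases k) auto
    finally show ?thesis .
  qed
  show ?thesis
  proof (cases "?N = 0")
    case True
    have "S = (\<Sum>l\<in>#\<kappa>. 0)"
      unfolding S_def
    proof (intro sum_mset_cong)
      fix l assume "l \<in># \<kappa>"
      then have "l = 0" using mem_le_sum_mset[of l \<kappa>] True by simp
      then show "real l ^ k = 0" using k by simp
    qed
    then have "S = 0" by simp
    with True D d(2) show ?thesis by (simp add: psum_eq N' d(1) S_def)
  next
    case False
    let ?q = "real ?N ^ k / real (Suc ?N) ^ k"
    have S: "0 \<le> psum k \<kappa>" "psum k \<kappa> \<le> 1"     proof -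
      have "0 < ?N" using False by (simp only: neq0_conv)
      then show "0 \<le> psum k \<kappa>" "psum k \<kappa> \<le> 1" using psum_bounds k by auto
    qed
    have q: "0 \<le> ?q" "?q \<le> 1" "1 - ?q \<le> real k / real (Suc ?N)"
    proof -
      show "0 \<le> ?q" by simp
      show "?q \<le> 1" by (simp add: divide_le_eq_1 power_mono)
      have "1 - ?q = (real (Suc ?N) ^ k - real ?N ^ k) / real (Suc ?N) ^ k"
        using pos by (simp add: diff_divide_distrib del: of_nat_Suc)
      also have "\<dots> \<le> (real k * real (Suc ?N) ^ (k - 1)) / real (Suc ?N) ^ k"
        using power_diff_le[of "real ?N" k] by (intro divide_right_mono) (auto simp: add.commute)
      also have "\<dots> = real k / real (Suc ?N)" using k by (cases k) auto
      finally show "1 - ?q \<le> real k / real (Suc ?N)" .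
    qed
    have "psum k \<nu> = psum k \<kappa> * ?q + d / real (Suc ?N) ^ k"
      using False by (simp add: psum_eq N' d(1) S_def[symmetric] add_divide_distrib)
    then have "psum k \<nu> - psum k \<kappa> = d / real (Suc ?N) ^ k - psum k \<kappa> * (1 - ?q)"
      by (simp add: algebra_simps)
    moreover have "0 \<le> psum k \<kappa> * (1 - ?q)" using S q by simp
    moreover have "psum k \<kappa> * (1 - ?q) \<le> 1 * (real k / real (Suc ?N))"
      using q(2) by (intro mult_mono S q(3)) simp_all
    moreover have "0 \<le> d / real (Suc ?N) ^ k" using d(2) by simp
    ultimately show ?thesis using D by (simp add: abs_le_iff del: of_nat_Suc)
  qed
qed

lemma count_1_step:
  assumes \<nu>: "\<nu> = add_mset 1 \<kappa> \<or> (\<exists>j\<in>#\<kappa>. \<nu> = add_mset (j + 1) (\<kappa> - {#j#}))" "0 \<notin># \<kappa>"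
  shows "\<bar>real (count \<nu> 1) - real (count \<kappa> 1)\<bar> \<le> 1"
proof (cases "\<nu> = add_mset 1 \<kappa>")
  case False
  with \<nu> obtain j where "j \<in># \<kappa>" "\<nu> = add_mset (j + 1) (\<kappa> - {#j#})" by blast
  moreover from this obtain \<kappa>' where "\<kappa> = add_mset j \<kappa>'" by (metis mset_add)
  ultimately show ?thesis using \<nu>(2) by auto
qed simp

definition approx_err :: "nat multiset \<Rightarrow> real" where
  "approx_err \<kappa> = approx_const \<kappa> + (real (sum_mset \<kappa>))\<^sup>2"

lemma approx_err_nonneg: "0 \<le> approx_err \<kappa>"
  by (simp add: approx_err_def)

lemma sampling_spow_err:
  assumes "0 \<notin># \<kappa>" "sum_mset \<kappa> \<le> sum_mset \<rho>" "0 < sum_mset \<rho>"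
  shows "\<bar>sampling \<kappa> \<rho> - spow \<kappa> \<rho>\<bar> \<le> approx_err \<kappa> / real (sum_mset \<rho>)"
  unfolding approx_err_def using assms u_sampling_le_1(2) by (intro sampling_approx) auto

lemma spow_singleton: "spow {#k#} \<rho> = psum k \<rho>"
  by (simp add: spow_def psum_def isum_add weight_pow_def)

text \<open>The square of a power sum expands exactly into two injective sums, each within O(1/N) of
  a sampling probability. These sample 2k elements, whence the lower bound on the total.\<close>

lemma psum_square_err:
  assumes "k \<ge> 1" "2 * k \<le> sum_mset \<rho>"
  shows "\<bar>(psum k \<rho>)\<^sup>2 - (sampling {#k, k#} \<rho> + sampling {#k + k#} \<rho>)\<bar> \<le>
    (approx_err {#k, k#} + approx_err {#k + k#}) / real (sum_mset \<rho>)"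
proof -
  have pos: "0 < sum_mset \<rho>" using assms by simp
  have "(psum k \<rho>)\<^sup>2 = spow {#k, k#} \<rho> + spow {#k + k#} \<rho>"
    using spow_recursion[OF pos, of k "{#k#}"] by (simp add: spow_singleton power2_eq_square)
  moreover have "\<bar>sampling {#k, k#} \<rho> - spow {#k, k#} \<rho>\<bar> \<le> approx_err {#k, k#} / real (sum_mset \<rho>)"
    "\<bar>sampling {#k + k#} \<rho> - spow {#k + k#} \<rho>\<bar> \<le> approx_err {#k + k#} / real (sum_mset \<rho>)"
    using assms pos by (intro sampling_spow_err; simp)+
  ultimately show ?thesis by (simp add: add_divide_distrib)
qed

context central_pf
begin

lemma prob_paths [simp]: "prob paths = 1"
  using prob_space by simp

lemma pf_path_step:
  assumes "pf_path \<omega>"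
  shows "Y (Suc N) \<omega> = add_mset 1 (Y N \<omega>) \<or> (\<exists>j\<in>#Y N \<omega>. Y (Suc N) \<omega> = add_mset (j + 1) (Y N \<omega> - {#j#}))"
proof -
  note D = pf_pathD(1)[OF assms] pf_pathD(2-6)[OF assms, of N] pf_pathD(2)[OF assms, of "Suc N"]
  have "\<omega> N \<in> edges" "tgt (\<omega> N) = src (\<omega> (Suc N))" using D(1) by (auto simp: paths_def)
  then have "src (\<omega> (Suc N)) \<in># grow (src (\<omega> N))" using tgt_out_edges[of "\<omega> N" "src (\<omega> N)"] by (simp add: out_edges_def)
  then show ?thesis using grow_shape[OF D(3), of "src (\<omega> (Suc N))"] D(6,7) by simp
qed

text \<open>Write R for the power sum and S for \<open>sampling {#k#}\<close>. E R^2 is within c2/M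
  of a constant independent of the level. S is a reverse martingale and R - S is at most c1/M, so
  E(R_M R_N) is within 4 c1/M of E R_N^2. Expanding the square gives 2 c2 + 8 c1.\<close>

lemma psum_variance:
  assumes k: "k \<ge> 1" and M: "2 * k \<le> M" "M \<le> N"
  shows "(\<integral>\<omega>. (psum k (Y M \<omega>) - psum k (Y N \<omega>))\<^sup>2 \<partial>\<mu>) \<le>
    (2 * (approx_err {#k, k#} + approx_err {#k + k#}) + 8 * approx_err {#k#}) / real M"
proof -
  define c1 where "c1 = approx_err {#k#}"
  define c2 where "c2 = approx_err {#k, k#} + approx_err {#k + k#}"
  have c0: "0 \<le> c1" "0 \<le> c2" by (simp_all add: c1_def c2_def approx_err_nonneg)
  let ?R = "\<lambda>N \<omega>. psum k (Y N \<omega>)" and ?S = "\<lambda>N \<omega>. sampling {#k#} (Y N \<omega>)"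
  define a where "a = weight {#k, k#} + weight {#k + k#}"
  have M0: "M > 0" using k M by simp
  have int2: "integrable \<mu> (\<lambda>\<omega>. f (Y M' \<omega>) * g (Y N' \<omega>))" for f g :: "nat multiset \<Rightarrow> real" and M' N'
    using integrable_Y2[of "\<lambda>x y. f x * g y"] .
  have int1: "integrable \<mu> (\<lambda>\<omega>. (f (Y N' \<omega>))\<^sup>2)" for f :: "nat multiset \<Rightarrow> real" and N'
    using integrable_Y[of "\<lambda>x. (f x)\<^sup>2"] .
  have AE_int_le: "\<bar>(\<integral>\<omega>. F \<omega> \<partial>\<mu>) - (\<integral>\<omega>. G \<omega> \<partial>\<mu>)\<bar> \<le> e"
    if "integrable \<mu> F" "integrable \<mu> G" "AE \<omega> in \<mu>. \<bar>F \<omega> - G \<omega>\<bar> \<le> e" for F G :: "path \<Rightarrow> real" and e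
  proof -
    have "\<bar>(\<integral>\<omega>. F \<omega> - G \<omega> \<partial>\<mu>)\<bar> \<le> (\<integral>\<omega>. \<bar>F \<omega> - G \<omega>\<bar> \<partial>\<mu>)" by (rule integral_abs_bound)
    also have "\<dots> \<le> (\<integral>\<omega>. e \<partial>\<mu>)" using that by (intro integral_mono_AE) auto
    finally show ?thesis using that by (simp add: prob_space)
  qed
  have sq: "\<bar>(\<integral>\<omega>. (?R L \<omega>)\<^sup>2 \<partial>\<mu>) - a\<bar> \<le> c2 / real M" if L: "M \<le> L" for L
  proof -
    have "(\<integral>\<omega>. sampling {#k, k#} (Y L \<omega>) + sampling {#k + k#} (Y L \<omega>) \<partial>\<mu>) = a"
      using k M L by (subst Bochner_Integration.integral_add)
        (auto simp: integrable_Y a_def intro!: arg_cong2[where f="(+)"] expectation_sampling)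
    moreover have "\<bar>(\<integral>\<omega>. (?R L \<omega>)\<^sup>2 \<partial>\<mu>) - (\<integral>\<omega>. sampling {#k, k#} (Y L \<omega>) + sampling {#k + k#} (Y L \<omega>) \<partial>\<mu>)\<bar> \<le> c2 / real M"
    proof (rule AE_int_le[OF int1])
      show "integrable \<mu> (\<lambda>\<omega>. sampling {#k, k#} (Y L \<omega>) + sampling {#k + k#} (Y L \<omega>))"
        by (intro Bochner_Integration.integrable_add integrable_Y)
      show "AE \<omega> in \<mu>. \<bar>(?R L \<omega>)\<^sup>2 - (sampling {#k, k#} (Y L \<omega>) + sampling {#k + k#} (Y L \<omega>))\<bar> \<le> c2 / real M"
        using AE_pf
      proof eventually_elim
        case (elim \<omega>)
        have s: "sum_mset (Y L \<omega>) = L" by (rule pf_pathD(4)[OF elim])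
        have "\<bar>(?R L \<omega>)\<^sup>2 - (sampling {#k, k#} (Y L \<omega>) + sampling {#k + k#} (Y L \<omega>))\<bar> \<le> c2 / real L"
          using psum_square_err[of k "Y L \<omega>"] k M L unfolding s c2_def by simp
        also have "\<dots> \<le> c2 / real M" using c0 L M0 by (intro divide_left_mono) auto
        finally show ?case .
      qed
    qed
    ultimately show ?thesis by simp
  qed
  have RS: "\<bar>?R L \<omega> - ?S L \<omega>\<bar> \<le> c1 / real M \<and> 0 \<le> ?R L \<omega> \<and> ?R L \<omega> \<le> 1 \<and> 0 \<le> ?S L \<omega> \<and> ?S L \<omega> \<le> 1"
    if L: "M \<le> L" and p: "pf_path \<omega>" for L \<omega>
  proof -
    have s: "sum_mset (Y L \<omega>) = L" by (rule pf_pathD(4)[OF p])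
    have "\<bar>?S L \<omega> - ?R L \<omega>\<bar> \<le> c1 / real L"
      using sampling_spow_err[of "{#k#}" "Y L \<omega>"] k M L M0 unfolding s spow_singleton c1_def by simp
    also have "\<dots> \<le> c1 / real M" using c0 L M0 by (intro divide_left_mono) auto
    finally have "\<bar>?R L \<omega> - ?S L \<omega>\<bar> \<le> c1 / real M" by (simp add: abs_minus_commute)
    moreover have "?R L \<omega> \<le> 1" "0 \<le> ?R L \<omega>" using psum_bounds(2)[of "Y L \<omega>" k] psum_bounds(1) k s M0 L by auto
    moreover have "?S L \<omega> \<le> 1" using u_sampling_le_1(2)[of "{#k#}" "Y L \<omega>"] k s M L by simp
    ultimately show ?thesis by simp
  qed
  have prod: "\<bar>(\<integral>\<omega>. ?R M \<omega> * ?R L \<omega> \<partial>\<mu>) - (\<integral>\<omega>. ?S M \<omega> * ?S L \<omega> \<partial>\<mu>)\<bar> \<le> 2 * c1 / real M" if L: "M \<le> L" and M': "M \<le> M'" for L and M' :: nat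
  proof (rule AE_int_le[OF int2 int2])
    show "AE \<omega> in \<mu>. \<bar>?R M \<omega> * ?R L \<omega> - ?S M \<omega> * ?S L \<omega>\<bar> \<le> 2 * c1 / real M"
      using AE_pf
    proof eventually_elim
      case (elim \<omega>)
      note b = RS[OF order_refl elim] RS[OF L elim]
      have "?R M \<omega> * ?R L \<omega> - ?S M \<omega> * ?S L \<omega> = (?R M \<omega> - ?S M \<omega>) * ?R L \<omega> + ?S M \<omega> * (?R L \<omega> - ?S L \<omega>)"
        by (simp add: algebra_simps)
      also have "\<bar>\<dots>\<bar> \<le> \<bar>?R M \<omega> - ?S M \<omega>\<bar> * ?R L \<omega> + ?S M \<omega> * \<bar>?R L \<omega> - ?S L \<omega>\<bar>"
        using b by (intro order_trans[OF abs_triangle_ineq]) (simp add: abs_mult)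
      also have "\<dots> \<le> (c1 / real M) * 1 + 1 * (c1 / real M)"
        using b c0 by (intro add_mono mult_mono) auto
      finally show ?case by simp
    qed
  qed
  have prodN: "\<bar>(\<integral>\<omega>. (?S N \<omega>)\<^sup>2 \<partial>\<mu>) - (\<integral>\<omega>. (?R N \<omega>)\<^sup>2 \<partial>\<mu>)\<bar> \<le> 2 * c1 / real M"
  proof (rule AE_int_le[OF int1 int1])
    show "AE \<omega> in \<mu>. \<bar>(?S N \<omega>)\<^sup>2 - (?R N \<omega>)\<^sup>2\<bar> \<le> 2 * c1 / real M"
      using AE_pf
    proof eventually_elim
      case (elim \<omega>)
      note b = RS[OF M(2) elim]
      have "(?S N \<omega>)\<^sup>2 - (?R N \<omega>)\<^sup>2 = (?S N \<omega> - ?R N \<omega>) * (?S N \<omega> + ?R N \<omega>)"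
        by (simp add: power2_eq_square algebra_simps)
      also have "\<bar>\<dots>\<bar> \<le> (c1 / real M) * 2"
        unfolding abs_mult using b c0 by (intro mult_mono) auto
      finally show ?case by (simp add: mult.commute)
    qed
  qed
  have mart: "(\<integral>\<omega>. ?S M \<omega> * ?S N \<omega> \<partial>\<mu>) = (\<integral>\<omega>. (?S N \<omega>)\<^sup>2 \<partial>\<mu>)"
    using reverse_martingale[of "{#k#}" M N "sampling {#k#}"] k M by (simp add: power2_eq_square)
  have "(\<integral>\<omega>. (?R M \<omega> - ?R N \<omega>)\<^sup>2 \<partial>\<mu>) =
     (\<integral>\<omega>. (?R M \<omega>)\<^sup>2 + (?R N \<omega>)\<^sup>2 - 2 * (?R M \<omega> * ?R N \<omega>) \<partial>\<mu>)"
    by (intro Bochner_Integration.integral_cong) (auto simp: power2_eq_square algebra_simps)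
  also have "\<dots> = (\<integral>\<omega>. (?R M \<omega>)\<^sup>2 \<partial>\<mu>) + (\<integral>\<omega>. (?R N \<omega>)\<^sup>2 \<partial>\<mu>) - 2 * (\<integral>\<omega>. ?R M \<omega> * ?R N \<omega> \<partial>\<mu>)"
    using int1 int2 by simp
  also have "\<dots> \<le> (2 * c2 + 8 * c1) / real M"
    using sq[OF order_refl] sq[OF M(2)] prod[OF M(2) order_refl] prodN mart by (simp add: add_divide_distrib)
  finally show ?thesis by (simp add: c1_def c2_def)
qed

lemma AE_psum_convergent: "AE \<omega> in \<mu>. \<forall>k\<ge>2. convergent (\<lambda>N. psum k (Y N \<omega>))"
proof -
  have "AE \<omega> in \<mu>. convergent (\<lambda>N. psum k (Y N \<omega>))" if k: "k \<ge> 1" for k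
  proof (rule slowly_varying_AE_convergent)
    show "integrable \<mu> (\<lambda>\<omega>. (psum k (Y M' \<omega>) - psum k (Y N \<omega>))\<^sup>2)" for M' N
      using integrable_Y2[of "\<lambda>x y. (psum k x - psum k y)\<^sup>2"] .
    show "integrable \<mu> (\<lambda>\<omega>. psum k (Y N \<omega>))" for N by (rule integrable_Y)
    show "(\<integral>\<omega>. (psum k (Y m \<omega>) - psum k (Y N \<omega>))\<^sup>2 \<partial>\<mu>) \<le>
      (2 * (approx_err {#k, k#} + approx_err {#k + k#}) + 8 * approx_err {#k#}) / real m" if "2 * k \<le> m" "m \<le> N" for m N
      by (rule psum_variance[OF k that])
    show "AE \<omega> in \<mu>. \<forall>N. \<bar>psum k (Y (Suc N) \<omega>) - psum k (Y N \<omega>)\<bar> \<le> real k / real (Suc N)"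
      using AE_pf
    proof eventually_elim
      case (elim \<omega>)
      show ?case
        using psum_step[OF pf_path_step[OF elim] k] pf_pathD(4)[OF elim] by simp
    qed
  qed
  then have "AE \<omega> in \<mu>. \<forall>k. k \<ge> 1 \<longrightarrow> convergent (\<lambda>N. psum k (Y N \<omega>))"
    by (simp add: AE_all_countable)
  then show ?thesis by eventually_elim auto
qed

lemma AE_freq_convergent: "AE \<omega> in \<mu>. \<exists>p\<in>nabla. \<forall>i. (\<lambda>N. freq (Y N \<omega>) i) \<longlonglongrightarrow> p i"
  using AE_psum_convergent AE_pf
proof eventually_elim
  case (elim \<omega>)
  show ?case
  proof (rule nabla_convergence)
    fix k :: nat assume k: "k \<ge> 2"
    have "(\<lambda>N. power_sum k (freq (Y (Suc N) \<omega>))) = (\<lambda>N. psum k (Y (Suc N) \<omega>))"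
      using power_sum_freq[of "Y (Suc _) \<omega>" k] pf_pathD(4)[OF elim(2)] k by auto
    moreover have "convergent (\<lambda>N. psum k (Y (Suc N) \<omega>))"
      using elim(1) k convergent_Suc_iff[of "\<lambda>N. psum k (Y N \<omega>)"] by blast
    ultimately have "convergent (\<lambda>N. power_sum k (freq (Y (Suc N) \<omega>)))" by simp
    then show "convergent (\<lambda>N. power_sum k (freq (Y N \<omega>)))"
      by (subst (asm) convergent_Suc_iff)
  qed (rule freq_in_nabla)
qed

end

section \<open>The limit frequencies\<close>

text \<open>No law occurs here. One divergent coordinate resets all of them, so the value is either
  a genuine limit or the zero sequence and always lies in \<open>nabla\<close>.\<close>

definition limit_freq :: "path \<Rightarrow> nat \<Rightarrow> real" where
  "limit_freq \<omega> = (\<lambda>i. if \<forall>j. convergent (\<lambda>n. emp_freq n (vertex_at n \<omega>) j)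
     then lim (\<lambda>n. emp_freq n (vertex_at n \<omega>) i) else 0)"

lemma emp_freq_eq:
  assumes "\<omega> \<in> paths" "2 \<le> n" "path_forest (vertex_at n \<omega>)"
  shows "emp_freq n (vertex_at n \<omega>) = freq (shape (vertex_at n \<omega>))"
proof -
  have "sum_mset (shape (vertex_at n \<omega>)) = n - 1"
    using shape_partition(3)[OF assms(3)] vertices_src_path[OF assms(1), of "n - 1"] assms(2)
    by (simp add: vertex_at_def edge_at_def)
  then show ?thesis using assms(2,3) by (auto simp: emp_freq_def freq_def fun_eq_iff of_nat_diff)
qed

lemma emp_freq_in_nabla: "\<omega> \<in> paths \<Longrightarrow> emp_freq n (vertex_at n \<omega>) \<in> nabla"
  using emp_freq_eq[of \<omega> n] freq_in_nabla by (cases "2 \<le> n \<and> path_forest (vertex_at n \<omega>)") (auto simp: emp_freq_def)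

lemma limit_freq_in_nabla:
  assumes "\<omega> \<in> paths" shows "limit_freq \<omega> \<in> nabla"
proof (cases "\<forall>j. convergent (\<lambda>n. emp_freq n (vertex_at n \<omega>) j)")
  case True
  then have "(\<lambda>n. emp_freq n (vertex_at n \<omega>) i) \<longlonglongrightarrow> limit_freq \<omega> i" for i
    by (simp add: limit_freq_def convergent_LIMSEQ_iff)
  then show ?thesis by (rule nabla_closed_limit[OF emp_freq_in_nabla[OF assms]])
next
  case False
  have "limit_freq \<omega> = (\<lambda>_. 0)" unfolding limit_freq_def by (simp only: if_not_P[OF False])
  then show ?thesis by simp
qed

lemma sets_raw_tail: "sets (sigma paths (raw_tail_from N)) = raw_tail_from N"
  "space (sigma paths (raw_tail_from N)) = paths"
proof -
  interpret sigma_algebra paths "raw_tail_from N" by (rule raw_tail_sigma_algebra)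
  show "sets (sigma paths (raw_tail_from N)) = raw_tail_from N"
    by (rule sets_measure_of_eq)
  show "space (sigma paths (raw_tail_from N)) = paths"
    by (rule space_measure_of) (rule space_closed)
qed

lemma raw_central_tail_sigma_algebra: "sigma_algebra paths raw_central_tail"
proof -
  have eq: "raw_central_tail = (\<Inter>N\<in>{1..}. raw_tail_from N)" by (simp add: raw_central_tail_def)
  have alg: "sigma_algebra paths (raw_tail_from N)" for N by (rule raw_tail_sigma_algebra)
  show ?thesis
    unfolding sigma_algebra_iff2 eq
  proof (intro conjI ballI allI impI)
    show "(\<Inter>N\<in>{1..}. raw_tail_from N) \<subseteq> Pow paths"
      using alg[of 1] unfolding sigma_algebra_iff2 by auto
    show "{} \<in> (\<Inter>N\<in>{1..}. raw_tail_from N)"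
      using alg unfolding sigma_algebra_iff2 by blast
    show "paths - s \<in> (\<Inter>N\<in>{1..}. raw_tail_from N)" if "s \<in> (\<Inter>N\<in>{1..}. raw_tail_from N)" for s
      using alg that unfolding sigma_algebra_iff2 by blast
    show "(\<Union>i. A i) \<in> (\<Inter>N\<in>{1..}. raw_tail_from N)"
      if "range A \<subseteq> (\<Inter>N\<in>{1..}. raw_tail_from N)" for A :: "nat \<Rightarrow> path set"
    proof
      fix N :: nat assume "N \<in> {1..}"
      with that have "range A \<subseteq> raw_tail_from N" by blast
      with alg[of N] show "(\<Union>i. A i) \<in> raw_tail_from N" unfolding sigma_algebra_iff2 by blast
    qed
  qed
qed

lemma sets_raw_central_tail: "sets (sigma paths raw_central_tail) = raw_central_tail"
  "space (sigma paths raw_central_tail) = paths"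
proof -
  interpret sigma_algebra paths raw_central_tail by (rule raw_central_tail_sigma_algebra)
  show "sets (sigma paths raw_central_tail) = raw_central_tail" by (rule sets_measure_of_eq)
  show "space (sigma paths raw_central_tail) = paths"
    by (rule space_measure_of) (rule space_closed)
qed

lemma raw_central_tail_sub: "raw_central_tail \<subseteq> raw_tail_from (Suc N)"
  by (auto simp: raw_central_tail_def)

lemma raw_central_tail_sets: "T \<in> raw_central_tail \<Longrightarrow> T \<in> sets path_borel"
  using raw_central_tail_sub raw_tail_sets by blast

text \<open>Dropping the first N + 1 terms changes neither convergence nor the limit, and the
  remaining terms are functions of the tail. Convergence is written as a Cauchy condition, which is
  a countable one.\<close>

lemma limit_freq_coordinate_measurable:
  "(\<lambda>\<omega>. limit_freq \<omega> i) \<in> borel_measurable (sigma paths (raw_tail_from (Suc N)))"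
proof -
  let ?M = "sigma paths (raw_tail_from (Suc N))"
  let ?f = "\<lambda>j n \<omega>. emp_freq (n + Suc N) (vertex_at (n + Suc N) \<omega>) j"
  have f: "?f j n \<in> borel_measurable ?M" for j n
  proof (rule borel_measurableI)
    fix S :: "real set" assume "open S"
    have "?f j n -` S \<inter> space ?M = {\<omega> \<in> paths. emp_freq (n + Suc N) (src (\<omega> (n + N))) j \<in> S}"
      by (auto simp: sets_raw_tail vertex_at_def edge_at_def)
    then show "?f j n -` S \<inter> space ?M \<in> sets ?M"
      using raw_tail_state[of N "n + N" "\<lambda>t. emp_freq (n + Suc N) t j \<in> S"] by (simp add: sets_raw_tail)
  qed
  have conv: "convergent (\<lambda>n. emp_freq n (vertex_at n \<omega>) j) \<longleftrightarrow> Cauchy (\<lambda>n. ?f j n \<omega>)" for \<omega> j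
    unfolding Cauchy_convergent_iff
    using convergent_ignore_initial_segment[of "\<lambda>n. emp_freq n (vertex_at n \<omega>) j" "Suc N"] by (rule sym)
  have lim_eq: "lim (\<lambda>n. emp_freq n (vertex_at n \<omega>) i) = lim (\<lambda>n. ?f i n \<omega>)"
    if "convergent (\<lambda>n. emp_freq n (vertex_at n \<omega>) i)" for \<omega>
  proof -
    from that obtain L where L: "(\<lambda>n. emp_freq n (vertex_at n \<omega>) i) \<longlonglongrightarrow> L" by (auto simp: convergent_def)
    show ?thesis using limI[OF L] limI[OF LIMSEQ_ignore_initial_segment[OF L, of "Suc N"]] by (rule trans[OF _ sym])
  qed
  have "(\<lambda>\<omega>. if \<forall>j. Cauchy (\<lambda>n. ?f j n \<omega>) then lim (\<lambda>n. ?f i n \<omega>) else 0) \<in> borel_measurable ?M"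
  proof (rule measurable_If)
    show "{\<omega> \<in> space ?M. \<forall>j. Cauchy (\<lambda>n. ?f j n \<omega>)} \<in> sets ?M"
      by (intro sets.sets_Collect_countable_All sets_Collect_Cauchy f)
    show "(\<lambda>\<omega>. lim (\<lambda>n. ?f i n \<omega>)) \<in> borel_measurable ?M" by (intro borel_measurable_lim_metric f)
  qed simp
  moreover have "limit_freq \<omega> i = (if \<forall>j. Cauchy (\<lambda>n. ?f j n \<omega>) then lim (\<lambda>n. ?f i n \<omega>) else 0)" for \<omega>
  proof (cases "\<forall>j. convergent (\<lambda>n. emp_freq n (vertex_at n \<omega>) j)")
    case True
    then have C: "\<forall>j. Cauchy (\<lambda>n. ?f j n \<omega>)" using conv by blast
    show ?thesis unfolding limit_freq_def if_P[OF True] if_P[OF C] by (rule lim_eq) (rule True[rule_format])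
  next
    case False
    then have C: "\<not> (\<forall>j. Cauchy (\<lambda>n. ?f j n \<omega>))" using conv by blast
    show ?thesis unfolding limit_freq_def if_not_P[OF False] if_not_P[OF C] ..
  qed
  ultimately show ?thesis by (simp only:)
qed

lemma limit_freq_measurable: "limit_freq \<in> measurable (sigma paths raw_central_tail) nabla_borel"
  unfolding nabla_borel_def
proof (rule measurable_restrict_space2)
  show "limit_freq \<in> space (sigma paths raw_central_tail) \<rightarrow> nabla"
    using limit_freq_in_nabla by (auto simp: sets_raw_central_tail)
  show "limit_freq \<in> borel_measurable (sigma paths raw_central_tail)"
  proof (rule measurable_coordinatewise_then_product)
    fix i
    show "(\<lambda>\<omega>. limit_freq \<omega> i) \<in> borel_measurable (sigma paths raw_central_tail)"
    proof (rule measurableI)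
      fix S :: "real set" assume S: "S \<in> sets borel"
      have "(\<lambda>\<omega>. limit_freq \<omega> i) -` S \<inter> paths \<in> raw_tail_from N" if "N \<ge> 1" for N
        using measurable_sets[OF limit_freq_coordinate_measurable[of i "N - 1"] S] that by (simp add: sets_raw_tail)
      then show "(\<lambda>\<omega>. limit_freq \<omega> i) -` S \<inter> space (sigma paths raw_central_tail) \<in> sets (sigma paths raw_central_tail)"
        by (simp add: sets_raw_central_tail) (simp add: raw_central_tail_def)
    qed simp
  qed
qed

lemma space_nabla_borel [simp]: "space nabla_borel = nabla"
  by (simp add: nabla_borel_def space_restrict_space)

lemma limit_freq_path_borel: "limit_freq \<in> measurable path_borel nabla_borel"
proof (rule measurableI)
  fix B assume "B \<in> sets nabla_borel"
  from measurable_sets[OF limit_freq_measurable this]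
  show "limit_freq -` B \<inter> space path_borel \<in> sets path_borel"
    using raw_central_tail_sets by (simp add: sets_raw_central_tail)
qed (use limit_freq_in_nabla in simp)

lemma coordinate_nabla_borel: "(\<lambda>p. p i) \<in> borel_measurable nabla_borel"
  unfolding nabla_borel_def by (intro measurable_restrict_space1 borel_measurable_continuous_onI) simp

lemma continuous_nabla_borel: "continuous_on nabla f \<Longrightarrow> f \<in> borel_measurable nabla_borel" for f :: "(nat \<Rightarrow> real) \<Rightarrow> real"
  unfolding nabla_borel_def by (rule borel_measurable_continuous_on_restrict)

section \<open>Weak convergence of the empirical measures\<close>

lemma measure_atomic:
  assumes w: "\<And>i. 0 \<le> w i" "summable w" and A: "A \<in> sets borel"
  shows "measure (atomic w x) A = suminf (\<lambda>i. if x i \<in> A then w i else 0)"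
    "emeasure (atomic w x) A = ennreal (suminf (\<lambda>i. if x i \<in> A then w i else 0))"
proof -
  let ?D = "density (count_space UNIV) (\<lambda>i. ennreal (w i))"
  have x: "x \<in> measurable ?D borel" by simp
  have s: "summable (\<lambda>i. if x i \<in> A then w i else 0)"
    using w by (intro summable_comparison_test'[OF w(2), of 0]) auto
  have "emeasure (atomic w x) A = emeasure ?D (x -` A)"
    unfolding atomic_def using A x by (subst emeasure_distr) auto
  also have "\<dots> = (\<integral>\<^sup>+i. ennreal (w i) * indicator (x -` A) i \<partial>count_space UNIV)"
    by (rule emeasure_density) auto
  also have "\<dots> = (\<integral>\<^sup>+i. ennreal (if x i \<in> A then w i else 0) \<partial>count_space UNIV)"
    by (intro nn_integral_cong) (auto simp: indicator_def)
  also have "\<dots> = suminf (\<lambda>i. ennreal (if x i \<in> A then w i else 0))"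
    by (rule nn_integral_count_space_nat)
  also have "\<dots> = ennreal (suminf (\<lambda>i. if x i \<in> A then w i else 0))"
    using w s by (intro suminf_ennreal2) auto
  finally show e: "emeasure (atomic w x) A = ennreal (suminf (\<lambda>i. if x i \<in> A then w i else 0))" .
  have "0 \<le> suminf (\<lambda>i. if x i \<in> A then w i else 0)" using w s by (intro suminf_nonneg) auto
  then show "measure (atomic w x) A = suminf (\<lambda>i. if x i \<in> A then w i else 0)"
    using e by (simp add: measure_def)
qed

lemma finite_borel_atomic:
  assumes "\<And>i. 0 \<le> w i" "summable w"
  shows "finite_borel_measure (atomic w x)"
proof -
  have sp: "space (atomic w x) = UNIV" "sets (atomic w x) = sets borel" by (simp_all add: atomic_def)
  interpret finite_measure "atomic w x"
    by standard (simp add: sp measure_atomic(2)[OF assms])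
  show ?thesis by standard (rule sp(2))
qed

lemma nu_weights:
  assumes "p \<in> nabla"
  shows "0 \<le> case_nat (dust p) p i" "summable (case_nat (dust p) p)"
    "suminf (\<lambda>i. if case_nat 0 p i \<in> A then case_nat (dust p) p i else 0) =
      (if 0 \<in> A then dust p else 0) + suminf (\<lambda>i. if p i \<in> A then p i else 0)"
proof -
  show "0 \<le> case_nat (dust p) p i" using nablaD(2,4)[OF assms] by (simp add: dust_def split: nat.split)
  have "summable (\<lambda>n. case_nat (dust p) p (Suc n))" using nablaD(3)[OF assms] by simp
  then show "summable (case_nat (dust p) p)" by (simp only: summable_Suc_iff)
  let ?g = "\<lambda>i. if case_nat 0 p i \<in> A then case_nat (dust p) p i else 0"
  have g: "(\<lambda>n. ?g (Suc n)) = (\<lambda>i. if p i \<in> A then p i else 0)" "?g 0 = (if 0 \<in> A then dust p else 0)" by auto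
  have "summable (\<lambda>i. if p i \<in> A then p i else 0)"
    using nablaD(2)[OF assms] by (intro summable_comparison_test'[OF nablaD(3)[OF assms], of 0]) auto
  then have "summable (\<lambda>n. ?g (Suc n))" unfolding g .
  then have "summable ?g" by (rule iffD1[OF summable_Suc_iff])
  from suminf_split_head[OF this] show "suminf ?g = (if 0 \<in> A then dust p else 0) + suminf (\<lambda>i. if p i \<in> A then p i else 0)"
    unfolding g by linarith
qed

text \<open>For t > 0 the mass above t sits on the finitely many indices with t < 1/(i+1), and
  continuity at t rules out p i = t, so this mass converges termwise. What is lost in the limit
  becomes the atom at 0. For t <= 0 the approximating distribution functions vanish; 0 is a
  continuity point only when there is no dust.\<close>

lemma weak_conv_nu:
  assumes x: "\<And>N. x N \<in> nabla" "\<And>N. N \<ge> N0 \<Longrightarrow> suminf (x N) = 1" and p: "p \<in> nabla"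
    and lim: "\<And>i. (\<lambda>N. x N i) \<longlonglongrightarrow> p i" and M: "\<And>N. N \<ge> N0 \<Longrightarrow> M N = atomic (x N) (x N)"
  shows "weak_conv_m M (nu p)"
  unfolding weak_conv_m_def weak_conv_def
proof (intro allI impI)
  fix t assume cont: "isCont (cdf (nu p)) t"
  note w = nablaD(2,3)[OF x(1)]
  note nw = nu_weights[OF p]
  interpret nu: finite_borel_measure "nu p" unfolding nu_def by (rule finite_borel_atomic[OF nw(1,2)])
  have m0: "measure (nu p) {t} = 0" using cont nu.isCont_cdf by blast
  have split: "suminf (\<lambda>i. if y i \<in> {..t} then y i else 0) = suminf y - suminf (\<lambda>i. if t < y i then y i else 0)"
    if y: "y \<in> nabla" for y
  proof -
    have "summable (\<lambda>i. if t < y i then y i else 0)"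
      using nablaD(2)[OF y] by (intro summable_comparison_test'[OF nablaD(3)[OF y], of 0]) auto
    then have "suminf y - suminf (\<lambda>i. if t < y i then y i else 0) = suminf (\<lambda>i. y i - (if t < y i then y i else 0))"
      by (rule suminf_diff[OF nablaD(3)[OF y]])
    also have "\<dots> = suminf (\<lambda>i. if y i \<in> {..t} then y i else 0)" by (intro suminf_cong) auto
    finally show ?thesis ..
  qed
  have cdf_N: "cdf (M N) t = 1 - suminf (\<lambda>i. if t < x N i then x N i else 0)" if "N \<ge> N0" for N
    using measure_atomic(1)[OF w, of "{..t}" N "x N"] split[OF x(1)] x(2)[OF that] M[OF that] by (simp add: cdf_def)
  have cdf_p: "cdf (nu p) t = (if 0 \<le> t then dust p else 0) + suminf p - suminf (\<lambda>i. if t < p i then p i else 0)"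
    unfolding cdf_def nu_def using measure_atomic(1)[OF nw(1,2), of "{..t}"] nw(3)[of "{..t}"] split[OF p] by simp
  show "(\<lambda>N. cdf (M N) t) \<longlonglongrightarrow> cdf (nu p) t"
  proof (cases "t > 0")
    case True
    have ne: "p i \<noteq> t" for i
    proof
      assume pi: "p i = t"
      have s: "summable (\<lambda>i. if p i \<in> {t} then p i else 0)"
        using nablaD(2)[OF p] by (intro summable_comparison_test'[OF nablaD(3)[OF p], of 0]) auto
      have "measure (nu p) {t} = suminf (\<lambda>i. if p i \<in> {t} then p i else 0)"
        unfolding nu_def using measure_atomic(1)[OF nw(1,2), of "{t}"] nw(3)[of "{t}"] True by simp
      also have "\<dots> \<ge> (\<Sum>i\<in>{i}. if p i \<in> {t} then p i else 0)"
        using nablaD(2)[OF p] by (intro sum_le_suminf s) auto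
      finally show False using m0 pi True by simp
    qed
    have "(\<lambda>N. suminf (\<lambda>i. if t < x N i then x N i else 0)) \<longlonglongrightarrow> suminf (\<lambda>i. if t < p i then p i else 0)"
    proof (rule tannery_sequence)
      show "(\<lambda>N. if t < x N i then x N i else 0) \<longlonglongrightarrow> (if t < p i then p i else 0)" for i
      proof (cases "t < p i")
        case True
        then have "\<forall>\<^sub>F N in sequentially. t < x N i" using lim by (rule order_tendstoD(1)[rotated])
        then have "\<forall>\<^sub>F N in sequentially. x N i = (if t < x N i then x N i else 0)" by eventually_elim simp
        from Lim_transform_eventually[OF lim this] True show ?thesis by (simp only: if_P)
      next
        case False
        with ne[of i] have "p i < t" by simp
        with lim have "\<forall>\<^sub>F N in sequentially. x N i < t" by (rule order_tendstoD(2))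
        then have "\<forall>\<^sub>F N in sequentially. 0 = (if t < x N i then x N i else 0)" by eventually_elim simp
        with False show ?thesis by (simp add: Lim_transform_eventually[OF tendsto_const])
      qed
      show "\<bar>if t < x N i then x N i else 0\<bar> \<le> (if t < 1 / real (Suc i) then 1 else 0)" for N i
        using nablaD(2,6,7)[OF x(1)[of N], of i] by auto
      have fin: "finite {i. t < 1 / real (Suc i)}"
      proof -
        obtain n :: nat where "1 / t < real n" using reals_Archimedean2 by blast
        have "{i. t < 1 / real (Suc i)} \<subseteq> {..<n}"
        proof safe
          fix i assume "t < 1 / real (Suc i)"
          then have "real (Suc i) < 1 / t" using True by (subst (asm) less_divide_eq) (simp add: less_divide_eq mult.commute)
          with \<open>1 / t < real n\<close> show "i < n" by linarith
        qed
        then show ?thesis by (rule finite_subset) simp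
      qed
      show "summable (\<lambda>i. if t < 1 / real (Suc i) then 1 else (0::real))"
        by (rule summable_finite[OF fin]) auto
    qed
    then have "(\<lambda>N. 1 - suminf (\<lambda>i. if t < x N i then x N i else 0)) \<longlonglongrightarrow> cdf (nu p) t"
      using True by (auto simp: cdf_p dust_def intro!: tendsto_intros)
    then show ?thesis
      by (rule Lim_transform_eventually) (use cdf_N in \<open>auto simp: eventually_sequentially intro!: exI[of _ N0]\<close>)
  next
    case False
    have full: "suminf (\<lambda>i. if t < y i then y i else 0) = suminf y" if "y \<in> nabla" for y
    proof (intro suminf_cong)
      show "(if t < y i then y i else 0) = y i" for i using nablaD(2)[OF that, of i] False by auto
    qed
    have "cdf (nu p) t = 0"
    proof (cases "t = 0")
      case True
      have "measure (nu p) {0} = dust p + suminf (\<lambda>i. if p i \<in> {0} then p i else 0)"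
        unfolding nu_def using measure_atomic(1)[OF nw(1,2), of "{0}"] nw(3)[of "{0}"] by simp
      also have "(\<lambda>i. if p i \<in> {0} then p i else 0) = (\<lambda>i. 0)" by auto
      finally have "dust p = 0" using m0 True by simp
      then show ?thesis unfolding cdf_p full[OF p] by simp
    next
      case False
      with \<open>\<not> t > 0\<close> show ?thesis unfolding cdf_p full[OF p] by simp
    qed
    moreover have "cdf (M N) t = 0" if "N \<ge> N0" for N
      using cdf_N[OF that] full[OF x(1)] x(2)[OF that] by simp
    ultimately show ?thesis
      by (intro tendsto_eventually) (auto simp: eventually_sequentially)
  qed
qed

section \<open>Martin convergence\<close>

lemma martin_kernel_bounds:
  assumes "0 \<notin># \<kappa>" "0 \<notin># \<rho>" shows "0 \<le> martin_kernel \<kappa> \<rho>" "martin_kernel \<kappa> \<rho> \<le> 1"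
  using martin_kernel_eq[OF assms] u_sampling_le_1(1)[OF assms(1), of \<rho>] by auto

lemma martin_vertex_topspace: "\<rho> \<in> partitions \<Longrightarrow> martin_vertex \<rho> \<in> topspace martin_cube"
  by (auto simp: martin_cube_def martin_vertex_def partitions_def martin_kernel_bounds)

text \<open>Each kernel coordinate eventually equals \<open>u\<close> times a sampling probability,
  whose limit is the paintbox value. The boundary point lies in the closure because vertices
  converge to it.\<close>

lemma martin_limit:
  assumes \<rho>: "\<And>n. 0 \<notin># \<rho> n" "\<And>k. k \<ge> 2 \<Longrightarrow> (\<lambda>n. psum k (\<rho> n)) \<longlonglongrightarrow> power_sum k p"
    and size: "\<And>n. 0 < sum_mset (\<rho> n)" "filterlim (\<lambda>n. sum_mset (\<rho> n)) at_top sequentially"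
  shows "limitin martin_compactification (\<lambda>n. martin_vertex (\<rho> n)) (martin_boundary_point p) sequentially"
proof -
  have vp: "\<rho> n \<in> partitions" for n using \<rho>(1) by (simp add: partitions_def)
  have lim: "(\<lambda>n. martin_kernel \<kappa> (\<rho> n)) \<longlonglongrightarrow> real (u (path_forest_tree \<kappa>)) * paintbox p \<kappa>" if \<kappa>: "0 \<notin># \<kappa>" for \<kappa>
  proof -
    have "(\<lambda>n. real (u (path_forest_tree \<kappa>)) * sampling \<kappa> (\<rho> n)) \<longlonglongrightarrow> real (u (path_forest_tree \<kappa>)) * paintbox p \<kappa>"
      by (intro tendsto_mult tendsto_const sampling_tendsto size \<rho>(2) \<kappa>)
    moreover have "\<forall>\<^sub>F n in sequentially. real (u (path_forest_tree \<kappa>)) * sampling \<kappa> (\<rho> n) = martin_kernel \<kappa> (\<rho> n)"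
      using size(2)[unfolded filterlim_at_top, rule_format, of "sum_mset \<kappa>"]
      by eventually_elim (simp add: martin_kernel_eq[OF \<kappa> \<rho>(1)])
    ultimately show ?thesis by (rule Lim_transform_eventually)
  qed
  have cube: "limitin martin_cube (\<lambda>n. martin_vertex (\<rho> n)) (martin_boundary_point p) sequentially"
    unfolding martin_cube_def limitin_componentwise
  proof (intro conjI ballI)
    show "martin_boundary_point p \<in> extensional partitions" by (simp add: martin_boundary_point_def)
    show "\<forall>\<^sub>F n in sequentially. martin_vertex (\<rho> n) \<in> topspace (product_topology (\<lambda>_. top_of_set {0..1}) partitions)"
      using martin_vertex_topspace[OF vp] by (simp add: martin_cube_def)
    fix \<kappa> :: "nat multiset" assume \<kappa>: "\<kappa> \<in> partitions"
    then have k0: "0 \<notin># \<kappa>" by (simp add: partitions_def)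
    have b: "0 \<le> martin_kernel \<kappa> (\<rho> n) \<and> martin_kernel \<kappa> (\<rho> n) \<le> 1" for n
      using martin_kernel_bounds[OF k0 \<rho>(1)] by simp
    have "real (u (path_forest_tree \<kappa>)) * paintbox p \<kappa> \<in> {0..1}"
      using LIMSEQ_le_const[OF lim[OF k0], of 0] LIMSEQ_le_const2[OF lim[OF k0], of 1] b by auto
    then show "limitin (top_of_set {0..1}) (\<lambda>n. martin_vertex (\<rho> n) \<kappa>) (martin_boundary_point p \<kappa>) sequentially"
      using lim[OF k0] b \<kappa>
      by (simp add: limitin_subtopology martin_vertex_def martin_boundary_point_def paintbox_def)
  qed
  have clos: "martin_vertex \<rho>' \<in> martin_cube closure_of (martin_vertex ` partitions)" if "\<rho>' \<in> partitions" for \<rho>'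
    using closure_of_subset[of "martin_vertex ` partitions" martin_cube] martin_vertex_topspace that by blast
  have "martin_boundary_point p \<in> martin_cube closure_of (martin_vertex ` partitions)"
    unfolding in_closure_of
  proof (intro conjI allI impI)
    show "martin_boundary_point p \<in> topspace martin_cube" using cube by (rule limitin_topspace)
    fix T assume "martin_boundary_point p \<in> T \<and> openin martin_cube T"
    with cube have "\<forall>\<^sub>F n in sequentially. martin_vertex (\<rho> n) \<in> T" by (simp add: limitin_def)
    then obtain n where "martin_vertex (\<rho> n) \<in> T" by (auto simp: eventually_sequentially)
    with vp show "\<exists>y. y \<in> martin_vertex ` partitions \<and> y \<in> T" by blast
  qed
  with cube clos[OF vp] show ?thesis
    unfolding martin_compactification_def limitin_subtopology by simp
qed

section \<open>Almost sure limits of the observables\<close>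

context central_pf
begin

definition typical :: "path \<Rightarrow> bool" where
  "typical \<omega> \<longleftrightarrow> pf_path \<omega> \<and> (\<forall>i. (\<lambda>N. freq (Y N \<omega>) i) \<longlonglongrightarrow> limit_freq \<omega> i)"

lemma emp_freq_Suc: "pf_path \<omega> \<Longrightarrow> 1 \<le> N \<Longrightarrow> emp_freq (Suc N) (vertex_at (Suc N) \<omega>) = freq (Y N \<omega>)"
  using emp_freq_eq[of \<omega> "Suc N"] pf_pathD(1,2) by (simp add: vertex_at_def edge_at_def)

lemma emp_freq_tendsto_iff:
  assumes "pf_path \<omega>"
  shows "(\<lambda>n. emp_freq n (vertex_at n \<omega>) i) \<longlonglongrightarrow> l \<longleftrightarrow> (\<lambda>N. freq (Y N \<omega>) i) \<longlonglongrightarrow> l"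
proof -
  have "(\<lambda>n. emp_freq n (vertex_at n \<omega>) i) \<longlonglongrightarrow> l \<longleftrightarrow> (\<lambda>N. emp_freq (Suc N) (vertex_at (Suc N) \<omega>) i) \<longlonglongrightarrow> l"
    by (rule filterlim_sequentially_Suc[symmetric])
  also have "\<dots> \<longleftrightarrow> (\<lambda>N. freq (Y N \<omega>) i) \<longlonglongrightarrow> l"
    using emp_freq_Suc[OF assms] by (intro tendsto_cong) (auto simp: eventually_sequentially intro!: exI[of _ 1])
  finally show ?thesis .
qed

lemma AE_typical: "AE \<omega> in \<mu>. typical \<omega>"
  using AE_pf AE_freq_convergent
proof eventually_elim
  case (elim \<omega>)
  then obtain p where p: "(\<lambda>n. emp_freq n (vertex_at n \<omega>) i) \<longlonglongrightarrow> p i" for i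
    using emp_freq_tendsto_iff by blast
  then have "\<forall>j. convergent (\<lambda>n. emp_freq n (vertex_at n \<omega>) j)" by (auto simp: convergent_def)
  from if_P[OF this] have "limit_freq \<omega> i = lim (\<lambda>n. emp_freq n (vertex_at n \<omega>) i)" for i
    unfolding limit_freq_def by (rule fun_cong[of _ _ _, OF ext])
  with limI[OF p] have "limit_freq \<omega> i = p i" for i by simp
  with p elim show ?case by (simp add: typical_def emp_freq_tendsto_iff)
qed

lemma typicalD:
  assumes "typical \<omega>"
  shows "pf_path \<omega>" "\<omega> \<in> paths" "limit_freq \<omega> \<in> nabla"
    "(\<lambda>n. emp_freq n (vertex_at n \<omega>) i) \<longlonglongrightarrow> limit_freq \<omega> i"
    "k \<ge> 2 \<Longrightarrow> (\<lambda>N. psum k (Y N \<omega>)) \<longlonglongrightarrow> power_sum k (limit_freq \<omega>)"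
    "0 \<notin># \<kappa> \<Longrightarrow> (\<lambda>N. sampling \<kappa> (Y N \<omega>)) \<longlonglongrightarrow> paintbox (limit_freq \<omega>) \<kappa>"
    "weak_conv_m (\<lambda>n. emp_nu n (vertex_at n \<omega>)) (nu (limit_freq \<omega>))"
    "limitin martin_compactification (\<lambda>n. martin_vertex (shape (vertex_at n \<omega>)))
      (martin_boundary_point (limit_freq \<omega>)) sequentially"
proof -
  show pf: "pf_path \<omega>" using assms by (simp add: typical_def)
  show w: "\<omega> \<in> paths" by (rule pf_pathD(1)[OF pf])
  show nab: "limit_freq \<omega> \<in> nabla" by (rule limit_freq_in_nabla[OF w])
  have lim: "(\<lambda>N. freq (Y N \<omega>) i) \<longlonglongrightarrow> limit_freq \<omega> i" for i using assms by (simp add: typical_def)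
  show emp: "(\<lambda>n. emp_freq n (vertex_at n \<omega>) i) \<longlonglongrightarrow> limit_freq \<omega> i" for i
    using lim emp_freq_tendsto_iff[OF pf] by blast
  have psum: "(\<lambda>N. psum k (Y N \<omega>)) \<longlonglongrightarrow> power_sum k (limit_freq \<omega>)" if k: "k \<ge> 2" for k
  proof -
    have "\<forall>\<^sub>F N in sequentially. power_sum k (freq (Y N \<omega>)) = psum k (Y N \<omega>)"
      using pf_pathD(4)[OF pf] k by (auto simp: eventually_sequentially intro!: exI[of _ 1] power_sum_freq)
    with power_sum_tendsto[OF freq_in_nabla lim k] show ?thesis by (rule Lim_transform_eventually)
  qed
  show "k \<ge> 2 \<Longrightarrow> (\<lambda>N. psum k (Y N \<omega>)) \<longlonglongrightarrow> power_sum k (limit_freq \<omega>)" by (rule psum)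
  have Y: "0 \<notin># Y N \<omega>" "sum_mset (Y N \<omega>) = N" for N using pf_pathD[OF pf] by auto
  have psum': "(\<lambda>N. psum k (Y (Suc N) \<omega>)) \<longlonglongrightarrow> power_sum k (limit_freq \<omega>)" if "k \<ge> 2" for k
    by (rule LIMSEQ_Suc[OF psum[OF that]])
  have size: "0 < sum_mset (Y (Suc N) \<omega>)" "filterlim (\<lambda>N. sum_mset (Y (Suc N) \<omega>)) at_top sequentially" for N
    unfolding Y(2) by (auto intro: filterlim_Suc)
  show "0 \<notin># \<kappa> \<Longrightarrow> (\<lambda>N. sampling \<kappa> (Y N \<omega>)) \<longlonglongrightarrow> paintbox (limit_freq \<omega>) \<kappa>"
    by (rule LIMSEQ_imp_Suc, rule sampling_tendsto[OF size(1) psum' _ size(2)])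
  show "weak_conv_m (\<lambda>n. emp_nu n (vertex_at n \<omega>)) (nu (limit_freq \<omega>))"
  proof (rule weak_conv_nu[where ?x = "\<lambda>n. emp_freq n (vertex_at n \<omega>)" and ?N0.0 = 2, OF _ _ nab emp])
    show "emp_freq N (vertex_at N \<omega>) \<in> nabla" for N by (rule emp_freq_in_nabla[OF w])
    fix N :: nat assume N: "2 \<le> N"
    then have pfN: "path_forest (vertex_at N \<omega>)" using pf_pathD(2)[OF pf] by (simp add: vertex_at_def edge_at_def)
    obtain M where M: "N = Suc M" "1 \<le> M" using N by (cases N) auto
    show "suminf (emp_freq N (vertex_at N \<omega>)) = 1"
      using emp_freq_Suc[OF pf M(2)] suminf_freq[of "Y M \<omega>"] Y(2)[of M] M by (simp add: sums_iff)
    show "emp_nu N (vertex_at N \<omega>) = atomic (emp_freq N (vertex_at N \<omega>)) (emp_freq N (vertex_at N \<omega>))"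
      using N pfN by (simp add: emp_nu_def emp_freq_def)
  qed
  have "limitin martin_compactification (\<lambda>n. martin_vertex (Y (Suc n) \<omega>))
      (martin_boundary_point (limit_freq \<omega>)) sequentially"
    by (rule martin_limit[OF Y(1) psum' size])
  \<comment> \<open>\<open>vertex_at (n + 2)\<close> reads index n + 1 and so carries
    \<open>Y (Suc n)\<close>; the offset skips the empty partition.\<close>
  then have "limitin martin_compactification (\<lambda>n. martin_vertex (shape (vertex_at (n + 2) \<omega>)))
      (martin_boundary_point (limit_freq \<omega>)) sequentially"
    by (simp add: vertex_at_def edge_at_def)
  then show "limitin martin_compactification (\<lambda>n. martin_vertex (shape (vertex_at n \<omega>)))
      (martin_boundary_point (limit_freq \<omega>)) sequentially"
    by (rule limitin_sequentially_offset_rev)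
qed

end

section \<open>The proportion of singletons\<close>

text \<open>Compared factor by factor, the right side exceeds the left by (a-1) * (b-1). In the
  truncated range the left side is zero unless k = 0. This is the negative dependence of two
  singletons in a sample.\<close>

lemma fall_mult_le:
  assumes "1 \<le> a" "1 \<le> b"
  shows "fall k (n + 2 - a - b) * fall k n \<le> fall k (n + 1 - a) * fall k (n + 1 - b)"
proof (cases "k \<le> n + 2 - a - b \<and> a + b \<le> n + 2")
  case True
  then have eq: "real (n + 2 - a - b) = real n + 2 - real a - real b" "real (n + 1 - a) = real n + 1 - real a"
    "real (n + 1 - b) = real n + 1 - real b" using assms by auto
  have "(real (n + 2 - a - b) - real i) * (real n - real i) \<le> (real (n + 1 - a) - real i) * (real (n + 1 - b) - real i)" for i
  proof -
    have "(real n + 1 - real a - real i) * (real n + 1 - real b - real i) - (real n + 2 - real a - real b - real i) * (real n - real i)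
        = (real a - 1) * (real b - 1)" by (simp add: algebra_simps)
    also have "\<dots> \<ge> 0" using assms by simp
    finally show ?thesis unfolding eq by linarith
  qed
  moreover have "0 \<le> (real (n + 2 - a - b) - real i) * (real n - real i)" if "i < k" for i
    using True that assms by (intro mult_nonneg_nonneg) auto
  ultimately show ?thesis unfolding fall_def prod.distrib[symmetric] by (intro prod_mono) auto
next
  case False
  show ?thesis
  proof (cases "k = 0")
    case False
    with \<open>\<not> (k \<le> _ \<and> _)\<close> have "n + 2 - a - b < k" by auto
    then show ?thesis by (simp add: fall_eq_0)
  qed simp
qed

text \<open>Factor by factor the difference is a - 1. The inequality changes the reference total
  from n + 1 to n + 2, as needed to compare with the mean.\<close>

lemma fall_shift_le:
  assumes "1 \<le> a" shows "fall k (n + 1 - a) * fall k (n + 1) \<le> fall k (n + 2 - a) * fall k n"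
proof (cases "k \<le> n + 1 - a \<and> a \<le> n + 1")
  case True
  then have eq: "real (n + 2 - a) = real n + 2 - real a" "real (n + 1 - a) = real n + 1 - real a" by auto
  have "(real (n + 1 - a) - real i) * (real (n + 1) - real i) \<le> (real (n + 2 - a) - real i) * (real n - real i)" for i
  proof -
    have "(real n + 2 - real a - real i) * (real n - real i) - (real n + 1 - real a - real i) * (real n + 1 - real i) = real a - 1"
      by (simp add: algebra_simps)
    also have "\<dots> \<ge> 0" using assms by simp
    finally show ?thesis unfolding eq by (simp add: add.commute)
  qed
  moreover have "0 \<le> (real (n + 1 - a) - real i) * (real (n + 1) - real i)" if "i < k" for i
    using True that assms by (intro mult_nonneg_nonneg) auto
  ultimately show ?thesis unfolding fall_def prod.distrib[symmetric] by (intro prod_mono) auto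
next
  case False
  show ?thesis
  proof (cases "k = 0")
    case False
    with \<open>\<not> (k \<le> _ \<and> _)\<close> have "n + 1 - a < k" by auto
    then show ?thesis by (simp add: fall_eq_0)
  qed simp
qed

text \<open>Every factor of the falling factorial is at least N - l - m, and Bernoulli's inequality
  bounds the resulting power. If that base is negative, the left side is negative.\<close>

lemma fall_bernoulli:
  assumes "l \<le> N" "0 < N"
  shows "1 - real m * (real l / real N) - (real m)\<^sup>2 / real N \<le> fall m (N - l) / real N ^ m"
proof -
  define x where "x = real l / real N + real m / real N"
  have x: "0 \<le> x" by (simp add: x_def)
  have eq: "1 - real m * (real l / real N) - (real m)\<^sup>2 / real N = 1 - real m * x"
    by (simp add: x_def power2_eq_square distrib_left)
  show ?thesis
  proof (cases "x \<le> 1 \<and> m \<noteq> 0")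
    case True
    then have lm: "l + m \<le> N" using assms by (simp add: x_def add_divide_distrib[symmetric] divide_le_eq)
    have "1 - real m * x \<le> (1 - x) ^ m" using Bernoulli_inequality[of "- x" m] True by simp
    also have "1 - x = (real N - real l - real m) / real N" using assms by (simp add: x_def field_simps)
    also have "\<dots> ^ m = (\<Prod>i<m. real N - real l - real m) / real N ^ m" by (simp add: power_divide)
    also have "\<dots> \<le> fall m (N - l) / real N ^ m"
      unfolding fall_def using lm by (intro divide_right_mono prod_mono) auto
    finally show ?thesis unfolding eq .
  next
    case False
    then have "m = 0 \<or> 1 - real m * x < 0"
    proof (cases "m = 0")
      case False
      with \<open>\<not> (x \<le> 1 \<and> m \<noteq> 0)\<close> have "1 < x" "1 \<le> real m" by auto
      then have "1 * 1 < real m * x" by (intro mult_le_less_imp_less) auto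
      then show ?thesis by simp
    qed simp
    then show ?thesis unfolding eq
    proof
      assume "1 - real m * x < 0"
      also have "0 \<le> fall m (N - l) / real N ^ m" by simp
      finally show "1 - real m * x \<le> fall m (N - l) / real N ^ m" by simp
    qed simp
  qed
qed

lemma sum_sum_mset_swap: "(\<Sum>a\<in>A. \<Sum>b\<in>#B. f a b) = (\<Sum>b\<in>#B. \<Sum>a\<in>A. f a b :: 'b::comm_monoid_add)"
  by (induction B) (auto simp: sum.distrib)

lemma sum_mset_divide: "(\<Sum>a\<in>#A. f a / c) = (\<Sum>a\<in>#A. f a) / (c :: 'b::field)"
  by (induction A) (auto simp: add_divide_distrib)

text \<open>The conditional expectation of the proportion of singletons at level \<open>M\<close> given the partition
  \<open>\<rho>\<close> at a later level.\<close>

definition singleton_mean :: "nat \<Rightarrow> nat multiset \<Rightarrow> real" where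
  "singleton_mean M \<rho> =
    (\<Sum>\<kappa>\<in>parts M. real (u (path_forest_tree \<kappa>)) * sampling \<kappa> \<rho> * (real (count \<kappa> 1) / real M))"

lemma count_1_le: "\<kappa> \<in> parts M \<Longrightarrow> count \<kappa> 1 \<le> M"
proof -
  have "count \<kappa> 1 \<le> sum_mset \<kappa>" for \<kappa> :: "nat multiset" by (induction \<kappa>) auto
  then show "\<kappa> \<in> parts M \<Longrightarrow> count \<kappa> 1 \<le> M" by (auto simp: parts_def)
qed

lemma singleton_mean_bounds:
  assumes "M \<le> sum_mset \<rho>" shows "0 \<le> singleton_mean M \<rho>" "singleton_mean M \<rho> \<le> 1"
proof -
  show "0 \<le> singleton_mean M \<rho>" unfolding singleton_mean_def by (intro sum_nonneg) (auto simp: sampling_nonneg)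
  have "singleton_mean M \<rho> \<le> (\<Sum>\<kappa>\<in>parts M. real (u (path_forest_tree \<kappa>)) * sampling \<kappa> \<rho> * 1)"
    unfolding singleton_mean_def
    using count_1_le by (intro sum_mono mult_left_mono) (auto simp: sampling_nonneg divide_le_eq)
  with sum_u_sampling[OF assms] show "singleton_mean M \<rho> \<le> 1" by simp
qed

text \<open>The expected proportion is the probability that one marked element is alone: choose its
  block, of size l, and draw the other m elements from the N - l elements outside it.\<close>

lemma singleton_mean_eq:
  assumes "Suc m \<le> sum_mset \<rho>"
  shows "singleton_mean (Suc m) \<rho> = (\<Sum>l\<in>#\<rho>. real l * fall m (sum_mset \<rho> - l) / fall (Suc m) (sum_mset \<rho>))"
proof -
  let ?F = "fall (Suc m) (sum_mset \<rho>)"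
  let ?u = "\<lambda>\<kappa>. real (u (path_forest_tree \<kappa>))"
  have "singleton_mean (Suc m) \<rho> = (\<Sum>\<kappa>\<in>parts (Suc m). ?u \<kappa> * real (count \<kappa> 1) * sfall \<kappa> \<rho>) / (?F * real (Suc m))"
    unfolding singleton_mean_def sum_divide_distrib by (intro sum.cong) (auto simp: sampling_def parts_def)
  also have "\<dots> = (\<Sum>\<kappa>\<in>parts m. ?u \<kappa> * sfall (add_mset 1 \<kappa>) \<rho>) / ?F"
    unfolding sum_parts_count_1 by simp
  also have "(\<Sum>\<kappa>\<in>parts m. ?u \<kappa> * sfall (add_mset 1 \<kappa>) \<rho>) = (\<Sum>\<kappa>\<in>parts m. \<Sum>l\<in>#\<rho>. real l * (?u \<kappa> * sfall \<kappa> (\<rho> - {#l#})))"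
    by (simp only: sfall_add fall_1 sum_mset_distrib_left mult.left_commute)
  also have "\<dots> = (\<Sum>l\<in>#\<rho>. \<Sum>\<kappa>\<in>parts m. real l * (?u \<kappa> * sfall \<kappa> (\<rho> - {#l#})))"
    by (rule sum_sum_mset_swap)
  also have "\<dots> = (\<Sum>l\<in>#\<rho>. real l * fall m (sum_mset \<rho> - l))"
    unfolding sum_distrib_left[symmetric] sum_u_sfall by (intro sum_mset_cong) (auto dest!: multi_member_split)
  finally show ?thesis by (simp add: sum_mset_divide)
qed

text \<open>Two marked singletons lie in distinct blocks l, l' and the remaining m elements avoid
  both. By negative dependence this costs at most the product of two single-mark probabilities, up
  to N/(N-1). The marks use up two of the m + 2 elements, so the comparison is with the mean at
  level m + 1.\<close>

lemma singleton_pairs_le: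
  assumes "Suc (Suc m) \<le> sum_mset \<rho>"
  shows "(\<Sum>\<kappa>\<in>parts (Suc (Suc m)). real (u (path_forest_tree \<kappa>)) * sampling \<kappa> \<rho> *
      (real (count \<kappa> 1) * (real (count \<kappa> 1) - 1))) \<le>
    real (Suc (Suc m)) * real (Suc m) * (real (sum_mset \<rho>) / (real (sum_mset \<rho>) - 1) * (singleton_mean (Suc m) \<rho>)\<^sup>2)"
    (is "?L \<le> _")
proof -
  let ?u = "\<lambda>\<kappa>. real (u (path_forest_tree \<kappa>))"
  \<comment> \<open>Writing the total as n + 2 avoids truncated subtraction in the falling
    factorials.\<close>
  obtain n where n: "sum_mset \<rho> = n + 2" "m \<le> n" using assms by (metis Suc_le_mono add_2_eq_Suc' le_Suc_ex add_Suc le_add1)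
  define F where "F = fall m n"
  define F1 where "F1 = fall m (n + 1)"
  have F: "F > 0" "F1 > 0" unfolding F_def F1_def using n by (auto intro!: fall_pos)
  have F_2: "fall (Suc (Suc m)) (n + 2) = (real n + 2) * (real n + 1) * F"
    and F_1: "fall (Suc m) (n + 2) = (real n + 2) * F1"
    unfolding F_def F1_def using fall_Suc_shift[of "Suc m" "n + 1"] fall_Suc_shift[of m "n + 1"] fall_Suc_shift[of m n]
    by (simp_all add: algebra_simps)
  have l1: "1 \<le> l" "l \<le> n + 2" if "l \<in># \<rho>" "l \<noteq> 0" for l using that mem_le_sum_mset[OF that(1)] n by auto
  have "?L = (\<Sum>\<kappa>\<in>parts (Suc (Suc m)). ?u \<kappa> * real (count \<kappa> 1) * (sfall \<kappa> \<rho> * (real (count \<kappa> 1) - 1))) /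
      fall (Suc (Suc m)) (n + 2)"
    unfolding sum_divide_distrib using n by (intro sum.cong) (auto simp: sampling_def parts_def)
  also have "\<dots> = real (Suc (Suc m)) * (\<Sum>\<kappa>\<in>parts (Suc m). ?u \<kappa> * real (count \<kappa> 1) * sfall (add_mset 1 \<kappa>) \<rho>) /
      fall (Suc (Suc m)) (n + 2)"
    by (subst sum_parts_count_1[of "\<lambda>\<kappa>. sfall \<kappa> \<rho> * (real (count \<kappa> 1) - 1)" "Suc m"]) (simp add: mult_ac)
  also have "\<dots> = real (Suc (Suc m)) * real (Suc m) *
      ((\<Sum>\<kappa>\<in>parts m. ?u \<kappa> * sfall (add_mset 1 (add_mset 1 \<kappa>)) \<rho>) / fall (Suc (Suc m)) (n + 2))"
    by (subst sum_parts_count_1[of "\<lambda>\<kappa>. sfall (add_mset 1 \<kappa>) \<rho>" m]) (simp only: times_divide_eq_right mult.assoc)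
  also have "(\<Sum>\<kappa>\<in>parts m. ?u \<kappa> * sfall (add_mset 1 (add_mset 1 \<kappa>)) \<rho>) =
      (\<Sum>l\<in>#\<rho>. real l * (\<Sum>l'\<in>#\<rho> - {#l#}. real l' * fall m (n + 2 - l - l')))"
  proof -
    have "(\<Sum>\<kappa>\<in>parts m. ?u \<kappa> * sfall (add_mset 1 (add_mset 1 \<kappa>)) \<rho>) =
      (\<Sum>\<kappa>\<in>parts m. \<Sum>l\<in>#\<rho>. \<Sum>l'\<in>#\<rho> - {#l#}. real l * (real l' * (?u \<kappa> * sfall \<kappa> (\<rho> - {#l#} - {#l'#}))))"
      unfolding sfall_add fall_1 sum_mset_distrib_left
      by (intro sum.cong sum_mset_cong refl) (simp add: mult_ac)
    also have "\<dots> = (\<Sum>l\<in>#\<rho>. \<Sum>l'\<in>#\<rho> - {#l#}. \<Sum>\<kappa>\<in>parts m. real l * (real l' * (?u \<kappa> * sfall \<kappa> (\<rho> - {#l#} - {#l'#}))))"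
      unfolding sum_sum_mset_swap ..
    also have "\<dots> = (\<Sum>l\<in>#\<rho>. real l * (\<Sum>l'\<in>#\<rho> - {#l#}. real l' * fall m (n + 2 - l - l')))"
      unfolding sum_distrib_left[symmetric] sum_mset_distrib_left sum_u_sfall
    proof (intro sum_mset_cong)
      fix l l' assume l: "l \<in># \<rho>" "l' \<in># \<rho> - {#l#}"
      from l(1) obtain A where A: "\<rho> = add_mset l A" by (rule mset_add)
      with l(2) obtain B where B: "A = add_mset l' B" by (auto elim: mset_add)
      have "sum_mset (\<rho> - {#l#} - {#l'#}) = n + 2 - l - l'" using n(1) A B by simp
      then show "real l * (real l' * fall m (sum_mset (\<rho> - {#l#} - {#l'#}))) = real l * (real l' * fall m (n + 2 - l - l'))"
        by simp
    qed
    finally show ?thesis .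
  qed
  also have "\<dots> / fall (Suc (Suc m)) (n + 2) \<le> (real n + 2) / (real n + 1) * (singleton_mean (Suc m) \<rho>)\<^sup>2"
  proof -
    define c where "c = real n + 2"
    have c: "c > 0" by (simp add: c_def)
    let ?b = "\<lambda>l. real l * fall m (n + 2 - l) / (c * F1)"
    have mean: "singleton_mean (Suc m) \<rho> = (\<Sum>l\<in>#\<rho>. ?b l)"
      using assms n F_1 by (subst singleton_mean_eq) (auto simp: c_def)
    have b: "0 \<le> ?b l" for l using F c by simp
    have "(\<Sum>l\<in>#\<rho>. real l * (\<Sum>l'\<in>#\<rho> - {#l#}. real l' * fall m (n + 2 - l - l'))) \<le>
      (\<Sum>l\<in>#\<rho>. (\<Sum>l'\<in>#\<rho>. F * c\<^sup>2 * (?b l * ?b l')))"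
    proof (rule sum_mset_mono)
      fix l assume l: "l \<in># \<rho>"
      have "(\<Sum>l'\<in>#\<rho> - {#l#}. real l * (real l' * fall m (n + 2 - l - l'))) \<le>
        (\<Sum>l'\<in>#\<rho> - {#l#}. F * c\<^sup>2 * (?b l * ?b l'))"
      proof (rule sum_mset_mono)
        fix l' assume l': "l' \<in># \<rho> - {#l#}"
        show "real l * (real l' * fall m (n + 2 - l - l')) \<le> F * c\<^sup>2 * (?b l * ?b l')"
        proof (cases "l = 0 \<or> l' = 0")
          case False
          then have ll: "1 \<le> l" "1 \<le> l'" by auto
          have "fall m (n + 2 - l - l') * F * (F1 * F1) \<le> fall m (n + 1 - l) * fall m (n + 1 - l') * (F1 * F1)"
            unfolding F_def using F fall_mult_le[OF ll] by (intro mult_right_mono) auto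
          also have "\<dots> = (fall m (n + 1 - l) * F1) * (fall m (n + 1 - l') * F1)" by (simp only: mult_ac)
          also have "\<dots> \<le> (fall m (n + 2 - l) * F) * (fall m (n + 2 - l') * F)"
            unfolding F_def F1_def
            by (rule mult_mono[OF fall_shift_le[OF ll(1)] fall_shift_le[OF ll(2)]]) simp_all
          finally have "fall m (n + 2 - l - l') * (F1 * F1) \<le> F * (fall m (n + 2 - l) * fall m (n + 2 - l'))"
            using F(1) by (simp add: mult_ac)
          then have "fall m (n + 2 - l - l') \<le> F * (fall m (n + 2 - l) * fall m (n + 2 - l')) / (F1 * F1)"
            using F by (simp add: pos_le_divide_eq)
          then have "real l * (real l' * fall m (n + 2 - l - l')) \<le>
              real l * (real l' * (F * (fall m (n + 2 - l) * fall m (n + 2 - l')) / (F1 * F1)))"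
            by (intro mult_left_mono) auto
          also have "\<dots> = F * c\<^sup>2 * (?b l * ?b l')"
            using F c by (simp add: power2_eq_square)
          finally show ?thesis .
        qed auto
      qed
      also have "\<dots> = (\<Sum>l'\<in>#\<rho>. F * c\<^sup>2 * (?b l * ?b l')) - F * c\<^sup>2 * (?b l * ?b l)"
        by (rule sum_mset_remove[OF l])
      \<comment> \<open>Restoring the nonnegative diagonal term completes the square of the
        mean.\<close>
      also have "\<dots> \<le> (\<Sum>l'\<in>#\<rho>. F * c\<^sup>2 * (?b l * ?b l'))"
        using mult_nonneg_nonneg[OF mult_nonneg_nonneg[OF less_imp_le[OF F(1)] zero_le_power2[of c]] mult_nonneg_nonneg[OF b[of l] b[of l]]] by linarith
      finally show "real l * (\<Sum>l'\<in>#\<rho> - {#l#}. real l' * fall m (n + 2 - l - l')) \<le>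
          (\<Sum>l'\<in>#\<rho>. F * c\<^sup>2 * (?b l * ?b l'))"
        unfolding sum_mset_distrib_left .
    qed
    also have "\<dots> = F * c\<^sup>2 * (singleton_mean (Suc m) \<rho>)\<^sup>2"
      unfolding mean power2_eq_square[of "sum_mset _"] sum_mset_product unfolding sum_mset_distrib_left ..
    finally have "(\<Sum>l\<in>#\<rho>. real l * (\<Sum>l'\<in>#\<rho> - {#l#}. real l' * fall m (n + 2 - l - l'))) / (c * (real n + 1) * F) \<le>
        F * c\<^sup>2 * (singleton_mean (Suc m) \<rho>)\<^sup>2 / (c * (real n + 1) * F)"
      using F c by (intro divide_right_mono) auto
    also have "\<dots> = c / (real n + 1) * (singleton_mean (Suc m) \<rho>)\<^sup>2" using F c by (simp add: power2_eq_square)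
    finally show ?thesis unfolding F_2 c_def .
  qed
  also have "(real n + 2) / (real n + 1) = real (sum_mset \<rho>) / (real (sum_mset \<rho>) - 1)" unfolding n by (simp add: add.commute)
  finally show ?thesis by (simp add: mult_left_mono)
qed

text \<open>A marked element in a block of frequency x fails to be alone among m others with
  probability at most about min 1 (m x), by Bernoulli's inequality; weighted by x this is a loss of
  min x (m x^2), which in the limit is at most the sum of the p i.\<close>

lemma singleton_mean_tendsto_ge_dust:
  assumes \<rho>: "\<And>N. sum_mset (\<rho> N) = N" and lim: "\<And>i. (\<lambda>N. freq (\<rho> N) i) \<longlonglongrightarrow> p i" and p: "p \<in> nabla"
    and q: "(\<lambda>N. singleton_mean (Suc m) (\<rho> N)) \<longlonglongrightarrow> q"
  shows "dust p \<le> q"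
proof -
  \<comment> \<open>The branch m x^2 gives a summable majorant uniform in N; the branch x bounds the
    limiting sum by the mass outside the dust.\<close>
  let ?g = "\<lambda>x::real. min x (real m * x\<^sup>2)"
  have bound: "1 - suminf (\<lambda>i. ?g (freq (\<rho> N) i)) - (real m)\<^sup>2 / real N \<le> singleton_mean (Suc m) (\<rho> N)" if N: "Suc m \<le> N" for N
  proof -
    have g: "(\<lambda>i. ?g (freq (\<rho> N) i)) sums (\<Sum>l\<in>#\<rho> N. ?g (real l / real N))"
      unfolding freq_def \<rho> by (rule sums_part) simp
    have "1 - suminf (\<lambda>i. ?g (freq (\<rho> N) i)) - (real m)\<^sup>2 / real N =
      (\<Sum>l\<in>#\<rho> N. real l / real N) - (\<Sum>l\<in>#\<rho> N. ?g (real l / real N)) - (\<Sum>l\<in>#\<rho> N. real l / real N) * ((real m)\<^sup>2 / real N)"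
    proof -
      have "(\<Sum>l\<in>#\<rho> N. real l / real N) = 1" using psum_1[of "\<rho> N"] \<rho>[of N] N by (simp add: psum_def)
      with g show ?thesis by (simp add: sums_iff)
    qed
    also have "\<dots> = (\<Sum>l\<in>#\<rho> N. real l / real N - ?g (real l / real N) - real l / real N * ((real m)\<^sup>2 / real N))"
      unfolding sum_mset_subtractf sum_mset_distrib_right ..
    also have "\<dots> \<le> (\<Sum>l\<in>#\<rho> N. real l * fall m (N - l) / fall (Suc m) N)"
    proof (rule sum_mset_mono)
      fix l assume l: "l \<in># \<rho> N"
      then have lN: "l \<le> N" using mem_le_sum_mset[of l "\<rho> N"] \<rho> by simp
      let ?x = "real l / real N"
      have y: "1 - real m * ?x - (real m)\<^sup>2 / real N \<le> fall m (N - l) / real N ^ m" "0 \<le> fall m (N - l) / real N ^ m"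
        using fall_bernoulli[OF lN, of m] N by auto
      have "0 \<le> (real m)\<^sup>2 / real N" by simp
      with y have y': "1 - min 1 (real m * ?x) - (real m)\<^sup>2 / real N \<le> fall m (N - l) / real N ^ m" by linarith
      have "min ?x (real m * ?x\<^sup>2) = ?x * min 1 (real m * ?x)"
        by (simp add: min_mult_distrib_left power2_eq_square mult_ac)
      then have "?x - ?g ?x - ?x * ((real m)\<^sup>2 / real N) = ?x * (1 - min 1 (real m * ?x) - (real m)\<^sup>2 / real N)"
        by (simp only: right_diff_distrib mult_1_right)
      also have "\<dots> \<le> ?x * (fall m (N - l) / real N ^ m)" using y' by (intro mult_left_mono) auto
      also have "\<dots> = real l * fall m (N - l) / real N ^ Suc m" by simp
      also have "\<dots> \<le> real l * fall m (N - l) / fall (Suc m) N"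
        using N fall_le_power[of "Suc m" N] fall_pos[OF N] by (intro divide_left_mono mult_pos_pos) auto
      finally show "?x - ?g ?x - ?x * ((real m)\<^sup>2 / real N) \<le> real l * fall m (N - l) / fall (Suc m) N" .
    qed
    also have "\<dots> = singleton_mean (Suc m) (\<rho> N)" using N \<rho>[of N] by (subst singleton_mean_eq) auto
    finally show ?thesis .
  qed
  have "(\<lambda>N. suminf (\<lambda>i. ?g (freq (\<rho> N) i))) \<longlonglongrightarrow> suminf (\<lambda>i. ?g (p i))"
  proof (rule tannery_sequence)
    show "(\<lambda>N. ?g (freq (\<rho> N) i)) \<longlonglongrightarrow> ?g (p i)" for i by (intro tendsto_intros lim)
    show "\<bar>?g (freq (\<rho> N) i)\<bar> \<le> real m * (1 / real (Suc i))\<^sup>2" for N i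
    proof -
      have "0 \<le> freq (\<rho> N) i" "freq (\<rho> N) i \<le> 1 / real (Suc i)" using nablaD(2,6)[OF freq_in_nabla] by auto
      then have "0 \<le> ?g (freq (\<rho> N) i)" "real m * (freq (\<rho> N) i)\<^sup>2 \<le> real m * (1 / real (Suc i))\<^sup>2"
        by (auto intro!: mult_left_mono power_mono)
      then show ?thesis by linarith
    qed
    have "summable (\<lambda>i. 1 / (real (Suc i))\<^sup>2)"
      using inverse_power_summable[of 2, where 'a=real] by (subst summable_Suc_iff) (simp add: inverse_eq_divide)
    then show "summable (\<lambda>i. real m * (1 / real (Suc i))\<^sup>2)" unfolding power_divide one_power2 by (rule summable_mult)
  qed
  moreover have "(\<lambda>N. (real m)\<^sup>2 / real N) \<longlonglongrightarrow> 0" by (rule lim_const_over_n)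
  ultimately have "(\<lambda>N. 1 - suminf (\<lambda>i. ?g (freq (\<rho> N) i)) - (real m)\<^sup>2 / real N) \<longlonglongrightarrow> 1 - suminf (\<lambda>i. ?g (p i)) - 0"
    by (intro tendsto_diff tendsto_const)
  then have "1 - suminf (\<lambda>i. ?g (p i)) \<le> q"
    using LIMSEQ_le[OF _ q, of _ "1 - suminf (\<lambda>i. ?g (p i)) - 0"] bound by auto
  moreover have "suminf (\<lambda>i. ?g (p i)) \<le> suminf p"
  proof (rule suminf_le)
    have "0 \<le> ?g (p i)" for i using nablaD(2)[OF p] by simp
    then show "summable (\<lambda>i. ?g (p i))"
      by (intro summable_comparison_test'[OF nablaD(3)[OF p], of 0]) (simp add: abs_of_nonneg)
  qed (use nablaD(3)[OF p] in auto)
  ultimately show ?thesis by (simp add: dust_def)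
qed

text \<open>The J largest blocks contain their share of the elements and at most J singletons among
  them; all other singletons lie outside these blocks.\<close>

lemma singleton_proportion_le:
  assumes "0 < sum_mset \<rho>"
  shows "real (count \<rho> 1) / real (sum_mset \<rho>) \<le> 1 - (\<Sum>i<J. freq \<rho> i) + real J / real (sum_mset \<rho>)"
proof -
  let ?N = "real (sum_mset \<rho>)"
  let ?d = "\<lambda>i. (if part \<rho> i = 1 then 1 else 0) / ?N"
  have "(\<Sum>l\<in>#\<rho>. (if l = 1 then 1 else 0) / ?N) = real (count \<rho> 1) / ?N"
  proof -
    have "(\<Sum>l\<in>#\<rho>. (if l = 1 then 1 else 0) / c) = real (count \<rho> 1) / c" for c :: real
      by (induction \<rho>) (auto simp: add_divide_distrib)
    then show ?thesis .
  qed
  moreover have "?d sums (\<Sum>l\<in>#\<rho>. (if l = 1 then 1 else 0) / ?N)" by (rule sums_part) simp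
  ultimately have d: "?d sums (real (count \<rho> 1) / ?N)" by simp
  have f: "freq \<rho> sums 1" by (rule suminf_freq[OF assms])
  have "(\<lambda>i. freq \<rho> i - ?d i) sums (1 - real (count \<rho> 1) / ?N)" by (rule sums_diff[OF f d])
  moreover have "0 \<le> freq \<rho> i - ?d i" for i by (simp add: freq_def divide_right_mono)
  ultimately have "(\<Sum>i<J. freq \<rho> i - ?d i) \<le> 1 - real (count \<rho> 1) / ?N"
    using sum_le_suminf[of "\<lambda>i. freq \<rho> i - ?d i" "{..<J}"] by (auto simp: sums_iff)
  moreover have "(\<Sum>i<J. ?d i) \<le> (\<Sum>i<J. 1 / ?N)" by (intro sum_mono divide_right_mono) auto
  ultimately show ?thesis by (simp add: sum_subtractf)
qed

section \<open>Almost sure limit of the singleton proportion\<close>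

context central_pf
begin

abbreviation singleton_prop :: "nat \<Rightarrow> path \<Rightarrow> real" where
  "singleton_prop M \<omega> \<equiv> real (count (Y M \<omega>) 1) / real M"

lemma singleton_prop_bounds: "pf_path \<omega> \<Longrightarrow> 0 \<le> singleton_prop M \<omega> \<and> singleton_prop M \<omega> \<le> 1"
  using count_1_le[OF pf_pathD(5)] by (simp add: divide_le_eq)

text \<open>The count moves by at most 1 and the change of normalisation costs at most another
  1/(M+1), whence the 2.\<close>

lemma singleton_prop_step:
  assumes "pf_path \<omega>"
  shows "\<bar>singleton_prop (Suc M) \<omega> - singleton_prop M \<omega>\<bar> \<le> 2 / real (Suc M)"
proof (cases "M = 0")
  case True
  then show ?thesis using singleton_prop_bounds[OF assms, of "Suc 0"] by simp
next
  case False
  have c: "\<bar>real (count (Y (Suc M) \<omega>) 1) - real (count (Y M \<omega>) 1)\<bar> \<le> 1"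
    by (rule count_1_step[OF pf_path_step[OF assms] pf_pathD(3)[OF assms]])
  have "singleton_prop (Suc M) \<omega> - singleton_prop M \<omega> =
    ((real (count (Y (Suc M) \<omega>) 1) - real (count (Y M \<omega>) 1)) - singleton_prop M \<omega>) / real (Suc M)"
    using False by (simp add: field_simps)
  also have "\<bar>\<dots>\<bar> = \<bar>(real (count (Y (Suc M) \<omega>) 1) - real (count (Y M \<omega>) 1)) - singleton_prop M \<omega>\<bar> / real (Suc M)"
    by simp
  also have "\<dots> \<le> 2 / real (Suc M)"
    using c conjunct1[OF singleton_prop_bounds[OF assms, of M]] conjunct2[OF singleton_prop_bounds[OF assms, of M]]
    by (intro divide_right_mono) linarith+
  finally show ?thesis .
qed

text \<open>Let D be the proportion at level M, W its mean given level N, and W' that at level M -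
  1. The pair bound gives E D^2 <= E W'^2 + 2/M, conditioning gives E(D W) = E W^2, and E W'^2 - E
  W^2 <= 4/M; together 6/M.\<close>

lemma singleton_variance:
  assumes N: "Suc (Suc m) < N"
  shows "(\<integral>\<omega>. (singleton_prop (Suc (Suc m)) \<omega> - singleton_mean (Suc (Suc m)) (Y N \<omega>))\<^sup>2 \<partial>\<mu>) \<le> 6 / real (Suc (Suc m))"
proof -
  let ?M = "Suc (Suc m)"
  let ?D = "\<lambda>\<kappa>. real (count \<kappa> 1) / real ?M" and ?D' = "\<lambda>\<kappa>. real (count \<kappa> 1) / real (Suc m)"
  let ?W = "singleton_mean ?M" and ?W' = "singleton_mean (Suc m)"
  let ?E2 = "\<lambda>\<rho>. \<Sum>\<kappa>\<in>parts ?M. real (u (path_forest_tree \<kappa>)) * sampling \<kappa> \<rho> * (?D \<kappa>)\<^sup>2"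
  note int = integrable_Y integrable_Y2
  have W: "0 \<le> ?W (Y N \<omega>)" "?W (Y N \<omega>) \<le> 1" "0 \<le> ?W' (Y N \<omega>)" "?W' (Y N \<omega>) \<le> 1" if "pf_path \<omega>" for \<omega>
    using pf_pathD(4)[OF that, of N] N by (auto intro!: singleton_mean_bounds)
  have E2: "?E2 (Y N \<omega>) \<le> (?W' (Y N \<omega>))\<^sup>2 + 2 / real ?M" if pf: "pf_path \<omega>" for \<omega>
  proof -
    let ?\<rho> = "Y N \<omega>"
    have sN: "sum_mset ?\<rho> = N" by (rule pf_pathD(4)[OF pf])
    \<comment> \<open>c^2 = c (c - 1) + c splits the second moment into pairs of singletons and the
      mean.\<close>
    have "?E2 ?\<rho> = (\<Sum>\<kappa>\<in>parts ?M. real (u (path_forest_tree \<kappa>)) * sampling \<kappa> ?\<rho> *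
        (real (count \<kappa> 1) * (real (count \<kappa> 1) - 1))) / (real ?M)\<^sup>2 + ?W ?\<rho> / real ?M"
      unfolding singleton_mean_def sum_divide_distrib sum.distrib[symmetric]
    proof (intro sum.cong refl)
      fix \<kappa> :: "nat multiset"
      define c where "c = real (count \<kappa> 1)"
      define M where "M = real ?M"
      have "M > 0" by (simp add: M_def)
      then have "(c / M)\<^sup>2 = c * (c - 1) / M\<^sup>2 + c / M / M" by (simp add: field_simps power2_eq_square)
      then show "real (u (path_forest_tree \<kappa>)) * sampling \<kappa> ?\<rho> * (real (count \<kappa> 1) / real ?M)\<^sup>2 =
        real (u (path_forest_tree \<kappa>)) * sampling \<kappa> ?\<rho> * (real (count \<kappa> 1) * (real (count \<kappa> 1) - 1)) / (real ?M)\<^sup>2 +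
        real (u (path_forest_tree \<kappa>)) * sampling \<kappa> ?\<rho> * (real (count \<kappa> 1) / real ?M) / real ?M"
        unfolding c_def[symmetric] M_def[symmetric] by (simp only: distrib_left times_divide_eq_right[symmetric])
    qed
    also have "\<dots> \<le> real ?M * real (Suc m) * (real N / (real N - 1) * (?W' ?\<rho>)\<^sup>2) / (real ?M)\<^sup>2 + 1 / real ?M"
      using singleton_pairs_le[of m ?\<rho>] N W(2)[OF pf] sN by (intro add_mono divide_right_mono) auto
    also have "real ?M * real (Suc m) * (real N / (real N - 1) * (?W' ?\<rho>)\<^sup>2) / (real ?M)\<^sup>2 =
      (real (Suc m) / real ?M) * ((?W' ?\<rho>)\<^sup>2 + (?W' ?\<rho>)\<^sup>2 / (real N - 1))"
    proof -
      have "real N - 1 \<noteq> 0" using N by simp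
      then have r: "real N / (real N - 1) = 1 + 1 / (real N - 1)" by (simp add: field_simps)
      have "A * B * ((1 + 1 / c) * w) / A\<^sup>2 = B / A * (w + w / c)" if "A \<noteq> 0" for A B c w :: real
        using that by (simp add: power2_eq_square distrib_right)
      then show ?thesis unfolding r by simp
    qed
    also have "\<dots> \<le> 1 * ((?W' ?\<rho>)\<^sup>2 + 1 / real ?M)"
    proof (intro mult_mono add_mono order_refl)
      have "(?W' ?\<rho>)\<^sup>2 \<le> 1" using W(3,4)[OF pf] by (simp add: power_le_one)
      moreover have "real ?M \<le> real N - 1" using N by simp
      ultimately show "(?W' ?\<rho>)\<^sup>2 / (real N - 1) \<le> 1 / real ?M" by (intro frac_le) auto
    qed (use N in auto)
    finally show ?thesis by simp
  qed
  have second: "(\<integral>\<omega>. (?D (Y ?M \<omega>))\<^sup>2 \<partial>\<mu>) \<le> (\<integral>\<omega>. (?W' (Y N \<omega>))\<^sup>2 \<partial>\<mu>) + 2 / real ?M"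
  proof -
    have "(\<integral>\<omega>. (?D (Y ?M \<omega>))\<^sup>2 \<partial>\<mu>) = (\<integral>\<omega>. ?E2 (Y N \<omega>) \<partial>\<mu>)"
      using conditional_expectation_Y[of ?M N "\<lambda>\<kappa>. (?D \<kappa>)\<^sup>2" "\<lambda>_. 1"] N by simp
    also have "\<dots> \<le> (\<integral>\<omega>. (?W' (Y N \<omega>))\<^sup>2 + 2 / real ?M \<partial>\<mu>)"
      using int(1)[of ?E2 N] int(1)[of "\<lambda>\<rho>. (?W' \<rho>)\<^sup>2 + 2 / real ?M" N]
      by (rule integral_mono_AE) (use AE_pf E2 in \<open>auto elim: eventually_mono\<close>)
    also have "\<dots> = (\<integral>\<omega>. (?W' (Y N \<omega>))\<^sup>2 \<partial>\<mu>) + 2 / real ?M"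
      using int(1)[of "\<lambda>\<rho>. (?W' \<rho>)\<^sup>2" N] by (simp add: prob_space)
    finally show ?thesis .
  qed
  have mixed: "(\<integral>\<omega>. ?D (Y ?M \<omega>) * ?W (Y N \<omega>) \<partial>\<mu>) = (\<integral>\<omega>. (?W (Y N \<omega>))\<^sup>2 \<partial>\<mu>)"
    using conditional_expectation_Y[of ?M N ?D ?W] N
    unfolding singleton_mean_def[of ?M "Y N _", symmetric] by (simp add: power2_eq_square)
  \<comment> \<open>W'^2 - W^2 = (W' - W) * (W' + W). Against a function of level N the two means
    may be replaced by the proportions themselves, which are one step apart and differ by at most
    2/M.\<close>
  let ?h = "\<lambda>\<rho>. ?W' \<rho> + ?W \<rho>"
  have "(\<integral>\<omega>. (?W' (Y N \<omega>))\<^sup>2 \<partial>\<mu>) - (\<integral>\<omega>. (?W (Y N \<omega>))\<^sup>2 \<partial>\<mu>) =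
      (\<integral>\<omega>. (?W' (Y N \<omega>))\<^sup>2 - (?W (Y N \<omega>))\<^sup>2 \<partial>\<mu>)"
    using int(1)[of "\<lambda>\<rho>. (?W' \<rho>)\<^sup>2" N] int(1)[of "\<lambda>\<rho>. (?W \<rho>)\<^sup>2" N] by simp
  also have "\<dots> = (\<integral>\<omega>. ?W' (Y N \<omega>) * ?h (Y N \<omega>) - ?W (Y N \<omega>) * ?h (Y N \<omega>) \<partial>\<mu>)"
    by (intro Bochner_Integration.integral_cong refl) (simp add: power2_eq_square algebra_simps)
  also have "\<dots> = (\<integral>\<omega>. ?W' (Y N \<omega>) * ?h (Y N \<omega>) \<partial>\<mu>) - (\<integral>\<omega>. ?W (Y N \<omega>) * ?h (Y N \<omega>) \<partial>\<mu>)"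
    using int(1)[of "\<lambda>\<rho>. ?W' \<rho> * ?h \<rho>" N] int(1)[of "\<lambda>\<rho>. ?W \<rho> * ?h \<rho>" N] by simp
  also have "\<dots> = (\<integral>\<omega>. ?D' (Y (Suc m) \<omega>) * ?h (Y N \<omega>) \<partial>\<mu>) - (\<integral>\<omega>. ?D (Y ?M \<omega>) * ?h (Y N \<omega>) \<partial>\<mu>)"
    using conditional_expectation_Y[of ?M N ?D ?h] conditional_expectation_Y[of "Suc m" N ?D' ?h] N
    unfolding singleton_mean_def[of _ "Y N _", symmetric] by simp
  also have "\<dots> = (\<integral>\<omega>. ?D' (Y (Suc m) \<omega>) * ?h (Y N \<omega>) - ?D (Y ?M \<omega>) * ?h (Y N \<omega>) \<partial>\<mu>)"
    using int(2)[of "\<lambda>x y. ?D' x * ?h y" "Suc m" N] int(2)[of "\<lambda>x y. ?D x * ?h y" ?M N] by simp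
  also have "\<dots> \<le> (\<integral>\<omega>. 4 / real ?M \<partial>\<mu>)"
  proof (rule integral_mono_AE)
    show "integrable \<mu> (\<lambda>\<omega>. ?D' (Y (Suc m) \<omega>) * ?h (Y N \<omega>) - ?D (Y ?M \<omega>) * ?h (Y N \<omega>))"
      using int(2)[of "\<lambda>x y. ?D' x * ?h y" "Suc m" N] int(2)[of "\<lambda>x y. ?D x * ?h y" ?M N] by simp
    show "AE \<omega> in \<mu>. ?D' (Y (Suc m) \<omega>) * ?h (Y N \<omega>) - ?D (Y ?M \<omega>) * ?h (Y N \<omega>) \<le> 4 / real ?M"
      using AE_pf
    proof eventually_elim
      case (elim \<omega>)
      have "?D' (Y (Suc m) \<omega>) * ?h (Y N \<omega>) - ?D (Y ?M \<omega>) * ?h (Y N \<omega>) = (?D' (Y (Suc m) \<omega>) - ?D (Y ?M \<omega>)) * ?h (Y N \<omega>)"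
        by (simp only: left_diff_distrib)
      also have "\<dots> \<le> 2 / real ?M * ?h (Y N \<omega>)"
        using singleton_prop_step[OF elim, of "Suc m"] W[OF elim] by (intro mult_right_mono) (auto simp only: abs_le_iff minus_diff_eq add_nonneg_nonneg)
      also have "\<dots> \<le> 2 / real ?M * 2" using W[OF elim] by (intro mult_left_mono) auto
      finally show ?case by simp
    qed
  qed simp
  also have "\<dots> = 4 / real ?M" by (simp add: prob_space)
  finally have diff: "(\<integral>\<omega>. (?W' (Y N \<omega>))\<^sup>2 \<partial>\<mu>) - (\<integral>\<omega>. (?W (Y N \<omega>))\<^sup>2 \<partial>\<mu>) \<le> 4 / real ?M" .
  have "(\<integral>\<omega>. (?D (Y ?M \<omega>) - ?W (Y N \<omega>))\<^sup>2 \<partial>\<mu>) =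
      (\<integral>\<omega>. (?D (Y ?M \<omega>))\<^sup>2 - 2 * (?D (Y ?M \<omega>) * ?W (Y N \<omega>)) + (?W (Y N \<omega>))\<^sup>2 \<partial>\<mu>)"
  proof -
    have "(a - b)\<^sup>2 = a\<^sup>2 - 2 * (a * b) + b\<^sup>2" for a b :: real by (simp add: power2_diff)
    then show ?thesis by presburger
  qed
  also have "\<dots> = (\<integral>\<omega>. (?D (Y ?M \<omega>))\<^sup>2 \<partial>\<mu>) - 2 * (\<integral>\<omega>. ?D (Y ?M \<omega>) * ?W (Y N \<omega>) \<partial>\<mu>) + (\<integral>\<omega>. (?W (Y N \<omega>))\<^sup>2 \<partial>\<mu>)"
  proof -
    have "(\<integral>\<omega>. A \<omega> - 2 * B \<omega> + C \<omega> \<partial>\<mu>) = (\<integral>\<omega>. A \<omega> \<partial>\<mu>) - 2 * (\<integral>\<omega>. B \<omega> \<partial>\<mu>) + (\<integral>\<omega>. C \<omega> \<partial>\<mu>)"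
      if "integrable \<mu> A" "integrable \<mu> B" "integrable \<mu> C" for A B C :: "path \<Rightarrow> real"
      using that by simp
    from this[OF int(1)[of "\<lambda>\<rho>. (?D \<rho>)\<^sup>2" ?M] int(2)[of "\<lambda>x y. ?D x * ?W y" ?M N] int(1)[of "\<lambda>\<rho>. (?W \<rho>)\<^sup>2" N]]
    show ?thesis .
  qed
  finally show ?thesis using second mixed diff by linarith
qed

text \<open>Letting N grow in the variance bound compares the proportion with q, the limit of its
  means. Along fourth powers the difference tends to 0, and q is at least the dust; the upper bound
  holds path by path.\<close>

lemma AE_singleton_prop:
  "AE \<omega> in \<mu>. (\<lambda>N. singleton_prop N \<omega>) \<longlonglongrightarrow> dust (limit_freq \<omega>)"
proof -
  define q where "q M \<omega> = (\<Sum>\<kappa>\<in>parts M. real (u (path_forest_tree \<kappa>)) * paintbox (limit_freq \<omega>) \<kappa> * (real (count \<kappa> 1) / real M))" for M \<omega>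
  have q_lim: "(\<lambda>N. singleton_mean M (Y N \<omega>)) \<longlonglongrightarrow> q M \<omega>" if "typical \<omega>" for M \<omega>
    unfolding singleton_mean_def q_def
    by (intro tendsto_sum tendsto_mult tendsto_const typicalD(6)[OF that]) (simp add: parts_def)
  have q_meas: "q M \<in> borel_measurable \<mu>" for M
  proof -
    have "limit_freq \<in> measurable \<mu> nabla_borel" using limit_freq_path_borel measurable_cong_sets[OF sets_eq refl] by blast
    then have "(\<lambda>\<omega>. paintbox (limit_freq \<omega>) \<kappa>) \<in> borel_measurable \<mu>" if "0 \<notin># \<kappa>" for \<kappa>
      by (rule measurable_compose[OF _ continuous_nabla_borel[OF continuous_on_paintbox[OF that]]])
    then show ?thesis unfolding q_def[abs_def] by (intro borel_measurable_sum borel_measurable_times borel_measurable_const) (simp add: parts_def)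
  qed
  let ?F = "\<lambda>M \<omega>. (singleton_prop M \<omega> - q M \<omega>)\<^sup>2"
  have F: "integrable \<mu> (?F (Suc (Suc m))) \<and> (\<integral>\<omega>. ?F (Suc (Suc m)) \<omega> \<partial>\<mu>) \<le> 6 / real (Suc (Suc m))" for m
  proof -
    let ?M = "Suc (Suc m)"
    let ?s = "\<lambda>n \<omega>. (singleton_prop ?M \<omega> - singleton_mean ?M (Y (n + Suc ?M) \<omega>))\<^sup>2"
    have meas: "?F ?M \<in> borel_measurable \<mu>"
      using q_meas measurable_Y[of "\<lambda>\<rho>. real (count \<rho> 1) / real ?M"] by (intro borel_measurable_power borel_measurable_diff)
    have smeas: "?s n \<in> borel_measurable \<mu>" for n
      using integrable_Y2[of "\<lambda>x y. (real (count x 1) / real ?M - singleton_mean ?M y)\<^sup>2" ?M "n + Suc ?M"]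
      by (rule borel_measurable_integrable)
    have lim: "AE \<omega> in \<mu>. (\<lambda>n. ?s n \<omega>) \<longlonglongrightarrow> ?F ?M \<omega>"
      using AE_typical
      by eventually_elim (intro tendsto_power tendsto_diff tendsto_const LIMSEQ_ignore_initial_segment q_lim)
    have dom: "AE \<omega> in \<mu>. norm (?s n \<omega>) \<le> 1" for n
      using AE_pf
    proof eventually_elim
      case (elim \<omega>)
      have "0 \<le> singleton_mean ?M (Y (n + Suc ?M) \<omega>)" "singleton_mean ?M (Y (n + Suc ?M) \<omega>) \<le> 1"
        using pf_pathD(4)[OF elim, of "n + Suc ?M"] by (auto intro!: singleton_mean_bounds)
      then have "\<bar>singleton_prop ?M \<omega> - singleton_mean ?M (Y (n + Suc ?M) \<omega>)\<bar> \<le> 1"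
        using singleton_prop_bounds[OF elim, of ?M] by (simp only: abs_le_iff) linarith
      then show ?case by (simp only: abs_square_le_1[symmetric] real_norm_def abs_power2)
    qed
    have one: "integrable \<mu> (\<lambda>_. 1 :: real)" by simp
    have "(\<lambda>n. \<integral>\<omega>. ?s n \<omega> \<partial>\<mu>) \<longlonglongrightarrow> (\<integral>\<omega>. ?F ?M \<omega> \<partial>\<mu>)"
      by (rule integral_dominated_convergence[OF meas smeas one lim dom])
    moreover have "(\<integral>\<omega>. ?s n \<omega> \<partial>\<mu>) \<le> 6 / real ?M" for n by (rule singleton_variance) simp
    ultimately have "(\<integral>\<omega>. ?F ?M \<omega> \<partial>\<mu>) \<le> 6 / real ?M" by (intro LIMSEQ_le_const2) auto
    moreover have "integrable \<mu> (?F ?M)"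
      by (rule integrable_dominated_convergence[OF meas smeas one lim dom])
    ultimately show ?thesis by blast
  qed
  \<comment> \<open>The offset 2 keeps the levels in the range at least 2 where the variance bound
    holds.\<close>
  have F4: "integrable \<mu> (?F ((j + 2) ^ 4)) \<and> (\<integral>\<omega>. ?F ((j + 2) ^ 4) \<omega> \<partial>\<mu>) \<le> 6 / real ((j + 2) ^ 4)" for j
  proof -
    have "2 \<le> (j + 2) ^ 4" using self_le_power[of "j + 2" 4] by simp
    then obtain m where "(j + 2) ^ 4 = Suc (Suc m)" by (metis add_2_eq_Suc le_Suc_ex)
    with F[of m] show ?thesis by simp
  qed
  have "summable (\<lambda>j. 6 / real ((j + 2) ^ 4))"
  proof -
    have "summable (\<lambda>j. inverse (real (j + 2) ^ 4))"
      using summable_ignore_initial_segment[OF inverse_power_summable[of 4, where 'a=real], of 2] by simp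
    then have "summable (\<lambda>j. 6 * inverse (real (j + 2) ^ 4))" by (rule summable_mult)
    then show ?thesis by (simp only: divide_inverse of_nat_power)
  qed
  from AE_summable[OF conjunct1[OF F4] zero_le_power2 conjunct2[OF F4] this] AE_typical
  show ?thesis
  proof eventually_elim
    case (elim \<omega>)
    let ?p = "limit_freq \<omega>" and ?D = "\<lambda>N. singleton_prop N \<omega>"
    note pf = typicalD(1)[OF elim(2)]
    have p: "?p \<in> nabla" by (rule typicalD(3)[OF elim(2)])
    have Ysum: "sum_mset (Y N \<omega>) = N" for N by (rule pf_pathD(4)[OF pf])
    have fr: "(\<lambda>N. freq (Y N \<omega>) i) \<longlonglongrightarrow> ?p i" for i using elim(2) by (simp add: typical_def)
    have q_ge: "dust ?p \<le> q M \<omega>" if "M \<ge> 1" for M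
      using singleton_mean_tendsto_ge_dust[OF Ysum fr p, of "M - 1"] q_lim[OF elim(2), of M] that by simp
    have "(\<lambda>j. ?F ((j + 2) ^ 4) \<omega>) \<longlonglongrightarrow> 0" using elim(1) by (rule summable_LIMSEQ_zero)
    then have "(\<lambda>j. sqrt (?F ((j + 2) ^ 4) \<omega>)) \<longlonglongrightarrow> sqrt 0" by (rule tendsto_real_sqrt)
    then have err: "(\<lambda>j. \<bar>?D ((j + 2) ^ 4) - q ((j + 2) ^ 4) \<omega>\<bar>) \<longlonglongrightarrow> 0" by simp
    \<comment> \<open>Fix J so large that the frequencies beyond it are negligible in the limit; the
      correction J/N then vanishes.\<close>
    have upper: "\<forall>\<^sub>F N in sequentially. ?D N < a" if a: "dust ?p < a" for a
    proof -
      have "(\<lambda>J. 1 - (\<Sum>i<J. ?p i)) \<longlonglongrightarrow> dust ?p"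
        unfolding dust_def by (intro tendsto_diff tendsto_const summable_LIMSEQ nablaD(3)[OF p])
      then have "\<forall>\<^sub>F J in sequentially. 1 - (\<Sum>i<J. ?p i) < a" using a by (rule order_tendstoD(2))
      then obtain J where J: "1 - (\<Sum>i<J. ?p i) + 0 < a" by (auto simp: eventually_sequentially)
      have "(\<lambda>N. 1 - (\<Sum>i<J. freq (Y N \<omega>) i) + real J / real N) \<longlonglongrightarrow> 1 - (\<Sum>i<J. ?p i) + 0"
        by (intro tendsto_add tendsto_diff tendsto_const tendsto_sum fr lim_const_over_n)
      from order_tendstoD(2)[OF this J] eventually_gt_at_top[of 0] show ?thesis
      proof eventually_elim
        case (elim N)
        with singleton_proportion_le[of "Y N \<omega>" J] Ysum[of N] show ?case by simp
      qed
    qed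
    have "(\<lambda>j. ?D ((j + 2) ^ 4)) \<longlonglongrightarrow> dust ?p"
    proof (rule order_tendstoI)
      fix a assume "dust ?p < a"
      have "filterlim (\<lambda>j. (j + 2) ^ 4) at_top (sequentially :: nat filter)"
        unfolding filterlim_at_top
      proof (intro allI eventually_sequentiallyI)
        fix Z j :: nat assume "Z \<le> j"
        then show "Z \<le> (j + 2) ^ 4" using self_le_power[of "j + 2" 4] by linarith
      qed
      from eventually_compose_filterlim[OF upper[OF \<open>dust ?p < a\<close>] this]
      show "\<forall>\<^sub>F j in sequentially. ?D ((j + 2) ^ 4) < a" .
    next
      fix a assume "a < dust ?p"
      then have "0 < dust ?p - a" by simp
      from order_tendstoD(2)[OF err this] show "\<forall>\<^sub>F j in sequentially. a < ?D ((j + 2) ^ 4)"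
      proof eventually_elim
        case (elim j)
        have "1 \<le> (j + 2) ^ 4" by simp
        from q_ge[OF this] elim show ?case by linarith
      qed
    qed
    then have "(\<lambda>j. ?D (j ^ 4)) \<longlonglongrightarrow> dust ?p" by (rule LIMSEQ_offset)
    then show ?case by (intro slowly_varying_limit[of ?D 2] singleton_prop_step[OF pf])
  qed
qed

lemma AE_emp_dust: "AE \<omega> in \<mu>. (\<lambda>n. emp_dust n (vertex_at n \<omega>)) \<longlonglongrightarrow> dust (limit_freq \<omega>)"
  using AE_singleton_prop AE_pf
proof eventually_elim
  case (elim \<omega>)
  have "\<forall>\<^sub>F N in sequentially. singleton_prop N \<omega> = emp_dust (Suc N) (vertex_at (Suc N) \<omega>)"
    using eventually_ge_at_top[of 1] by eventually_elim (use pf_pathD(2)[OF elim(2)] in \<open>auto simp: emp_dust_def vertex_at_def edge_at_def\<close>)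
  from Lim_transform_eventually[OF elim(1) this] show ?case by (rule LIMSEQ_imp_Suc)
qed

end

section \<open>The kernel of extreme laws\<close>

lemma extreme_law_measure:
  assumes "p \<in> nabla"
  shows "prob_space (extreme_law p)" "sets (extreme_law p) = sets path_borel" "space (extreme_law p) = paths"
  by (rule central_measuresD[OF extreme_law(1)[OF assms]])+

lemma extreme_law_cylinder_not_pf:
  assumes "p \<in> nabla" "\<gamma> \<in> walks leaf n" "\<not> path_forest (walk_end leaf \<gamma>)"
  shows "measure (extreme_law p) (cylinder \<gamma>) = 0"
  using extreme_law(2)[OF assms(1,2)] assms(3) by (simp add: pf_fun_def)

lemma extreme_law_cylinder_path_forest:
  assumes "p \<in> nabla" "\<gamma> \<in> walks leaf n" "walk_end leaf \<gamma> = path_forest_tree \<kappa>" "0 \<notin># \<kappa>"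
  shows "measure (extreme_law p) (cylinder \<gamma>) = paintbox p \<kappa>"
  using extreme_law(2)[OF assms(1,2)] assms(3,4) by (simp add: pf_fun_def shape_path_forest_tree partitions_def)

lemma continuous_extreme_law_cylinder: "continuous_on nabla (\<lambda>p. measure (extreme_law p) (cylinder \<gamma>))"
proof (cases "\<gamma> \<in> walks leaf (length \<gamma>)")
  case True
  show ?thesis
  proof (cases "path_forest (walk_end leaf \<gamma>)")
    case pf: True
    then obtain \<kappa> where \<kappa>: "0 \<notin># \<kappa>" "walk_end leaf \<gamma> = path_forest_tree \<kappa>" by (auto simp: path_forest_iff partitions_def)
    show ?thesis
      using extreme_law_cylinder_path_forest[OF _ True \<kappa>(2,1)] continuous_on_paintbox[OF \<kappa>(1)]
      by (subst continuous_on_cong[OF refl]) auto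
  next
    case False
    then show ?thesis
      using extreme_law_cylinder_not_pf[OF _ True] by (subst continuous_on_cong[OF refl, of _ _ "\<lambda>_. 0"]) auto
  qed
next
  case False
  then show ?thesis by (simp add: cylinder_not_walk)
qed

lemma extreme_law_kernel: "extreme_law \<in> measurable nabla_borel (subprob_algebra path_borel)"
proof (rule measurable_subprob_algebra_generated[OF sets_path_borel Int_stable_cylinder])
  show "range cylinder \<subseteq> Pow paths" using cylinder_subset_paths by auto
  show "subprob_space (extreme_law p)" "sets (extreme_law p) = sets path_borel" if "p \<in> space nabla_borel" for p
    using extreme_law_measure[of p] that by (auto intro: prob_space_imp_subprob_space)
  have cyl: "(\<lambda>p. emeasure (extreme_law p) (cylinder \<gamma>)) \<in> borel_measurable nabla_borel" for \<gamma>
  proof -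
    have "(\<lambda>p. ennreal (measure (extreme_law p) (cylinder \<gamma>))) \<in> borel_measurable nabla_borel"
      using continuous_nabla_borel[OF continuous_extreme_law_cylinder] by (rule measurable_compose[OF _ measurable_ennreal])
    moreover have "emeasure (extreme_law p) (cylinder \<gamma>) = ennreal (measure (extreme_law p) (cylinder \<gamma>))"
      if "p \<in> space nabla_borel" for p
      using that extreme_law_measure(1)[of p] by (intro finite_measure.emeasure_eq_measure) (simp add: prob_space_def)
    ultimately show ?thesis by (subst measurable_cong)
  qed
  then show "(\<lambda>p. emeasure (extreme_law p) A) \<in> borel_measurable nabla_borel" if "A \<in> range cylinder" for A
    using that by blast
  show "(\<lambda>p. emeasure (extreme_law p) paths) \<in> borel_measurable nabla_borel" using cyl[of "[]"] by simp
qed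

text \<open>This makes the whole almost sure theory available for the paintbox laws
  themselves.\<close>

lemma central_pf_extreme_law:
  assumes p: "p \<in> nabla" shows "central_pf (extreme_law p)"
proof
  interpret prob_space "extreme_law p" by (rule extreme_law_measure[OF p])
  have "measure (extreme_law p) {\<omega> \<in> paths. path_forest (vertex_at n \<omega>)} = 1" if n: "n \<ge> 1" for n
  proof -
    let ?Q = "\<lambda>\<gamma>. path_forest (walk_end leaf \<gamma>)"
    have "1 = measure (extreme_law p) {\<omega> \<in> paths. True}" using prob_space extreme_law_measure(3)[OF p] by simp
    also have "\<dots> = (\<Sum>\<gamma>\<in>walks leaf (n - 1). measure (extreme_law p) (cylinder \<gamma>))"
      using measure_prefix_set[OF extreme_law_measure(1,2)[OF p], of "\<lambda>_. True" "n - 1"] by simp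
    also have "\<dots> = (\<Sum>\<gamma>\<in>{\<gamma>\<in>walks leaf (n - 1). ?Q \<gamma>}. measure (extreme_law p) (cylinder \<gamma>))"
      using extreme_law_cylinder_not_pf[OF p] by (intro sum.mono_neutral_right) auto
    also have "\<dots> = measure (extreme_law p) {\<omega> \<in> paths. ?Q (prefix_at (n - 1) \<omega>)}"
      by (rule measure_prefix_set[OF extreme_law_measure(1,2)[OF p], symmetric])
    also have "{\<omega> \<in> paths. ?Q (prefix_at (n - 1) \<omega>)} = {\<omega> \<in> paths. path_forest (vertex_at n \<omega>)}"
      using prefix_at_path(2) by (auto simp: vertex_at_def edge_at_def)
    finally show ?thesis by simp
  qed
  then show "extreme_law p \<in> central_measures_pf" using extreme_law(1)[OF p] by (simp add: central_measures_pf_def)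
qed

lemma paintbox_singleton: "k \<ge> 1 \<Longrightarrow> paintbox p {#k#} = power_sum k p"
  using paintbox_recursion[of "{#}" k p] by simp

lemma paintbox_pair: "k \<ge> 1 \<Longrightarrow> (power_sum k p)\<^sup>2 = paintbox p {#k, k#} + paintbox p {#k + k#}"
  using paintbox_recursion[of "{#k#}" k p] by (simp add: paintbox_singleton power2_eq_square)

section \<open>The conditional law given the limit frequencies\<close>

context central_pf
begin

lemma limit_freq_measurable' [measurable]: "limit_freq \<in> measurable \<mu> nabla_borel"
  using limit_freq_path_borel measurable_cong_sets[OF sets_eq refl] by blast

lemma kernel_measurable [measurable]: "(\<lambda>\<omega>. extreme_law (limit_freq \<omega>)) \<in> measurable \<mu> (subprob_algebra path_borel)"
  by (rule measurable_compose[OF limit_freq_measurable' extreme_law_kernel])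

text \<open>For T in the central tail, \<open>sampling_integral\<close> holds at every level with
  the same left-hand side; let the level grow by dominated convergence. Prefixes ending outside the
  path-forests have mass zero on both sides.\<close>

lemma tail_cylinder:
  assumes \<gamma>: "\<gamma> \<in> walks leaf n" and T: "T \<in> raw_central_tail"
  shows "measure \<mu> (cylinder \<gamma> \<inter> T) = (\<integral>\<omega>. indicator T \<omega> * measure (extreme_law (limit_freq \<omega>)) (cylinder \<gamma>) \<partial>\<mu>)"
proof (cases "path_forest (walk_end leaf \<gamma>)")
  case True
  then obtain \<kappa> where \<kappa>: "0 \<notin># \<kappa>" "walk_end leaf \<gamma> = path_forest_tree \<kappa>" by (auto simp: path_forest_iff partitions_def)
  have "vertices (walk_end leaf \<gamma>) = Suc n" using vertices_walk_end[OF \<gamma>] by (simp add: leaf_def)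
  then have n: "n = sum_mset \<kappa>" using \<kappa> by (simp add: vertices_path_forest_tree)
  have T': "T \<in> sets \<mu>" using raw_central_tail_sets[OF T] sets_eq by simp
  let ?s = "\<lambda>N \<omega>. indicator T \<omega> * sampling \<kappa> (Y (N + n) \<omega>)"
  have "(\<lambda>N. \<integral>\<omega>. ?s N \<omega> \<partial>\<mu>) \<longlonglongrightarrow> (\<integral>\<omega>. indicator T \<omega> * paintbox (limit_freq \<omega>) \<kappa> \<partial>\<mu>)"
  proof (rule integral_dominated_convergence[where w = "\<lambda>_. 1"])
    show "(\<lambda>\<omega>. indicator T \<omega> * paintbox (limit_freq \<omega>) \<kappa>) \<in> borel_measurable \<mu>"
      using T' measurable_compose[OF limit_freq_measurable' continuous_nabla_borel[OF continuous_on_paintbox[OF \<kappa>(1)]]]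
      by (intro borel_measurable_times borel_measurable_indicator)
    show "?s N \<in> borel_measurable \<mu>" for N
      using T' measurable_Y by (intro borel_measurable_times borel_measurable_indicator)
    show "AE \<omega> in \<mu>. (\<lambda>N. ?s N \<omega>) \<longlonglongrightarrow> indicator T \<omega> * paintbox (limit_freq \<omega>) \<kappa>"
      using AE_typical
      by eventually_elim (intro tendsto_mult tendsto_const LIMSEQ_ignore_initial_segment typicalD(6) \<kappa>(1))
    show "AE \<omega> in \<mu>. norm (?s N \<omega>) \<le> 1" for N
      using AE_pf
    proof eventually_elim
      case (elim \<omega>)
      have "sampling \<kappa> (Y (N + n) \<omega>) \<le> 1"
        using u_sampling_le_1(2)[OF \<kappa>(1)] pf_pathD(4)[OF elim, of "N + n"] n by simp
      then show ?case by (auto simp: indicator_def sampling_nonneg)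
    qed
  qed simp
  moreover have "(\<integral>\<omega>. ?s N \<omega> \<partial>\<mu>) = measure \<mu> (cylinder \<gamma> \<inter> T)" for N
    using sampling_integral[OF \<kappa>(1), of \<gamma> "N + n" T] \<gamma> \<kappa>(2) n subsetD[OF raw_central_tail_sub T, of "N + n"] by simp
  ultimately have "measure \<mu> (cylinder \<gamma> \<inter> T) = (\<integral>\<omega>. indicator T \<omega> * paintbox (limit_freq \<omega>) \<kappa> \<partial>\<mu>)"
    by (simp add: LIMSEQ_const_iff)
  also have "\<dots> = (\<integral>\<omega>. indicator T \<omega> * measure (extreme_law (limit_freq \<omega>)) (cylinder \<gamma>) \<partial>\<mu>)"
    using extreme_law_cylinder_path_forest[OF limit_freq_in_nabla \<gamma> \<kappa>(2,1)]
    by (intro Bochner_Integration.integral_cong) auto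
  finally show ?thesis .
next
  case False
  have "AE \<omega> in \<mu>. \<omega> \<notin> cylinder \<gamma>"
    using AE_pf
  proof eventually_elim
    case (elim \<omega>)
    from False pf_pathD(1)[OF elim] pf_pathD(2)[OF elim, of n] show ?case
      using prefix_at_path(2)[of \<omega> n] walks_length[OF \<gamma>] by (auto simp: cylinder_eq)
  qed
  then have "cylinder \<gamma> \<in> null_sets \<mu>" using AE_iff_null_sets[of "cylinder \<gamma>" \<mu>] sets_eq by simp
  then have "measure \<mu> (cylinder \<gamma>) = 0" by (rule measure_eq_0_null_sets)
  moreover have "measure \<mu> (cylinder \<gamma> \<inter> T) \<le> measure \<mu> (cylinder \<gamma>)"
    by (intro finite_measure_mono) (auto simp: sets_eq)
  ultimately have "measure \<mu> (cylinder \<gamma> \<inter> T) = 0" using measure_nonneg[of \<mu> "cylinder \<gamma> \<inter> T"] by linarith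
  moreover have "(\<integral>\<omega>. indicator T \<omega> * measure (extreme_law (limit_freq \<omega>)) (cylinder \<gamma>) \<partial>\<mu>) = (\<integral>\<omega>. 0 \<partial>\<mu>)"
    using extreme_law_cylinder_not_pf[OF limit_freq_in_nabla \<gamma> False]
    by (intro Bochner_Integration.integral_cong) auto
  ultimately show ?thesis by simp
qed

text \<open>For fixed T both sides are finite measures in A, the restriction of \<mu> to T and a
  mixture of paintbox laws; they agree on cylinders.\<close>

lemma tail_emeasure:
  assumes A: "A \<in> sets path_borel" and T: "T \<in> raw_central_tail"
  shows "emeasure \<mu> (A \<inter> T) = (\<integral>\<^sup>+\<omega>. indicator T \<omega> * emeasure (extreme_law (limit_freq \<omega>)) A \<partial>\<mu>)"
proof -
  have T': "T \<in> sets \<mu>" using raw_central_tail_sets[OF T] sets_eq by simp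
  let ?D = "density \<mu> (indicator T)"
  let ?B = "?D \<bind> (\<lambda>\<omega>. extreme_law (limit_freq \<omega>))"
  have ne: "space ?D \<noteq> {}" unfolding space_density by (rule not_empty)
  have kern: "(\<lambda>\<omega>. extreme_law (limit_freq \<omega>)) \<in> measurable ?D (subprob_algebra path_borel)"
    using kernel_measurable by simp
  have sets_B: "sets ?B = sets path_borel"
    using subprob_measurableD(2)[OF kern] by (rule sets_bind) (simp, rule ne)
  have D: "emeasure ?D X = emeasure \<mu> (X \<inter> T)" if "X \<in> sets path_borel" for X
    using that T' sets_eq by (simp add: emeasure_density indicator_inter_arith[symmetric] Int_commute)
  have B: "emeasure ?B X = (\<integral>\<^sup>+\<omega>. indicator T \<omega> * emeasure (extreme_law (limit_freq \<omega>)) X \<partial>\<mu>)" if X: "X \<in> sets path_borel" for X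
  proof -
    have "(\<lambda>\<omega>. emeasure (extreme_law (limit_freq \<omega>)) X) \<in> borel_measurable \<mu>"
      by (rule measurable_compose[OF kernel_measurable measurable_emeasure_subprob_algebra[OF X]])
    then show ?thesis using emeasure_bind[OF ne kern X] T' by (simp add: nn_integral_density)
  qed
  have "?D = ?B"
  proof (rule measure_eqI_generator_eq[OF Int_stable_cylinder, of paths ?D ?B "\<lambda>_. paths"])
    show "range cylinder \<subseteq> Pow paths" using cylinder_subset_paths by auto
    fix X assume "X \<in> range cylinder"
    then obtain \<gamma> where X: "X = cylinder \<gamma>" by blast
    show "emeasure ?D X = emeasure ?B X"
    proof (cases "\<gamma> \<in> walks leaf (length \<gamma>)")
      case True
      have "emeasure ?D X = ennreal (measure \<mu> (cylinder \<gamma> \<inter> T))" using D[of X] X by (simp add: emeasure_eq_measure)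
      also have "\<dots> = ennreal (\<integral>\<omega>. indicator T \<omega> * measure (extreme_law (limit_freq \<omega>)) (cylinder \<gamma>) \<partial>\<mu>)"
        using tail_cylinder[OF True T] by simp
      also have "\<dots> = (\<integral>\<^sup>+\<omega>. ennreal (indicator T \<omega> * measure (extreme_law (limit_freq \<omega>)) (cylinder \<gamma>)) \<partial>\<mu>)"
      proof (rule nn_integral_eq_integral[symmetric])
        have meas: "(\<lambda>\<omega>. measure (extreme_law (limit_freq \<omega>)) (cylinder \<gamma>)) \<in> borel_measurable \<mu>"
          by (rule measurable_compose[OF kernel_measurable measurable_measure_subprob_algebra[OF cylinder_sets]])
        show "integrable \<mu> (\<lambda>\<omega>. indicator T \<omega> * measure (extreme_law (limit_freq \<omega>)) (cylinder \<gamma>))"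
        proof (rule integrable_const_bound[where B = 1])
          show "AE \<omega> in \<mu>. norm (indicator T \<omega> * measure (extreme_law (limit_freq \<omega>)) (cylinder \<gamma>)) \<le> 1"
            using prob_space.prob_le_1[OF extreme_law_measure(1)[OF limit_freq_in_nabla]]
            by (intro AE_I2) (auto simp: indicator_def)
        qed (use T' meas in \<open>intro borel_measurable_times borel_measurable_indicator\<close>)
      qed simp
      also have "\<dots> = emeasure ?B X"
        unfolding X B[OF cylinder_sets]
        using finite_measure.emeasure_eq_measure[OF prob_space.axioms(1)[OF extreme_law_measure(1)[OF limit_freq_in_nabla]]]
        by (intro nn_integral_cong) (auto simp: indicator_def)
      finally show ?thesis .
    next
      case False
      then show ?thesis unfolding X by (simp add: cylinder_not_walk)
    qed
  next
    show "sets ?D = sigma_sets paths (range cylinder)" by (simp add: sets_eq sets_path_borel)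
    show "sets ?B = sigma_sets paths (range cylinder)" unfolding sets_B by (rule sets_path_borel)
    show "range (\<lambda>_. paths) \<subseteq> range cylinder" using rangeI[of cylinder "[]"] by auto
    show "emeasure ?D paths \<noteq> \<infinity>" for i :: nat using D[of paths] sets.top[of path_borel] by (simp add: emeasure_eq_measure)
  qed simp
  then show ?thesis using D[OF A] B[OF A] by simp
qed

lemma measure_extreme_law_measurable:
  "A \<in> sets path_borel \<Longrightarrow> (\<lambda>\<omega>. measure (extreme_law (limit_freq \<omega>)) A) \<in> borel_measurable \<mu>"
  by (rule measurable_compose[OF kernel_measurable measurable_measure_subprob_algebra])

lemma emeasure_extreme_law: "\<omega> \<in> paths \<Longrightarrow> emeasure (extreme_law (limit_freq \<omega>)) A = ennreal (measure (extreme_law (limit_freq \<omega>)) A)"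
  using finite_measure.emeasure_eq_measure[OF prob_space.axioms(1)[OF extreme_law_measure(1)[OF limit_freq_in_nabla]]] .

lemma extreme_law_bound: "\<omega> \<in> paths \<Longrightarrow> measure (extreme_law (limit_freq \<omega>)) A \<le> 1"
  by (rule prob_space.prob_le_1[OF extreme_law_measure(1)[OF limit_freq_in_nabla]])

lemma tail_measure:
  assumes A: "A \<in> sets path_borel" and T: "T \<in> raw_central_tail"
  shows "integrable \<mu> (\<lambda>\<omega>. indicator T \<omega> * measure (extreme_law (limit_freq \<omega>)) A)"
    "measure \<mu> (A \<inter> T) = (\<integral>\<omega>. indicator T \<omega> * measure (extreme_law (limit_freq \<omega>)) A \<partial>\<mu>)"
proof -
  have T': "T \<in> sets \<mu>" using raw_central_tail_sets[OF T] sets_eq by simp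
  show int: "integrable \<mu> (\<lambda>\<omega>. indicator T \<omega> * measure (extreme_law (limit_freq \<omega>)) A)"
  proof (rule integrable_const_bound[where B = 1])
    show "AE \<omega> in \<mu>. norm (indicator T \<omega> * measure (extreme_law (limit_freq \<omega>)) A) \<le> 1"
      using extreme_law_bound by (intro AE_I2) (auto simp: indicator_def)
  qed (use T' measure_extreme_law_measurable[OF A] in \<open>intro borel_measurable_times borel_measurable_indicator\<close>)
  have "ennreal (measure \<mu> (A \<inter> T)) = (\<integral>\<^sup>+\<omega>. ennreal (indicator T \<omega> * measure (extreme_law (limit_freq \<omega>)) A) \<partial>\<mu>)"
    unfolding emeasure_eq_measure[symmetric] tail_emeasure[OF A T]
    using emeasure_extreme_law by (intro nn_integral_cong) (auto simp: indicator_def)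
  also have "\<dots> = ennreal (\<integral>\<omega>. indicator T \<omega> * measure (extreme_law (limit_freq \<omega>)) A \<partial>\<mu>)"
    by (rule nn_integral_eq_integral[OF int]) simp
  finally show "measure \<mu> (A \<inter> T) = (\<integral>\<omega>. indicator T \<omega> * measure (extreme_law (limit_freq \<omega>)) A \<partial>\<mu>)"
    by (subst (asm) ennreal_inj) (auto intro!: integral_nonneg_AE)
qed

lemma paths_tail: "paths \<in> raw_central_tail"
  using sets.top[of "sigma paths raw_central_tail"] unfolding sets_raw_central_tail .

lemma mixture_emeasure:
  assumes A: "A \<in> sets path_borel"
  shows "emeasure \<mu> A = (\<integral>\<^sup>+\<omega>. emeasure (extreme_law (limit_freq \<omega>)) A \<partial>\<mu>)"
proof -
  have "A \<inter> paths = A" using sets.sets_into_space[OF A] by auto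
  then have "emeasure \<mu> A = (\<integral>\<^sup>+\<omega>. indicator paths \<omega> * emeasure (extreme_law (limit_freq \<omega>)) A \<partial>\<mu>)"
    using tail_emeasure[OF A paths_tail] by simp
  also have "\<dots> = (\<integral>\<^sup>+\<omega>. emeasure (extreme_law (limit_freq \<omega>)) A \<partial>\<mu>)"
    by (intro nn_integral_cong) simp
  finally show ?thesis .
qed

lemma mixture_measure:
  assumes A: "A \<in> sets path_borel"
  shows "integrable \<mu> (\<lambda>\<omega>. measure (extreme_law (limit_freq \<omega>)) A)"
    "measure \<mu> A = (\<integral>\<omega>. measure (extreme_law (limit_freq \<omega>)) A \<partial>\<mu>)"
proof -
  have eq: "indicator paths \<omega> * measure (extreme_law (limit_freq \<omega>)) A = measure (extreme_law (limit_freq \<omega>)) A"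
    if "\<omega> \<in> space \<mu>" for \<omega> using that by simp
  have "A \<inter> paths = A" using sets.sets_into_space[OF A] by auto
  with tail_measure(2)[OF A paths_tail] Bochner_Integration.integral_cong[OF refl eq, of \<mu>]
  show "measure \<mu> A = (\<integral>\<omega>. measure (extreme_law (limit_freq \<omega>)) A \<partial>\<mu>)" by simp
  show "integrable \<mu> (\<lambda>\<omega>. measure (extreme_law (limit_freq \<omega>)) A)"
    using tail_measure(1)[OF A paths_tail] Bochner_Integration.integrable_cong[OF refl eq, of \<mu>] by simp
qed

section \<open>The completed tail and the conditional law\<close>

abbreviation tail_limit :: "path measure" where
  "tail_limit \<equiv> vimage_algebra paths limit_freq nabla_borel"

lemma sets_tail_limit: "sets tail_limit = {limit_freq -` B \<inter> paths | B. B \<in> sets nabla_borel}"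
  using limit_freq_in_nabla by (subst sets_vimage_algebra2) auto

lemma tail_limit_subset: "sets tail_limit \<subseteq> raw_central_tail"
  using measurable_sets[OF limit_freq_measurable] by (auto simp: sets_tail_limit sets_raw_central_tail)

lemma measure_extreme_law_tail_limit:
  assumes "A \<in> sets path_borel"
  shows "(\<lambda>\<omega>. measure (extreme_law (limit_freq \<omega>)) A) \<in> borel_measurable tail_limit"
proof -
  have "limit_freq \<in> measurable tail_limit nabla_borel"
    using limit_freq_in_nabla by (intro measurable_vimage_algebra1) auto
  from measurable_compose[OF measurable_compose[OF this extreme_law_kernel] measurable_measure_subprob_algebra[OF assms]]
  show ?thesis .
qed

text \<open>Apply \<open>tail_measure\<close> to A = T: the conditional probability of T integrates
  to the mass of T over T, and to 0 over the complement, so it is the indicator of T.\<close>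

lemma AE_tail_indicator:
  assumes T: "T \<in> raw_central_tail"
  shows "AE \<omega> in \<mu>. \<omega> \<in> T \<longleftrightarrow> measure (extreme_law (limit_freq \<omega>)) T = 1"
proof -
  let ?f = "\<lambda>\<omega>. measure (extreme_law (limit_freq \<omega>)) T"
  have Tb: "T \<in> sets path_borel" by (rule raw_central_tail_sets[OF T])
  have T': "T \<in> sets \<mu>" using Tb sets_eq by simp
  have C: "paths - T \<in> raw_central_tail"
    using sets.compl_sets[of T "sigma paths raw_central_tail"] T unfolding sets_raw_central_tail by simp
  have "(\<integral>\<omega>. indicator T \<omega> - indicator T \<omega> * ?f \<omega> \<partial>\<mu>) = 0"
    using tail_measure[OF Tb T] T' sets.sets_into_space[OF T'] by (simp add: emeasure_eq_measure Int_absorb2)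
  then have 1: "AE \<omega> in \<mu>. indicator T \<omega> - indicator T \<omega> * ?f \<omega> = 0"
  proof (subst (asm) integral_nonneg_eq_0_iff_AE)
    show "integrable \<mu> (\<lambda>\<omega>. indicator T \<omega> - indicator T \<omega> * ?f \<omega>)"
      using tail_measure(1)[OF Tb T] T' by (intro Bochner_Integration.integrable_diff) (simp_all add: emeasure_eq_measure)
    show "AE \<omega> in \<mu>. 0 \<le> indicator T \<omega> - indicator T \<omega> * ?f \<omega>"
      using extreme_law_bound by (intro AE_I2) (auto simp: indicator_def)
  qed
  have "(\<integral>\<omega>. indicator (paths - T) \<omega> * ?f \<omega> \<partial>\<mu>) = 0"
    using tail_measure(2)[OF Tb C] by simp
  then have 2: "AE \<omega> in \<mu>. indicator (paths - T) \<omega> * ?f \<omega> = 0"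
    using tail_measure(1)[OF Tb C] by (subst (asm) integral_nonneg_eq_0_iff_AE) auto
  show ?thesis using 1 2 AE_space by eventually_elim (auto simp: indicator_def split: if_splits)
qed

text \<open>A tail event T differs from the event that its conditional probability equals 1, which
  is a function of the limit frequencies, only inside a null Borel set N; T is rebuilt from that
  event off N and from T within N.\<close>

lemma completed_tail: "completed \<mu> raw_central_tail = completed \<mu> (sets tail_limit)"
proof
  let ?null = "{A. \<exists>N\<in>null_sets \<mu>. A \<subseteq> N}"
  show "completed \<mu> (sets tail_limit) \<subseteq> completed \<mu> raw_central_tail"
    unfolding completed_def using tail_limit_subset by (intro sigma_sets_mono') auto
  have null_paths: "?null \<subseteq> Pow paths" using sets.sets_into_space[of _ \<mu>] by (auto simp: null_sets_def)
  have gen: "sets tail_limit \<union> ?null \<subseteq> Pow paths"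
    using null_paths sets.sets_into_space[of _ tail_limit] by auto
  interpret C: sigma_algebra paths "completed \<mu> (sets tail_limit)"
    unfolding completed_def by (rule sigma_algebra_sigma_sets[OF gen])
  have sub: "sets tail_limit \<subseteq> completed \<mu> (sets tail_limit)" "?null \<subseteq> completed \<mu> (sets tail_limit)"
    unfolding completed_def by auto
  have "raw_central_tail \<subseteq> completed \<mu> (sets tail_limit)"
  proof
    fix T assume T: "T \<in> raw_central_tail"
    let ?f = "\<lambda>\<omega>. measure (extreme_law (limit_freq \<omega>)) T"
    let ?B = "{\<omega> \<in> paths. ?f \<omega> = 1}"
    have Tb: "T \<in> sets path_borel" by (rule raw_central_tail_sets[OF T])
    then have Tp: "T \<subseteq> paths" using sets.sets_into_space[of T path_borel] by simp
    have "?B = ?f -` {1} \<inter> space tail_limit" by auto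
    also have "\<dots> \<in> sets tail_limit" by (rule measurable_sets[OF measure_extreme_law_tail_limit[OF Tb]]) simp
    finally have B: "?B \<in> completed \<mu> (sets tail_limit)" using sub by blast
    from AE_tail_indicator[OF T] obtain N where N: "{\<omega> \<in> space \<mu>. \<not> (\<omega> \<in> T \<longleftrightarrow> ?f \<omega> = 1)} \<subseteq> N"
      "emeasure \<mu> N = 0" "N \<in> sets \<mu>" by (rule AE_E)
    then have null: "N \<in> null_sets \<mu>" by auto
    have "N \<in> completed \<mu> (sets tail_limit)" "T \<inter> N \<in> completed \<mu> (sets tail_limit)"
      using null by (intro subsetD[OF sub(2)], blast)+
    then have "(?B - N) \<union> (T \<inter> N) \<in> completed \<mu> (sets tail_limit)" using B by (intro C.Un C.Diff)
    moreover have "T = (?B - N) \<union> (T \<inter> N)" using N(1) Tp by auto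
    ultimately show "T \<in> completed \<mu> (sets tail_limit)" by (rule ssubst[rotated])
  qed
  then have "raw_central_tail \<union> ?null \<subseteq> completed \<mu> (sets tail_limit)" using sub(2) by blast
  then show "completed \<mu> raw_central_tail \<subseteq> completed \<mu> (sets tail_limit)"
    unfolding completed_def[of \<mu> raw_central_tail] by (rule C.sigma_sets_subset)
qed

lemma conditional_law:
  assumes A: "A \<in> sets path_borel"
  shows "AE \<omega> in \<mu>. real_cond_exp \<mu> tail_limit (indicator A) \<omega> = measure (extreme_law (limit_freq \<omega>)) A"
proof -
  have sub: "subalgebra \<mu> tail_limit"
    using tail_limit_subset raw_central_tail_sets sets_eq by (auto simp: subalgebra_def)
  interpret finite_measure_subalgebra \<mu> tail_limit
    by (intro finite_measure_subalgebra.intro finite_measure_axioms finite_measure_subalgebra_axioms.intro sub)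
  interpret sigma_finite_subalgebra \<mu> tail_limit
    by (rule finite_measure_subalgebra_is_sigma_finite) unfold_locales
  have A': "A \<in> sets \<mu>" using A sets_eq by simp
  show ?thesis
  proof (rule real_cond_exp_charact)
    fix T assume "T \<in> sets tail_limit"
    then have T: "T \<in> raw_central_tail" using tail_limit_subset by blast
    then have T': "T \<in> sets \<mu>" using raw_central_tail_sets sets_eq by simp
    have AT: "A \<inter> T \<in> sets \<mu>" using A' T' by blast
    have "(\<integral>\<omega>\<in>T. indicator A \<omega> \<partial>\<mu>) = (\<integral>\<omega>. indicator (A \<inter> T) \<omega> \<partial>\<mu>)"
      unfolding set_lebesgue_integral_def by (intro Bochner_Integration.integral_cong) (auto simp: indicator_def)
    also have "\<dots> = measure \<mu> (A \<inter> T)"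
      using Bochner_Integration.integral_indicator[of \<mu> "A \<inter> T"] sets.Int_space_eq2[OF AT] by simp
    also have "\<dots> = (\<integral>\<omega>. indicator T \<omega> * measure (extreme_law (limit_freq \<omega>)) A \<partial>\<mu>)" by (rule tail_measure(2)[OF A T])
    also have "\<dots> = (\<integral>\<omega>\<in>T. measure (extreme_law (limit_freq \<omega>)) A \<partial>\<mu>)"
      unfolding set_lebesgue_integral_def by simp
    finally show "(\<integral>\<omega>\<in>T. indicator A \<omega> \<partial>\<mu>) = (\<integral>\<omega>\<in>T. measure (extreme_law (limit_freq \<omega>)) A \<partial>\<mu>)" .
  next
    show "integrable \<mu> (indicator A :: path \<Rightarrow> real)" using A' by (simp add: emeasure_eq_measure)
    show "integrable \<mu> (\<lambda>\<omega>. measure (extreme_law (limit_freq \<omega>)) A)"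
      by (rule mixture_measure(1)[OF A])
    show "(\<lambda>\<omega>. measure (extreme_law (limit_freq \<omega>)) A) \<in> borel_measurable tail_limit"
      by (rule measure_extreme_law_tail_limit[OF A])
  qed
qed

end

section \<open>The weak topology on central measures\<close>

lemma prefix_integral:
  fixes k :: "edge list \<Rightarrow> real"
  assumes "prob_space m" "sets m = sets path_borel"
  shows "(\<integral>\<omega>. k (prefix_at n \<omega>) \<partial>m) = (\<Sum>\<gamma>\<in>walks leaf n. k \<gamma> * measure m (cylinder \<gamma>))"
proof -
  interpret prob_space m by fact
  have sp: "space m = paths" using sets_eq_imp_space_eq[OF assms(2)] by simp
  have cyl: "cylinder \<gamma> \<in> sets m" for \<gamma> using assms(2) by simp
  have "(\<integral>\<omega>. k (prefix_at n \<omega>) \<partial>m) = (\<integral>\<omega>. (\<Sum>\<gamma>\<in>walks leaf n. k \<gamma> * indicator (cylinder \<gamma>) \<omega>) \<partial>m)"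
  proof (intro Bochner_Integration.integral_cong refl)
    fix \<omega> assume "\<omega> \<in> space m"
    then have \<omega>: "\<omega> \<in> paths" using sp by simp
    have "(\<Sum>\<gamma>\<in>walks leaf n. k \<gamma> * indicator (cylinder \<gamma>) \<omega>) =
        (\<Sum>\<gamma>\<in>walks leaf n. if \<gamma> = prefix_at n \<omega> then k (prefix_at n \<omega>) else 0)"
      using \<omega> by (intro sum.cong) (auto simp: cylinder_eq indicator_def dest: walks_length)
    then show "k (prefix_at n \<omega>) = (\<Sum>\<gamma>\<in>walks leaf n. k \<gamma> * indicator (cylinder \<gamma>) \<omega>)"
      using prefix_at_path(1)[OF \<omega>] by simp
  qed
  also have "\<dots> = (\<Sum>\<gamma>\<in>walks leaf n. \<integral>\<omega>. k \<gamma> * indicator (cylinder \<gamma>) \<omega> \<partial>m)"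
    using cyl by (intro Bochner_Integration.integral_sum integrable_mult_right) (simp add: emeasure_eq_measure)
  also have "\<dots> = (\<Sum>\<gamma>\<in>walks leaf n. k \<gamma> * measure m (cylinder \<gamma>))"
    using sets.Int_space_eq2[OF cyl] by simp
  finally show ?thesis .
qed

text \<open>Replacing f by its value at a sample point of each cylinder changes the integral by less
  than e uniformly in p, and the new integral is a finite combination of continuous cylinder
  probabilities.\<close>

lemma continuous_extreme_law_integral:
  assumes f: "continuous_map path_topology euclideanreal f"
  shows "continuous_on nabla (\<lambda>p. \<integral>\<omega>. f \<omega> \<partial>extreme_law p)"
proof -
  \<comment> \<open>For an empty cylinder the chosen value is arbitrary, but it is multiplied by
    mass 0.\<close>
  define k where "k \<gamma> = f (SOME \<omega>. \<omega> \<in> cylinder \<gamma>)" for \<gamma>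
  let ?g = "\<lambda>n p. \<Sum>\<gamma>\<in>walks leaf n. k \<gamma> * measure (extreme_law p) (cylinder \<gamma>)"
  show ?thesis
  proof (rule uniform_limit_theorem)
    show "\<forall>\<^sub>F n in sequentially. continuous_on nabla (?g n)"
      by (intro always_eventually allI continuous_intros continuous_extreme_law_cylinder)
    show "uniform_limit nabla ?g (\<lambda>p. \<integral>\<omega>. f \<omega> \<partial>extreme_law p) sequentially"
    proof (rule uniform_limitI)
      fix e :: real assume e: "0 < e"
      then obtain n where n: "\<And>\<omega> \<omega>'. \<omega> \<in> paths \<Longrightarrow> \<omega>' \<in> paths \<Longrightarrow> prefix_at n \<omega> = prefix_at n \<omega>' \<Longrightarrow> \<bar>f \<omega> - f \<omega>'\<bar> < e / 2"
        using continuous_uniform_approx[OF f, of "e / 2"] by auto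
      have "dist (?g N p) (\<integral>\<omega>. f \<omega> \<partial>extreme_law p) < e" if N: "n \<le> N" and p: "p \<in> nabla" for N p
      proof -
        interpret prob_space "extreme_law p" by (rule extreme_law_measure[OF p])
        note E = extreme_law_measure[OF p]
        have fm: "f \<in> borel_measurable (extreme_law p)"
          using continuous_measurable[OF f] E(2) measurable_cong_sets by blast
        obtain B where B: "\<And>\<omega>. \<omega> \<in> paths \<Longrightarrow> \<bar>f \<omega>\<bar> \<le> B" using continuous_bounded[OF f] by blast
        have fi: "integrable (extreme_law p) f"
          using B E(3) by (intro integrable_const_bound[OF AE_I2 fm]) auto
        have ki: "integrable (extreme_law p) (\<lambda>\<omega>. k (prefix_at N \<omega>))" by (rule integrable_prefix[OF E(1,2)])
        have "?g N p - (\<integral>\<omega>. f \<omega> \<partial>extreme_law p) = (\<integral>\<omega>. k (prefix_at N \<omega>) - f \<omega> \<partial>extreme_law p)"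
          unfolding prefix_integral[OF E(1,2), symmetric] using ki fi by simp
        also have "\<bar>\<dots>\<bar> \<le> (\<integral>\<omega>. \<bar>k (prefix_at N \<omega>) - f \<omega>\<bar> \<partial>extreme_law p)" by (rule integral_abs_bound)
        also have "\<dots> \<le> (\<integral>\<omega>. e / 2 \<partial>extreme_law p)"
        proof (rule integral_mono)
          show "integrable (extreme_law p) (\<lambda>\<omega>. \<bar>k (prefix_at N \<omega>) - f \<omega>\<bar>)" using ki fi by simp
          fix \<omega> assume "\<omega> \<in> space (extreme_law p)"
          then have \<omega>: "\<omega> \<in> paths" using E(3) by simp
          let ?\<omega> = "SOME \<omega>'. \<omega>' \<in> cylinder (prefix_at N \<omega>)"
          have "\<omega> \<in> cylinder (prefix_at N \<omega>)" using \<omega> by (simp add: cylinder_eq)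
          then have "?\<omega> \<in> cylinder (prefix_at N \<omega>)" by (rule someI[of "\<lambda>\<omega>'. \<omega>' \<in> cylinder (prefix_at N \<omega>)"])
          then have "?\<omega> \<in> paths" "prefix_at N ?\<omega> = prefix_at N \<omega>" by (auto simp: cylinder_eq)
          moreover from this(2) have "prefix_at n ?\<omega> = prefix_at n \<omega>"
            using take_prefix_at[OF N, of ?\<omega>] take_prefix_at[OF N, of \<omega>] by simp
          ultimately show "\<bar>k (prefix_at N \<omega>) - f \<omega>\<bar> \<le> e / 2" using n[of ?\<omega> \<omega>] \<omega> by (simp add: k_def)
        qed simp
        also have "\<dots> < e" using e prob_space by simp
        finally show ?thesis by (simp add: dist_real_def)
      qed
      then show "\<forall>\<^sub>F N in sequentially. \<forall>p\<in>nabla. dist (?g N p) (\<integral>\<omega>. f \<omega> \<partial>extreme_law p) < e"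
        by (auto simp: eventually_sequentially)
    qed
  qed simp
qed

abbreviation weak_subbasis :: "path measure set set" where
  "weak_subbasis \<equiv> {{m \<in> central_measures. (\<integral>\<omega>. f \<omega> \<partial>m) \<in> U} | f U.
     continuous_map path_topology euclideanreal f \<and> open U}"

lemma Union_weak_subbasis: "\<Union>weak_subbasis = central_measures"
proof
  have "{m \<in> central_measures. (\<integral>\<omega>. 0 \<partial>m) \<in> (UNIV :: real set)} \<in> weak_subbasis"
    by (intro CollectI exI[of _ "\<lambda>_. 0"] exI[of _ UNIV]) simp
  then show "central_measures \<subseteq> \<Union>weak_subbasis" by auto
qed auto

lemma weak_open_subset: "{U. openin weak_topology U} \<subseteq> Pow central_measures"
proof -
  have "topspace weak_topology = central_measures"
    unfolding weak_topology_def topology_generated_by_topspace by (rule Union_weak_subbasis)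
  then show ?thesis using openin_subset by blast
qed

lemma space_central_borel [simp]: "space central_borel = central_measures"
  unfolding central_borel_def by (rule space_measure_of[OF weak_open_subset])

lemma weak_open_sets: "openin weak_topology U \<Longrightarrow> U \<in> sets central_borel"
  unfolding central_borel_def sets_measure_of[OF weak_open_subset] by (rule sigma_sets.Basic) simp

lemma integral_central_borel:
  assumes f: "continuous_map path_topology euclideanreal f"
  shows "(\<lambda>m. \<integral>\<omega>. f \<omega> \<partial>m) \<in> borel_measurable central_borel"
proof (rule borel_measurableI)
  fix U :: "real set" assume "open U"
  then have "openin weak_topology {m \<in> central_measures. (\<integral>\<omega>. f \<omega> \<partial>m) \<in> U}"
    unfolding weak_topology_def using f by (intro topology_generated_by_Basis) blast
  then have "{m \<in> central_measures. (\<integral>\<omega>. f \<omega> \<partial>m) \<in> U} \<in> sets central_borel" by (rule weak_open_sets)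
  also have "{m \<in> central_measures. (\<integral>\<omega>. f \<omega> \<partial>m) \<in> U} = (\<lambda>m. \<integral>\<omega>. f \<omega> \<partial>m) -` U \<inter> space central_borel" by auto
  finally show "(\<lambda>m. \<integral>\<omega>. f \<omega> \<partial>m) -` U \<inter> space central_borel \<in> sets central_borel" .
qed

text \<open>Proved through continuity, which reaches every weakly open set at once; preimages of
  subbasic sets alone would not control arbitrary unions.\<close>

lemma extreme_law_measurable: "extreme_law \<in> measurable nabla_borel central_borel"
  unfolding central_borel_def
proof (rule measurable_measure_of[OF weak_open_subset])
  show "extreme_law \<in> space nabla_borel \<rightarrow> central_measures" using extreme_law(1) by simp
  have cont: "continuous_map (top_of_set nabla) weak_topology extreme_law"
    unfolding weak_topology_def
  proof (rule continuous_on_generated_topo)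
    show "extreme_law ` topspace (top_of_set nabla) \<subseteq> \<Union>weak_subbasis"
      unfolding Union_weak_subbasis using extreme_law(1) by auto
    fix W assume "W \<in> weak_subbasis"
    then obtain f U where W: "W = {m \<in> central_measures. (\<integral>\<omega>. f \<omega> \<partial>m) \<in> U}"
      and f: "continuous_map path_topology euclideanreal f" and U: "open U" by blast
    have "openin (top_of_set nabla) (nabla \<inter> (\<lambda>p. \<integral>\<omega>. f \<omega> \<partial>extreme_law p) -` U)"
      by (rule continuous_openin_preimage_gen[OF continuous_extreme_law_integral[OF f] U])
    also have "nabla \<inter> (\<lambda>p. \<integral>\<omega>. f \<omega> \<partial>extreme_law p) -` U = extreme_law -` W \<inter> topspace (top_of_set nabla)"
      unfolding W using extreme_law(1) by auto
    finally show "openin (top_of_set nabla) (extreme_law -` W \<inter> topspace (top_of_set nabla))" .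
  qed
  fix W assume "W \<in> {U. openin weak_topology U}"
  then have "openin (top_of_set nabla) {p \<in> topspace (top_of_set nabla). extreme_law p \<in> W}"
    using cont openin_continuous_map_preimage by fastforce
  then obtain O' where "open O'" "{p \<in> nabla. extreme_law p \<in> W} = nabla \<inter> O'" by (auto simp: openin_open)
  then show "extreme_law -` W \<inter> space nabla_borel \<in> sets nabla_borel"
    by (auto simp: nabla_borel_def sets_restrict_space space_restrict_space vimage_def Int_def conj_commute intro!: image_eqI[of _ _ O'])
qed

text \<open>Viewing a central law as a kernel over itself turns the barycentre of a measure on laws
  into a monadic bind.\<close>

lemma central_borel_kernel: "(\<lambda>m. m) \<in> measurable central_borel (subprob_algebra path_borel)"
proof (rule measurable_subprob_algebra_generated[OF sets_path_borel Int_stable_cylinder])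
  show "range cylinder \<subseteq> Pow paths" using cylinder_subset_paths by auto
  show "subprob_space m" "sets m = sets path_borel" if "m \<in> space central_borel" for m
    using central_measuresD[of m] that by (auto intro: prob_space_imp_subprob_space)
  have cyl: "(\<lambda>m. emeasure m (cylinder \<gamma>)) \<in> borel_measurable central_borel" for \<gamma>
  proof -
    have "(\<lambda>m. ennreal (\<integral>\<omega>. indicator (cylinder \<gamma>) \<omega> \<partial>m)) \<in> borel_measurable central_borel"
      by (rule measurable_compose[OF integral_central_borel[OF continuous_indicator_cylinder] measurable_ennreal])
    moreover have "emeasure m (cylinder \<gamma>) = ennreal (\<integral>\<omega>. indicator (cylinder \<gamma>) \<omega> \<partial>m)" if "m \<in> space central_borel" for m
    proof -
      have m: "prob_space m" "sets m = sets path_borel" using central_measuresD[of m] that by auto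
      interpret prob_space m by fact
      have "cylinder \<gamma> \<in> sets m" using m(2) by simp
      then show ?thesis using sets.Int_space_eq2 by (simp add: emeasure_eq_measure)
    qed
    ultimately show ?thesis by (subst measurable_cong)
  qed
  then show "(\<lambda>m. emeasure m A) \<in> borel_measurable central_borel" if "A \<in> range cylinder" for A
    using that by blast
  show "(\<lambda>m. emeasure m paths) \<in> borel_measurable central_borel" using cyl[of "[]"] by simp
qed

text \<open>Cylinder indicators are continuous test functions, so the barycentre formula fixes all
  cylinder masses, and with them the measure.\<close>

lemma represents_emeasure:
  assumes M: "represents M m" and m: "m \<in> central_measures" and A: "A \<in> sets path_borel"
  shows "emeasure m A = (\<integral>\<^sup>+m'. emeasure m' A \<partial>M)"
proof -
  have sM: "sets M = sets central_borel" and spM: "space M = central_measures"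
    and rep: "\<And>f. continuous_map path_topology euclideanreal f \<Longrightarrow> (\<integral>\<omega>. f \<omega> \<partial>m) = (\<integral>m'. (\<integral>\<omega>. f \<omega> \<partial>m') \<partial>M)"
    using M sets_eq_imp_space_eq[of M central_borel] by (auto simp: represents_def)
  interpret M: prob_space M using M by (simp add: represents_def)
  have kern: "(\<lambda>m. m) \<in> measurable M (subprob_algebra path_borel)"
    using central_borel_kernel measurable_cong_sets[OF sM refl] by blast
  have ind: "(\<integral>\<omega>. indicator (cylinder \<gamma>) \<omega> \<partial>m') = measure m' (cylinder \<gamma>)" if "m' \<in> central_measures" for m' \<gamma>
    using central_measuresD(2,3)[OF that] cylinder_subset_paths[of \<gamma>] by (simp add: Int_absorb2)
  have "m = M \<bind> (\<lambda>m. m)"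
  proof (rule path_measure_eqI)
    show "prob_space m" "sets m = sets path_borel" by (rule central_measuresD[OF m])+
    show "prob_space (M \<bind> (\<lambda>m. m))"
      using central_measuresD(1) spM by (intro M.prob_space_bind[OF AE_I2 kern]) auto
    show "sets (M \<bind> (\<lambda>m. m)) = sets path_borel"
      using central_measuresD(2) spM M.not_empty by (intro sets_bind) auto
    fix n \<gamma>
    have "measure (M \<bind> (\<lambda>m. m)) (cylinder \<gamma>) = (\<integral>m'. measure m' (cylinder \<gamma>) \<partial>M)"
      by (rule M.measure_bind[OF kern cylinder_sets])
    also have "\<dots> = (\<integral>m'. (\<integral>\<omega>. indicator (cylinder \<gamma>) \<omega> \<partial>m') \<partial>M)"
      using ind spM by (intro Bochner_Integration.integral_cong) auto
    also have "\<dots> = measure m (cylinder \<gamma>)" using rep[OF continuous_indicator_cylinder] ind[OF m] by simp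
    finally show "measure m (cylinder \<gamma>) = measure (M \<bind> (\<lambda>m. m)) (cylinder \<gamma>)" ..
  qed
  then show ?thesis using emeasure_bind[OF M.not_empty kern A] by simp
qed

section \<open>Extreme points\<close>

text \<open>A variance argument: for k >= 2 the power sum q of the limit frequencies has mean c =
  power_sum k p, and the product rule gives E q^2 = c^2. So q = c almost surely, and the power sums
  determine the point.\<close>

lemma AE_limit_freq_extreme_law:
  assumes p: "p \<in> nabla" shows "AE \<omega> in extreme_law p. limit_freq \<omega> = p"
proof -
  interpret central_pf "extreme_law p" by (rule central_pf_extreme_law[OF p])
  have E: "integrable (extreme_law p) (\<lambda>\<omega>. paintbox (limit_freq \<omega>) \<kappa>) \<and>
      (\<integral>\<omega>. paintbox (limit_freq \<omega>) \<kappa> \<partial>extreme_law p) = paintbox p \<kappa>" if \<kappa>: "0 \<notin># \<kappa>" for \<kappa>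
  proof -
    obtain \<gamma> where \<gamma>: "\<gamma> \<in> walks leaf (sum_mset \<kappa>)" "walk_end leaf \<gamma> = path_forest_tree \<kappa>" using ex_walk[OF \<kappa>] by blast
    note c = extreme_law_cylinder_path_forest[OF _ \<gamma> \<kappa>]
    have eq: "measure (extreme_law (limit_freq \<omega>)) (cylinder \<gamma>) = paintbox (limit_freq \<omega>) \<kappa>" if "\<omega> \<in> space (extreme_law p)" for \<omega>
      using c[OF limit_freq_in_nabla] that by simp
    have "(\<integral>\<omega>. measure (extreme_law (limit_freq \<omega>)) (cylinder \<gamma>) \<partial>extreme_law p) = (\<integral>\<omega>. paintbox (limit_freq \<omega>) \<kappa> \<partial>extreme_law p)"
      by (intro Bochner_Integration.integral_cong refl eq)
    moreover have "integrable (extreme_law p) (\<lambda>\<omega>. measure (extreme_law (limit_freq \<omega>)) (cylinder \<gamma>)) =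
        integrable (extreme_law p) (\<lambda>\<omega>. paintbox (limit_freq \<omega>) \<kappa>)"
      by (intro Bochner_Integration.integrable_cong refl eq)
    ultimately show ?thesis using mixture_measure[OF cylinder_sets] c[OF p] by metis
  qed
  have "AE \<omega> in extreme_law p. power_sum k (limit_freq \<omega>) = power_sum k p" if k: "k \<ge> 2" for k
  proof -
    let ?c = "power_sum k p" and ?q = "\<lambda>\<omega>. power_sum k (limit_freq \<omega>)"
    have q: "integrable (extreme_law p) ?q" "(\<integral>\<omega>. ?q \<omega> \<partial>extreme_law p) = ?c"
      using E[of "{#k#}"] k by (simp_all add: paintbox_singleton)
    have q2: "integrable (extreme_law p) (\<lambda>\<omega>. (?q \<omega>)\<^sup>2)" "(\<integral>\<omega>. (?q \<omega>)\<^sup>2 \<partial>extreme_law p) = ?c\<^sup>2"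
      using E[of "{#k, k#}"] E[of "{#k + k#}"] k by (simp_all add: paintbox_pair)
    have eq: "(\<lambda>\<omega>. (?q \<omega> - ?c)\<^sup>2) = (\<lambda>\<omega>. (?q \<omega>)\<^sup>2 - 2 * ?c * ?q \<omega> + ?c\<^sup>2)" by (simp add: fun_eq_iff power2_diff)
    have int: "integrable (extreme_law p) (\<lambda>\<omega>. (?q \<omega> - ?c)\<^sup>2)" unfolding eq using q q2 by simp
    have "(\<integral>\<omega>. (?q \<omega> - ?c)\<^sup>2 \<partial>extreme_law p) = ?c\<^sup>2 - 2 * ?c * ?c + ?c\<^sup>2" unfolding eq using q q2 by (simp add: prob_space)
    also have "\<dots> = 0" by (simp add: power2_eq_square)
    finally have "AE \<omega> in extreme_law p. (?q \<omega> - ?c)\<^sup>2 = 0"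
      by (subst (asm) integral_nonneg_eq_0_iff_AE[OF int]) auto
    then show ?thesis by eventually_elim simp
  qed
  then have "AE \<omega> in extreme_law p. \<forall>k. k \<ge> 2 \<longrightarrow> power_sum k (limit_freq \<omega>) = power_sum k p"
    by (simp add: AE_all_countable)
  then show ?thesis using AE_space
    by eventually_elim (use nabla_eqI[OF limit_freq_in_nabla p] in auto)
qed

lemma (in central_pf) eq_extreme_law:
  assumes p: "p \<in> nabla" and AE: "AE \<omega> in \<mu>. limit_freq \<omega> = p"
  shows "\<mu> = extreme_law p"
proof (rule measure_eqI)
  show "sets \<mu> = sets (extreme_law p)" using extreme_law_measure(2)[OF p] sets_eq by simp
  fix A assume "A \<in> sets \<mu>"
  then have "emeasure \<mu> A = (\<integral>\<^sup>+\<omega>. emeasure (extreme_law (limit_freq \<omega>)) A \<partial>\<mu>)" by (intro mixture_emeasure) (simp add: sets_eq)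
  also have "\<dots> = (\<integral>\<^sup>+\<omega>. emeasure (extreme_law p) A \<partial>\<mu>)" using AE by (intro nn_integral_cong_AE) (auto elim: eventually_mono)
  also have "\<dots> = emeasure (extreme_law p) A" using emeasure_space_1 by simp
  finally show "emeasure \<mu> A = emeasure (extreme_law p) A" .
qed

lemma path_forest_set: "{\<omega> \<in> paths. path_forest (vertex_at n \<omega>)} \<in> sets path_borel"
  using coordinate_sets[of "\<lambda>e. path_forest (src e)" "n - 1"] by (simp add: vertex_at_def edge_at_def)

text \<open>A component of positive weight is null on every null set of \<mu>. It therefore also
  lives on path-forests with the same constant limit, and both laws are the paintbox law of that
  constant.\<close>

lemma (in central_pf) extreme_if_constant:
  assumes p: "p \<in> nabla" and AE: "AE \<omega> in \<mu>. limit_freq \<omega> = p"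
  shows "\<mu> \<in> extreme_central"
proof -
  have eq: "m1 = \<mu>" if m: "m1 \<in> central_measures" "m2 \<in> central_measures" and c: "0 < c" "c < 1"
    and mix: "\<And>A. A \<in> sets path_borel \<Longrightarrow> measure \<mu> A = c * measure m1 A + (1 - c) * measure m2 A" for m1 m2 c
  proof -
    interpret m1: prob_space m1 by (rule central_measuresD[OF m(1)])
    interpret m2: prob_space m2 by (rule central_measuresD[OF m(2)])
    have "measure m1 {\<omega> \<in> paths. path_forest (vertex_at n \<omega>)} = 1" if n: "n \<ge> 1" for n
    proof -
      let ?B = "{\<omega> \<in> paths. path_forest (vertex_at n \<omega>)}"
      have "1 = c * measure m1 ?B + (1 - c) * measure m2 ?B"
        using mix[OF path_forest_set, of n] central_pf n by (simp add: central_measures_pf_def)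
      moreover have "(1 - c) * measure m2 ?B \<le> 1 - c" using mult_left_mono[of "measure m2 ?B" 1 "1 - c"] c by simp
      ultimately have "c * 1 \<le> c * measure m1 ?B" by argo
      then show ?thesis using c m1.prob_le_1[of ?B] by simp
    qed
    then interpret m1: central_pf m1 using m(1) by unfold_locales (simp add: central_measures_pf_def)
    from AE obtain N where N: "{\<omega> \<in> space \<mu>. limit_freq \<omega> \<noteq> p} \<subseteq> N" "emeasure \<mu> N = 0" "N \<in> sets \<mu>" by (rule AE_E)
    have "0 = c * measure m1 N + (1 - c) * measure m2 N"
      using mix[of N] N(2,3) sets_eq by (simp add: measure_def)
    moreover have "0 \<le> c * measure m1 N" "0 \<le> (1 - c) * measure m2 N" using c by simp_all
    ultimately have "c * measure m1 N = 0" by argo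
    then have "measure m1 N = 0" using c by simp
    then have "AE \<omega> in m1. limit_freq \<omega> = p"
      using N(1,3) by (intro AE_I[of _ _ N]) (auto simp: m1.emeasure_eq_measure m1.sets_eq sets_eq)
    from m1.eq_extreme_law[OF p this] eq_extreme_law[OF p AE] show ?thesis by simp
  qed
  show ?thesis
    unfolding extreme_central_def
  proof (intro CollectI conjI ballI allI impI central)
    fix m1 m2 c
    assume m: "m1 \<in> central_measures" "m2 \<in> central_measures"
      and c: "0 < c \<and> c < 1 \<and> (\<forall>A\<in>sets path_borel. measure \<mu> A = c * measure m1 A + (1 - c) * measure m2 A)"
    then show "m1 = \<mu>" using eq[of m1 m2 c] by blast
    \<comment> \<open>The second component is treated by exchanging the roles, with weight 1 -
      c.\<close>
    have "measure \<mu> A = (1 - c) * measure m2 A + (1 - (1 - c)) * measure m1 A" if "A \<in> sets path_borel" for A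
      using c that by (simp add: add.commute)
    then show "m2 = \<mu>" using eq[of m2 m1 "1 - c"] m c by auto
  qed
qed

text \<open>By \<open>tail_cylinder\<close> the mass of a prefix on a tail event depends on the
  prefix only through its end, and normalising keeps this.\<close>

lemma (in central_pf) central_conditioned:
  assumes T: "T \<in> raw_central_tail" and pos: "0 < measure \<mu> T"
  shows "uniform_measure \<mu> T \<in> central_measures"
proof (rule central_measuresI)
  have T': "T \<in> sets \<mu>" using raw_central_tail_sets[OF T] sets_eq by simp
  show "prob_space (uniform_measure \<mu> T)"
    using pos by (intro prob_space_uniform_measure) (auto simp: emeasure_eq_measure)
  show "sets (uniform_measure \<mu> T) = sets path_borel" by (simp add: sets_eq)
  fix n \<gamma> assume \<gamma>: "\<gamma> \<in> walks leaf n"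
  have "measure (uniform_measure \<mu> T) (cylinder \<gamma>) = measure \<mu> (cylinder \<gamma> \<inter> T) / measure \<mu> T"
    using pos by (simp add: emeasure_eq_measure sets_eq Int_commute)
  also have "measure \<mu> (cylinder \<gamma> \<inter> T) = (\<integral>\<omega>. indicator T \<omega> * measure (extreme_law (limit_freq \<omega>)) (cylinder \<gamma>) \<partial>\<mu>)"
    by (rule tail_cylinder[OF \<gamma> T])
  also have "\<dots> = (\<integral>\<omega>. indicator T \<omega> * pf_fun (paintbox (limit_freq \<omega>)) (walk_end leaf \<gamma>) \<partial>\<mu>)"
    using extreme_law(2)[OF limit_freq_in_nabla \<gamma>] by (intro Bochner_Integration.integral_cong) auto
  finally show "measure (uniform_measure \<mu> T) (cylinder \<gamma>) =
      (\<lambda>t. (\<integral>\<omega>. indicator T \<omega> * pf_fun (paintbox (limit_freq \<omega>)) t \<partial>\<mu>) / measure \<mu> T) (walk_end leaf \<gamma>)" .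
qed

text \<open>A tail event of intermediate probability would split \<mu> into its two conditioned
  laws, both central. Extremality identifies \<mu> with the law conditioned on T, under which T has
  probability 1.\<close>

lemma (in central_pf) extreme_tail_trivial:
  assumes ext: "\<mu> \<in> extreme_central" and T: "T \<in> raw_central_tail"
  shows "measure \<mu> T = 0 \<or> measure \<mu> T = 1"
proof (rule ccontr)
  assume "\<not> ?thesis"
  then have t: "0 < measure \<mu> T" "measure \<mu> T < 1"
    using prob_le_1[of T] measure_nonneg[of \<mu> T] by linarith+
  have T': "T \<in> sets \<mu>" using raw_central_tail_sets[OF T] sets_eq by simp
  have C: "paths - T \<in> raw_central_tail"
    using sets.compl_sets[of T "sigma paths raw_central_tail"] T unfolding sets_raw_central_tail by simp
  have C': "measure \<mu> (paths - T) = 1 - measure \<mu> T" using prob_compl[OF T'] by simp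
  let ?m1 = "uniform_measure \<mu> T" and ?m2 = "uniform_measure \<mu> (paths - T)"
  have m: "?m1 \<in> central_measures" "?m2 \<in> central_measures"
    using central_conditioned T C t C' by simp_all
  have "measure \<mu> A = measure \<mu> T * measure ?m1 A + (1 - measure \<mu> T) * measure ?m2 A" if A: "A \<in> sets path_borel" for A
  proof -
    have A': "A \<in> sets \<mu>" using A sets_eq by simp
    have CT: "paths - T \<in> sets \<mu>" using raw_central_tail_sets[OF C] sets_eq by simp
    have "measure ?m1 A = measure \<mu> (T \<inter> A) / measure \<mu> T" "measure ?m2 A = measure \<mu> ((paths - T) \<inter> A) / (1 - measure \<mu> T)"
      using A' t C' by (simp_all add: emeasure_eq_measure)
    moreover have "measure \<mu> A = measure \<mu> (T \<inter> A) + measure \<mu> ((paths - T) \<inter> A)"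
    proof -
      have "A = (T \<inter> A) \<union> ((paths - T) \<inter> A)" using sets.sets_into_space[OF A'] by auto
      then have "measure \<mu> A = measure \<mu> ((T \<inter> A) \<union> ((paths - T) \<inter> A))" by simp
      also have "\<dots> = measure \<mu> (T \<inter> A) + measure \<mu> ((paths - T) \<inter> A)"
        using A' T' CT by (intro finite_measure_Union) auto
      finally show ?thesis .
    qed
    ultimately show ?thesis using t by simp
  qed
  then have "?m1 = \<mu>" using ext m t unfolding extreme_central_def by blast
  then have "measure \<mu> T = measure ?m1 T" by simp
  also have "\<dots> = 1" using t T' by (simp add: emeasure_eq_measure)
  finally show False using t by simp
qed

text \<open>On extreme path-forest laws this is the constant value of the limit frequencies. As an
  integral it is a Borel function of the law, and it serves as the inverse of
  \<open>extreme_law\<close>.\<close>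

definition mean_freq :: "path measure \<Rightarrow> nat \<Rightarrow> real" where
  "mean_freq m i = (\<integral>\<omega>. limit_freq \<omega> i \<partial>m)"

lemma limit_freq_coordinate: "(\<lambda>\<omega>. limit_freq \<omega> i) \<in> borel_measurable path_borel"
  by (rule measurable_compose[OF limit_freq_path_borel coordinate_nabla_borel])

lemma limit_freq_integrable:
  assumes m: "m \<in> central_measures"
  shows "integrable m (\<lambda>\<omega>. limit_freq \<omega> i)" "integrable m (\<lambda>\<omega>. (limit_freq \<omega> i)\<^sup>2)"
proof -
  interpret prob_space m by (rule central_measuresD[OF m])
  have meas: "(\<lambda>\<omega>. limit_freq \<omega> i) \<in> borel_measurable m"
    using limit_freq_coordinate central_measuresD(2)[OF m] measurable_cong_sets by blast
  have b: "\<bar>limit_freq \<omega> i\<bar> \<le> 1" if "\<omega> \<in> space m" for \<omega>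
    using nablaD(2,7)[OF limit_freq_in_nabla[of \<omega>], of i] that central_measuresD(3)[OF m] by simp
  show "integrable m (\<lambda>\<omega>. limit_freq \<omega> i)"
    using b by (intro integrable_const_bound[where B = 1, OF AE_I2 meas]) simp
  show "integrable m (\<lambda>\<omega>. (limit_freq \<omega> i)\<^sup>2)"
    using b by (intro integrable_const_bound[where B = 1, OF AE_I2 borel_measurable_power[OF meas]]) (simp add: abs_square_le_1)
qed

lemma mean_freq_in_nabla:
  assumes m: "m \<in> central_measures" shows "mean_freq m \<in> nabla"
proof (rule nablaI)
  interpret prob_space m by (rule central_measuresD[OF m])
  have P: "limit_freq \<omega> \<in> nabla" if "\<omega> \<in> space m" for \<omega> using that limit_freq_in_nabla central_measuresD(3)[OF m] by simp
  note int = limit_freq_integrable(1)[OF m]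
  show "decseq (mean_freq m)"
    unfolding decseq_def mean_freq_def
    using nablaD(1)[OF P] by (intro allI impI integral_mono int) (simp add: decseq_def)
  show "0 \<le> mean_freq m i" for i
    unfolding mean_freq_def using nablaD(2)[OF P] by (intro Bochner_Integration.integral_nonneg)
  show "sum (mean_freq m) {..<n} \<le> 1" for n
  proof -
    have "sum (mean_freq m) {..<n} = (\<integral>\<omega>. (\<Sum>i<n. limit_freq \<omega> i) \<partial>m)"
      unfolding mean_freq_def using int by (intro Bochner_Integration.integral_sum[symmetric])
    also have "\<dots> \<le> (\<integral>\<omega>. 1 \<partial>m)" using int nablaD(5)[OF P] by (intro integral_mono) auto
    finally show ?thesis by (simp add: prob_space)
  qed
qed

text \<open>The event that a coordinate does not exceed its mean is a tail event, hence trivial.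
  Either way the coordinate lies almost surely on one side of its mean, so it equals the
  mean.\<close>

lemma (in central_pf) extreme_constant:
  assumes ext: "\<mu> \<in> extreme_central" shows "AE \<omega> in \<mu>. limit_freq \<omega> = mean_freq \<mu>"
proof -
  have "AE \<omega> in \<mu>. limit_freq \<omega> i = mean_freq \<mu> i" for i
  proof -
    let ?a = "mean_freq \<mu> i"
    let ?T = "{\<omega> \<in> paths. limit_freq \<omega> i \<le> ?a}"
    note int = limit_freq_integrable(1)[OF central, of i]
    have "(\<lambda>\<omega>. limit_freq \<omega> i) -` {..?a} \<inter> space (sigma paths raw_central_tail) \<in> sets (sigma paths raw_central_tail)"
      by (rule measurable_sets[OF measurable_compose[OF limit_freq_measurable coordinate_nabla_borel]]) simp
    also have "(\<lambda>\<omega>. limit_freq \<omega> i) -` {..?a} \<inter> space (sigma paths raw_central_tail) = ?T" by (auto simp: sets_raw_central_tail)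
    finally have T: "?T \<in> raw_central_tail" by (simp add: sets_raw_central_tail)
    then have T': "?T \<in> sets \<mu>" using raw_central_tail_sets sets_eq by simp
    have zero: "(\<integral>\<omega>. limit_freq \<omega> i - ?a \<partial>\<mu>) = 0" "(\<integral>\<omega>. ?a - limit_freq \<omega> i \<partial>\<mu>) = 0"
      using int by (simp_all add: mean_freq_def prob_space)
    from extreme_tail_trivial[OF ext T] show ?thesis
    proof
      assume "measure \<mu> ?T = 1"
      then have "AE \<omega> in \<mu>. \<omega> \<in> ?T" using T' by (simp only: AE_in_set_eq_1)
      then have "AE \<omega> in \<mu>. 0 \<le> ?a - limit_freq \<omega> i" by eventually_elim simp
      from integral_nonneg_eq_0_iff_AE[OF _ this] zero(2) int have "AE \<omega> in \<mu>. ?a - limit_freq \<omega> i = 0" by simp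
      then show ?thesis by eventually_elim simp
    next
      assume "measure \<mu> ?T = 0"
      then have "?T \<in> null_sets \<mu>" using T' by (simp add: emeasure_eq_measure null_sets_def)
      from AE_not_in[OF this] AE_space have "AE \<omega> in \<mu>. 0 \<le> limit_freq \<omega> i - ?a" by eventually_elim auto
      from integral_nonneg_eq_0_iff_AE[OF _ this] zero(1) int have "AE \<omega> in \<mu>. limit_freq \<omega> i - ?a = 0" by simp
      then show ?thesis by eventually_elim simp
    qed
  qed
  then have "AE \<omega> in \<mu>. \<forall>i. limit_freq \<omega> i = mean_freq \<mu> i" by (simp add: AE_all_countable)
  then show ?thesis by eventually_elim auto
qed

lemma (in central_pf) extreme_iff: "\<mu> \<in> extreme_central \<longleftrightarrow> (\<exists>p\<in>nabla. AE \<omega> in \<mu>. limit_freq \<omega> = p)"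
  using extreme_constant mean_freq_in_nabla[OF central] extreme_if_constant by blast

section \<open>The extremal decomposition\<close>

text \<open>A Borel set inside \<open>extreme_central\<close>, cut out by vanishing variance of each
  limit coordinate. It replaces the set of extreme points, defined by a quantification over pairs of
  laws, where measurability is needed.\<close>

definition pf_extreme :: "path measure set" where
  "pf_extreme = {m \<in> central_measures. (\<forall>n\<ge>1. measure m {\<omega> \<in> paths. path_forest (vertex_at n \<omega>)} = 1) \<and>
     (\<forall>i. (\<integral>\<omega>. (limit_freq \<omega> i)\<^sup>2 \<partial>m) = (mean_freq m i)\<^sup>2)}"

lemma mean_freq_measurable: "mean_freq \<in> measurable central_borel nabla_borel"
  unfolding nabla_borel_def
proof (rule measurable_restrict_space2)
  show "mean_freq \<in> space central_borel \<rightarrow> nabla" using mean_freq_in_nabla by simp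
  show "mean_freq \<in> borel_measurable central_borel"
    unfolding mean_freq_def[abs_def]
    by (rule measurable_coordinatewise_then_product)
      (rule measurable_compose[OF central_borel_kernel integral_measurable_subprob_algebra[OF limit_freq_coordinate]])
qed

lemma pf_extreme_sets: "pf_extreme \<in> sets central_borel"
proof -
  have 1: "(\<lambda>m. measure m A) \<in> borel_measurable central_borel" if "A \<in> sets path_borel" for A
    by (rule measurable_compose[OF central_borel_kernel measurable_measure_subprob_algebra[OF that]])
  have 2: "(\<lambda>m. \<integral>\<omega>. f \<omega> \<partial>m) \<in> borel_measurable central_borel" if "f \<in> borel_measurable path_borel" for f :: "path \<Rightarrow> real"
    by (rule measurable_compose[OF central_borel_kernel integral_measurable_subprob_algebra[OF that]])
  have 3: "(\<lambda>m. mean_freq m i) \<in> borel_measurable central_borel" for i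
    unfolding mean_freq_def by (rule 2[OF limit_freq_coordinate])
  have A: "{m \<in> space central_borel. \<forall>n. n \<ge> 1 \<longrightarrow> measure m {\<omega> \<in> paths. path_forest (vertex_at n \<omega>)} = 1} \<in> sets central_borel"
  proof (rule sets.sets_Collect_countable_All)
    fix n :: nat
    have "{m \<in> space central_borel. measure m {\<omega> \<in> paths. path_forest (vertex_at n \<omega>)} = 1} \<in> sets central_borel"
      by (rule borel_measurable_eq[OF 1[OF path_forest_set] borel_measurable_const])
    then show "{m \<in> space central_borel. n \<ge> 1 \<longrightarrow> measure m {\<omega> \<in> paths. path_forest (vertex_at n \<omega>)} = 1} \<in> sets central_borel"
      using sets.top[of central_borel] by (cases "n \<ge> 1") simp_all
  qed
  have B: "{m \<in> space central_borel. \<forall>i. (\<integral>\<omega>. (limit_freq \<omega> i)\<^sup>2 \<partial>m) = (mean_freq m i)\<^sup>2} \<in> sets central_borel"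
    by (rule sets.sets_Collect_countable_All)
      (rule borel_measurable_eq[OF 2[OF borel_measurable_power[OF limit_freq_coordinate]] borel_measurable_power[OF 3]])
  have eq: "pf_extreme = {m \<in> space central_borel. \<forall>n. n \<ge> 1 \<longrightarrow> measure m {\<omega> \<in> paths. path_forest (vertex_at n \<omega>)} = 1} \<inter>
      {m \<in> space central_borel. \<forall>i. (\<integral>\<omega>. (limit_freq \<omega> i)\<^sup>2 \<partial>m) = (mean_freq m i)\<^sup>2}"
    by (auto simp: pf_extreme_def)
  show ?thesis unfolding eq by (rule sets.Int[OF A B])
qed

lemma pf_extremeD:
  assumes "m \<in> pf_extreme"
  shows "m \<in> extreme_central"
proof -
  have m: "m \<in> central_measures" "central_pf m"
    using assms by (auto simp: pf_extreme_def central_measures_pf_def intro!: central_pf.intro)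
  interpret central_pf m by fact
  have "AE \<omega> in m. limit_freq \<omega> i = mean_freq m i" for i
  proof -
    let ?a = "mean_freq m i"
    note int = limit_freq_integrable[OF m(1), of i]
    have eq: "(\<lambda>\<omega>. (limit_freq \<omega> i - ?a)\<^sup>2) = (\<lambda>\<omega>. (limit_freq \<omega> i)\<^sup>2 - 2 * ?a * limit_freq \<omega> i + ?a\<^sup>2)"
      by (simp add: fun_eq_iff power2_diff)
    have i: "integrable m (\<lambda>\<omega>. (limit_freq \<omega> i - ?a)\<^sup>2)" unfolding eq using int by simp
    have "(\<integral>\<omega>. (limit_freq \<omega> i - ?a)\<^sup>2 \<partial>m) = (\<integral>\<omega>. (limit_freq \<omega> i)\<^sup>2 \<partial>m) - 2 * ?a * (\<integral>\<omega>. limit_freq \<omega> i \<partial>m) + ?a\<^sup>2"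
      unfolding eq using int by (simp add: prob_space)
    also have "\<dots> = 0" using assms by (simp add: pf_extreme_def mean_freq_def[symmetric] power2_eq_square)
    finally have "AE \<omega> in m. (limit_freq \<omega> i - ?a)\<^sup>2 = 0"
      by (subst (asm) integral_nonneg_eq_0_iff_AE[OF i]) auto
    then show ?thesis by eventually_elim simp
  qed
  then have "AE \<omega> in m. \<forall>i. limit_freq \<omega> i = mean_freq m i" by (simp add: AE_all_countable)
  then have "AE \<omega> in m. limit_freq \<omega> = mean_freq m" by eventually_elim auto
  then show ?thesis by (rule extreme_if_constant[OF mean_freq_in_nabla[OF m(1)]])
qed

lemma mean_freq_extreme_law: "p \<in> nabla \<Longrightarrow> mean_freq (extreme_law p) = p"
proof
  fix i assume p: "p \<in> nabla"
  interpret central_pf "extreme_law p" by (rule central_pf_extreme_law[OF p])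
  have "mean_freq (extreme_law p) i = (\<integral>\<omega>. p i \<partial>extreme_law p)"
    unfolding mean_freq_def using AE_limit_freq_extreme_law[OF p] limit_freq_integrable(1)[OF central, of i]
    by (intro integral_cong_AE) (auto elim: eventually_mono)
  then show "mean_freq (extreme_law p) i = p i" by (simp add: prob_space)
qed

lemma extreme_law_pf_extreme:
  assumes p: "p \<in> nabla" shows "extreme_law p \<in> pf_extreme"
proof -
  interpret central_pf "extreme_law p" by (rule central_pf_extreme_law[OF p])
  have "(\<integral>\<omega>. (limit_freq \<omega> i)\<^sup>2 \<partial>extreme_law p) = (\<integral>\<omega>. (p i)\<^sup>2 \<partial>extreme_law p)" for i
    using AE_limit_freq_extreme_law[OF p] limit_freq_integrable(2)[OF central, of i]
    by (intro integral_cong_AE) (auto elim: eventually_mono)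
  then show ?thesis
    using central_pf by (simp add: pf_extreme_def central_measures_pf_def mean_freq_extreme_law[OF p] prob_space)
qed

section \<open>Existence and uniqueness of the extremal decomposition\<close>

context central_pf
begin

abbreviation directing_law :: "(nat \<Rightarrow> real) measure" where
  "directing_law \<equiv> distr \<mu> nabla_borel limit_freq"

lemma distr_directing_law:
  "distr directing_law central_borel extreme_law = distr \<mu> central_borel (\<lambda>\<omega>. extreme_law (limit_freq \<omega>))"
  by (subst distr_distr[OF extreme_law_measurable limit_freq_measurable']) (simp add: comp_def)

lemma kernel_central_borel: "(\<lambda>\<omega>. extreme_law (limit_freq \<omega>)) \<in> measurable \<mu> central_borel"
  by (rule measurable_compose[OF limit_freq_measurable' extreme_law_measurable])

lemma directing_law_mixture:
  assumes "A \<in> sets path_borel"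
  shows "emeasure \<mu> A = (\<integral>\<^sup>+p. emeasure (extreme_law p) A \<partial>directing_law)"
proof -
  have "(\<lambda>p. emeasure (extreme_law p) A) \<in> borel_measurable nabla_borel"
    by (rule measurable_compose[OF extreme_law_kernel measurable_emeasure_subprob_algebra[OF assms]])
  then show ?thesis using mixture_emeasure[OF assms] by (simp add: nn_integral_distr)
qed

lemma directing_law_represents: "represents (distr directing_law central_borel extreme_law) \<mu>"
  unfolding represents_def distr_directing_law
proof (intro conjI allI impI)
  show "prob_space (distr \<mu> central_borel (\<lambda>\<omega>. extreme_law (limit_freq \<omega>)))"
    by (rule prob_space_distr[OF kernel_central_borel])
  fix f assume f: "continuous_map path_topology euclideanreal f"
  have ne: "space \<mu> \<noteq> {}" by (rule not_empty)
  let ?B = "\<mu> \<bind> (\<lambda>\<omega>. extreme_law (limit_freq \<omega>))"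
  have bind: "\<mu> = ?B"
  proof (rule measure_eqI)
    show s: "sets \<mu> = sets ?B"
      using sets_bind[OF subprob_measurableD(2)[OF kernel_measurable] ne] sets_eq by simp
    fix A assume "A \<in> sets \<mu>"
    then have A: "A \<in> sets path_borel" using sets_eq by simp
    show "emeasure \<mu> A = emeasure ?B A"
      using emeasure_bind[OF ne kernel_measurable A] mixture_emeasure[OF A] by simp
  qed
  obtain B where B: "\<And>\<omega>. \<omega> \<in> paths \<Longrightarrow> \<bar>f \<omega>\<bar> \<le> B" using continuous_bounded[OF f] by blast
  have "(\<integral>\<omega>. f \<omega> \<partial>\<mu>) = (\<integral>\<omega>. f \<omega> \<partial>?B)" using bind by simp
  also have "\<dots> = (\<integral>\<omega>. (\<integral>\<omega>'. f \<omega>' \<partial>extreme_law (limit_freq \<omega>)) \<partial>\<mu>)"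
  proof (rule integral_bind[OF continuous_measurable[OF f] _ kernel_measurable finite_measure_axioms])
    show "\<bar>f \<omega>\<bar> \<le> B" if "\<omega> \<in> space path_borel" for \<omega> using B that by simp
    show "AE \<omega> in \<mu>. emeasure (extreme_law (limit_freq \<omega>)) (space (extreme_law (limit_freq \<omega>))) \<le> ennreal 1"
      using prob_space.emeasure_space_1[OF extreme_law_measure(1)[OF limit_freq_in_nabla]] by (intro AE_I2) simp
  qed
  also have "\<dots> = (\<integral>m'. (\<integral>\<omega>. f \<omega> \<partial>m') \<partial>distr \<mu> central_borel (\<lambda>\<omega>. extreme_law (limit_freq \<omega>)))"
    by (rule integral_distr[OF kernel_central_borel integral_central_borel[OF f], symmetric])
  finally show "(\<integral>\<omega>. f \<omega> \<partial>\<mu>) = (\<integral>m'. (\<integral>\<omega>. f \<omega> \<partial>m') \<partial>distr \<mu> central_borel (\<lambda>\<omega>. extreme_law (limit_freq \<omega>)))" .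
qed simp

text \<open>Transferring an almost sure property to an image measure needs a measurable set, hence
  the detour through \<open>pf_extreme\<close>.\<close>

lemma directing_law_extremal: "extremal_decomposition (distr directing_law central_borel extreme_law) \<mu>"
  unfolding extremal_decomposition_def
proof
  have "{m \<in> space central_borel. m \<in> pf_extreme} \<in> sets central_borel"
    using pf_extreme_sets sets.sets_into_space[OF pf_extreme_sets] by (simp add: Collect_conj_eq Int_absorb1)
  then have "AE m in distr \<mu> central_borel (\<lambda>\<omega>. extreme_law (limit_freq \<omega>)). m \<in> pf_extreme"
    using extreme_law_pf_extreme[OF limit_freq_in_nabla] by (subst AE_distr_iff[OF kernel_central_borel]) auto
  then show "AE m' in distr directing_law central_borel extreme_law. m' \<in> extreme_central"
    unfolding distr_directing_law by eventually_elim (rule pf_extremeD)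
qed (rule directing_law_represents)

text \<open>M-almost every law m is a paintbox law, m = extreme_law (mean_freq m), so M is recovered
  from the M-law of \<open>mean_freq\<close>. That law does not depend on M: it is the law of the
  limit frequencies under \<mu>.\<close>

lemma extremal_decomposition_unique:
  assumes ext: "extremal_decomposition M \<mu>"
  shows "M = distr directing_law central_borel extreme_law"
proof -
  have rep: "represents M \<mu>" and AE_ext: "AE m in M. m \<in> extreme_central"
    using ext by (auto simp: extremal_decomposition_def)
  interpret M: prob_space M using rep by (simp add: represents_def)
  have sM: "sets M = sets central_borel" and spM: "space M = central_measures"
    using rep sets_eq_imp_space_eq[of M central_borel] by (auto simp: represents_def)
  have kern: "(\<lambda>m. m) \<in> measurable M (subprob_algebra path_borel)"
    using central_borel_kernel measurable_cong_sets[OF sM refl] by blast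
  note emeas = represents_emeasure[OF rep central]
  have prob: "prob_space m" if "m \<in> space M" for m using that central_measuresD(1) spM by blast
  \<comment> \<open>The average of m(B) over M is \<mu>(B) = 1 while m(B) <= 1, so almost every m
    gives B full mass.\<close>
  have AE_pf: "AE m in M. \<forall>n. n \<ge> 1 \<longrightarrow> measure m {\<omega> \<in> paths. path_forest (vertex_at n \<omega>)} = 1"
    unfolding AE_all_countable
  proof (intro allI AE_impI)
    fix n :: nat assume n: "n \<ge> 1"
    let ?B = "{\<omega> \<in> paths. path_forest (vertex_at n \<omega>)}"
    have meas: "(\<lambda>m. measure m ?B) \<in> borel_measurable M"
      by (rule measurable_compose[OF kern measurable_measure_subprob_algebra[OF path_forest_set]])
    have le1: "measure m ?B \<le> 1" if "m \<in> space M" for m by (rule prob_space.prob_le_1[OF prob[OF that]])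
    have int: "integrable M (\<lambda>m. measure m ?B)"
      using le1 by (intro M.integrable_const_bound[where B = 1, OF AE_I2 meas]) auto
    have "ennreal (measure \<mu> ?B) = (\<integral>\<^sup>+m. ennreal (measure m ?B) \<partial>M)"
      unfolding emeasure_eq_measure[symmetric] emeas[OF path_forest_set]
      using finite_measure.emeasure_eq_measure[OF prob_space.axioms(1)[OF prob]] by (intro nn_integral_cong) simp
    also have "\<dots> = ennreal (\<integral>m. measure m ?B \<partial>M)" by (rule nn_integral_eq_integral[OF int]) simp
    finally have "(\<integral>m. measure m ?B \<partial>M) = 1"
      using central_pf n by (subst (asm) ennreal_inj) (auto simp: central_measures_pf_def)
    then have "(\<integral>m. 1 - measure m ?B \<partial>M) = 0" using int by (simp add: M.prob_space)
    moreover have "integrable M (\<lambda>m. 1 - measure m ?B)" using int by simp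
    ultimately have "AE m in M. 1 - measure m ?B = 0"
      using le1 by (subst (asm) integral_nonneg_eq_0_iff_AE) (auto intro!: AE_I2)
    then show "AE m in M. measure m ?B = 1" by eventually_elim simp
  qed
  have AE_Q: "AE m in M. (AE \<omega> in m. limit_freq \<omega> = mean_freq m) \<and> m = extreme_law (mean_freq m)"
    using AE_pf AE_ext AE_space
  proof eventually_elim
    case (elim m)
    then have "central_pf m" using spM by (intro central_pf.intro) (simp add: central_measures_pf_def)
    then interpret m: central_pf m .
    have "AE \<omega> in m. limit_freq \<omega> = mean_freq m" by (rule m.extreme_constant) fact
    with m.eq_extreme_law[OF mean_freq_in_nabla[OF m.central] this] show ?case by blast
  qed
  have Q: "mean_freq \<in> measurable M nabla_borel" using mean_freq_measurable measurable_cong_sets[OF sM refl] by blast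
  \<comment> \<open>Under almost every m the event that the limit frequencies lie in B has
    probability 1 or 0 according to whether \<open>mean_freq m\<close> is in B; average over
    M.\<close>
  have "distr M nabla_borel mean_freq = directing_law"
  proof (rule measure_eqI)
    fix B assume "B \<in> sets (distr M nabla_borel mean_freq)"
    then have B: "B \<in> sets nabla_borel" by simp
    have PB: "limit_freq -` B \<inter> paths \<in> sets path_borel" using measurable_sets[OF limit_freq_path_borel B] by simp
    have "emeasure directing_law B = emeasure \<mu> (limit_freq -` B \<inter> paths)" using B by (simp add: emeasure_distr)
    also have "\<dots> = (\<integral>\<^sup>+m. emeasure m (limit_freq -` B \<inter> paths) \<partial>M)" by (rule emeas[OF PB])
    also have "\<dots> = (\<integral>\<^sup>+m. indicator (mean_freq -` B \<inter> space M) m \<partial>M)"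
    proof (rule nn_integral_cong_AE)
      show "AE m in M. emeasure m (limit_freq -` B \<inter> paths) = indicator (mean_freq -` B \<inter> space M) m"
        using AE_Q AE_space
      proof eventually_elim
        case (elim m)
        then have c: "m \<in> central_measures" using spM by simp
        interpret m: prob_space m by (rule central_measuresD[OF c])
        have ae: "AE \<omega> in m. limit_freq \<omega> = mean_freq m" using elim by simp
        show ?case
        proof (cases "mean_freq m \<in> B")
          case True
          have "AE \<omega> in m. \<omega> \<in> limit_freq -` B \<inter> paths"
            using ae AE_space by eventually_elim (use central_measuresD(3)[OF c] True in auto)
          then have "emeasure m (limit_freq -` B \<inter> paths) = 1" using PB central_measuresD(2)[OF c] by (intro m.emeasure_eq_1_AE) auto
          with True elim show ?thesis by simp
        next
          case False
          have "AE \<omega> in m. \<omega> \<notin> limit_freq -` B \<inter> paths" using ae by eventually_elim (use False in auto)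
          then have "emeasure m (limit_freq -` B \<inter> paths) = 0" using PB central_measuresD(2)[OF c] AE_iff_null_sets[of "limit_freq -` B \<inter> paths" m] by auto
          with False show ?thesis by simp
        qed
      qed
    qed
    also have "\<dots> = emeasure M (mean_freq -` B \<inter> space M)" using measurable_sets[OF Q B] by (rule nn_integral_indicator)
    also have "\<dots> = emeasure (distr M nabla_borel mean_freq) B" by (rule emeasure_distr[OF Q B, symmetric])
    finally show "emeasure (distr M nabla_borel mean_freq) B = emeasure directing_law B" ..
  qed simp
  then have "distr directing_law central_borel extreme_law = distr (distr M nabla_borel mean_freq) central_borel extreme_law" by simp
  also have "\<dots> = distr M central_borel (\<lambda>m. extreme_law (mean_freq m))"
    by (subst distr_distr[OF extreme_law_measurable Q]) (simp add: comp_def)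
  also have "\<dots> = distr M central_borel (\<lambda>m. m)"
  proof (rule distr_cong_AE[OF refl refl])
    show "(\<lambda>m. extreme_law (mean_freq m)) \<in> measurable M central_borel"
      by (rule measurable_compose[OF Q extreme_law_measurable])
    show "(\<lambda>m. m) \<in> measurable M central_borel" by (rule measurable_ident_sets[OF sM])
    show "AE m in M. extreme_law (mean_freq m) = m" using AE_Q by eventually_elim simp
  qed
  also have "\<dots> = M" by (rule distr_id2[OF sM[symmetric]])
  finally show ?thesis ..
qed

end

theorem theorem6p2:
  shows "\<exists>P. P \<in> measurable (sigma paths raw_central_tail) nabla_borel \<and>
    (\<forall>\<mu> \<in> central_measures_pf.
      (AE \<omega> in \<mu>.
         (\<forall>i. (\<lambda>n. emp_freq n (vertex_at n \<omega>) i) \<longlonglongrightarrow> P \<omega> i) \<and>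
         (\<lambda>n. emp_dust n (vertex_at n \<omega>)) \<longlonglongrightarrow> dust (P \<omega>) \<and>
         weak_conv_m (\<lambda>n. emp_nu n (vertex_at n \<omega>)) (nu (P \<omega>))) \<and>
      (AE \<omega> in \<mu>.
         (\<forall>n \<ge> 1. path_forest (vertex_at n \<omega>)) \<and>
         limitin martin_compactification (\<lambda>n. martin_vertex (shape (vertex_at n \<omega>)))
           (martin_boundary_point (P \<omega>)) sequentially) \<and>
      completed \<mu> raw_central_tail = completed \<mu> (sets (vimage_algebra paths P nabla_borel)) \<and>
      (\<forall>A \<in> sets path_borel. AE \<omega> in \<mu>.
         real_cond_exp \<mu> (vimage_algebra paths P nabla_borel) (indicator A) \<omega>
           = measure (extreme_law (P \<omega>)) A) \<and>
      (let \<Theta> = distr \<mu> nabla_borel P in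
         extreme_law \<in> measurable nabla_borel central_borel \<and>
         (\<forall>A \<in> sets path_borel. emeasure \<mu> A = (\<integral>\<^sup>+ p. emeasure (extreme_law p) A \<partial>\<Theta>)) \<and>
         extremal_decomposition (distr \<Theta> central_borel extreme_law) \<mu> \<and>
         (\<forall>M. extremal_decomposition M \<mu> \<longrightarrow> M = distr \<Theta> central_borel extreme_law)) \<and>
      (\<mu> \<in> extreme_central \<longleftrightarrow> (\<exists>p \<in> nabla. AE \<omega> in \<mu>. P \<omega> = p)))"
proof (intro exI[of _ limit_freq] conjI ballI limit_freq_measurable)
  fix \<mu> assume "\<mu> \<in> central_measures_pf"
  then interpret central_pf \<mu> by unfold_locales
  show "AE \<omega> in \<mu>. (\<forall>i. (\<lambda>n. emp_freq n (vertex_at n \<omega>) i) \<longlonglongrightarrow> limit_freq \<omega> i) \<and>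
      (\<lambda>n. emp_dust n (vertex_at n \<omega>)) \<longlonglongrightarrow> dust (limit_freq \<omega>) \<and>
      weak_conv_m (\<lambda>n. emp_nu n (vertex_at n \<omega>)) (nu (limit_freq \<omega>))"
    using AE_typical AE_emp_dust by eventually_elim (blast intro: typicalD(4,7))
  show "AE \<omega> in \<mu>. (\<forall>n \<ge> 1. path_forest (vertex_at n \<omega>)) \<and>
      limitin martin_compactification (\<lambda>n. martin_vertex (shape (vertex_at n \<omega>)))
        (martin_boundary_point (limit_freq \<omega>)) sequentially"
    using AE_typical
    by eventually_elim (use typicalD(8) pf_pathD(2)[OF typicalD(1)] in \<open>auto simp: vertex_at_def edge_at_def\<close>)
  show "completed \<mu> raw_central_tail = completed \<mu> (sets tail_limit)" by (rule completed_tail)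
  show "AE \<omega> in \<mu>. real_cond_exp \<mu> tail_limit (indicator A) \<omega> = measure (extreme_law (limit_freq \<omega>)) A"
    if "A \<in> sets path_borel" for A by (rule conditional_law[OF that])
  show "let \<Theta> = directing_law in
         extreme_law \<in> measurable nabla_borel central_borel \<and>
         (\<forall>A \<in> sets path_borel. emeasure \<mu> A = (\<integral>\<^sup>+ p. emeasure (extreme_law p) A \<partial>\<Theta>)) \<and>
         extremal_decomposition (distr \<Theta> central_borel extreme_law) \<mu> \<and>
         (\<forall>M. extremal_decomposition M \<mu> \<longrightarrow> M = distr \<Theta> central_borel extreme_law)"
    unfolding Let_def
    by (intro conjI ballI allI impI extreme_law_measurable directing_law_mixture directing_law_extremal extremal_decomposition_unique)
  show "\<mu> \<in> extreme_central \<longleftrightarrow> (\<exists>p \<in> nabla. AE \<omega> in \<mu>. limit_freq \<omega> = p)" by (rule extreme_iff)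
qed

end
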